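(* Assume that $r_1,\dots,r_k$ are bounded and Riemann integrable, that $\lim_{N\to\infty}(N\varepsilon_N)^{-1}(\log N)^{\xi}=0$ for some fixed $\xi>8$, and that $\lim_{N\to\infty}\varepsilon_N=\varepsilon_\infty$ for some $\varepsilon_\infty\ge 0$. If $\mathcal I$ is a non-empty set, then as $N\to\infty$, $$\left(\varepsilon_N^{-1/2}\left(\lambda_i(A_N)-\mathrm{E}[\lambda_i(A_N)]\right):i\in\mathcal I\right)\Rightarrow\left(G_i:i\in\mathcal I\right)$$ (convergence in distribution), where the right hand side is a multivariate normal random vector in $\mathbb{R}^{|\mathcal I|}$ with mean zero and $$\mathrm{Cov}(G_i,G_j)=2\int_0^1\int_0^1 r_i(x)r_i(y)r_j(x)r_j(y)f(x,y)\left[1-\varepsilon_\infty f(x,y)\right]dx\,dy$$ for all $i,j\in\mathcal I$.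
   Context: Setting. Let $k\ge 1$, let $\theta_1\ge\dots\ge\theta_k>0$, and let $r_1,\dots,r_k:[0,1]\to\mathbb{R}$ be an orthonormal set in $L^2[0,1]$ such that $f(x,y):=\sum_{i=1}^k\theta_i r_i(x)r_i(y)\ge 0$ for all $(x,y)\in[0,1]^2$. Let $(\varepsilon_N)_{N\ge1}$ be a real sequence with $0<\varepsilon_N\le\left[\sup_{0\le x,y\le 1}f(x,y)\right]^{-1}$. For each $N\ge 1$, $A_N$ is the $N\times N$ random symmetric matrix whose entries $\{A_N(i,j):1\le i\le j\le N\}$ are independent with $A_N(i,j)\sim\mathrm{Bernoulli}(\varepsilon_N f(i/N,j/N))$ (self-loops allowed). For a real symmetric matrix $M$, $\lambda_1(M)\ge\lambda_2(M)\ge\cdots$ denote its eigenvalues. With $\theta_0=\infty$ and $\theta_{k+1}=-\infty$, $\mathcal I:=\{1\le i\le k:\theta_{i-1}>\theta_i>\theta_{i+1}\}$. *)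

theory Defs
  imports
    "HOL-Probability.Probability"
    "Jordan_Normal_Form.Char_Poly"
begin

text \<open>
  The Riemann integral in the classical sense (tagged Riemann sums converge as the mesh tends
  to \<open>0\<close>). This is stronger than \<open>f integrable_on {a..b}\<close>, which is the gauge integral.
\<close>
definition riemann_integrable :: "real \<Rightarrow> real \<Rightarrow> (real \<Rightarrow> real) \<Rightarrow> bool" where
  "riemann_integrable a b f \<longleftrightarrow>
     (\<exists>I. \<forall>e>0. \<exists>d>0. \<forall>p. p tagged_division_of {a..b} \<and> (\<forall>(x, K)\<in>p. diameter K < d) \<longrightarrow>
        \<bar>(\<Sum>(x, K)\<in>p. measure lborel K * f x) - I\<bar> < e)"

text \<open>
  Lebesgue rather than Borel measurability is used throughout, because a Riemann integrable
  function need not be Borel measurable.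
\<close>
definition orthonormal_L2 :: "nat \<Rightarrow> (nat \<Rightarrow> real \<Rightarrow> real) \<Rightarrow> bool" where
  "orthonormal_L2 k r \<longleftrightarrow>
     (\<forall>i\<in>{1..k}. r i \<in> borel_measurable (lebesgue_on {0..1}) \<and>
        integrable (lebesgue_on {0..1}) (\<lambda>x. (r i x)\<^sup>2)) \<and>
     (\<forall>i\<in>{1..k}. \<forall>j\<in>{1..k}.
        (\<integral>x. r i x * r j x \<partial>lebesgue_on {0..1}) = (if i = j then 1 else 0))"

definition edge_kernel ::
  "nat \<Rightarrow> (nat \<Rightarrow> real) \<Rightarrow> (nat \<Rightarrow> real \<Rightarrow> real) \<Rightarrow> real \<Rightarrow> real \<Rightarrow> real" where
  "edge_kernel k \<theta> r x y = (\<Sum>i=1..k. \<theta> i * r i x * r i y)"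

definition extended_theta :: "nat \<Rightarrow> (nat \<Rightarrow> real) \<Rightarrow> nat \<Rightarrow> ereal" where
  "extended_theta k \<theta> i = (if i = 0 then \<infinity> else if i = k + 1 then - \<infinity> else ereal (\<theta> i))"

definition simple_indices :: "nat \<Rightarrow> (nat \<Rightarrow> real) \<Rightarrow> nat set" where
  "simple_indices k \<theta> = {i\<in>{1..k}. extended_theta k \<theta> (i - 1) > extended_theta k \<theta> i \<and>
     extended_theta k \<theta> i > extended_theta k \<theta> (i + 1)}"

text \<open>
  The \<open>i\<close>-th largest eigenvalue, \<open>1 \<le> i\<close>, counted with multiplicity; for a real symmetric
  \<open>N\<times>N\<close> matrix the characteristic polynomial splits over the reals, so the list has length \<open>N\<close>.
  The value is unspecified for \<open>i > N\<close>.
\<close>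
definition eig :: "nat \<Rightarrow> real mat \<Rightarrow> real" where
  "eig i A = rev (sorted_list_of_multiset (proots (char_poly A))) ! (i - 1)"

definition bernoulli_law :: "real \<Rightarrow> real measure" where
  "bernoulli_law p = distr (measure_pmf (bernoulli_pmf p)) borel of_bool"

text \<open>The matrix is indexed from \<open>0\<close>, so entry \<open>(i, j)\<close> corresponds to \<open>((i+1)/N, (j+1)/N)\<close>.\<close>
definition random_bernoulli_matrix ::
  "'w measure \<Rightarrow> nat \<Rightarrow> real \<Rightarrow> (real \<Rightarrow> real \<Rightarrow> real) \<Rightarrow> ('w \<Rightarrow> real mat) \<Rightarrow> bool" where
  "random_bernoulli_matrix M N \<epsilon> f A \<longleftrightarrow>
     (\<forall>\<omega>\<in>space M. A \<omega> \<in> carrier_mat N N \<and> transpose_mat (A \<omega>) = A \<omega>) \<and>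
     prob_space.indep_vars M (\<lambda>_. borel) (\<lambda>(i, j) \<omega>. A \<omega> $$ (i, j)) {(i, j). i \<le> j \<and> j < N} \<and>
     (\<forall>i j. i \<le> j \<and> j < N \<longrightarrow>
        distr M borel (\<lambda>\<omega>. A \<omega> $$ (i, j)) =
        bernoulli_law (\<epsilon> * f (real (i + 1) / real N) (real (j + 1) / real N)))"

text \<open>Here \<open>\<sigma>\<close> is the standard deviation; the degenerate case is the point mass at \<open>m\<close>.\<close>
definition normal_law :: "real \<Rightarrow> real \<Rightarrow> real measure" where
  "normal_law m \<sigma> =
     (if \<sigma> = 0 then return borel m else density lborel (\<lambda>x. ennreal (normal_density m \<sigma> x)))"

text \<open>
  Laws on \<open>\<real>\<^sup>I\<close>, for a finite index set \<open>I\<close>, are measures on the product space \<open>Pi\<^sub>M I (\<lambda>_. borel)\<close>.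
  A law is multivariate normal (possibly degenerate) if all linear combinations of the
  coordinates are normal.
\<close>
definition multivariate_normal :: "'i set \<Rightarrow> ('i \<Rightarrow> real) measure \<Rightarrow> bool" where
  "multivariate_normal I G \<longleftrightarrow>
     sets G = sets (Pi\<^sub>M I (\<lambda>_. borel)) \<and>
     (\<forall>t :: 'i \<Rightarrow> real. \<exists>m \<sigma>. \<sigma> \<ge> 0 \<and> distr G borel (\<lambda>x. \<Sum>i\<in>I. t i * x i) = normal_law m \<sigma>)"

definition covariance :: "'w measure \<Rightarrow> ('w \<Rightarrow> real) \<Rightarrow> ('w \<Rightarrow> real) \<Rightarrow> real" where
  "covariance M X Y =
     (\<integral>\<omega>. (X \<omega> - (\<integral>\<omega>'. X \<omega>' \<partial>M)) * (Y \<omega> - (\<integral>\<omega>'. Y \<omega>' \<partial>M)) \<partial>M)"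

text \<open>
  Convergence in distribution on \<open>\<real>\<^sup>I\<close>, tested on bounded continuous functions. The topology on
  \<open>Pi\<^sub>E I (\<lambda>_. UNIV)\<close> is inherited from the product topology on functions; as the coordinates
  outside \<open>I\<close> are frozen, it is the usual topology of \<open>\<real>\<^sup>I\<close>.
\<close>
definition weak_conv_PiM ::
  "'i set \<Rightarrow> (nat \<Rightarrow> ('i \<Rightarrow> real) measure) \<Rightarrow> ('i \<Rightarrow> real) measure \<Rightarrow> bool" where
  "weak_conv_PiM I \<mu> \<nu> \<longleftrightarrow>
     (\<forall>g :: ('i \<Rightarrow> real) \<Rightarrow> real.
        continuous_on (Pi\<^sub>E I (\<lambda>_. UNIV)) g \<and> bounded (g ` Pi\<^sub>E I (\<lambda>_. UNIV)) \<longrightarrow>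
        (\<lambda>n. \<integral>x. g x \<partial>\<mu> n) \<longlonglongrightarrow> (\<integral>x. g x \<partial>\<nu>))"

end

theory Submission
  imports
    Defs
    "HOL-Real_Asymp.Real_Asymp"
begin

text \<open>
  Write \<open>A\<close> for the random matrix, \<open>d = N \<epsilon>\<^sub>N\<close> and \<open>e\<^sub>j = (r\<^sub>j(a/N) / sqrt N)\<^sub>a\<close>. The mean of \<open>A\<close> is \<open>d \<Sum> \<theta>\<^sub>j e\<^sub>j e\<^sub>j\<^sup>T\<close>, a
  matrix of rank at most \<open>k\<close>, and by convergence of Riemann sums the vectors \<open>e\<^sub>j\<close> are nearly orthonormal. The
  random variable \<open>e\<^sub>i\<^sup>T A e\<^sub>i\<close> is \<^emph>\<open>linear\<close> in the independent entries of \<open>A\<close>, with uniformly small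
  coefficients after division by \<open>sqrt \<epsilon>\<^sub>N\<close>; so these variables jointly obey a central limit theorem, and
  their covariances are Riemann sums for the double integral of the claim. The theorem follows once
  \<open>\<lambda>\<^sub>i(A) - e\<^sub>i\<^sup>T A e\<^sub>i\<close> is shown to have variance \<open>o(\<epsilon>\<^sub>N)\<close>. Only this variance matters, since the
  eigenvalue is centred by its own expectation; no expansion of the expectation is required.

  The variance is bounded by the Poincare inequality for independent Bernoulli variables
  (\<open>bernoulli_poincare\<close>), that is, by the sum over all entries \<open>c = {a, b}\<close> of the squared effect of switching
  the entry \<open>c\<close>. First-order perturbation theory says that, with \<open>v\<close> the \<open>i\<close>-th unit eigenvector,
  this switch changes the eigenvalue by \<open>2 v\<^sub>a v\<^sub>b\<close>, up to an error of order \<open>(v\<^sub>a\<^sup>2 + v\<^sub>b\<^sup>2) / d\<close>, because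
  the gap around a simple eigenvalue is of order \<open>d\<close>. It changes \<open>e\<^sub>i\<^sup>T A e\<^sub>i\<close> by \<open>2 e\<^sub>i(a) e\<^sub>i(b)\<close>. The squared
  effects therefore add up to a multiple of \<open>\<parallel>v v\<^sup>T - e\<^sub>i e\<^sub>i\<^sup>T\<parallel>\<^sup>2 + (N / d\<^sup>2) \<Sum> v\<^sub>a\<^sup>4\<close> (\<open>eigenvalue_variance\<close>),
  with the Hilbert-Schmidt norm, and three estimates make this small.

  First, \<open>\<parallel>A - E A\<parallel> \<le> \<delta> d\<close> outside an event whose probability is at most a high power of \<open>1/N\<close>
  (\<open>noise_norm_tail\<close>). The even moments of the trace are bounded by a discrete integration by parts: the
  difference of \<open>tr (W\<^sup>2\<^sup>q\<^sup>+\<^sup>1 H)\<close> between two matrices that differ by \<open>H\<close> is computed by expanding one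
  eigenbasis in the other (\<open>spectral_sum_diff_le\<close>). This gives a recursion that leads from traces to
  vertex degrees; moments of order \<open>log N\<close> suffice when \<open>log N = o(d)\<close>.

  Second, the eigenvector \<open>v\<close> is then close to \<open>\<plusminus>e\<^sub>i\<close> (\<open>eigenvector_close\<close>), which bounds the first term.

  Third, \<open>\<Sum> v\<^sub>a\<^sup>4\<close> is of order \<open>1/N\<close> in expectation (\<open>delocalization\<close>). Removing row \<open>a\<close> makes the eigenvector
  independent of that row; perturbation theory bounds \<open>\<bar>v\<^sub>a\<bar>\<close> by a multiple of \<open>\<bar>Y\<^sub>a\<bar> / d\<close>, where \<open>Y\<^sub>a\<close> is the
  inner product of row \<open>a\<close> with the eigenvector of the reduced matrix (\<open>leave_one_out\<close>). The fourth moment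
  of such a linear form involves the fourth powers of the eigenvector again, and the inequality closes on itself.

  Everything up to this point concerns expectations over subsets of a finite set of entries. The passage to
  convergence in distribution uses characteristic functions: for sums of Bernoulli variables they are
  compared factor by factor with those of normal variables (\<open>bernoulli_clt_char\<close>), and convergence of
  characteristic functions together with bounded second moments implies weak convergence on \<open>\<real>\<^sup>I\<close>
  (\<open>multivariate_levy_continuity\<close>, by the Stone-Weierstrass theorem on a torus).
\<close>

section \<open>Vectors and symmetric matrices of variable size\<close>

text \<open>
  The size \<open>N\<close> varies in the limit, so vectors are functions on \<open>nat\<close> of which only the coordinates below \<open>N\<close>
  matter, and matrices are functions of two indices. The inner product and the matrix action carry \<open>N\<close>.
\<close>
definition ip :: "nat \<Rightarrow> (nat \<Rightarrow> real) \<Rightarrow> (nat \<Rightarrow> real) \<Rightarrow> real" where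
  "ip N u v = (\<Sum>a<N. u a * v a)"

definition mv :: "nat \<Rightarrow> (nat \<Rightarrow> nat \<Rightarrow> real) \<Rightarrow> (nat \<Rightarrow> real) \<Rightarrow> nat \<Rightarrow> real" where
  "mv N M u = (\<lambda>a. \<Sum>b<N. M a b * u b)"

definition symm :: "nat \<Rightarrow> (nat \<Rightarrow> nat \<Rightarrow> real) \<Rightarrow> bool" where
  "symm N M \<longleftrightarrow> (\<forall>a<N. \<forall>b<N. M a b = M b a)"

text \<open>
  A full orthonormal eigenbasis. Eigenvalues are numbered from \<open>0\<close> in decreasing order, so that the
  \<open>i\<close>-th largest eigenvalue is \<open>l (i - 1)\<close>.
\<close>
definition eigensystem ::
  "nat \<Rightarrow> (nat \<Rightarrow> nat \<Rightarrow> real) \<Rightarrow> (nat \<Rightarrow> real) \<Rightarrow> (nat \<Rightarrow> nat \<Rightarrow> real) \<Rightarrow> bool" where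
  "eigensystem N M l u \<longleftrightarrow>
     (\<forall>m<N. \<forall>n<N. ip N (u m) (u n) = (if m = n then 1 else 0)) \<and>
     (\<forall>m n. m \<le> n \<and> n < N \<longrightarrow> l n \<le> l m) \<and>
     (\<forall>m<N. \<forall>a<N. mv N M (u m) a = l m * u m a)"

lemma ip_commute: "ip N u v = ip N v u"
  by (simp add: ip_def mult.commute)

lemma ip_add_left: "ip N (\<lambda>a. u a + v a) w = ip N u w + ip N v w"
  and ip_add_right: "ip N w (\<lambda>a. u a + v a) = ip N w u + ip N w v"
  by (simp_all add: ip_def sum.distrib algebra_simps)

lemma ip_diff_left: "ip N (\<lambda>a. u a - v a) w = ip N u w - ip N v w"
  and ip_diff_right: "ip N w (\<lambda>a. u a - v a) = ip N w u - ip N w v"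
  by (simp_all add: ip_def sum_subtractf algebra_simps)

lemma ip_scale_left: "ip N (\<lambda>a. c * u a) w = c * ip N u w"
  and ip_scale_right: "ip N w (\<lambda>a. c * u a) = c * ip N w u"
  by (simp_all add: ip_def sum_distrib_left algebra_simps)

lemma ip_sum_left: "ip N (\<lambda>a. \<Sum>i\<in>I. f i a) w = (\<Sum>i\<in>I. ip N (f i) w)"
proof -
  have "ip N (\<lambda>a. \<Sum>i\<in>I. f i a) w = (\<Sum>a<N. \<Sum>i\<in>I. f i a * w a)"
    by (simp add: ip_def sum_distrib_right)
  also have "\<dots> = (\<Sum>i\<in>I. \<Sum>a<N. f i a * w a)"
    by (rule sum.swap)
  finally show ?thesis
    by (simp add: ip_def)
qed

lemma ip_sum_right: "ip N w (\<lambda>a. \<Sum>i\<in>I. f i a) = (\<Sum>i\<in>I. ip N w (f i))"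
  by (subst ip_commute) (simp add: ip_sum_left ip_commute[of N w])

lemma ip_cong: "(\<And>a. a < N \<Longrightarrow> u a = u' a) \<Longrightarrow> (\<And>a. a < N \<Longrightarrow> v a = v' a) \<Longrightarrow> ip N u v = ip N u' v'"
  by (simp add: ip_def)

lemma ip_self_nonneg [simp]: "0 \<le> ip N u u"
  by (simp add: ip_def sum_nonneg)

lemma ip_self_eq_0: "ip N u u = 0 \<longleftrightarrow> (\<forall>a<N. u a = 0)"
  by (auto simp: ip_def sum_nonneg_eq_0_iff)

lemma ip_self_ge_coord: "a < N \<Longrightarrow> (u a)\<^sup>2 \<le> ip N u u"
  unfolding ip_def power2_eq_square
  by (rule member_le_sum[where f="\<lambda>a. u a * u a"]) auto

lemma ip_Cauchy_Schwarz: "(ip N u v)\<^sup>2 \<le> ip N u u * ip N v v"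
  using Cauchy_Schwarz_ineq_sum[of u v "{..<N}"] by (simp add: ip_def power2_eq_square)

lemma ip_Cauchy_Schwarz_abs: "\<bar>ip N u v\<bar> \<le> sqrt (ip N u u) * sqrt (ip N v v)"
  using ip_Cauchy_Schwarz[of N u v] by (metis real_sqrt_abs real_sqrt_le_iff real_sqrt_mult)

lemma sqrt_ip_triangle: "sqrt (ip N (\<lambda>a. u a + v a) (\<lambda>a. u a + v a)) \<le> sqrt (ip N u u) + sqrt (ip N v v)"
proof (rule real_le_lsqrt)
  have "ip N (\<lambda>a. u a + v a) (\<lambda>a. u a + v a) = ip N u u + 2 * ip N u v + ip N v v"
    by (simp add: ip_add_left ip_add_right ip_commute)
  also have "\<dots> \<le> (sqrt (ip N u u) + sqrt (ip N v v))\<^sup>2"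
    using ip_Cauchy_Schwarz_abs[of N u v] by (simp add: power2_sum)
  finally show "ip N (\<lambda>a. u a + v a) (\<lambda>a. u a + v a) \<le> (sqrt (ip N u u) + sqrt (ip N v v))\<^sup>2" .
qed auto

lemma ip_mv_sym:
  assumes "symm N M"
  shows "ip N u (mv N M v) = ip N (mv N M u) v"
proof -
  have "ip N u (mv N M v) = (\<Sum>a<N. \<Sum>b<N. M a b * u a * v b)"
    by (simp add: ip_def mv_def sum_distrib_left algebra_simps)
  also have "\<dots> = (\<Sum>b<N. \<Sum>a<N. M a b * u a * v b)"
    by (rule sum.swap)
  also have "\<dots> = (\<Sum>b<N. \<Sum>a<N. M b a * u a * v b)"
    using assms by (intro sum.cong refl) (auto simp: symm_def)
  also have "\<dots> = ip N (mv N M u) v"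
    by (simp add: ip_def mv_def sum_distrib_right)
  finally show ?thesis .
qed

lemma mv_add: "mv N M (\<lambda>a. u a + v a) a = mv N M u a + mv N M v a"
  by (simp add: mv_def sum.distrib algebra_simps)

lemma mv_diff: "mv N M (\<lambda>a. u a - v a) a = mv N M u a - mv N M v a"
  by (simp add: mv_def sum_subtractf algebra_simps)

lemma mv_scale: "mv N M (\<lambda>a. c * u a) a = c * mv N M u a"
  by (simp add: mv_def sum_distrib_left algebra_simps)

lemma mv_matrix_add: "mv N (\<lambda>a b. M a b + H a b) u a = mv N M u a + mv N H u a"
  by (simp add: mv_def sum.distrib algebra_simps)

lemma mv_matrix_diff: "mv N (\<lambda>a b. M a b - H a b) u a = mv N M u a - mv N H u a"
  by (simp add: mv_def sum_subtractf algebra_simps)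

lemma mv_cong: "(\<And>a. a < N \<Longrightarrow> u a = v a) \<Longrightarrow> mv N M u a = mv N M v a"
  by (simp add: mv_def)

section \<open>The spectral theorem\<close>

text \<open>
  More unknowns than homogeneous linear equations leave a nonzero solution. Gaussian elimination of one
  unknown proves it; it supplies every dimension count below.
\<close>
lemma underdetermined_system:
  fixes a :: "nat \<Rightarrow> 'i \<Rightarrow> real"
  assumes "finite I" "card I > m"
  shows "\<exists>c. (\<exists>i\<in>I. c i \<noteq> 0) \<and> (\<forall>j<m. (\<Sum>i\<in>I. a j i * c i) = 0)"
  using assms
proof (induction m arbitrary: I a)
  case 0
  then have "I \<noteq> {}" by auto
  then show ?case by (intro exI[of _ "\<lambda>_. 1"]) auto
next
  case (Suc m)
  show ?case
  proof (cases "\<forall>i\<in>I. a m i = 0")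
    case True
    obtain c where "(\<exists>i\<in>I. c i \<noteq> 0)" "\<forall>j<m. (\<Sum>i\<in>I. a j i * c i) = 0"
      using Suc.IH[of I a] Suc.prems by auto
    with True show ?thesis
      by (intro exI[of _ c]) (auto simp: less_Suc_eq)
  next
    case False
    then obtain k where k: "k \<in> I" "a m k \<noteq> 0" by auto
    \<comment> \<open>The equation \<open>m\<close> is used to eliminate the unknown \<open>k\<close>.\<close>
    define b where "b j i = a j i - a m i / a m k * a j k" for j i
    have fin: "finite (I - {k})" and cd: "card (I - {k}) > m"
      using Suc.prems k by auto
    obtain c where c: "\<exists>i\<in>I-{k}. c i \<noteq> 0" "\<forall>j<m. (\<Sum>i\<in>I-{k}. b j i * c i) = 0"
      using Suc.IH[OF fin cd, of b] by auto
    define s where "s = (\<Sum>i\<in>I-{k}. a m i * c i)"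
    define c' where "c' = c(k := - s / a m k)"
    have eq: "(\<Sum>i\<in>I. a j i * c' i) = (\<Sum>i\<in>I-{k}. a j i * c i) - a j k * s / a m k" for j
      using k Suc.prems(1) by (subst sum.remove[of I k]) (auto simp: c'_def)
    have "(\<Sum>i\<in>I. a j i * c' i) = 0" if "j < m" for j
    proof -
      have "(\<Sum>i\<in>I-{k}. b j i * c i) = (\<Sum>i\<in>I-{k}. a j i * c i) - (\<Sum>i\<in>I-{k}. a m i * c i) * (a j k / a m k)"
        by (simp add: b_def sum_subtractf algebra_simps sum_distrib_left sum_distrib_right sum_divide_distrib)
      with c(2) that show ?thesis
        unfolding eq s_def by (simp add: algebra_simps)
    qed
    moreover have "(\<Sum>i\<in>I. a m i * c' i) = 0"
      unfolding eq s_def using k by simp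
    ultimately show ?thesis
      using c(1) by (intro exI[of _ c']) (auto simp: less_Suc_eq c'_def)
  qed
qed

text \<open>
  Tychonoff's theorem: spheres in coordinates below \<open>N\<close> become compact once the other coordinates are
  fixed.
\<close>
lemma compact_box_functions:
  fixes K :: "nat \<Rightarrow> 'a::topological_space set"
  assumes "\<And>a. compact (K a)"
  shows "compact {x. \<forall>a. x a \<in> K a}"
proof -
  have "compactin (product_topology (\<lambda>_. euclidean) UNIV) (PiE UNIV K)"
    using assms by (subst compactin_PiE) auto
  moreover have "PiE UNIV K = {x. \<forall>a. x a \<in> K a}"
    by auto
  ultimately show ?thesis
    by (simp add: euclidean_product_topology)
qed

lemma continuous_on_ip:
  assumes "\<And>a. a < N \<Longrightarrow> continuous_on S (\<lambda>x. f x a)" "\<And>a. a < N \<Longrightarrow> continuous_on S (\<lambda>x. g x a)"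
  shows "continuous_on S (\<lambda>x. ip N (f x) (g x))"
  unfolding ip_def using assms by (intro continuous_on_sum continuous_on_mult) auto

lemma continuous_on_coord: "continuous_on S (\<lambda>x::nat \<Rightarrow> real. x a)"
  by (rule continuous_on_subset[where s=UNIV]) (simp_all add: continuous_on_product_coordinates)

text \<open>
  The next eigenvector maximizes the quadratic form on the unit sphere of the orthogonal complement of the
  eigenvectors \<open>u i\<close> already found. The extremal property is kept in the conclusion because it puts the
  eigenvalues in decreasing order.
\<close>
lemma rayleigh_step:
  assumes sym: "symm N M" and mN: "m < N"
    and ev: "\<And>i. i < m \<Longrightarrow> \<forall>a<N. mv N M (u i) a = l i * u i a"
  obtains v lam where "ip N v v = 1" "\<And>i. i < m \<Longrightarrow> ip N (u i) v = 0"
    "\<And>a. a < N \<Longrightarrow> mv N M v a = lam * v a"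
    "\<And>y. (\<And>i. i < m \<Longrightarrow> ip N (u i) y = 0) \<Longrightarrow> ip N y (mv N M y) \<le> lam * ip N y y"
proof -
  \<comment> \<open>Coordinates from \<open>N\<close> on are set to \<open>0\<close>, so that the sphere is a closed subset of a compact box.\<close>
  define B where "B = {x::nat \<Rightarrow> real. \<forall>a. x a \<in> (if a < N then {-1..1} else {0})}"
  define S where "S = {x\<in>B. ip N x x = 1 \<and> (\<forall>i<m. ip N (u i) x = 0)}"
  have cB: "compact B"
    unfolding B_def by (rule compact_box_functions) auto
  have "closed {x. ip N x x = 1}" and "\<And>i. closed {x. ip N (u i) x = 0}"
    by (intro closed_Collect_eq continuous_on_ip continuous_on_coord continuous_on_const)+
  then have "closed ({x. ip N x x = 1} \<inter> (\<Inter>i\<in>{..<m}. {x. ip N (u i) x = 0}))"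
    by (intro closed_Int closed_INT) auto
  moreover have "S = B \<inter> ({x. ip N x x = 1} \<inter> (\<Inter>i\<in>{..<m}. {x. ip N (u i) x = 0}))"
    by (auto simp: S_def)
  ultimately have cS: "compact S"
    using cB by (simp add: compact_Int_closed)
  have norm: "\<exists>x\<in>S. \<exists>c. c \<noteq> 0 \<and> (\<forall>a<N. x a = c * y a)"
    if y: "ip N y y \<noteq> 0" "\<And>i. i < m \<Longrightarrow> ip N (u i) y = 0" for y
  proof -
    define c where "c = 1 / sqrt (ip N y y)"
    define x where "x = (\<lambda>a. (if a < N then c * y a else 0))"
    have pos: "ip N y y > 0" using y(1) ip_self_nonneg[of N y] by linarith
    have c0: "c \<noteq> 0" "c\<^sup>2 * ip N y y = 1"
      using pos by (auto simp: c_def power_divide)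
    have ix: "ip N w x = c * ip N w y" for w
    proof -
      have "ip N w x = ip N w (\<lambda>a. c * y a)"
        by (rule ip_cong) (auto simp: x_def)
      then show ?thesis by (simp add: ip_scale_right)
    qed
    have "ip N x x = 1"
      using c0(2) by (simp add: ix power2_eq_square ip_commute[of N x y])
    moreover have "x a \<in> {-1..1}" if "a < N" for a
    proof -
      have "(x a)\<^sup>2 \<le> 1"
        using ip_self_ge_coord[OF that, of x] \<open>ip N x x = 1\<close> by simp
      then show ?thesis
        using abs_square_le_1[of "x a"] by auto
    qed
    ultimately have "x \<in> S"
      using y(2) by (auto simp: S_def B_def ix) (auto simp: x_def)
    then show ?thesis
      using c0 by (intro bexI[of _ x] exI[of _ c]) (auto simp: x_def)
  qed
  obtain c where c: "\<exists>i\<in>{..<N}. c i \<noteq> 0" "\<forall>j<m. (\<Sum>i\<in>{..<N}. u j i * c i) = 0"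
    using underdetermined_system[of "{..<N}" m u] mN by auto
  have "ip N c c \<noteq> 0"
    using c(1) by (auto simp: ip_self_eq_0)
  moreover have "ip N (u i) c = 0" if "i < m" for i
    using c(2) that by (auto simp: ip_def)
  ultimately have "S \<noteq> {}"
    using norm[of c] by blast
  moreover have "continuous_on S (\<lambda>x. ip N x (mv N M x))"
    unfolding mv_def
    by (intro continuous_on_ip continuous_on_sum continuous_on_mult continuous_on_const continuous_on_coord)
  ultimately obtain v where v: "v \<in> S" "\<And>x. x \<in> S \<Longrightarrow> ip N x (mv N M x) \<le> ip N v (mv N M v)"
    using continuous_attains_sup[OF cS] by blast
  define lam where "lam = ip N v (mv N M v)"
  have v1: "ip N v v = 1" and v0: "\<And>i. i < m \<Longrightarrow> ip N (u i) v = 0"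
    using v(1) by (auto simp: S_def)
  have max: "ip N y (mv N M y) \<le> lam * ip N y y" if y: "\<And>i. i < m \<Longrightarrow> ip N (u i) y = 0" for y
  proof (cases "ip N y y = 0")
    case True
    then have "ip N y (mv N M y) = 0"
      unfolding ip_self_eq_0 by (simp add: ip_def)
    with True show ?thesis by simp
  next
    case False
    then obtain x c where x: "x \<in> S" "c \<noteq> 0" "\<forall>a<N. x a = c * y a"
      using norm[of y] y by auto
    have "ip N x (mv N M x) = c\<^sup>2 * ip N y (mv N M y)"
    proof -
      have "mv N M x a = c * mv N M y a" for a
        using mv_cong[of N x "\<lambda>a. c * y a" M a] x(3) by (simp add: mv_scale)
      then have "ip N x (mv N M x) = ip N (\<lambda>a. c * y a) (\<lambda>a. c * mv N M y a)"
        using x(3) by (intro ip_cong) auto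
      then show ?thesis by (simp add: ip_scale_left ip_scale_right power2_eq_square)
    qed
    moreover have "ip N x x = c\<^sup>2 * ip N y y"
      using ip_cong[of N x "\<lambda>a. c * y a" x "\<lambda>a. c * y a"] x(3)
      by (simp add: ip_scale_left ip_scale_right power2_eq_square)
    moreover have "ip N x x = 1" using x(1) by (auto simp: S_def)
    ultimately have "c\<^sup>2 * ip N y (mv N M y) \<le> lam * (c\<^sup>2 * ip N y y)"
      using v(2)[OF x(1)] by (simp add: lam_def)
    then have "c\<^sup>2 * ip N y (mv N M y) \<le> c\<^sup>2 * (lam * ip N y y)"
      by (simp add: algebra_simps)
    then show ?thesis
      using x(2) by (simp add: mult_le_cancel_left_pos)
  qed
  define w where "w = (\<lambda>a. mv N M v a - lam * v a)"
  have vMw: "ip N z (mv N M v) = ip N (mv N M z) v" for z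
    by (rule ip_mv_sym[OF sym])
  have w0: "ip N (u i) w = 0" if "i < m" for i
  proof -
    have "ip N (u i) (mv N M v) = ip N (\<lambda>a. l i * u i a) v"
      unfolding vMw using ev[OF that] by (intro ip_cong) auto
    then show ?thesis
      unfolding w_def using v0[OF that] by (simp add: ip_diff_right ip_scale_right ip_scale_left)
  qed
  have vw: "ip N v w = 0"
    unfolding w_def by (simp add: ip_diff_right ip_scale_right v1 lam_def)
  \<comment> \<open>Moving \<open>v\<close> a little in the direction of the residual \<open>w\<close> would increase the Rayleigh quotient.\<close>
  have ww: "ip N w w = 0"
  proof (rule ccontr)
    assume "ip N w w \<noteq> 0"
    then have pos: "ip N w w > 0" using ip_self_nonneg[of N w] by linarith
    define q where "q = lam * ip N w w - ip N w (mv N M w)"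
    have q0: "q \<ge> 0" using max[OF w0] by (simp add: q_def)
    have wMv: "ip N w (mv N M v) = ip N w w"
    proof -
      have "ip N w w = ip N w (\<lambda>a. mv N M v a - lam * v a)"
        by (rule ip_cong) (simp_all add: w_def)
      then have "ip N w w = ip N w (mv N M v) - lam * ip N w v"
        by (simp add: ip_diff_right ip_scale_right)
      then show ?thesis using vw by (simp add: ip_commute)
    qed
    have key: "2 * t * ip N w w \<le> t\<^sup>2 * q" for t
    proof -
      define y where "y = (\<lambda>a. v a + t * w a)"
      have "mv N M y = (\<lambda>a. mv N M v a + t * mv N M w a)"
        unfolding y_def by (rule ext) (simp add: mv_add mv_scale)
      then have "ip N y (mv N M y) = ip N v (mv N M v) + t * ip N v (mv N M w) + t * ip N w (mv N M v) + t\<^sup>2 * ip N w (mv N M w)"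
        unfolding y_def
        by (simp add: ip_add_left ip_add_right ip_scale_left ip_scale_right power2_eq_square algebra_simps)
      moreover have "ip N v (mv N M w) = ip N w w"
        using vMw[of w] ip_mv_sym[OF sym, of v w] wMv by (simp add: ip_commute)
      ultimately have "ip N y (mv N M y) = lam + 2 * t * ip N w w + t\<^sup>2 * ip N w (mv N M w)"
        by (simp add: wMv lam_def)
      moreover have "ip N y y = 1 + t\<^sup>2 * ip N w w"
        unfolding y_def by (simp add: ip_add_left ip_add_right ip_scale_left ip_scale_right power2_eq_square v1 vw ip_commute[of N w v])
      moreover have "ip N y (mv N M y) \<le> lam * ip N y y"
        by (rule max) (simp add: y_def ip_add_right ip_scale_right v0 w0)
      ultimately show ?thesis by (simp add: q_def algebra_simps)
    qed
    define t where "t = ip N w w / (q + 1)"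
    have t: "t > 0" using pos q0 by (simp add: t_def)
    have "t * (2 * ip N w w) \<le> t * (t * q)"
      using key[of t] by (simp add: power2_eq_square algebra_simps)
    then have "2 * ip N w w \<le> t * q"
      using t by simp
    also have "\<dots> \<le> ip N w w"
      using q0 pos by (simp add: t_def field_simps)
    finally show False using pos by simp
  qed
  have "mv N M v a = lam * v a" if "a < N" for a
    using ww that unfolding ip_self_eq_0 w_def by auto
  with v1 v0 max show ?thesis using that by blast
qed

text \<open>
  The \<open>n\<close>-th eigenvector is a competitor in the maximization that defines an earlier \<open>l m\<close>; hence
  \<open>l n \<le> l m\<close>.
\<close>
lemma eigensystem_exists:
  assumes sym: "symm N M"
  shows "\<exists>l u. eigensystem N M l u"
proof -
  have "\<exists>l u. (\<forall>i<m. \<forall>j<m. ip N (u i) (u j) = (if i = j then 1 else 0)) \<and>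
     (\<forall>i<m. \<forall>a<N. mv N M (u i) a = l i * u i a) \<and>
     (\<forall>i<m. \<forall>y. (\<forall>j<i. ip N (u j) y = 0) \<longrightarrow> ip N y (mv N M y) \<le> l i * ip N y y)" if "m \<le> N" for m
    using that
  proof (induction m)
    case 0
    then show ?case by simp
  next
    case (Suc m)
    then obtain l u where lu:
      "\<forall>i<m. \<forall>j<m. ip N (u i) (u j) = (if i = j then 1 else 0)"
      "\<forall>i<m. \<forall>a<N. mv N M (u i) a = l i * u i a"
      "\<forall>i<m. \<forall>y. (\<forall>j<i. ip N (u j) y = 0) \<longrightarrow> ip N y (mv N M y) \<le> l i * ip N y y"
      by auto
    obtain v lam where v: "ip N v v = 1" "\<And>i. i < m \<Longrightarrow> ip N (u i) v = 0"
        "\<And>a. a < N \<Longrightarrow> mv N M v a = lam * v a"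
        "\<And>y. (\<And>i. i < m \<Longrightarrow> ip N (u i) y = 0) \<Longrightarrow> ip N y (mv N M y) \<le> lam * ip N y y"
      using rayleigh_step[OF sym, of m u l] Suc.prems lu(2) by auto
    define u' where "u' = u(m := v)"
    define l' where "l' = l(m := lam)"
    have old: "u' i = u i" "l' i = l i" if "i < m" for i
      using that by (auto simp: u'_def l'_def)
    have new: "u' m = v" "l' m = lam"
      by (auto simp: u'_def l'_def)
    have vu: "ip N v (u i) = 0" if "i < m" for i
      using v(2)[OF that] by (metis ip_commute)
    have "ip N (u' i) (u' j) = (if i = j then 1 else 0)" if "i < Suc m" "j < Suc m" for i j
    proof -
      have "i < m \<or> i = m" "j < m \<or> j = m" using that by auto
      then show ?thesis
        using lu(1) v(1) vu by (elim disjE) (simp_all add: old new v(2))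
    qed
    moreover have "mv N M (u' i) a = l' i * u' i a" if "i < Suc m" "a < N" for i a
    proof -
      have "i < m \<or> i = m" using that by auto
      then show ?thesis
        using lu(2) v(3) that(2) by (elim disjE) (simp_all add: old new)
    qed
    moreover have "ip N y (mv N M y) \<le> l' i * ip N y y"
      if "i < Suc m" and y: "\<forall>j<i. ip N (u' j) y = 0" for i y
    proof -
      have "\<forall>j<i. ip N (u j) y = 0" using y that(1) by (auto simp: u'_def split: if_splits)
      moreover have "i < m \<or> i = m" using that by auto
      ultimately show ?thesis
        using lu(3) v(4)[of y] by (elim disjE) (simp_all add: old new)
    qed
    ultimately show ?case by blast
  qed
  then obtain l u where lu:
      "\<forall>i<N. \<forall>j<N. ip N (u i) (u j) = (if i = j then 1 else 0)"
      "\<forall>i<N. \<forall>a<N. mv N M (u i) a = l i * u i a"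
      "\<forall>i<N. \<forall>y. (\<forall>j<i. ip N (u j) y = 0) \<longrightarrow> ip N y (mv N M y) \<le> l i * ip N y y"
    by blast
  have "l n \<le> l m" if "m \<le> n" "n < N" for m n
  proof -
    have "\<forall>j<m. ip N (u j) (u n) = 0"
      using lu(1) that by auto
    then have "ip N (u n) (mv N M (u n)) \<le> l m * ip N (u n) (u n)"
      using lu(3) that by auto
    moreover have "ip N (u n) (mv N M (u n)) = ip N (u n) (\<lambda>a. l n * u n a)"
      using lu(2) that by (intro ip_cong) auto
    ultimately show ?thesis
      using lu(1) that by (simp add: ip_scale_right)
  qed
  with lu show ?thesis
    unfolding eigensystem_def by blast
qed

lemma eigensystem_ortho: "eigensystem N M l u \<Longrightarrow> m < N \<Longrightarrow> n < N \<Longrightarrow> ip N (u m) (u n) = (if m = n then 1 else 0)"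
  and eigensystem_mono: "eigensystem N M l u \<Longrightarrow> m \<le> n \<Longrightarrow> n < N \<Longrightarrow> l n \<le> l m"
  and eigensystem_mv: "eigensystem N M l u \<Longrightarrow> m < N \<Longrightarrow> a < N \<Longrightarrow> mv N M (u m) a = l m * u m a"
  by (auto simp: eigensystem_def)

text \<open>
  A left inverse of a square matrix is a right inverse, so orthonormal rows give orthonormal columns.
\<close>
lemma eigensystem_complete:
  assumes es: "eigensystem N M l u" and "a < N" "b < N"
  shows "(\<Sum>m<N. u m a * u m b) = (if a = b then 1 else 0)"
proof -
  define U where "U = mat N N (\<lambda>(m, a). u m a)"
  have U: "U \<in> carrier_mat N N" by (simp add: U_def)
  have "U * transpose_mat U = 1\<^sub>m N"
    using eigensystem_ortho[OF es]
    by (intro eq_matI) (auto simp: U_def times_mat_def scalar_prod_def ip_def lessThan_atLeast0)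
  then have "transpose_mat U * U = 1\<^sub>m N"
    using U by (intro mat_mult_left_right_inverse[of U N]) auto
  then have "(transpose_mat U * U) $$ (a, b) = 1\<^sub>m N $$ (a, b)" by simp
  then show ?thesis
    using assms(2,3) by (simp add: U_def times_mat_def scalar_prod_def lessThan_atLeast0)
qed

lemma eigensystem_expand:
  assumes es: "eigensystem N M l u" and "a < N"
  shows "x a = (\<Sum>m<N. ip N (u m) x * u m a)"
proof -
  have "(\<Sum>m<N. ip N (u m) x * u m a) = (\<Sum>m<N. \<Sum>b<N. u m b * x b * u m a)"
    by (simp add: ip_def sum_distrib_right)
  also have "\<dots> = (\<Sum>b<N. \<Sum>m<N. u m b * x b * u m a)"
    by (rule sum.swap)
  also have "\<dots> = (\<Sum>b<N. x b * (\<Sum>m<N. u m b * u m a))"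
    by (simp add: sum_distrib_left algebra_simps)
  also have "\<dots> = (\<Sum>b<N. x b * (if b = a then 1 else 0))"
    using eigensystem_complete[OF es _ assms(2)] by (intro sum.cong) auto
  also have "\<dots> = x a"
    using assms(2) by (simp add: if_distrib cong: if_cong)
  finally show ?thesis ..
qed

lemma eigensystem_parseval:
  assumes es: "eigensystem N M l u"
  shows "ip N x y = (\<Sum>m<N. ip N (u m) x * ip N (u m) y)"
proof -
  have "ip N x y = ip N (\<lambda>a. \<Sum>m<N. ip N (u m) x * u m a) y"
    using eigensystem_expand[OF es, of _ x] by (intro ip_cong) auto
  then show ?thesis
    by (simp add: ip_sum_left ip_scale_left)
qed

lemma eigensystem_ip_mv:
  assumes es: "eigensystem N M l u" and sym: "symm N M" and m: "m < N"
  shows "ip N (u m) (mv N M x) = l m * ip N (u m) x"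
proof -
  have "ip N (u m) (mv N M x) = ip N (\<lambda>a. l m * u m a) x"
    unfolding ip_mv_sym[OF sym] using eigensystem_mv[OF es m] by (intro ip_cong) auto
  then show ?thesis by (simp add: ip_scale_left)
qed

lemma eigensystem_quadratic_form:
  assumes es: "eigensystem N M l u" and sym: "symm N M"
  shows "ip N x (mv N M x) = (\<Sum>m<N. l m * (ip N (u m) x)\<^sup>2)"
  unfolding eigensystem_parseval[OF es, of x]
  by (intro sum.cong refl) (simp add: eigensystem_ip_mv[OF es sym] power2_eq_square)

lemma eigensystem_mv_norm:
  assumes es: "eigensystem N M l u" and sym: "symm N M"
  shows "ip N (mv N M x) (mv N M x) = (\<Sum>m<N. (l m)\<^sup>2 * (ip N (u m) x)\<^sup>2)"
  unfolding eigensystem_parseval[OF es, of "mv N M x"]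
  by (intro sum.cong refl) (simp add: eigensystem_ip_mv[OF es sym] power2_eq_square)

definition mat_fun :: "nat \<Rightarrow> (nat \<Rightarrow> nat \<Rightarrow> real) \<Rightarrow> real mat" where
  "mat_fun N M = mat N N (\<lambda>(a, b). M a b)"

text \<open>
  The eigenbasis diagonalizes the matrix by similarity, which preserves the characteristic polynomial;
  the multiset of its roots is therefore the list of eigenvalues.
\<close>
lemma eigensystem_eig:
  assumes es: "eigensystem N M l u" and sym: "symm N M" and m: "m < N"
  shows "eig (Suc m) (mat_fun N M) = l m"
proof -
  define U where "U = mat N N (\<lambda>(a, m). u m a)"
  define D where "D = mat N N (\<lambda>(m, n). if m = n then l m else 0)"
  have U: "U \<in> carrier_mat N N" "transpose_mat U \<in> carrier_mat N N" by (simp_all add: U_def)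
  have D: "D \<in> carrier_mat N N" by (simp add: D_def)
  have M: "mat_fun N M \<in> carrier_mat N N" by (simp add: mat_fun_def)
  have UtU: "transpose_mat U * U = 1\<^sub>m N"
    using eigensystem_ortho[OF es]
    by (intro eq_matI) (auto simp: U_def times_mat_def scalar_prod_def ip_def lessThan_atLeast0)
  have UUt: "U * transpose_mat U = 1\<^sub>m N"
    using mat_mult_left_right_inverse[OF U(2) U(1) UtU] .
  have MU: "mat_fun N M * U = U * D"
  proof (rule eq_matI)
    fix i j assume "i < dim_row (U * D)" "j < dim_col (U * D)"
    then have ij: "i < N" "j < N" by (simp_all add: U_def D_def)
    have "(mat_fun N M * U) $$ (i, j) = mv N M (u j) i"
      using ij by (simp add: mat_fun_def U_def times_mat_def scalar_prod_def mv_def lessThan_atLeast0)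
    moreover have "(U * D) $$ (i, j) = (\<Sum>k<N. u k i * (if k = j then l k else 0))"
      using ij by (simp add: U_def D_def times_mat_def scalar_prod_def lessThan_atLeast0)
    ultimately show "(mat_fun N M * U) $$ (i, j) = (U * D) $$ (i, j)"
      using eigensystem_mv[OF es] ij by (simp add: if_distrib cong: if_cong)
  qed (simp_all add: mat_fun_def U_def D_def)
  have "mat_fun N M = mat_fun N M * (U * transpose_mat U)"
    unfolding UUt using M by simp
  also have "\<dots> = mat_fun N M * U * transpose_mat U"
    using assoc_mult_mat[OF M U] by simp
  finally have "mat_fun N M = U * D * transpose_mat U"
    unfolding MU .
  then have "similar_mat (mat_fun N M) D"
    using U D M UtU UUt by (intro similar_matI[of _ _ U "transpose_mat U" N]) auto
  then have "char_poly (mat_fun N M) = char_poly D"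
    by (rule char_poly_similar)
  also have "\<dots> = (\<Prod>a\<leftarrow>diag_mat D. [:- a, 1:])"
    by (rule char_poly_upper_triangular[OF D]) (auto simp: D_def upper_triangular_def)
  also have "diag_mat D = map l [0..<N]"
    by (auto simp: diag_mat_def D_def)
  finally have cp: "char_poly (mat_fun N M) = (\<Prod>p\<leftarrow>map (\<lambda>a. [:- a, 1:]) (map l [0..<N]). p)"
    by simp
  have "proots (char_poly (mat_fun N M)) = (\<Sum>p\<leftarrow>map (\<lambda>a. [:- a, 1:]) (map l [0..<N]). proots p)"
    unfolding cp by (rule proots_prod_list) auto
  also have "\<dots> = mset (rev (map l [0..<N]))"
    by (induction N) auto
  finally have *: "sorted_list_of_multiset (proots (char_poly (mat_fun N M))) = sort (rev (map l [0..<N]))"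
    by (simp only: sorted_list_of_multiset_mset)
  have "sorted (rev (map l [0..<N]))"
    using eigensystem_mono[OF es] by (auto simp: sorted_wrt_iff_nth_less rev_nth sorted_iff_nth_mono)
  then have "sort (rev (map l [0..<N])) = rev (map l [0..<N])"
    by (simp add: sorted_sort_id)
  with * show ?thesis
    using m by (simp add: eig_def)
qed

text \<open>
  Half of the min-max principle: the common kernel of \<open>m\<close> functionals, where the form is at most \<open>t\<close>, meets the span
  of the first \<open>m + 1\<close> eigenvectors, where it is at least \<open>l m\<close>.
\<close>
lemma eigensystem_le_subspace:
  assumes es: "eigensystem N M l u" and sym: "symm N M" and m: "m < N"
    and le: "\<And>x. (\<And>j. j < m \<Longrightarrow> ip N (w j) x = 0) \<Longrightarrow> ip N x (mv N M x) \<le> t * ip N x x"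
  shows "l m \<le> t"
proof -
  obtain c where c: "\<exists>i\<in>{..m}. c i \<noteq> 0" "\<forall>j<m. (\<Sum>i\<in>{..m}. ip N (w j) (u i) * c i) = 0"
    using underdetermined_system[of "{..m}" m "\<lambda>j i. ip N (w j) (u i)"] by auto
  define x where "x = (\<lambda>a. (\<Sum>i\<le>m. c i * u i a))"
  have ux: "ip N (u n) x = (if n \<le> m then c n else 0)" if "n < N" for n
  proof -
    have "ip N (u n) x = (\<Sum>i\<le>m. c i * ip N (u n) (u i))"
      by (simp add: x_def ip_sum_right ip_scale_right)
    also have "\<dots> = (\<Sum>i\<le>m. if i = n then c i else 0)"
      using eigensystem_ortho[OF es that] m by (intro sum.cong) auto
    finally show ?thesis by simp
  qed
  have wx: "ip N (w j) x = 0" if "j < m" for j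
    using c(2) that by (simp add: x_def ip_sum_right ip_scale_right mult.commute)
  have xx: "ip N x x = (\<Sum>n<N. (ip N (u n) x)\<^sup>2)"
    by (simp add: eigensystem_parseval[OF es, of x x] power2_eq_square)
  obtain i where i: "i \<le> m" "c i \<noteq> 0" using c(1) by auto
  have "(ip N (u i) x)\<^sup>2 \<le> ip N x x"
    unfolding xx using i m by (intro member_le_sum) auto
  then have pos: "ip N x x > 0"
    using ux[of i] i m by (simp add: order_less_le_trans[of 0 "(c i)\<^sup>2"])
  have "l m * ip N x x = (\<Sum>n<N. l m * (ip N (u n) x)\<^sup>2)"
    unfolding xx by (simp add: sum_distrib_left)
  also have "\<dots> \<le> (\<Sum>n<N. l n * (ip N (u n) x)\<^sup>2)"
  proof (rule sum_mono)
    fix n assume "n \<in> {..<N}"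
    then show "l m * (ip N (u n) x)\<^sup>2 \<le> l n * (ip N (u n) x)\<^sup>2"
      using eigensystem_mono[OF es, of n m] m ux[of n]
      by (cases "n \<le> m") (auto intro: mult_right_mono)
  qed
  also have "\<dots> = ip N x (mv N M x)"
    by (rule eigensystem_quadratic_form[OF es sym, symmetric])
  also have "\<dots> \<le> t * ip N x x"
    using wx by (rule le)
  finally show ?thesis using pos by simp
qed

text \<open>
  The other half: an \<open>(m + 1)\<close>-dimensional space, where the form is at least \<open>t\<close>, meets the orthogonal complement
  of the first \<open>m\<close> eigenvectors, where it is at most \<open>l m\<close>. The strict inequality in the hypothesis expresses that the vectors \<open>w i\<close> are linearly
  independent.
\<close>
lemma eigensystem_ge_subspace:
  assumes es: "eigensystem N M l u" and sym: "symm N M" and m: "m < N"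
    and ge: "\<And>c. (\<exists>i\<le>m. c i \<noteq> 0) \<Longrightarrow>
       t * ip N (\<lambda>a. \<Sum>i\<le>m. c i * w i a) (\<lambda>a. \<Sum>i\<le>m. c i * w i a)
         \<le> ip N (\<lambda>a. \<Sum>i\<le>m. c i * w i a) (mv N M (\<lambda>a. \<Sum>i\<le>m. c i * w i a))
       \<and> 0 < ip N (\<lambda>a. \<Sum>i\<le>m. c i * w i a) (\<lambda>a. \<Sum>i\<le>m. c i * w i a)"
  shows "t \<le> l m"
proof -
  obtain c where c: "\<exists>i\<in>{..m}. c i \<noteq> 0" "\<forall>j<m. (\<Sum>i\<in>{..m}. ip N (u j) (w i) * c i) = 0"
    using underdetermined_system[of "{..m}" m "\<lambda>j i. ip N (u j) (w i)"] by auto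
  define x where "x = (\<lambda>a. (\<Sum>i\<le>m. c i * w i a))"
  have x: "t * ip N x x \<le> ip N x (mv N M x)" "0 < ip N x x"
    using ge[of c] c(1) unfolding x_def by auto
  have ux: "ip N (u j) x = 0" if "j < m" for j
    using c(2) that by (simp add: x_def ip_sum_right ip_scale_right mult.commute)
  have "ip N x (mv N M x) = (\<Sum>n<N. l n * (ip N (u n) x)\<^sup>2)"
    by (rule eigensystem_quadratic_form[OF es sym])
  also have "\<dots> \<le> (\<Sum>n<N. l m * (ip N (u n) x)\<^sup>2)"
  proof (rule sum_mono)
    fix n assume "n \<in> {..<N}"
    then show "l n * (ip N (u n) x)\<^sup>2 \<le> l m * (ip N (u n) x)\<^sup>2"
      using eigensystem_mono[OF es, of m n] m ux[of n]
      by (cases "m \<le> n") (auto intro: mult_right_mono)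
  qed
  also have "\<dots> = l m * ip N x x"
    by (simp add: eigensystem_parseval[OF es, of x x] power2_eq_square sum_distrib_left)
  finally show ?thesis using x by (meson mult_le_cancel_right_pos order_trans)
qed

lemma weyl_le:
  assumes es: "eigensystem N M l u" and sym: "symm N M"
    and es': "eigensystem N M' l' u'" and sym': "symm N M'" and m: "m < N"
    and h: "\<And>x. ip N x (mv N (\<lambda>a b. M a b - M' a b) x) \<le> h * ip N x x"
  shows "l m \<le> l' m + h"
proof (rule eigensystem_le_subspace[OF es sym m, where w = u'])
  fix x assume x: "\<And>j. j < m \<Longrightarrow> ip N (u' j) x = 0"
  have "ip N x (mv N M' x) = (\<Sum>n<N. l' n * (ip N (u' n) x)\<^sup>2)"
    by (rule eigensystem_quadratic_form[OF es' sym'])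
  also have "\<dots> \<le> (\<Sum>n<N. l' m * (ip N (u' n) x)\<^sup>2)"
  proof (rule sum_mono)
    fix n assume "n \<in> {..<N}"
    then show "l' n * (ip N (u' n) x)\<^sup>2 \<le> l' m * (ip N (u' n) x)\<^sup>2"
      using eigensystem_mono[OF es', of m n] m x[of n]
      by (cases "m \<le> n") (auto intro: mult_right_mono)
  qed
  also have "\<dots> = l' m * ip N x x"
    by (simp add: eigensystem_parseval[OF es', of x x] power2_eq_square sum_distrib_left)
  finally have "ip N x (mv N M' x) \<le> l' m * ip N x x" .
  moreover have "ip N x (mv N (\<lambda>a b. M a b - M' a b) x) = ip N x (\<lambda>a. mv N M x a - mv N M' x a)"
    by (rule ip_cong) (simp_all add: mv_matrix_diff)
  ultimately show "ip N x (mv N M x) \<le> (l' m + h) * ip N x x"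
    using h[of x] by (simp add: ip_diff_right algebra_simps)
qed

section \<open>Operator norm bounds and perturbation\<close>

definition op_le :: "nat \<Rightarrow> (nat \<Rightarrow> nat \<Rightarrow> real) \<Rightarrow> real \<Rightarrow> bool" where
  "op_le N M t \<longleftrightarrow> 0 \<le> t \<and> (\<forall>x. sqrt (ip N (mv N M x) (mv N M x)) \<le> t * sqrt (ip N x x))"

lemma sqrt_ip_scale: "sqrt (ip N (\<lambda>a. c * u a) (\<lambda>a. c * u a)) = \<bar>c\<bar> * sqrt (ip N u u)"
  by (simp add: ip_scale_left ip_scale_right real_sqrt_mult flip: mult.assoc)

lemma op_leD: "op_le N M t \<Longrightarrow> sqrt (ip N (mv N M x) (mv N M x)) \<le> t * sqrt (ip N x x)"
  by (simp add: op_le_def)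

lemma op_le_nonneg: "op_le N M t \<Longrightarrow> 0 \<le> t"
  by (simp add: op_le_def)

lemma op_leI:
  assumes "0 \<le> t" "\<And>x. ip N (mv N M x) (mv N M x) \<le> t\<^sup>2 * ip N x x"
  shows "op_le N M t"
proof -
  have "sqrt (ip N (mv N M x) (mv N M x)) \<le> t * sqrt (ip N x x)" for x
  proof -
    have "sqrt (ip N (mv N M x) (mv N M x)) \<le> sqrt (t\<^sup>2 * ip N x x)"
      using assms(2) by simp
    then show ?thesis using assms(1) by (simp add: real_sqrt_mult)
  qed
  then show ?thesis using assms(1) by (simp add: op_le_def)
qed

lemma op_le_quadratic_form:
  assumes "op_le N M t"
  shows "\<bar>ip N x (mv N M x)\<bar> \<le> t * ip N x x"
proof -
  have "\<bar>ip N x (mv N M x)\<bar> \<le> sqrt (ip N x x) * sqrt (ip N (mv N M x) (mv N M x))"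
    by (rule ip_Cauchy_Schwarz_abs)
  also have "\<dots> \<le> sqrt (ip N x x) * (t * sqrt (ip N x x))"
    by (intro mult_left_mono op_leD[OF assms]) auto
  also have "\<dots> = t * ip N x x" by simp
  finally show ?thesis .
qed

lemma op_le_add:
  assumes "op_le N M s" "op_le N H t"
  shows "op_le N (\<lambda>a b. M a b + H a b) (s + t)"
  unfolding op_le_def
proof (intro conjI allI)
  show "0 \<le> s + t" using assms by (simp add: op_le_def)
  fix x
  have "mv N (\<lambda>a b. M a b + H a b) x = (\<lambda>a. mv N M x a + mv N H x a)"
    by (rule ext) (rule mv_matrix_add)
  then show "sqrt (ip N (mv N (\<lambda>a b. M a b + H a b) x) (mv N (\<lambda>a b. M a b + H a b) x)) \<le> (s + t) * sqrt (ip N x x)"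
    using sqrt_ip_triangle[of N "mv N M x" "mv N H x"] op_leD[OF assms(1), of x] op_leD[OF assms(2), of x]
    by (simp add: distrib_right)
qed

lemma op_le_uminus: "op_le N M t \<Longrightarrow> op_le N (\<lambda>a b. - M a b) t"
proof -
  have "mv N (\<lambda>a b. - M a b) x = (\<lambda>a. (-1) * mv N M x a)" for x
    by (rule ext) (simp add: mv_def sum_negf)
  then have "ip N (mv N (\<lambda>a b. - M a b) x) (mv N (\<lambda>a b. - M a b) x) = ip N (mv N M x) (mv N M x)" for x
    by (simp only: ip_scale_left ip_scale_right)
  then show "op_le N M t \<Longrightarrow> op_le N (\<lambda>a b. - M a b) t"
    by (simp add: op_le_def)
qed

lemma op_le_diff: "op_le N M s \<Longrightarrow> op_le N H t \<Longrightarrow> op_le N (\<lambda>a b. M a b - H a b) (s + t)"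
  using op_le_add[OF _ op_le_uminus, of N M s H t] by simp

lemma op_le_mono: "op_le N M s \<Longrightarrow> s \<le> t \<Longrightarrow> op_le N M t"
  unfolding op_le_def by (meson ip_self_nonneg mult_right_mono order_trans real_sqrt_ge_0_iff)

lemma op_le_eigensystem:
  assumes es: "eigensystem N M l u" and sym: "symm N M" and t: "0 \<le> t" "\<And>m. m < N \<Longrightarrow> \<bar>l m\<bar> \<le> t"
  shows "op_le N M t"
proof (rule op_leI[OF t(1)])
  fix x
  have "(\<Sum>m<N. (l m)\<^sup>2 * (ip N (u m) x)\<^sup>2) \<le> (\<Sum>m<N. t\<^sup>2 * (ip N (u m) x)\<^sup>2)"
  proof (intro sum_mono mult_right_mono)
    fix m assume "m \<in> {..<N}"
    then have "\<bar>l m\<bar> \<le> \<bar>t\<bar>" using t by auto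
    then show "(l m)\<^sup>2 \<le> t\<^sup>2" by (rule iffD2[OF abs_le_square_iff[symmetric], rotated])
  qed auto
  then show "ip N (mv N M x) (mv N M x) \<le> t\<^sup>2 * ip N x x"
    by (simp add: eigensystem_mv_norm[OF es sym] eigensystem_parseval[OF es, of x x] sum_distrib_left power2_eq_square)
qed

lemma op_le_frobenius: "op_le N H (sqrt (\<Sum>a<N. \<Sum>b<N. (H a b)\<^sup>2))"
proof (rule op_leI)
  fix x
  have "ip N (mv N H x) (mv N H x) = (\<Sum>a<N. (ip N (H a) x)\<^sup>2)"
    by (simp add: ip_def mv_def power2_eq_square)
  also have "\<dots> \<le> (\<Sum>a<N. (\<Sum>b<N. (H a b)\<^sup>2) * ip N x x)"
    using ip_Cauchy_Schwarz[of N "H _" x] by (intro sum_mono) (simp add: ip_def power2_eq_square)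
  finally show "ip N (mv N H x) (mv N H x) \<le> (sqrt (\<Sum>a<N. \<Sum>b<N. (H a b)\<^sup>2))\<^sup>2 * ip N x x"
    by (simp add: sum_nonneg sum_distrib_right)
qed (simp add: sum_nonneg)

lemma weyl_op:
  assumes es: "eigensystem N M l u" and sym: "symm N M"
    and es': "eigensystem N M' l' u'" and sym': "symm N M'" and m: "m < N"
    and h: "op_le N (\<lambda>a b. M a b - M' a b) h"
  shows "\<bar>l m - l' m\<bar> \<le> h"
proof -
  have "l m \<le> l' m + h"
    using op_le_quadratic_form[OF h] by (intro weyl_le[OF es sym es' sym' m]) (simp add: abs_le_iff)
  moreover have "op_le N (\<lambda>a b. M' a b - M a b) h"
    using op_le_uminus[OF h] by simp
  then have "l' m \<le> l m + h"
    using op_le_quadratic_form by (intro weyl_le[OF es' sym' es sym m]) (force simp: abs_le_iff)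
  ultimately show ?thesis by linarith
qed

text \<open>
  An arbitrary eigensystem is fixed for each matrix. The eigenvectors are determined only up to sign (and
  rotation in multiple eigenspaces), but every later bound holds for any choice; the eigenvalues do not
  depend on it.
\<close>
definition eigval :: "nat \<Rightarrow> (nat \<Rightarrow> nat \<Rightarrow> real) \<Rightarrow> nat \<Rightarrow> real" where
  "eigval N M = fst (SOME p. eigensystem N M (fst p) (snd p))"
definition eigvec :: "nat \<Rightarrow> (nat \<Rightarrow> nat \<Rightarrow> real) \<Rightarrow> nat \<Rightarrow> nat \<Rightarrow> real" where
  "eigvec N M = snd (SOME p. eigensystem N M (fst p) (snd p))"

lemma eigensystem_eigval: "symm N M \<Longrightarrow> eigensystem N M (eigval N M) (eigvec N M)"
proof -
  assume "symm N M"
  then have "\<exists>p. eigensystem N M (fst p) (snd p)"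
    using eigensystem_exists[of N M] by auto
  from someI_ex[OF this] show ?thesis
    unfolding eigval_def eigvec_def .
qed

text \<open>
  Used for the measurability of eigenvalues of a random matrix, through continuity in the entries.
\<close>
lemma eigval_Lipschitz:
  assumes "symm N M" "symm N M'" "m < N"
  shows "\<bar>eigval N M m - eigval N M' m\<bar> \<le> sqrt (\<Sum>a<N. \<Sum>b<N. (M a b - M' a b)\<^sup>2)"
  by (rule weyl_op[OF eigensystem_eigval[OF assms(1)] assms(1) eigensystem_eigval[OF assms(2)] assms(2,3) op_le_frobenius])

lemma eig_eigval:
  assumes "symm N M" "m < N"
  shows "eig (Suc m) (mat_fun N M) = eigval N M m"
  using eigensystem_eig[OF eigensystem_eigval] assms by simp

text \<open>
  Perturbation of a simple eigenvalue \<open>l m\<close> with gap \<open>g\<close>. The bounds are in terms of \<open>H (u m)\<close>, the perturbation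
  applied to the one unperturbed eigenvector, and not of the norm of \<open>H\<close>: when \<open>H\<close> is a change of one entry
  or of one row, and \<open>u m\<close> is spread out, then \<open>H (u m)\<close> is much smaller than the norm of \<open>H\<close>. The component \<open>w'\<close> of the new eigenvector
  \<open>w\<close> off \<open>u m\<close> satisfies \<open>(l n - mu) w' = - H w\<close> in each eigendirection, with \<open>H w = c H (u m) + H w'\<close>; the second
  summand is absorbed because \<open>h \<le> g / 4\<close>. Pairing the eigenvalue equation with \<open>u m\<close> gives the first-order
  expansion of the eigenvalue, with quadratic error.
\<close>
lemma simple_eigenvector_perturbation:
  assumes es: "eigensystem N M l u" and sym: "symm N M" and m: "m < N"
    and g: "0 < g" and gap: "\<And>n. n < N \<Longrightarrow> n \<noteq> m \<Longrightarrow> g \<le> \<bar>l n - l m\<bar>"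
    and symH: "symm N H" and h: "op_le N H h" "h \<le> g / 4"
    and w: "ip N w w = 1" "\<And>a. a < N \<Longrightarrow> mv N M w a + mv N H w a = mu * w a"
    and mu: "\<bar>mu - l m\<bar> \<le> g / 4"
  defines "w' \<equiv> \<lambda>a. w a - ip N (u m) w * u m a"
    and "nH \<equiv> sqrt (ip N (mv N H (u m)) (mv N H (u m)))"
  shows "sqrt (ip N w' w') \<le> 2 / g * \<bar>ip N (u m) w\<bar> * nH"
    and "\<bar>mu - l m - ip N (u m) (mv N H (u m))\<bar> \<le> 2 / g * nH\<^sup>2"
    and "ip N (u m) w \<noteq> 0"
proof -
  define c where "c = ip N (u m) w"
  define y where "y = mv N H w"
  define q where "q = sqrt (ip N w' w')"
  have w'_eq: "w' = (\<lambda>a. w a - c * u m a)" by (simp add: w'_def c_def)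
  have uw': "ip N (u n) w' = (if n = m then 0 else ip N (u n) w)" if "n < N" for n
    unfolding w'_eq using eigensystem_ortho[OF es that m] by (simp add: ip_diff_right ip_scale_right c_def)
  have rel: "(l n - mu) * ip N (u n) w = - ip N (u n) y" if "n < N" for n
  proof -
    have "ip N (u n) (\<lambda>a. mu * w a) = ip N (u n) (\<lambda>a. mv N M w a + y a)"
      using w(2) by (intro ip_cong) (auto simp: y_def)
    then show ?thesis
      by (simp add: ip_add_right ip_scale_right eigensystem_ip_mv[OF es sym that] algebra_simps)
  qed
  have ycw: "y = (\<lambda>a. c * mv N H (u m) a + mv N H w' a)"
    unfolding y_def w'_eq by (rule ext) (simp add: mv_diff mv_scale)
  have "(3 * g / 4)\<^sup>2 * ip N w' w' = (\<Sum>n<N. (3 * g / 4)\<^sup>2 * (ip N (u n) w')\<^sup>2)"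
    by (simp add: eigensystem_parseval[OF es, of w' w'] power2_eq_square sum_distrib_left)
  also have "\<dots> \<le> (\<Sum>n<N. (ip N (u n) y)\<^sup>2)"
  proof (rule sum_mono)
    fix n assume "n \<in> {..<N}"
    then have n: "n < N" by simp
    show "(3 * g / 4)\<^sup>2 * (ip N (u n) w')\<^sup>2 \<le> (ip N (u n) y)\<^sup>2"
    proof (cases "n = m")
      case True
      then show ?thesis using uw'[OF n] by simp
    next
      case False
      have "3 * g / 4 \<le> \<bar>l n - mu\<bar>"
        using gap[OF n False] mu by linarith
      then have "(3 * g / 4)\<^sup>2 \<le> (l n - mu)\<^sup>2"
        using g by (simp add: abs_le_square_iff[symmetric])
      then have "(3 * g / 4)\<^sup>2 * (ip N (u n) w)\<^sup>2 \<le> (l n - mu)\<^sup>2 * (ip N (u n) w)\<^sup>2"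
        by (rule mult_right_mono) simp
      then show ?thesis
        using uw'[OF n] False rel[OF n] by (simp add: power_mult_distrib[symmetric])
    qed
  qed
  also have "\<dots> = ip N y y"
    by (simp add: eigensystem_parseval[OF es, of y y] power2_eq_square)
  finally have "sqrt ((3 * g / 4)\<^sup>2 * ip N w' w') \<le> sqrt (ip N y y)"
    by (rule real_sqrt_le_mono)
  then have A: "3 * g / 4 * q \<le> sqrt (ip N y y)"
    using g by (simp add: real_sqrt_mult q_def)
  have "sqrt (ip N y y) \<le> \<bar>c\<bar> * nH + sqrt (ip N (mv N H w') (mv N H w'))"
    using sqrt_ip_triangle[of N "\<lambda>a. c * mv N H (u m) a" "mv N H w'"] unfolding ycw
    by (simp add: ip_scale_left ip_scale_right real_sqrt_mult nH_def flip: mult.assoc)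
  also have "\<dots> \<le> \<bar>c\<bar> * nH + g / 4 * q"
    using op_leD[OF op_le_mono[OF h], of w'] by (simp add: q_def)
  finally have B: "g / 2 * q \<le> \<bar>c\<bar> * nH"
    using A by (simp add: algebra_simps)
  then have C: "q \<le> 2 / g * \<bar>c\<bar> * nH"
    using g by (simp add: field_simps)
  then show "sqrt (ip N w' w') \<le> 2 / g * \<bar>ip N (u m) w\<bar> * nH"
    by (simp add: q_def c_def)
  have q0: "0 \<le> q" by (simp add: q_def)
  have c0: "c \<noteq> 0"
  proof
    assume "c = 0"
    then have "q \<le> 0" using C by simp
    then have "q = 0" using q0 by linarith
    then have "ip N w' w' = 0" by (simp add: q_def)
    moreover have "ip N w' w' = ip N w w"
      using \<open>c = 0\<close> by (simp add: w'_eq)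
    ultimately show False using w by simp
  qed
  then show "ip N (u m) w \<noteq> 0" by (simp add: c_def)
  have "(mu - l m) * c = ip N (u m) y"
    using rel[OF m] by (simp add: c_def algebra_simps)
  also have "\<dots> = c * ip N (u m) (mv N H (u m)) + ip N (mv N H (u m)) w'"
    unfolding ycw by (simp add: ip_add_right ip_scale_right ip_mv_sym[OF symH])
  finally have "(mu - l m - ip N (u m) (mv N H (u m))) * c = ip N (mv N H (u m)) w'"
    by (simp add: algebra_simps)
  then have "\<bar>mu - l m - ip N (u m) (mv N H (u m))\<bar> * \<bar>c\<bar> \<le> nH * q"
    using ip_Cauchy_Schwarz_abs[of N "mv N H (u m)" w'] by (simp add: nH_def q_def flip: abs_mult)
  also have "\<dots> \<le> nH * (2 / g * \<bar>c\<bar> * nH)"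
    using C by (intro mult_left_mono) (auto simp: nH_def)
  finally have "\<bar>mu - l m - ip N (u m) (mv N H (u m))\<bar> * \<bar>c\<bar> \<le> (2 / g * nH\<^sup>2) * \<bar>c\<bar>"
    by (simp add: power2_eq_square algebra_simps)
  then show "\<bar>mu - l m - ip N (u m) (mv N H (u m))\<bar> \<le> 2 / g * nH\<^sup>2"
    using c0 by (metis mult_right_le_imp_le zero_less_abs_iff)
qed

section \<open>Low-rank signal plus noise\<close>

definition signal :: "nat \<Rightarrow> (nat \<Rightarrow> real) \<Rightarrow> (nat \<Rightarrow> nat \<Rightarrow> real) \<Rightarrow> nat \<Rightarrow> nat \<Rightarrow> real" where
  "signal k \<theta> e a b = (\<Sum>j=1..k. \<theta> j * e j a * e j b)"

lemma mv_signal: "mv N (signal k \<theta> e) x a = (\<Sum>j=1..k. \<theta> j * ip N (e j) x * e j a)"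
proof -
  have "mv N (signal k \<theta> e) x a = (\<Sum>b<N. \<Sum>j=1..k. \<theta> j * e j a * e j b * x b)"
    by (simp add: mv_def signal_def sum_distrib_right)
  also have "\<dots> = (\<Sum>j=1..k. \<Sum>b<N. \<theta> j * e j a * e j b * x b)"
    by (rule sum.swap)
  finally show ?thesis
    by (simp add: ip_def sum_distrib_left sum_distrib_right algebra_simps)
qed

lemma ip_signal: "ip N x (mv N (signal k \<theta> e) x) = (\<Sum>j=1..k. \<theta> j * (ip N (e j) x)\<^sup>2)"
proof -
  have "mv N (signal k \<theta> e) x = (\<lambda>a. \<Sum>j=1..k. (\<theta> j * ip N (e j) x) * e j a)"
    by (rule ext) (rule mv_signal)
  then show ?thesis
    by (simp add: ip_sum_right ip_scale_right power2_eq_square ip_commute[of N x] mult.assoc)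
qed

definition near_orthonormal :: "nat \<Rightarrow> nat \<Rightarrow> (nat \<Rightarrow> nat \<Rightarrow> real) \<Rightarrow> real \<Rightarrow> bool" where
  "near_orthonormal N k e \<eta> \<longleftrightarrow>
     (\<forall>i\<in>{1..k}. \<forall>j\<in>{1..k}. \<bar>ip N (e i) (e j) - (if i = j then 1 else 0)\<bar> \<le> \<eta>)"

lemma near_orthonormal_comb:
  fixes c :: "nat \<Rightarrow> real"
  assumes no: "near_orthonormal N k e \<eta>" and I: "I \<subseteq> {1..k}"
  defines "z \<equiv> \<lambda>a. \<Sum>i\<in>I. c i * e i a"
  shows "\<bar>ip N z z - (\<Sum>i\<in>I. (c i)\<^sup>2)\<bar> \<le> k * \<eta> * (\<Sum>i\<in>I. (c i)\<^sup>2)"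
proof -
  have fin: "finite I" using I finite_subset by blast
  have "ip N z z = (\<Sum>i\<in>I. \<Sum>j\<in>I. c i * c j * ip N (e i) (e j))"
    unfolding z_def by (simp add: ip_sum_left ip_sum_right ip_scale_left ip_scale_right sum_distrib_left algebra_simps)
  moreover have "(\<Sum>i\<in>I. (c i)\<^sup>2) = (\<Sum>i\<in>I. \<Sum>j\<in>I. c i * c j * (if i = j then 1 else 0))"
    using fin by (simp add: power2_eq_square if_distrib cong: if_cong)
  ultimately have "ip N z z - (\<Sum>i\<in>I. (c i)\<^sup>2) = (\<Sum>i\<in>I. \<Sum>j\<in>I. c i * c j * (ip N (e i) (e j) - (if i = j then 1 else 0)))"
    by (simp only: right_diff_distrib sum_subtractf)
  also have "\<bar>\<dots>\<bar> \<le> (\<Sum>i\<in>I. \<Sum>j\<in>I. \<bar>c i * c j * (ip N (e i) (e j) - (if i = j then 1 else 0))\<bar>)"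
    by (intro order_trans[OF sum_abs] sum_mono sum_abs)
  also have "\<dots> \<le> (\<Sum>i\<in>I. \<Sum>j\<in>I. ((c i)\<^sup>2 + (c j)\<^sup>2) / 2 * \<eta>)"
  proof (intro sum_mono)
    fix i j assume ij: "i \<in> I" "j \<in> I"
    have "\<bar>c i * c j\<bar> \<le> ((c i)\<^sup>2 + (c j)\<^sup>2) / 2"
      using sum_squares_bound[of "\<bar>c i\<bar>" "\<bar>c j\<bar>"] by (simp add: abs_mult)
    moreover have "\<bar>ip N (e i) (e j) - (if i = j then 1 else 0)\<bar> \<le> \<eta>"
      using no ij I unfolding near_orthonormal_def by blast
    ultimately show "\<bar>c i * c j * (ip N (e i) (e j) - (if i = j then 1 else 0))\<bar> \<le> ((c i)\<^sup>2 + (c j)\<^sup>2) / 2 * \<eta>"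
      unfolding abs_mult[of "c i * c j"] by (intro mult_mono) simp_all
  qed
  also have "\<dots> = card I * \<eta> * (\<Sum>i\<in>I. (c i)\<^sup>2)"
    by (simp add: sum.distrib add_divide_distrib distrib_right sum_distrib_right[symmetric] sum_divide_distrib[symmetric] sum_distrib_left[symmetric])
  also have "\<dots> \<le> k * \<eta> * (\<Sum>i\<in>I. (c i)\<^sup>2)"
  proof (cases "I = {}")
    case False
    then obtain i where "i \<in> I" by auto
    then have "0 \<le> \<eta>" using no I unfolding near_orthonormal_def by force
    moreover have "card I \<le> k" using card_mono[OF _ I] by simp
    ultimately show ?thesis by (intro mult_right_mono) (auto intro: sum_nonneg)
  qed simp
  finally show ?thesis .
qed

text \<open>
  Bessel's inequality for nearly orthonormal vectors follows by Cauchy-Schwarz from the pairing of \<open>x\<close> with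
  \<open>z = \<Sum> (e j \<bullet> x) e j\<close>, whose norm \<open>near_orthonormal_comb\<close> controls.
\<close>
lemma near_orthonormal_bessel:
  assumes no: "near_orthonormal N k e \<eta>" and eta: "0 \<le> \<eta>"
  shows "(\<Sum>j=1..k. (ip N (e j) x)\<^sup>2) \<le> (1 + k * \<eta>) * ip N x x"
proof -
  define S where "S = (\<Sum>j=1..k. (ip N (e j) x)\<^sup>2)"
  define z where "z = (\<lambda>a. \<Sum>j=1..k. ip N (e j) x * e j a)"
  have S0: "0 \<le> S" by (simp add: S_def sum_nonneg)
  have "S = ip N x z"
    by (simp add: S_def z_def ip_sum_right ip_scale_right power2_eq_square ip_commute)
  then have "S\<^sup>2 \<le> ip N x x * ip N z z"
    using ip_Cauchy_Schwarz[of N x z] by simp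
  also have "\<dots> \<le> ip N x x * ((1 + k * \<eta>) * S)"
    using near_orthonormal_comb[OF no, of "{1..k}" "\<lambda>j. ip N (e j) x"]
    by (intro mult_left_mono) (auto simp: z_def S_def algebra_simps abs_le_iff)
  finally have "S * S \<le> ((1 + k * \<eta>) * ip N x x) * S"
    by (simp add: power2_eq_square algebra_simps)
  moreover have "0 \<le> (1 + k * \<eta>) * ip N x x" using eta by simp
  ultimately show ?thesis
    unfolding S_def[symmetric] using S0 by (cases "S = 0") (auto simp: mult_le_cancel_right)
qed

text \<open>
  Here \<open>d\<close> is the size of the signal, \<open>\<delta>\<close> the size of the noise relative to it, and \<open>\<eta>\<close> the defect of
  orthonormality of the vectors \<open>e i\<close>, \<open>1 \<le> i \<le> k\<close>.
\<close>
locale signal_noise =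
  fixes N k :: nat and \<theta> :: "nat \<Rightarrow> real" and e :: "nat \<Rightarrow> nat \<Rightarrow> real"
    and d \<delta> \<eta> :: real and M :: "nat \<Rightarrow> nat \<Rightarrow> real"
  assumes k1: "1 \<le> k"
    and theta_mono: "\<And>i j. 1 \<le> i \<Longrightarrow> i \<le> j \<Longrightarrow> j \<le> k \<Longrightarrow> \<theta> j \<le> \<theta> i"
    and theta_pos: "0 < \<theta> k"
    and d_pos: "0 < d"
    and eta_nonneg: "0 \<le> \<eta>"
    and k_eta: "k * \<eta> \<le> 1 / 2"
    and near: "near_orthonormal N k e \<eta>"
    and symM: "symm N M"
    and noise: "op_le N (\<lambda>a b. M a b - d * signal k \<theta> e a b) (\<delta> * d)"
begin

lemma theta_nonneg: "i \<in> {1..k} \<Longrightarrow> 0 < \<theta> i"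
  using theta_mono[of i k] theta_pos by auto

lemma theta_le: "i \<in> {1..k} \<Longrightarrow> \<theta> i \<le> \<theta> 1"
  using theta_mono[of 1 i] by auto

lemma delta_nonneg: "0 \<le> \<delta>"
  using op_le_nonneg[OF noise] d_pos by (simp add: zero_le_mult_iff)

lemma quadratic_form_M:
  "\<bar>ip N x (mv N M x) - d * (\<Sum>j=1..k. \<theta> j * (ip N (e j) x)\<^sup>2)\<bar> \<le> \<delta> * d * ip N x x"
proof -
  let ?W = "\<lambda>a b. M a b - d * signal k \<theta> e a b"
  have "ip N x (mv N ?W x) = ip N x (\<lambda>a. mv N M x a - d * mv N (signal k \<theta> e) x a)"
    by (rule ip_cong) (simp_all add: mv_def sum_subtractf sum_distrib_left algebra_simps)
  also have "\<dots> = ip N x (mv N M x) - d * (\<Sum>j=1..k. \<theta> j * (ip N (e j) x)\<^sup>2)"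
    by (simp add: ip_diff_right ip_scale_right ip_signal)
  finally show ?thesis
    using op_le_quadratic_form[OF noise, of x] by simp
qed

text \<open>
  On the common kernel of the first \<open>i - 1\<close> vectors the signal is at most \<open>\<theta> i\<close>; the min-max principle does
  the rest.
\<close>
lemma eigval_upper:
  assumes "i \<in> {1..k}" "i \<le> N"
  shows "eigval N M (i - 1) \<le> d * (\<theta> i * (1 + k * \<eta>) + \<delta>)"
proof (rule eigensystem_le_subspace[OF eigensystem_eigval[OF symM] symM, where w = "\<lambda>j. e (Suc j)"])
  show "i - 1 < N" using assms by auto
  fix x assume x: "\<And>j. j < i - 1 \<Longrightarrow> ip N (e (Suc j)) x = 0"
  have x': "ip N (e j) x = 0" if "j \<in> {1..k}" "j < i" for j
    using x[of "j - 1"] that by auto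
  have "(\<Sum>j=1..k. \<theta> j * (ip N (e j) x)\<^sup>2) \<le> (\<Sum>j=1..k. \<theta> i * (ip N (e j) x)\<^sup>2)"
  proof (rule sum_mono)
    fix j assume j: "j \<in> {1..k}"
    show "\<theta> j * (ip N (e j) x)\<^sup>2 \<le> \<theta> i * (ip N (e j) x)\<^sup>2"
      using x'[OF j] theta_mono[of i j] assms j by (cases "j < i") (auto intro: mult_right_mono)
  qed
  also have "\<dots> = \<theta> i * (\<Sum>j=1..k. (ip N (e j) x)\<^sup>2)"
    by (simp add: sum_distrib_left)
  also have "\<dots> \<le> \<theta> i * ((1 + k * \<eta>) * ip N x x)"
    using theta_nonneg[OF assms(1)] by (intro mult_left_mono near_orthonormal_bessel[OF near eta_nonneg]) auto
  finally have "d * (\<Sum>j=1..k. \<theta> j * (ip N (e j) x)\<^sup>2) \<le> d * (\<theta> i * ((1 + k * \<eta>) * ip N x x))"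
    using d_pos by simp
  then show "ip N x (mv N M x) \<le> d * (\<theta> i * (1 + k * \<eta>) + \<delta>) * ip N x x"
    using quadratic_form_M[of x] by (simp add: algebra_simps abs_le_iff)
qed

lemma eigval_tail:
  assumes "k \<le> m" "m < N"
  shows "eigval N M m \<le> d * \<delta>"
proof -
  have "eigval N M k \<le> d * \<delta>"
  proof (rule eigensystem_le_subspace[OF eigensystem_eigval[OF symM] symM, where w = "\<lambda>j. e (Suc j)"])
    show "k < N" using assms by auto
    fix x assume x: "\<And>j. j < k \<Longrightarrow> ip N (e (Suc j)) x = 0"
    have x': "ip N (e j) x = 0" if "j \<in> {1..k}" for j
      using x[of "j - 1"] that by auto
    then show "ip N x (mv N M x) \<le> d * \<delta> * ip N x x"
      using quadratic_form_M[of x] by (simp add: algebra_simps abs_le_iff)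
  qed
  then show ?thesis
    using eigensystem_mono[OF eigensystem_eigval[OF symM] assms] by linarith
qed

text \<open>
  On the span of the first \<open>i\<close> vectors the signal is at least \<open>\<theta> i\<close>, up to the defect of orthonormality.
\<close>
lemma eigval_lower:
  assumes i: "i \<in> {1..k}" "i \<le> N"
  shows "d * (\<theta> i * (1 - k * \<eta>) - \<delta>) \<le> eigval N M (i - 1)"
proof (rule eigensystem_ge_subspace[OF eigensystem_eigval[OF symM] symM, where w = "\<lambda>j. e (Suc j)"])
  show "i - 1 < N" using assms by auto
  fix c :: "nat \<Rightarrow> real" assume c: "\<exists>j\<le>i - 1. c j \<noteq> 0"
  define c' where "c' j = c (j - 1)" for j
  let ?x = "\<lambda>a. \<Sum>j\<le>i - 1. c j * e (Suc j) a"
  define x where "x = (\<lambda>a. \<Sum>j=1..i. c' j * e j a)"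
  have xe: "?x = x"
  proof
    fix a
    have "(\<Sum>j\<le>i - 1. c j * e (Suc j) a) = (\<Sum>j=Suc 0..Suc (i - 1). c' j * e j a)"
      unfolding sum.shift_bounds_cl_Suc_ivl by (simp add: c'_def atMost_atLeast0)
    then show "(\<Sum>j\<le>i - 1. c j * e (Suc j) a) = x a"
      using i by (simp add: x_def del: sum.cl_ivl_Suc)
  qed
  define C where "C = (\<Sum>j=1..i. (c' j)\<^sup>2)"
  define S where "S = (\<Sum>j=1..i. (ip N (e j) x)\<^sup>2)"
  obtain j where j: "j \<le> i - 1" "c j \<noteq> 0" using c by blast
  have "(c' (Suc j))\<^sup>2 \<le> C"
    unfolding C_def using j i by (intro member_le_sum[where f="\<lambda>j. (c' j)\<^sup>2"]) auto
  then have C0: "0 < C" using j by (simp add: c'_def order_less_le_trans[of 0 "(c j)\<^sup>2"])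
  have comb: "\<bar>ip N x x - C\<bar> \<le> k * \<eta> * C"
    unfolding x_def C_def using i by (intro near_orthonormal_comb[OF near]) auto
  have keC: "k * \<eta> * C \<le> 1/2 * C" using k_eta C0 by (intro mult_right_mono) auto
  then have x0: "0 < ip N x x" using comb C0 unfolding abs_le_iff by linarith
  have "ip N x x = (\<Sum>j=1..i. c' j * ip N (e j) x)"
    by (subst (1) x_def) (simp add: ip_sum_left ip_scale_left)
  then have "(ip N x x)\<^sup>2 \<le> C * S"
    using Cauchy_Schwarz_ineq_sum[of c' "\<lambda>j. ip N (e j) x" "{1..i}"] by (simp add: C_def S_def)
  moreover have "(1 - k * \<eta>) * C * ip N x x \<le> (ip N x x)\<^sup>2"
    using comb x0 unfolding power2_eq_square by (intro mult_right_mono) (auto simp: abs_le_iff algebra_simps)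
  ultimately have "C * ((1 - k * \<eta>) * ip N x x) \<le> C * S"
    by (simp add: algebra_simps)
  then have S: "(1 - k * \<eta>) * ip N x x \<le> S" using C0 by simp
  have "\<theta> i * ((1 - k * \<eta>) * ip N x x) \<le> \<theta> i * S"
    using S theta_nonneg[OF i(1)] by (intro mult_left_mono) auto
  also have "\<dots> \<le> (\<Sum>j=1..i. \<theta> j * (ip N (e j) x)\<^sup>2)"
    unfolding S_def sum_distrib_left using theta_mono[of _ i] i by (intro sum_mono mult_right_mono) auto
  also have "\<dots> \<le> (\<Sum>j=1..k. \<theta> j * (ip N (e j) x)\<^sup>2)"
    using i theta_nonneg by (intro sum_mono2) (auto intro!: mult_nonneg_nonneg simp: less_imp_le)
  finally have "d * (\<theta> i * ((1 - k * \<eta>) * ip N x x)) \<le> d * (\<Sum>j=1..k. \<theta> j * (ip N (e j) x)\<^sup>2)"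
    using d_pos by simp
  then have "d * (\<theta> i * (1 - k * \<eta>) - \<delta>) * ip N x x \<le> ip N x (mv N M x)"
    using quadratic_form_M[of x] by (simp add: algebra_simps abs_le_iff)
  with x0 show "d * (\<theta> i * (1 - k * \<eta>) - \<delta>) * ip N ?x ?x \<le> ip N ?x (mv N M ?x) \<and> 0 < ip N ?x ?x"
    unfolding xe by simp
qed

text \<open>
  The total relative error in the position of the leading eigenvalues.
\<close>
definition "tau = k * \<theta> 1 * \<eta> + \<delta>"

lemma tau_nonneg: "0 \<le> tau"
  using theta_nonneg[of 1] k1 eta_nonneg delta_nonneg by (simp add: tau_def)

lemma eigval_close:
  assumes i: "i \<in> {1..k}" "i \<le> N"
  shows "\<bar>eigval N M (i - 1) - d * \<theta> i\<bar> \<le> d * tau"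
proof -
  have "\<theta> i * (k * \<eta>) \<le> \<theta> 1 * (k * \<eta>)"
    using theta_le[OF i(1)] eta_nonneg by (intro mult_right_mono) auto
  then have "d * (\<theta> i * (k * \<eta>) + \<delta>) \<le> d * tau"
    using d_pos by (intro mult_left_mono) (auto simp: tau_def algebra_simps)
  then show ?thesis
    using eigval_upper[OF i] eigval_lower[OF i] by (simp add: abs_le_iff algebra_simps)
qed

lemma eigenvalue_gap:
  assumes i: "i \<in> {1..k}" "i \<le> N"
    and gap: "0 < \<gamma>" "\<gamma> \<le> \<theta> i" "1 < i \<Longrightarrow> \<theta> i + \<gamma> \<le> \<theta> (i - 1)" "i < k \<Longrightarrow> \<theta> (i + 1) + \<gamma> \<le> \<theta> i"
    and tau: "tau \<le> \<gamma> / 8"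
    and n: "n < N" "n \<noteq> i - 1"
  shows "3 / 4 * d * \<gamma> \<le> \<bar>eigval N M n - eigval N M (i - 1)\<bar>"
proof -
  have dt: "d * tau \<le> d * \<gamma> / 8" using mult_left_mono[OF tau, of d] d_pos by simp
  note es = eigensystem_eigval[OF symM]
  consider "n < i - 1" | "i - 1 < n" using n by linarith
  then show ?thesis
  proof cases
    case 1
    then have i': "i - 1 \<in> {1..k}" "i - 1 \<le> N" "n \<le> i - 1 - 1" "1 < i" using i by auto
    have "eigval N M (i - 1 - 1) \<le> eigval N M n"
      using i by (intro eigensystem_mono[OF es i'(3)]) auto
    moreover have "d * \<theta> i + d * \<gamma> \<le> d * \<theta> (i - 1)"
      using gap(3)[OF i'(4)] d_pos by (simp flip: distrib_left)
    ultimately have "3 / 4 * (d * \<gamma>) \<le> eigval N M n - eigval N M (i - 1)"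
      using eigval_close[OF i] eigval_close[OF i'(1,2)] dt unfolding abs_le_iff by linarith
    moreover have "3 / 4 * d * \<gamma> = 3 / 4 * (d * \<gamma>)" by simp
    ultimately show ?thesis by linarith
  next
    case 2
    have "eigval N M n \<le> d * \<theta> i - d * \<gamma> + d * tau"
    proof (cases "i < k")
      case True
      then have i': "i + 1 \<in> {1..k}" "i + 1 \<le> N" using i 2 n by auto
      have "eigval N M n \<le> eigval N M (i + 1 - 1)"
        using 2 n by (intro eigensystem_mono[OF es]) auto
      moreover have "d * \<theta> (i + 1) + d * \<gamma> \<le> d * \<theta> i"
        using gap(4)[OF True] d_pos by (simp flip: distrib_left)
      ultimately show ?thesis
        using eigval_close[OF i'] by (simp add: abs_le_iff)
    next
      case False
      then have "eigval N M n \<le> d * \<delta>" using 2 i n by (intro eigval_tail) auto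
      also have "\<dots> \<le> d * tau"
        using d_pos theta_nonneg[of 1] k1 eta_nonneg by (simp add: tau_def)
      finally have "eigval N M n \<le> d * tau" .
      moreover have "d * \<gamma> \<le> d * \<theta> i" using gap(2) d_pos by (intro mult_left_mono) auto
      ultimately show ?thesis by linarith
    qed
    then have "3 / 4 * (d * \<gamma>) \<le> eigval N M (i - 1) - eigval N M n"
      using eigval_close[OF i] dt unfolding abs_le_iff by linarith
    moreover have "3 / 4 * d * \<gamma> = 3 / 4 * (d * \<gamma>)" by simp
    ultimately show ?thesis by linarith
  qed
qed

lemma e_norm: "i \<in> {1..k} \<Longrightarrow> \<bar>ip N (e i) (e i) - 1\<bar> \<le> \<eta>"
  using near unfolding near_orthonormal_def by force

lemma e_norm_le: "i \<in> {1..k} \<Longrightarrow> sqrt (ip N (e i) (e i)) \<le> 2"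
proof -
  assume i: "i \<in> {1..k}"
  have "\<eta> \<le> k * \<eta>" using k1 eta_nonneg by (simp add: mult_le_cancel_right1)
  then have "ip N (e i) (e i) \<le> 4" using e_norm[OF i] k_eta by linarith
  then show ?thesis using real_sqrt_le_mono by fastforce
qed

lemma sqrt_ip_sum_le:
  "finite I \<Longrightarrow> sqrt (ip N (\<lambda>a. \<Sum>j\<in>I. f j a) (\<lambda>a. \<Sum>j\<in>I. f j a)) \<le> (\<Sum>j\<in>I. sqrt (ip N (f j) (f j)))"
proof (induction I rule: finite_induct)
  case empty
  then show ?case by (simp add: ip_def)
next
  case (insert x F)
  then show ?case
    using sqrt_ip_triangle[of N "f x" "\<lambda>a. \<Sum>j\<in>F. f j a"] by simp
qed

text \<open>
  The signal maps \<open>e i\<close> to \<open>d \<theta> i e i\<close> up to overlaps of size \<open>\<eta>\<close>, the noise moves it by at most \<open>2 \<delta> d\<close>, and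
  \<open>d \<theta> i\<close> is within \<open>d tau\<close> of the eigenvalue.
\<close>
lemma approx_eigenvector:
  assumes i: "i \<in> {1..k}" "i \<le> N"
  defines "y \<equiv> \<lambda>a. mv N M (e i) a - eigval N M (i - 1) * e i a"
  shows "sqrt (ip N y y) \<le> 4 * d * tau"
proof -
  let ?W = "\<lambda>a b. M a b - d * signal k \<theta> e a b"
  define f where "f j = (\<lambda>a. (d * \<theta> j * (ip N (e j) (e i) - (if j = i then 1 else 0))) * e j a)" for j
  define s where "s = d * \<theta> i - eigval N M (i - 1)"
  have "mv N M (e i) a = d * mv N (signal k \<theta> e) (e i) a + mv N ?W (e i) a" for a
    by (simp add: mv_def sum_subtractf sum_distrib_left algebra_simps)
  moreover have "d * mv N (signal k \<theta> e) (e i) a = (\<Sum>j=1..k. f j a) + d * \<theta> i * e i a" for a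
  proof -
    have "d * mv N (signal k \<theta> e) (e i) a = (\<Sum>j=1..k. f j a + (if j = i then d * \<theta> j * e j a else 0))"
      unfolding mv_signal sum_distrib_left f_def by (intro sum.cong refl) (simp add: algebra_simps)
    then show ?thesis using i by (simp add: sum.distrib)
  qed
  ultimately have y: "y = (\<lambda>a. ((\<Sum>j=1..k. f j a) + s * e i a) + mv N ?W (e i) a)"
    by (simp add: y_def s_def fun_eq_iff algebra_simps)
  have "sqrt (ip N y y) \<le> sqrt (ip N (\<lambda>a. \<Sum>j=1..k. f j a) (\<lambda>a. \<Sum>j=1..k. f j a))
     + sqrt (ip N (\<lambda>a. s * e i a) (\<lambda>a. s * e i a)) + sqrt (ip N (mv N ?W (e i)) (mv N ?W (e i)))"
    unfolding y
    using sqrt_ip_triangle[of N "\<lambda>a. (\<Sum>j=1..k. f j a) + s * e i a" "mv N ?W (e i)"]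
      sqrt_ip_triangle[of N "\<lambda>a. \<Sum>j=1..k. f j a" "\<lambda>a. s * e i a"] by linarith
  moreover have "sqrt (ip N (\<lambda>a. s * e i a) (\<lambda>a. s * e i a)) \<le> 2 * (d * tau)"
  proof -
    have "sqrt (ip N (\<lambda>a. s * e i a) (\<lambda>a. s * e i a)) = \<bar>s\<bar> * sqrt (ip N (e i) (e i))"
      by (simp add: ip_scale_left ip_scale_right real_sqrt_mult flip: mult.assoc)
    also have "\<dots> \<le> (d * tau) * 2"
      using eigval_close[OF i] e_norm_le[OF i(1)] d_pos tau_nonneg
      by (intro mult_mono) (auto simp: s_def abs_minus_commute)
    finally show ?thesis by simp
  qed
  moreover have "sqrt (ip N (mv N ?W (e i)) (mv N ?W (e i))) \<le> \<delta> * d * 2"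
    by (rule order_trans[OF op_leD[OF noise]])
      (use e_norm_le[OF i(1)] d_pos delta_nonneg in \<open>intro mult_left_mono, auto\<close>)
  moreover have "sqrt (ip N (\<lambda>a. \<Sum>j=1..k. f j a) (\<lambda>a. \<Sum>j=1..k. f j a)) \<le> (\<Sum>j=1..k. (d * \<theta> 1 * \<eta>) * 2)"
  proof (rule order_trans[OF sqrt_ip_sum_le sum_mono])
    fix j assume j: "j \<in> {1..k}"
    have "sqrt (ip N (f j) (f j)) = \<bar>d * \<theta> j * (ip N (e j) (e i) - (if j = i then 1 else 0))\<bar> * sqrt (ip N (e j) (e j))"
      unfolding f_def by (rule sqrt_ip_scale)
    also have "\<dots> \<le> (d * \<theta> 1 * \<eta>) * 2"
    proof (rule mult_mono)
      have "\<bar>ip N (e j) (e i) - (if j = i then 1 else 0)\<bar> \<le> \<eta>"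
        using near i j unfolding near_orthonormal_def by blast
      then show "\<bar>d * \<theta> j * (ip N (e j) (e i) - (if j = i then 1 else 0))\<bar> \<le> d * \<theta> 1 * \<eta>"
        using theta_nonneg[OF j] theta_le[OF j] d_pos unfolding abs_mult
        by (intro mult_mono) auto
    qed (use e_norm_le[OF j] d_pos theta_nonneg[of 1] k1 eta_nonneg in auto)
    finally show "sqrt (ip N (f j) (f j)) \<le> d * \<theta> 1 * \<eta> * 2" .
  qed simp
  ultimately show ?thesis by (simp add: tau_def algebra_simps)
qed

text \<open>
  An approximate eigenvector is close to the true one when the gap dominates the error. The rank one
  matrices are compared instead of the vectors because the sign of \<open>v\<close> is arbitrary, and because the
  variance estimate involves exactly this sum.
\<close>
lemma eigenvector_close:
  assumes i: "i \<in> {1..k}" "i \<le> N"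
    and gap: "0 < \<gamma>" "\<gamma> \<le> \<theta> i" "1 < i \<Longrightarrow> \<theta> i + \<gamma> \<le> \<theta> (i - 1)" "i < k \<Longrightarrow> \<theta> (i + 1) + \<gamma> \<le> \<theta> i"
    and tau: "tau \<le> \<gamma> / 8"
  defines "v \<equiv> eigvec N M (i - 1)"
  shows "(\<Sum>a<N. \<Sum>b<N. (v a * v b - e i a * e i b)\<^sup>2) \<le> \<eta>\<^sup>2 + 64 * tau\<^sup>2 / \<gamma>\<^sup>2"
proof -
  note es = eigensystem_eigval[OF symM]
  define y where "y = (\<lambda>a. mv N M (e i) a - eigval N M (i - 1) * e i a)"
  define ee where "ee = ip N (e i) (e i)"
  have m: "i - 1 < N" using i by auto
  have uy: "ip N (eigvec N M n) y = (eigval N M n - eigval N M (i - 1)) * ip N (eigvec N M n) (e i)" if "n < N" for n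
    unfolding y_def by (simp add: ip_diff_right ip_scale_right eigensystem_ip_mv[OF es symM that] left_diff_distrib)
  have "(3 / 4 * d * \<gamma>)\<^sup>2 * (ee - (ip N v (e i))\<^sup>2) = (3 / 4 * d * \<gamma>)\<^sup>2 * (\<Sum>n\<in>{..<N}-{i - 1}. (ip N (eigvec N M n) (e i))\<^sup>2)"
  proof -
    have "ee = (\<Sum>n<N. (ip N (eigvec N M n) (e i))\<^sup>2)"
      by (simp add: ee_def eigensystem_parseval[OF es, of "e i" "e i"] power2_eq_square)
    then show ?thesis using m by (simp add: v_def sum.remove[of "{..<N}" "i - 1"])
  qed
  also have "\<dots> = (\<Sum>n\<in>{..<N}-{i - 1}. (3 / 4 * d * \<gamma>)\<^sup>2 * (ip N (eigvec N M n) (e i))\<^sup>2)"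
    by (simp add: sum_distrib_left)
  also have "\<dots> \<le> (\<Sum>n\<in>{..<N}-{i - 1}. (ip N (eigvec N M n) y)\<^sup>2)"
  proof (rule sum_mono)
    fix n assume n: "n \<in> {..<N}-{i - 1}"
    have "3 / 4 * d * \<gamma> \<le> \<bar>eigval N M n - eigval N M (i - 1)\<bar>"
      using n by (intro eigenvalue_gap[OF i gap tau]) auto
    then have "(3 / 4 * d * \<gamma>)\<^sup>2 \<le> (eigval N M n - eigval N M (i - 1))\<^sup>2"
      using d_pos gap(1) by (simp add: abs_le_square_iff[symmetric])
    then show "(3 / 4 * d * \<gamma>)\<^sup>2 * (ip N (eigvec N M n) (e i))\<^sup>2 \<le> (ip N (eigvec N M n) y)\<^sup>2"
      using uy[of n] n unfolding power_mult_distrib by (auto simp: power_mult_distrib intro: mult_right_mono)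
  qed
  also have "\<dots> \<le> (\<Sum>n<N. (ip N (eigvec N M n) y)\<^sup>2)"
    by (intro sum_mono2) auto
  also have "\<dots> = ip N y y"
    by (simp add: eigensystem_parseval[OF es, of y y] power2_eq_square)
  also have "\<dots> \<le> (4 * d * tau)\<^sup>2"
    using approx_eigenvector[OF i] unfolding y_def[symmetric] by (rule sqrt_le_D)
  finally have "d\<^sup>2 * (9 / 16 * \<gamma>\<^sup>2 * (ee - (ip N v (e i))\<^sup>2)) \<le> d\<^sup>2 * (16 * tau\<^sup>2)"
    by (simp add: power_mult_distrib power_divide algebra_simps)
  then have "9 / 16 * \<gamma>\<^sup>2 * (ee - (ip N v (e i))\<^sup>2) \<le> 16 * tau\<^sup>2"
    using d_pos by simp
  then have "ee - (ip N v (e i))\<^sup>2 \<le> 256 / 9 * tau\<^sup>2 / \<gamma>\<^sup>2"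
    using gap(1) by (simp add: field_simps)
  also have "\<dots> \<le> 32 * tau\<^sup>2 / \<gamma>\<^sup>2"
    by (intro divide_right_mono mult_right_mono) auto
  finally have A: "ee - (ip N v (e i))\<^sup>2 \<le> 32 * tau\<^sup>2 / \<gamma>\<^sup>2" .
  have v1: "ip N v v = 1"
    using eigensystem_ortho[OF es m m] by (simp add: v_def)
  have prod: "(\<Sum>a<N. \<Sum>b<N. (p a * p b) * (q a * q b)) = (ip N p q)\<^sup>2" for p q :: "nat \<Rightarrow> real"
    by (simp add: ip_def power2_eq_square sum_product algebra_simps)
  have "(\<Sum>a<N. \<Sum>b<N. (v a * v b - e i a * e i b)\<^sup>2) = (ip N v v)\<^sup>2 + ee\<^sup>2 - 2 * (ip N v (e i))\<^sup>2"
    unfolding ee_def prod[symmetric] sum_distrib_left sum.distrib[symmetric] sum_subtractf[symmetric]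
    by (intro sum.cong refl) (simp add: power2_eq_square algebra_simps)
  also have "\<dots> \<le> (ee - 1)\<^sup>2 + 64 * tau\<^sup>2 / \<gamma>\<^sup>2"
  proof -
    have "64 * tau\<^sup>2 / \<gamma>\<^sup>2 = 2 * (32 * tau\<^sup>2 / \<gamma>\<^sup>2)" by simp
    moreover have "(ee - 1)\<^sup>2 = ee\<^sup>2 - 2 * ee + 1" by (simp add: power2_diff)
    ultimately show ?thesis using A v1 by simp
  qed
  also have "(ee - 1)\<^sup>2 \<le> \<eta>\<^sup>2"
    using e_norm[OF i(1)] unfolding ee_def by (metis abs_le_square_iff abs_of_nonneg eta_nonneg)
  finally show ?thesis by simp
qed

end

section \<open>Independent Bernoulli variables\<close>

text \<open>
  The probability of the outcome in which exactly the variables with index in \<open>x\<close> are \<open>1\<close>. A configuration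
  is the set \<open>x\<close> itself, so switching a variable on or off is \<open>insert e x\<close> or \<open>x - {e}\<close>, and expectations are finite
  sums over the power set of \<open>E\<close>.
\<close>
definition bern_wt :: "'e set \<Rightarrow> ('e \<Rightarrow> real) \<Rightarrow> 'e set \<Rightarrow> real" where
  "bern_wt E p x = (\<Prod>e\<in>E. if e \<in> x then p e else 1 - p e)"

definition mean :: "'e set \<Rightarrow> ('e \<Rightarrow> real) \<Rightarrow> ('e set \<Rightarrow> 'b::real_vector) \<Rightarrow> 'b" where
  "mean E p F = (\<Sum>x\<in>Pow E. bern_wt E p x *\<^sub>R F x)"

lemma mean_cong: "(\<And>x. x \<subseteq> E \<Longrightarrow> F x = G x) \<Longrightarrow> mean E p F = mean E p G"
  by (simp add: mean_def)

lemma mean_add: "mean E p (\<lambda>x. F x + G x) = mean E p F + mean E p G"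
  by (simp add: mean_def scaleR_add_right sum.distrib)

lemma mean_diff: "mean E p (\<lambda>x. F x - G x) = mean E p F - mean E p G"
  by (simp add: mean_def scaleR_diff_right sum_subtractf)

lemma mean_scaleR: "mean E p (\<lambda>x. c *\<^sub>R F x) = c *\<^sub>R mean E p F"
  by (simp add: mean_def scaleR_sum_right mult.commute)

lemma mean_cmult: "mean E p (\<lambda>x. c * F x) = (c::real) * mean E p F"
  using mean_scaleR[of E p c F] by simp

lemma mean_sum: "mean E p (\<lambda>x. \<Sum>i\<in>I. F i x) = (\<Sum>i\<in>I. mean E p (F i))"
  by (simp add: mean_def scaleR_sum_right) (rule sum.swap)

lemma mean_insert:
  assumes "finite E" "f \<notin> E"
  shows "mean (insert f E) p F = mean E p (\<lambda>x. p f *\<^sub>R F (insert f x) + (1 - p f) *\<^sub>R F x)"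
proof -
  have inj: "inj_on (insert f) (Pow E)"
    using assms by (auto simp: inj_on_def)
  have w1: "bern_wt (insert f E) p (insert f x) = p f * bern_wt E p x" if "x \<subseteq> E" for x
  proof -
    have "(\<Prod>e\<in>E. if e \<in> insert f x then p e else 1 - p e) = (\<Prod>e\<in>E. if e \<in> x then p e else 1 - p e)"
      using assms by (intro prod.cong) auto
    then show ?thesis using assms by (simp add: bern_wt_def)
  qed
  have w0: "bern_wt (insert f E) p x = (1 - p f) * bern_wt E p x" if "x \<subseteq> E" for x
    using assms that by (auto simp: bern_wt_def)
  have "mean (insert f E) p F = (\<Sum>x\<in>Pow E. bern_wt (insert f E) p x *\<^sub>R F x)
      + (\<Sum>x\<in>insert f ` Pow E. bern_wt (insert f E) p x *\<^sub>R F x)"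
    unfolding mean_def Pow_insert using assms by (intro sum.union_disjoint) auto
  also have "(\<Sum>x\<in>insert f ` Pow E. bern_wt (insert f E) p x *\<^sub>R F x)
      = (\<Sum>x\<in>Pow E. bern_wt E p x *\<^sub>R (p f *\<^sub>R F (insert f x)))"
    unfolding sum.reindex[OF inj] by (intro sum.cong) (auto simp: w1 mult.commute)
  also have "(\<Sum>x\<in>Pow E. bern_wt (insert f E) p x *\<^sub>R F x) = (\<Sum>x\<in>Pow E. bern_wt E p x *\<^sub>R ((1 - p f) *\<^sub>R F x))"
    by (intro sum.cong) (auto simp: w0 mult.commute)
  finally show ?thesis
    by (simp add: mean_def scaleR_add_right sum.distrib add.commute)
qed

text \<open>
  Resampling one variable does not change the expectation.
\<close>
lemma mean_step:
  assumes "finite E" "f \<in> E"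
  shows "mean E p F = mean E p (\<lambda>x. p f *\<^sub>R F (insert f x) + (1 - p f) *\<^sub>R F (x - {f}))"
proof -
  define E' where "E' = E - {f}"
  have E: "E = insert f E'" "finite E'" "f \<notin> E'" using assms by (auto simp: E'_def)
  have "mean E p (\<lambda>x. p f *\<^sub>R F (insert f x) + (1 - p f) *\<^sub>R F (x - {f}))
      = mean E' p (\<lambda>x. p f *\<^sub>R F (insert f x) + (1 - p f) *\<^sub>R F x)"
    unfolding E(1) mean_insert[OF E(2,3)]
  proof (rule mean_cong)
    fix x assume "x \<subseteq> E'"
    then have "x - {f} = x" "insert f x - {f} = x" using E(3) by auto
    then show "p f *\<^sub>R (p f *\<^sub>R F (insert f (insert f x)) + (1 - p f) *\<^sub>R F (insert f x - {f})) +
         (1 - p f) *\<^sub>R (p f *\<^sub>R F (insert f x) + (1 - p f) *\<^sub>R F (x - {f})) =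
         p f *\<^sub>R F (insert f x) + (1 - p f) *\<^sub>R F x"
      by (simp add: algebra_simps)
  qed
  then show ?thesis unfolding E(1) mean_insert[OF E(2,3)] by simp
qed

lemma mean_prod:
  fixes g :: "'e \<Rightarrow> bool \<Rightarrow> 'b::real_normed_field"
  assumes "finite E"
  shows "mean E p (\<lambda>x. \<Prod>e\<in>E. g e (e \<in> x)) = (\<Prod>e\<in>E. p e *\<^sub>R g e True + (1 - p e) *\<^sub>R g e False)"
  using assms
proof (induction E rule: finite_induct)
  case empty
  then show ?case by (simp add: mean_def bern_wt_def)
next
  case (insert f E)
  define G where "G = (\<lambda>x. \<Prod>e\<in>E. g e (e \<in> x))"
  have "mean (insert f E) p (\<lambda>x. \<Prod>e\<in>insert f E. g e (e \<in> x)) = mean E p (\<lambda>x. (p f *\<^sub>R g f True + (1 - p f) *\<^sub>R g f False) * G x)"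
    unfolding mean_insert[OF insert.hyps]
  proof (rule mean_cong)
    fix x assume x: "x \<subseteq> E"
    have "(\<Prod>e\<in>E. g e (e \<in> insert f x)) = G x"
      unfolding G_def
    proof (rule prod.cong[OF refl])
      fix e assume "e \<in> E"
      then have "e \<noteq> f" using insert.hyps by blast
      then show "g e (e \<in> insert f x) = g e (e \<in> x)" by simp
    qed
    moreover have "f \<notin> x" using x insert.hyps by auto
    ultimately show "p f *\<^sub>R (\<Prod>e\<in>insert f E. g e (e \<in> insert f x)) + (1 - p f) *\<^sub>R (\<Prod>e\<in>insert f E. g e (e \<in> x))
        = (p f *\<^sub>R g f True + (1 - p f) *\<^sub>R g f False) * G x"
      using insert.hyps x by (auto simp: G_def algebra_simps)
  qed
  also have "\<dots> = (p f *\<^sub>R g f True + (1 - p f) *\<^sub>R g f False) * mean E p G"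
    by (simp add: mean_def sum_distrib_left)
  finally show ?case
    using insert by (simp add: G_def)
qed

locale bernoulli =
  fixes E :: "'e set" and p :: "'e \<Rightarrow> real"
  assumes finE [simp]: "finite E" and p01: "\<And>e. e \<in> E \<Longrightarrow> 0 \<le> p e \<and> p e \<le> 1"
begin

lemma bern_wt_nonneg: "0 \<le> bern_wt E p x"
  using p01 by (auto simp: bern_wt_def intro!: prod_nonneg)

lemma mean_const: "mean E p (\<lambda>_. c) = c"
proof -
  have "mean E p (\<lambda>x. \<Prod>e\<in>E. 1::real) = (\<Prod>e\<in>E. p e *\<^sub>R 1 + (1 - p e) *\<^sub>R 1)"
    by (rule mean_prod) simp
  then have "(\<Sum>x\<in>Pow E. bern_wt E p x) = 1"
    by (simp add: mean_def)
  then show ?thesis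
    by (simp add: mean_def flip: scaleR_sum_left)
qed

lemma mean_mono:
  fixes F G :: "'e set \<Rightarrow> real"
  assumes "\<And>x. x \<subseteq> E \<Longrightarrow> F x \<le> G x"
  shows "mean E p F \<le> mean E p G"
  unfolding mean_def using assms bern_wt_nonneg by (auto intro!: sum_mono mult_left_mono)

lemma mean_nonneg:
  fixes F :: "'e set \<Rightarrow> real"
  assumes "\<And>x. x \<subseteq> E \<Longrightarrow> 0 \<le> F x"
  shows "0 \<le> mean E p F"
  unfolding mean_def using assms bern_wt_nonneg by (auto intro!: sum_nonneg)

lemma norm_mean_le: "norm (mean E p F) \<le> mean E p (\<lambda>x. norm (F x))"
  unfolding mean_def by (rule order_trans[OF norm_sum]) (simp add: bern_wt_nonneg)

lemma mean_square_le: "(mean E p F)\<^sup>2 \<le> mean E p (\<lambda>x. (F x :: real)\<^sup>2)"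
proof -
  define c where "c = mean E p F"
  have "0 \<le> mean E p (\<lambda>x. (F x - c)\<^sup>2)" by (rule mean_nonneg) simp
  also have "\<dots> = mean E p (\<lambda>x. (F x)\<^sup>2 - 2 * c * F x + c\<^sup>2)"
    by (simp add: power2_diff algebra_simps)
  also have "\<dots> = mean E p (\<lambda>x. (F x)\<^sup>2) - c\<^sup>2"
    by (simp add: mean_add mean_diff mean_cmult[of E p "2 * c"] mean_const) (simp add: c_def power2_eq_square)
  finally show ?thesis by (simp add: c_def)
qed

lemma mean_variance: "mean E p (\<lambda>x. (F x - mean E p F)\<^sup>2) = mean E p (\<lambda>x. (F x)\<^sup>2) - (mean E p F :: real)\<^sup>2"
proof -
  define c where "c = mean E p F"
  have "mean E p (\<lambda>x. (F x - c)\<^sup>2) = mean E p (\<lambda>x. (F x)\<^sup>2 - 2 * c * F x + c\<^sup>2)"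
    by (simp add: power2_diff algebra_simps)
  also have "\<dots> = mean E p (\<lambda>x. (F x)\<^sup>2) - c\<^sup>2"
    by (simp add: mean_add mean_diff mean_cmult[of E p "2 * c"] mean_const) (simp add: c_def power2_eq_square)
  finally show ?thesis by (simp add: c_def)
qed

lemma mean_markov:
  fixes F :: "'e set \<Rightarrow> real"
  assumes "0 < c" "\<And>x. x \<subseteq> E \<Longrightarrow> 0 \<le> F x"
  shows "mean E p (\<lambda>x. of_bool (c \<le> F x)) \<le> mean E p F / c"
proof -
  have "mean E p (\<lambda>x. of_bool (c \<le> F x)) \<le> mean E p (\<lambda>x. 1 / c * F x)"
    using assms by (intro mean_mono) (auto simp: field_simps)
  then show ?thesis by (simp only: mean_cmult) simp
qed

definition Xi :: "'e \<Rightarrow> 'e set \<Rightarrow> real" where "Xi e x = of_bool (e \<in> x) - p e"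

lemma Xi_le_1: "e \<in> E \<Longrightarrow> \<bar>Xi e x\<bar> \<le> 1"
  using p01[of e] by (auto simp: Xi_def abs_le_iff)

lemma mean_indep:
  fixes \<phi> :: "bool \<Rightarrow> real"
  assumes "e \<in> E" "\<And>x. g (insert e x) = g (x - {e})"
  shows "mean E p (\<lambda>x. \<phi> (e \<in> x) * g x) = (p e * \<phi> True + (1 - p e) * \<phi> False) * mean E p g"
proof -
  have "g (insert e x) = g x" for x
    using assms(2)[of x] assms(2)[of "x - {e}"] by (cases "e \<in> x") (auto simp: insert_absorb)
  then have g: "g (insert e x) = g x" "g (x - {e}) = g x" for x
    using assms(2) by metis+
  show ?thesis
    unfolding mean_step[OF finE assms(1), of p "\<lambda>x. \<phi> (e \<in> x) * g x"] mean_cmult[symmetric]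
    by (rule mean_cong) (simp add: g algebra_simps)
qed

text \<open>
  Discrete integration by parts: the centred variable \<open>Xi e\<close> is traded for a discrete derivative.
\<close>
lemma mean_Xi:
  assumes "e \<in> E"
  shows "mean E p (\<lambda>x. Xi e x * g x) = p e * (1 - p e) * mean E p (\<lambda>x. g (insert e x) - g (x - {e}))"
  unfolding mean_step[OF finE assms(1), of p "\<lambda>x. Xi e x * g x"] mean_cmult[symmetric]
  by (rule mean_cong) (simp add: Xi_def algebra_simps)

text \<open>
  The hypothesis says that \<open>g\<close> does not depend on the variable \<open>e\<close>.
\<close>
lemma mean_Xi_indep:
  assumes "e \<in> E" "\<And>x. g (insert e x) = g (x - {e})"
  shows "mean E p (\<lambda>x. Xi e x * g x) = 0"
    "mean E p (\<lambda>x. (Xi e x)\<^sup>2 * g x) = p e * (1 - p e) * mean E p g"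
  using mean_indep[OF assms, of "\<lambda>b. of_bool b - p e"] mean_indep[OF assms, of "\<lambda>b. (of_bool b - p e)\<^sup>2"]
  by (simp_all add: Xi_def power2_eq_square algebra_simps)

end

text \<open>
  The inequality tensorizes: averaging
  over one variable splits off its own contribution to the variance, and by convexity of the square the
  averaged function \<open>G\<close> has smaller derivatives in the remaining variables.
\<close>
theorem bernoulli_poincare:
  fixes F :: "'e set \<Rightarrow> real"
  assumes "bernoulli E p"
  shows "mean E p (\<lambda>x. (F x)\<^sup>2) - (mean E p F)\<^sup>2
    \<le> (\<Sum>e\<in>E. p e * (1 - p e) * mean E p (\<lambda>x. (F (insert e x) - F (x - {e}))\<^sup>2))"
proof -
  have "finite E" using assms by (simp add: bernoulli_def)
  then show ?thesis using assms
  proof (induction E arbitrary: F rule: finite_induct)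
    case empty
    then show ?case by (simp add: mean_def bern_wt_def)
  next
    case (insert f E)
    interpret B: bernoulli E p using insert.prems by (auto simp: bernoulli_def)
    have pf: "0 \<le> p f" "p f \<le> 1" using insert.prems by (auto simp: bernoulli_def)
    define G where "G x = p f * F (insert f x) + (1 - p f) * F x" for x
    define D where "D e x = F (insert e x) - F (x - {e})" for e x
    have FG: "mean (insert f E) p F = mean E p G"
      unfolding mean_insert[OF insert.hyps] by (rule mean_cong) (simp add: G_def)
    have "mean (insert f E) p (\<lambda>x. (F x)\<^sup>2) = mean E p (\<lambda>x. (G x)\<^sup>2 + p f * (1 - p f) * (F (insert f x) - F x)\<^sup>2)"
      unfolding mean_insert[OF insert.hyps]
      by (rule mean_cong) (simp add: G_def power2_eq_square algebra_simps)
    then have F2: "mean (insert f E) p (\<lambda>x. (F x)\<^sup>2) = mean E p (\<lambda>x. (G x)\<^sup>2) + p f * (1 - p f) * mean E p (\<lambda>x. (F (insert f x) - F x)\<^sup>2)"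
      by (simp add: mean_add mean_cmult)
    have Df: "mean (insert f E) p (\<lambda>x. (D f x)\<^sup>2) = mean E p (\<lambda>x. (F (insert f x) - F x)\<^sup>2)"
      unfolding mean_insert[OF insert.hyps]
    proof (rule mean_cong)
      fix x assume "x \<subseteq> E"
      then have "x - {f} = x" "insert f x - {f} = x" using insert.hyps by auto
      then show "p f *\<^sub>R (D f (insert f x))\<^sup>2 + (1 - p f) *\<^sub>R (D f x)\<^sup>2 = (F (insert f x) - F x)\<^sup>2"
        by (simp add: D_def algebra_simps)
    qed
    have "(\<Sum>e\<in>E. p e * (1 - p e) * mean E p (\<lambda>x. (G (insert e x) - G (x - {e}))\<^sup>2))
      \<le> (\<Sum>e\<in>E. p e * (1 - p e) * mean (insert f E) p (\<lambda>x. (D e x)\<^sup>2))"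
    proof (intro sum_mono mult_left_mono)
      fix e assume e: "e \<in> E"
      show "0 \<le> p e * (1 - p e)" using B.p01[OF e] by simp
      have "e \<noteq> f" using e insert.hyps by auto
      show "mean E p (\<lambda>x. (G (insert e x) - G (x - {e}))\<^sup>2) \<le> mean (insert f E) p (\<lambda>x. (D e x)\<^sup>2)"
        unfolding mean_insert[OF insert.hyps]
      proof (rule B.mean_mono)
        fix x
        have "insert f (x - {e}) = insert f x - {e}" using \<open>e \<noteq> f\<close> by auto
        then have "G (insert e x) - G (x - {e}) = p f * D e (insert f x) + (1 - p f) * D e x"
          by (simp add: G_def D_def insert_commute algebra_simps)
        moreover have "(p f * a + (1 - p f) * b)\<^sup>2 \<le> p f * a\<^sup>2 + (1 - p f) * b\<^sup>2" for a b :: real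
        proof -
          have "p f * a\<^sup>2 + (1 - p f) * b\<^sup>2 - (p f * a + (1 - p f) * b)\<^sup>2 = p f * (1 - p f) * (a - b)\<^sup>2"
            by (simp add: power2_eq_square algebra_simps)
          moreover have "0 \<le> p f * (1 - p f) * (a - b)\<^sup>2" using pf by simp
          ultimately show ?thesis by linarith
        qed
        ultimately show "(G (insert e x) - G (x - {e}))\<^sup>2 \<le> p f *\<^sub>R (D e (insert f x))\<^sup>2 + (1 - p f) *\<^sub>R (D e x)\<^sup>2"
          by simp
      qed
    qed
    moreover have "mean E p (\<lambda>x. (G x)\<^sup>2) - (mean E p G)\<^sup>2
        \<le> (\<Sum>e\<in>E. p e * (1 - p e) * mean E p (\<lambda>x. (G (insert e x) - G (x - {e}))\<^sup>2))"
      using insert.IH[OF B.bernoulli_axioms, of G] .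
    ultimately show ?case
      using insert.hyps F2 FG Df by (simp add: D_def)
  qed
qed

context bernoulli
begin

text \<open>
  The coefficients \<open>w x e\<close> and the weight \<open>h x\<close> may be random, but are independent of the variables in \<open>R\<close>; then
  the cross terms vanish.
\<close>
lemma second_moment_linear_form:
  fixes w :: "'e set \<Rightarrow> 'e \<Rightarrow> real" and h :: "'e set \<Rightarrow> real"
  assumes R: "finite R" "R \<subseteq> E" and q: "\<And>e. e \<in> R \<Longrightarrow> p e \<le> q"
    and w: "\<And>e f x. e \<in> R \<Longrightarrow> f \<in> R \<Longrightarrow> w (insert e x) f = w (x - {e}) f"
    and h: "\<And>e x. e \<in> R \<Longrightarrow> h (insert e x) = h (x - {e})" "\<And>x. 0 \<le> h x"
  shows "mean E p (\<lambda>x. h x * (\<Sum>e\<in>R. Xi e x * w x e)\<^sup>2) \<le> q * mean E p (\<lambda>x. h x * (\<Sum>e\<in>R. (w x e)\<^sup>2))"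
  using R q w h(1)
proof (induction R rule: finite_induct)
  case empty
  then show ?case by (simp add: mean_const)
next
  case (insert f R)
  define Y where "Y x = (\<Sum>e\<in>R. Xi e x * w x e)" for x
  have fE: "f \<in> E" using insert.prems by auto
  have Yf: "Y (insert f x) = Y (x - {f})" for x
    unfolding Y_def using insert.prems(3) insert.hyps
    by (intro sum.cong refl) (auto simp: Xi_def)
  have wf: "w (insert f x) f = w (x - {f}) f" for x using insert.prems(3)[of f f] by simp
  have hf: "h (insert f x) = h (x - {f})" for x using insert.prems(4)[of f] by simp
  have "mean E p (\<lambda>x. h x * (\<Sum>e\<in>insert f R. Xi e x * w x e)\<^sup>2)
      = mean E p (\<lambda>x. h x * (Y x)\<^sup>2 + 2 * (Xi f x * (h x * Y x * w x f)) + (Xi f x)\<^sup>2 * (h x * (w x f)\<^sup>2))"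
  proof (rule mean_cong)
    fix x
    have "(\<Sum>e\<in>insert f R. Xi e x * w x e) = Xi f x * w x f + Y x"
      using insert.hyps by (simp add: Y_def)
    then show "h x * (\<Sum>e\<in>insert f R. Xi e x * w x e)\<^sup>2
      = h x * (Y x)\<^sup>2 + 2 * (Xi f x * (h x * Y x * w x f)) + (Xi f x)\<^sup>2 * (h x * (w x f)\<^sup>2)"
      by (simp add: power2_eq_square algebra_simps)
  qed
  also have "\<dots> = mean E p (\<lambda>x. h x * (Y x)\<^sup>2) + p f * (1 - p f) * mean E p (\<lambda>x. h x * (w x f)\<^sup>2)"
    using mean_Xi_indep(1)[OF fE, of "\<lambda>x. h x * Y x * w x f"] mean_Xi_indep(2)[OF fE, of "\<lambda>x. h x * (w x f)\<^sup>2"]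
    by (simp add: mean_add mean_cmult Yf wf hf)
  also have "p f * (1 - p f) * mean E p (\<lambda>x. h x * (w x f)\<^sup>2) \<le> q * mean E p (\<lambda>x. h x * (w x f)\<^sup>2)"
  proof (rule mult_right_mono)
    have "p f * (1 - p f) \<le> p f * 1" using p01[OF fE] by (intro mult_left_mono) auto
    then show "p f * (1 - p f) \<le> q" using insert.prems(2)[of f] by simp
  qed (use h(2) in \<open>auto intro!: mean_nonneg\<close>)
  also have "mean E p (\<lambda>x. h x * (Y x)\<^sup>2) \<le> q * mean E p (\<lambda>x. h x * (\<Sum>e\<in>R. (w x e)\<^sup>2))"
    unfolding Y_def using insert.prems by (intro insert.IH) auto
  finally show ?case
    using insert.hyps by (simp add: mean_add distrib_left)
qed

text \<open>
  A Rosenthal inequality, by induction on the number of variables. In the expansion of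
  \<open>(Y + Xi f w\<^sub>f)\<^sup>4\<close> the term linear in \<open>Xi f\<close> has mean zero and the cubic term is absorbed into its
  neighbours by the arithmetic-geometric mean inequality, since \<open>\<bar>Xi f\<bar> \<le> 1\<close>. The coefficient of the second
  summand is only \<open>q\<close>, not \<open>q\<^sup>2\<close>: this is where sparse variables differ from Gaussian ones.
\<close>
lemma fourth_moment_linear_form:
  fixes w :: "'e set \<Rightarrow> 'e \<Rightarrow> real"
  assumes R: "finite R" "R \<subseteq> E" and q: "\<And>e. e \<in> R \<Longrightarrow> p e \<le> q" "0 \<le> q"
    and w: "\<And>e f x. e \<in> R \<Longrightarrow> f \<in> R \<Longrightarrow> w (insert e x) f = w (x - {e}) f"
  shows "mean E p (\<lambda>x. (\<Sum>e\<in>R. Xi e x * w x e)^4)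
    \<le> 8 * q\<^sup>2 * mean E p (\<lambda>x. (\<Sum>e\<in>R. (w x e)\<^sup>2)\<^sup>2) + 3 * q * mean E p (\<lambda>x. \<Sum>e\<in>R. (w x e)^4)"
  using R q(1) w
proof (induction R rule: finite_induct)
  case empty
  then show ?case by (simp add: mean_const)
next
  case (insert f R)
  define Y where "Y x = (\<Sum>e\<in>R. Xi e x * w x e)" for x
  define S where "S x = (\<Sum>e\<in>R. (w x e)\<^sup>2)" for x
  have fE: "f \<in> E" using insert.prems by auto
  have Yf: "Y (insert f x) = Y (x - {f})" for x
    unfolding Y_def using insert.prems(3) insert.hyps
    by (intro sum.cong refl) (auto simp: Xi_def)
  have wf: "w (insert f x) f = w (x - {f}) f" for x using insert.prems(3)[of f f] by simp
  have pq: "p f * (1 - p f) \<le> q"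
  proof -
    have "p f * (1 - p f) \<le> p f * 1" using p01[OF fE] by (intro mult_left_mono) auto
    then show "p f * (1 - p f) \<le> q" using insert.prems(2)[of f] by simp
  qed
  have S0: "0 \<le> S x" for x by (simp add: S_def sum_nonneg)
  have "mean E p (\<lambda>x. (\<Sum>e\<in>insert f R. Xi e x * w x e)^4)
      \<le> mean E p (\<lambda>x. (Y x)^4 + 4 * (Xi f x * ((Y x)^3 * w x f)) + (Xi f x)\<^sup>2 * (8 * (Y x)\<^sup>2 * (w x f)\<^sup>2 + 3 * (w x f)^4))"
  proof (rule mean_mono)
    fix x
    define a where "a = Xi f x"
    define u where "u = w x f"
    define y where "y = Y x"
    have a: "\<bar>a\<bar> \<le> 1" unfolding a_def by (rule Xi_le_1[OF fE])
    have a2: "a\<^sup>2 \<le> 1" using a by (simp add: abs_square_le_1)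
    have "4 * (a^3 * y * u^3) \<le> 4 * (a\<^sup>2 * ((y\<^sup>2 * u\<^sup>2 + u^4) / 2))"
    proof -
      have "a * (y * u * u\<^sup>2) \<le> \<bar>a\<bar> * \<bar>y * u * u\<^sup>2\<bar>" by (simp add: abs_mult[symmetric])
      also have "\<dots> \<le> 1 * \<bar>y * u * u\<^sup>2\<bar>" using a by (intro mult_right_mono) auto
      also have "\<dots> \<le> ((y * u)\<^sup>2 + (u\<^sup>2)\<^sup>2) / 2"
        using sum_squares_bound[of "\<bar>y * u\<bar>" "u\<^sup>2"] by (simp add: abs_mult power_mult_distrib)
      also have "\<dots> = (y\<^sup>2 * u\<^sup>2 + u^4) / 2"
        by (simp add: power_mult_distrib flip: power_mult)
      finally have "a\<^sup>2 * (a * (y * u * u\<^sup>2)) \<le> a\<^sup>2 * ((y\<^sup>2 * u\<^sup>2 + u^4) / 2)"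
        by (rule mult_left_mono) simp
      then show ?thesis by (simp add: eval_nat_numeral algebra_simps)
    qed
    moreover have "a\<^sup>2 * (a\<^sup>2 * u^4) \<le> a\<^sup>2 * (1 * u^4)"
      using a2 by (intro mult_left_mono mult_right_mono) auto
    moreover have "(y + a * u)^4 = y^4 + 4 * (a * (y^3 * u)) + 6 * (a\<^sup>2 * (y\<^sup>2 * u\<^sup>2)) + 4 * (a^3 * y * u^3) + a\<^sup>2 * (a\<^sup>2 * u^4)"
      by (simp add: eval_nat_numeral algebra_simps)
    ultimately have "(y + a * u)^4 \<le> y^4 + 4 * (a * (y^3 * u)) + a\<^sup>2 * (8 * y\<^sup>2 * u\<^sup>2 + 3 * u^4)"
      by (simp add: algebra_simps)
    then show "(\<Sum>e\<in>insert f R. Xi e x * w x e)^4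
      \<le> (Y x)^4 + 4 * (Xi f x * ((Y x)^3 * w x f)) + (Xi f x)\<^sup>2 * (8 * (Y x)\<^sup>2 * (w x f)\<^sup>2 + 3 * (w x f)^4)"
      using insert.hyps by (simp add: a_def u_def y_def Y_def add.commute)
  qed
  also have "\<dots> = mean E p (\<lambda>x. (Y x)^4) + p f * (1 - p f) * mean E p (\<lambda>x. 8 * (Y x)\<^sup>2 * (w x f)\<^sup>2 + 3 * (w x f)^4)"
    using mean_Xi_indep(1)[OF fE, of "\<lambda>x. (Y x)^3 * w x f"]
      mean_Xi_indep(2)[OF fE, of "\<lambda>x. 8 * (Y x)\<^sup>2 * (w x f)\<^sup>2 + 3 * (w x f)^4"]
    by (simp add: mean_add mean_cmult Yf wf)
  also have "p f * (1 - p f) * mean E p (\<lambda>x. 8 * (Y x)\<^sup>2 * (w x f)\<^sup>2 + 3 * (w x f)^4)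
      \<le> q * mean E p (\<lambda>x. 8 * (Y x)\<^sup>2 * (w x f)\<^sup>2 + 3 * (w x f)^4)"
    using pq by (intro mult_right_mono mean_nonneg) auto
  also have "mean E p (\<lambda>x. 8 * (Y x)\<^sup>2 * (w x f)\<^sup>2 + 3 * (w x f)^4)
      = 8 * mean E p (\<lambda>x. (w x f)\<^sup>2 * (Y x)\<^sup>2) + 3 * mean E p (\<lambda>x. (w x f)^4)"
    unfolding mean_cmult[symmetric] mean_add[symmetric] by (rule mean_cong) simp
  finally have A: "mean E p (\<lambda>x. (\<Sum>e\<in>insert f R. Xi e x * w x e)^4)
    \<le> mean E p (\<lambda>x. (Y x)^4) + q * (8 * mean E p (\<lambda>x. (w x f)\<^sup>2 * (Y x)\<^sup>2) + 3 * mean E p (\<lambda>x. (w x f)^4))"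
    by simp
  have "mean E p (\<lambda>x. (w x f)\<^sup>2 * (Y x)\<^sup>2) \<le> q * mean E p (\<lambda>x. (w x f)\<^sup>2 * S x)"
    unfolding Y_def S_def using insert.prems insert.hyps
    by (intro second_moment_linear_form) auto
  then have B: "q * (8 * mean E p (\<lambda>x. (w x f)\<^sup>2 * (Y x)\<^sup>2) + 3 * mean E p (\<lambda>x. (w x f)^4))
      \<le> q * (8 * (q * mean E p (\<lambda>x. (w x f)\<^sup>2 * S x)) + 3 * mean E p (\<lambda>x. (w x f)^4))"
    using q(2) by (intro mult_left_mono) auto
  have C: "mean E p (\<lambda>x. (Y x)^4) \<le> 8 * q\<^sup>2 * mean E p (\<lambda>x. (S x)\<^sup>2) + 3 * q * mean E p (\<lambda>x. \<Sum>e\<in>R. (w x e)^4)"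
    unfolding Y_def S_def using insert.prems by (intro insert.IH) auto
  have "mean E p (\<lambda>x. (\<Sum>e\<in>insert f R. Xi e x * w x e)^4)
    \<le> 8 * q\<^sup>2 * (mean E p (\<lambda>x. (S x)\<^sup>2) + mean E p (\<lambda>x. (w x f)\<^sup>2 * S x))
      + 3 * q * (mean E p (\<lambda>x. (w x f)^4) + mean E p (\<lambda>x. \<Sum>e\<in>R. (w x e)^4))"
    using A B C by (simp add: algebra_simps power2_eq_square)
  also have "mean E p (\<lambda>x. (w x f)^4) + mean E p (\<lambda>x. \<Sum>e\<in>R. (w x e)^4) = mean E p (\<lambda>x. \<Sum>e\<in>insert f R. (w x e)^4)"
    using insert.hyps by (simp add: mean_add)
  also have "8 * q\<^sup>2 * (mean E p (\<lambda>x. (S x)\<^sup>2) + mean E p (\<lambda>x. (w x f)\<^sup>2 * S x))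
      \<le> 8 * q\<^sup>2 * mean E p (\<lambda>x. (\<Sum>e\<in>insert f R. (w x e)\<^sup>2)\<^sup>2)"
    unfolding mean_add[symmetric]
  proof (intro mult_left_mono mean_mono)
    fix x
    show "(S x)\<^sup>2 + (w x f)\<^sup>2 * S x \<le> (\<Sum>e\<in>insert f R. (w x e)\<^sup>2)\<^sup>2"
      using insert.hyps S0[of x] by (simp add: S_def[symmetric] power2_sum)
  qed (use q in auto)
  finally show ?case by simp
qed

end

section \<open>Random symmetric matrices with Bernoulli entries\<close>

text \<open>
  An entry of a symmetric matrix is addressed by its indices in increasing order.
\<close>
definition pair_key :: "nat \<Rightarrow> nat \<Rightarrow> nat \<times> nat" where
  "pair_key a b = (min a b, max a b)"

definition pairs :: "nat \<Rightarrow> (nat \<times> nat) set" where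
  "pairs N = {(a, b). a \<le> b \<and> b < N}"

definition adj :: "(nat \<times> nat) set \<Rightarrow> nat \<Rightarrow> nat \<Rightarrow> real" where
  "adj x a b = of_bool (pair_key a b \<in> x)"

text \<open>
  The change of \<open>adj\<close> when the entry \<open>e\<close> is switched on.
\<close>
definition elem_sym :: "nat \<times> nat \<Rightarrow> nat \<Rightarrow> nat \<Rightarrow> real" where
  "elem_sym e a b = of_bool (pair_key a b = e)"

lemma pair_key_commute: "pair_key a b = pair_key b a"
  by (simp add: pair_key_def min.commute max.commute)

lemma pair_key_in_pairs [simp]: "pair_key a b \<in> pairs N \<longleftrightarrow> a < N \<and> b < N"
  by (auto simp: pair_key_def pairs_def)

lemma pair_key_inj: "pair_key a b = pair_key a c \<Longrightarrow> b = c"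
  by (auto simp: pair_key_def min_def max_def split: if_splits)

lemma pair_key_eq: "pair_key a b = (c, d) \<longleftrightarrow> c \<le> d \<and> (a = c \<and> b = d \<or> a = d \<and> b = c)"
  by (auto simp: pair_key_def min_def max_def split: if_splits)

lemma finite_pairs [simp]: "finite (pairs N)"
  by (rule finite_subset[of _ "{..<N} \<times> {..<N}"]) (auto simp: pairs_def)

lemma symm_adj: "symm N (adj x)"
  by (simp add: symm_def adj_def pair_key_commute)

lemma symm_elem_sym: "symm N (elem_sym e)"
  by (simp add: symm_def elem_sym_def pair_key_commute)

lemma adj_insert_delete: "adj (insert e x) a b - adj (x - {e}) a b = elem_sym e a b"
  by (auto simp: adj_def elem_sym_def)

text \<open>
  Sums over unordered pairs become sums over ordered pairs. The inner sum counts an off-diagonal pair twice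
  and a diagonal one once, which is how the entries occur in quadratic forms.
\<close>
lemma sum_pairs_key:
  fixes f :: "nat \<Rightarrow> nat \<Rightarrow> real"
  shows "(\<Sum>e\<in>pairs N. g e * (\<Sum>a<N. \<Sum>b<N. of_bool (pair_key a b = e) * f a b))
    = (\<Sum>a<N. \<Sum>b<N. g (pair_key a b) * f a b)"
proof -
  have "(\<Sum>e\<in>pairs N. g e * (\<Sum>a<N. \<Sum>b<N. of_bool (pair_key a b = e) * f a b))
      = (\<Sum>e\<in>pairs N. \<Sum>a<N. \<Sum>b<N. g e * of_bool (pair_key a b = e) * f a b)"
    by (simp only: sum_distrib_left mult.assoc)
  also have "\<dots> = (\<Sum>a<N. \<Sum>b<N. \<Sum>e\<in>pairs N. g e * of_bool (pair_key a b = e) * f a b)"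
    by (subst sum.swap, intro sum.cong refl, rule sum.swap)
  also have "\<dots> = (\<Sum>a<N. \<Sum>b<N. g (pair_key a b) * f a b)"
  proof (intro sum.cong refl)
    fix a b assume ab: "a \<in> {..<N}" "b \<in> {..<N}"
    have "(\<Sum>e\<in>pairs N. g e * of_bool (pair_key a b = e) * f a b) = (\<Sum>e\<in>pairs N. if e = pair_key a b then g e * f a b else 0)"
      by (intro sum.cong) auto
    then show "(\<Sum>e\<in>pairs N. g e * of_bool (pair_key a b = e) * f a b) = g (pair_key a b) * f a b"
      using ab by simp
  qed
  finally show ?thesis .
qed

lemma sum_key_fixed:
  fixes f :: "nat \<Rightarrow> nat \<Rightarrow> real"
  assumes "(c, d) \<in> pairs N"
  shows "(\<Sum>a<N. \<Sum>b<N. of_bool (pair_key a b = (c, d)) * f a b) = (if c = d then f c c else f c d + f d c)"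
proof -
  have cd: "c \<le> d" "c < N" "d < N" using assms by (auto simp: pairs_def)
  have eq: "of_bool (pair_key a b = (c, d)) * f a b
     = (if a = c then (if b = d then f c d else 0) else 0) + (if a = d then (if b = c then (if c = d then 0 else f d c) else 0) else 0)" for a b
    using cd by (auto simp: pair_key_eq)
  have inner: "(\<Sum>b<N. if a = c' then (if b = d' then y else 0) else 0) = (if a = c' then y else 0)" if "d' < N" for a c' d' and y :: real
    using that by (cases "a = c'") simp_all
  have "(\<Sum>a<N. \<Sum>b<N. of_bool (pair_key a b = (c, d)) * f a b) = f c d + (if c = d then 0 else f d c)"
    unfolding eq sum.distrib inner[OF cd(3)] inner[OF cd(2)] using cd by simp
  then show ?thesis by simp
qed

lemma ip_elem_sym:
  "ip N u (mv N (elem_sym e) v) = (\<Sum>a<N. \<Sum>b<N. of_bool (pair_key a b = e) * (u a * v b))"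
  unfolding ip_def mv_def elem_sym_def sum_distrib_left by (intro sum.cong refl) (simp only: mult_ac)

lemma norm_elem_sym:
  "ip N (mv N (elem_sym e) u) (mv N (elem_sym e) u) = (\<Sum>a<N. \<Sum>b<N. of_bool (pair_key a b = e) * (u b)\<^sup>2)"
proof -
  have "(\<Sum>b<N. of_bool (pair_key a b = e) * u b)\<^sup>2 = (\<Sum>b<N. of_bool (pair_key a b = e) * (u b)\<^sup>2)" for a
  proof (cases "\<exists>b<N. pair_key a b = e")
    case True
    then obtain c where c: "c < N" "pair_key a c = e" by auto
    have iff: "pair_key a b = e \<longleftrightarrow> b = c" for b
      using c(2) pair_key_inj by blast
    have eq: "of_bool (b = c) * y b = (if b = c then y b else 0)" for b and y :: "nat \<Rightarrow> real"
      by simp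
    have "(\<Sum>b<N. of_bool (pair_key a b = e) * y b) = y c" for y :: "nat \<Rightarrow> real"
      unfolding iff eq using c(1) by simp
    then show ?thesis by (simp only:)
  next
    case False
    then show ?thesis by simp
  qed
  then show ?thesis
    unfolding ip_def mv_def elem_sym_def power2_eq_square[symmetric] by (simp only:)
qed

lemma op_le_elem_sym: "op_le N (elem_sym e) (sqrt 2)"
proof (rule op_leI)
  fix x
  show "ip N (mv N (elem_sym e) x) (mv N (elem_sym e) x) \<le> (sqrt 2)\<^sup>2 * ip N x x"
  proof (cases "e \<in> pairs N")
    case True
    then obtain c d where e: "e = (c, d)" "(c, d) \<in> pairs N" by (cases e) auto
    then have "c < N" "d < N" by (auto simp: pairs_def)
    then have "(x c)\<^sup>2 \<le> ip N x x" "(x d)\<^sup>2 \<le> ip N x x" "0 \<le> ip N x x"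
      using ip_self_ge_coord by auto
    moreover have "(sqrt 2)\<^sup>2 * ip N x x = ip N x x + ip N x x" by simp
    moreover have "(x c)\<^sup>2 \<le> 2 * ip N x x"
      using \<open>(x c)\<^sup>2 \<le> ip N x x\<close> \<open>0 \<le> ip N x x\<close> by linarith
    ultimately have "(if c = d then (x c)\<^sup>2 else (x d)\<^sup>2 + (x c)\<^sup>2) \<le> (sqrt 2)\<^sup>2 * ip N x x"
      by (cases "c = d") auto
    then show ?thesis
      unfolding norm_elem_sym e(1) sum_key_fixed[OF e(2)] .
  next
    case False
    then have "pair_key a b \<noteq> e" if "a < N" "b < N" for a b using that by auto
    then show ?thesis unfolding norm_elem_sym by simp
  qed
qed simp

section \<open>The norm of the noise\<close>

text \<open>
  In the geometric sum for \<open>(s\<^sup>n - t\<^sup>n) / (s - t)\<close> with \<open>n = 2 q + 1\<close>, the terms \<open>s\<^sup>i t\<^sup>2\<^sup>q\<^sup>-\<^sup>i\<close> and \<open>s\<^sup>2\<^sup>q\<^sup>-\<^sup>i t\<^sup>i\<close> together are at most \<open>s\<^sup>2\<^sup>q + t\<^sup>2\<^sup>q\<close>.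
\<close>
lemma power_diff_mult_le:
  fixes s t :: real
  shows "(s ^ (2 * q + 1) - t ^ (2 * q + 1)) * (s - t) \<le> (2 * real q + 1) / 2 * (s - t)\<^sup>2 * (s ^ (2 * q) + t ^ (2 * q))"
proof -
  have am: "\<bar>s ^ i * t ^ (2 * q - i)\<bar> + \<bar>s ^ (2 * q - i) * t ^ i\<bar> \<le> s ^ (2 * q) + t ^ (2 * q)" if i: "i \<le> 2 * q" for i
  proof -
    define a b where "a = \<bar>s\<bar>" and "b = \<bar>t\<bar>"
    have ab: "0 \<le> a" "0 \<le> b" by (auto simp: a_def b_def)
    have "0 \<le> (a ^ i - b ^ i) * (a ^ (2 * q - i) - b ^ (2 * q - i))"
    proof (cases "a \<le> b")
      case True
      then show ?thesis using ab by (intro mult_nonpos_nonpos) (auto intro: power_mono)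
    next
      case False
      then show ?thesis using ab by (intro mult_nonneg_nonneg) (auto intro: power_mono)
    qed
    moreover have "a ^ i * a ^ (2 * q - i) = a ^ (2 * q)" "b ^ i * b ^ (2 * q - i) = b ^ (2 * q)"
      using i by (simp_all flip: power_add)
    moreover have "a ^ (2 * q) = s ^ (2 * q)" "b ^ (2 * q) = t ^ (2 * q)"
      by (simp_all add: a_def b_def power_even_abs)
    ultimately show ?thesis
      by (simp add: abs_mult power_abs a_def[symmetric] b_def[symmetric] algebra_simps)
  qed
  define Z where "Z = (\<Sum>i<2 * q + 1. s ^ i * t ^ (2 * q - i))"
  have Z': "Z = (\<Sum>i<2 * q + 1. s ^ (2 * q - i) * t ^ i)"
    unfolding Z_def by (rule sum.reindex_bij_witness[of _ "\<lambda>i. 2 * q - i" "\<lambda>i. 2 * q - i"]) auto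
  have "2 * Z = (\<Sum>i<2 * q + 1. s ^ i * t ^ (2 * q - i) + s ^ (2 * q - i) * t ^ i)"
    using Z' by (simp add: Z_def sum.distrib)
  also have "\<dots> \<le> (\<Sum>i<2 * q + 1. s ^ (2 * q) + t ^ (2 * q))"
  proof (rule sum_mono)
    fix i assume "i \<in> {..<2 * q + 1}"
    then show "s ^ i * t ^ (2 * q - i) + s ^ (2 * q - i) * t ^ i \<le> s ^ (2 * q) + t ^ (2 * q)"
      using am[of i] by (simp add: less_Suc_eq_le)
  qed
  also have "\<dots> = (2 * real q + 1) * (s ^ (2 * q) + t ^ (2 * q))"
    by simp
  finally have Zle: "Z \<le> (2 * real q + 1) / 2 * (s ^ (2 * q) + t ^ (2 * q))" by simp
  have "s ^ (2 * q + 1) - t ^ (2 * q + 1) = (s - t) * Z"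
    using power_diff_sumr2[of s "2 * q + 1" t] unfolding Z_def by (simp add: mult.commute[of "t ^ _"])
  then have "(s ^ (2 * q + 1) - t ^ (2 * q + 1)) * (s - t) = (s - t)\<^sup>2 * Z"
    by (simp add: power2_eq_square)
  also have "\<dots> \<le> (s - t)\<^sup>2 * ((2 * real q + 1) / 2 * (s ^ (2 * q) + t ^ (2 * q)))"
    using Zle by (intro mult_left_mono) auto
  finally show ?thesis by (simp only: mult_ac)
qed

text \<open>
  The left-hand side is \<open>tr (M\<^sup>n H) - tr (M'\<^sup>n H)\<close> for \<open>n = 2 q + 1\<close> and \<open>H = M - M'\<close>. With \<open>c m j\<close> the inner product of the
  \<open>m\<close>-th eigenvector of \<open>M\<close> and the \<open>j\<close>-th of \<open>M'\<close>, the matrix coefficients of \<open>H\<close> between the two bases are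
  \<open>(l m - l' j) c m j\<close>. The difference of traces becomes \<open>\<Sum> (l m\<^sup>n - l' j\<^sup>n) (l m - l' j) (c m j)\<^sup>2\<close>, to which the scalar
  inequality \<open>power_diff_mult_le\<close> applies term by term.
\<close>
lemma spectral_sum_diff_le:
  assumes es: "eigensystem N M l u" "symm N M" and es': "eigensystem N M' l' u'" "symm N M'"
    and H: "\<And>a b. a < N \<Longrightarrow> b < N \<Longrightarrow> M a b - M' a b = H a b" and symH: "symm N H"
  shows "(\<Sum>m<N. l m ^ (2 * q + 1) * ip N (u m) (mv N H (u m)))
      - (\<Sum>m<N. l' m ^ (2 * q + 1) * ip N (u' m) (mv N H (u' m)))
    \<le> (2 * real q + 1) / 2 * ((\<Sum>m<N. l m ^ (2 * q) * ip N (mv N H (u m)) (mv N H (u m)))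
      + (\<Sum>m<N. l' m ^ (2 * q) * ip N (mv N H (u' m)) (mv N H (u' m))))"
proof -
  define c where "c m j = ip N (u m) (u' j)" for m j
  have Hv: "mv N H x a = mv N M x a - mv N M' x a" if "a < N" for x a
    using that H by (simp add: mv_def sum_subtractf[symmetric] left_diff_distrib[symmetric])
  have uHu': "ip N (u m) (mv N H (u' j)) = (l m - l' j) * c m j" if mj: "m < N" "j < N" for m j
  proof -
    have "ip N (u m) (mv N H (u' j)) = ip N (u m) (mv N M (u' j)) - ip N (u m) (mv N M' (u' j))"
      unfolding ip_diff_right[symmetric] using Hv by (intro ip_cong) auto
    also have "ip N (u m) (mv N M' (u' j)) = ip N (u m) (\<lambda>a. l' j * u' j a)"
      using eigensystem_mv[OF es'(1)] mj by (intro ip_cong) auto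
    finally show ?thesis
      using eigensystem_ip_mv[OF es mj(1)] by (simp add: c_def ip_scale_right algebra_simps)
  qed
  have u'Hu: "ip N (u' j) (mv N H (u m)) = (l m - l' j) * c m j" if mj: "m < N" "j < N" for m j
    using uHu'[OF mj] ip_mv_sym[OF symH, of "u m" "u' j"] by (simp add: ip_commute)
  have q1: "ip N (u m) (mv N H (u m)) = (\<Sum>j<N. (l m - l' j) * (c m j)\<^sup>2)" if "m < N" for m
    unfolding eigensystem_parseval[OF es'(1), of "u m"]
    using that u'Hu by (intro sum.cong) (auto simp: c_def ip_commute power2_eq_square)
  have q2: "ip N (u' j) (mv N H (u' j)) = (\<Sum>m<N. (l m - l' j) * (c m j)\<^sup>2)" if "j < N" for j
    unfolding eigensystem_parseval[OF es(1), of "u' j"]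
    using that uHu' by (intro sum.cong) (auto simp: c_def power2_eq_square)
  have n1: "ip N (mv N H (u m)) (mv N H (u m)) = (\<Sum>j<N. (l m - l' j)\<^sup>2 * (c m j)\<^sup>2)" if "m < N" for m
    unfolding eigensystem_parseval[OF es'(1), of "mv N H (u m)"]
    using that u'Hu by (intro sum.cong) (auto simp: power2_eq_square)
  have n2: "ip N (mv N H (u' j)) (mv N H (u' j)) = (\<Sum>m<N. (l m - l' j)\<^sup>2 * (c m j)\<^sup>2)" if "j < N" for j
    unfolding eigensystem_parseval[OF es(1), of "mv N H (u' j)"]
    using that uHu' by (intro sum.cong) (auto simp: power2_eq_square)
  let ?n = "2 * q + 1"
  have "(\<Sum>m<N. l m ^ ?n * ip N (u m) (mv N H (u m))) - (\<Sum>m<N. l' m ^ ?n * ip N (u' m) (mv N H (u' m)))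
     = (\<Sum>m<N. \<Sum>j<N. l m ^ ?n * ((l m - l' j) * (c m j)\<^sup>2)) - (\<Sum>j<N. \<Sum>m<N. l' j ^ ?n * ((l m - l' j) * (c m j)\<^sup>2))"
    by (simp add: q1 q2 sum_distrib_left)
  also have "(\<Sum>j<N. \<Sum>m<N. l' j ^ ?n * ((l m - l' j) * (c m j)\<^sup>2)) = (\<Sum>m<N. \<Sum>j<N. l' j ^ ?n * ((l m - l' j) * (c m j)\<^sup>2))"
    by (rule sum.swap)
  also have "(\<Sum>m<N. \<Sum>j<N. l m ^ ?n * ((l m - l' j) * (c m j)\<^sup>2)) - (\<Sum>m<N. \<Sum>j<N. l' j ^ ?n * ((l m - l' j) * (c m j)\<^sup>2))
     = (\<Sum>m<N. \<Sum>j<N. ((l m ^ ?n - l' j ^ ?n) * (l m - l' j)) * (c m j)\<^sup>2)"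
    unfolding sum_subtractf[symmetric] by (intro sum.cong refl) (simp add: algebra_simps)
  also have "\<dots> \<le> (\<Sum>m<N. \<Sum>j<N. ((2 * real q + 1) / 2 * (l m - l' j)\<^sup>2 * (l m ^ (2 * q) + l' j ^ (2 * q))) * (c m j)\<^sup>2)"
    by (intro sum_mono mult_right_mono) (simp_all only: zero_le_power2 power_diff_mult_le)
  also have "\<dots> = (2 * real q + 1) / 2 * ((\<Sum>m<N. \<Sum>j<N. l m ^ (2 * q) * ((l m - l' j)\<^sup>2 * (c m j)\<^sup>2))
      + (\<Sum>m<N. \<Sum>j<N. l' j ^ (2 * q) * ((l m - l' j)\<^sup>2 * (c m j)\<^sup>2)))"
    unfolding sum.distrib[symmetric] sum_distrib_left
    by (intro sum.cong refl) (simp only: distrib_left distrib_right mult_ac)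
  also have "(\<Sum>m<N. \<Sum>j<N. l' j ^ (2 * q) * ((l m - l' j)\<^sup>2 * (c m j)\<^sup>2)) = (\<Sum>j<N. \<Sum>m<N. l' j ^ (2 * q) * ((l m - l' j)\<^sup>2 * (c m j)\<^sup>2))"
    by (rule sum.swap)
  finally show ?thesis
    by (simp add: n1 n2 sum_distrib_left)
qed

locale bernoulli_matrix =
  fixes N :: nat and p :: "nat \<times> nat \<Rightarrow> real"
  assumes p_range: "\<And>e. e \<in> pairs N \<Longrightarrow> 0 \<le> p e \<and> p e \<le> 1"

sublocale bernoulli_matrix \<subseteq> bernoulli "pairs N" p
  by unfold_locales (use p_range in auto)

context bernoulli_matrix
begin

definition noise :: "(nat \<times> nat) set \<Rightarrow> nat \<Rightarrow> nat \<Rightarrow> real" where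
  "noise x a b = adj x a b - p (pair_key a b)"

lemma noise_Xi: "noise x a b = Xi (pair_key a b) x"
  by (simp add: noise_def adj_def Xi_def)

lemma symm_noise: "symm N (noise x)"
  by (simp add: symm_def noise_Xi pair_key_commute)

text \<open>
  The degree of \<open>a\<close> plus its expectation.
\<close>
definition degsum :: "nat \<Rightarrow> (nat \<times> nat) set \<Rightarrow> real" where
  "degsum a x = (\<Sum>b<N. of_bool (pair_key a b \<in> x) + p (pair_key a b))"

lemma degsum_nonneg: "a < N \<Longrightarrow> 0 \<le> degsum a x"
  unfolding degsum_def using p_range by (intro sum_nonneg) auto

text \<open>
  With \<open>W\<close> the noise matrix, \<open>tr W\<^sup>2\<^sup>q\<^sup>+\<^sup>2 = \<Sum>\<^sub>e Xi e tr (W\<^sup>2\<^sup>q\<^sup>+\<^sup>1 E\<^sub>e)\<close>, where \<open>E\<^sub>e\<close> is the elementary symmetric matrix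
  of the entry \<open>e\<close>. Integration by parts in each variable and \<open>spectral_sum_diff_le\<close> bound its expectation by terms \<open>tr (W\<^sup>2\<^sup>q E\<^sub>e\<^sup>2)\<close>,
  whose weighted sum over \<open>e\<close> is \<open>tr (W\<^sup>2\<^sup>q D)\<close> with the diagonal matrix \<open>D\<close> of the degrees.
\<close>
lemma trace_moment_recursion:
  defines "l \<equiv> \<lambda>x. eigval N (noise x)" and "u \<equiv> \<lambda>x. eigvec N (noise x)"
  shows "mean (pairs N) p (\<lambda>x. \<Sum>m<N. l x m ^ (2 * q + 2))
    \<le> (2 * real q + 1) / 2 * mean (pairs N) p (\<lambda>x. \<Sum>m<N. l x m ^ (2 * q) * (\<Sum>a<N. degsum a x * (u x m a)\<^sup>2))"
proof -
  \<comment> \<open>These are \<open>tr (W\<^sup>2\<^sup>q\<^sup>+\<^sup>1 E\<^sub>e)\<close> and \<open>tr (W\<^sup>2\<^sup>q E\<^sub>e\<^sup>2)\<close>.\<close>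
  define \<phi> where "\<phi> e x = (\<Sum>m<N. l x m ^ (2 * q + 1) * ip N (u x m) (mv N (elem_sym e) (u x m)))" for e x
  define \<psi> where "\<psi> e x = (\<Sum>m<N. l x m ^ (2 * q) * ip N (mv N (elem_sym e) (u x m)) (mv N (elem_sym e) (u x m)))" for e x
  have es: "eigensystem N (noise x) (l x) (u x)" for x
    unfolding l_def u_def by (rule eigensystem_eigval[OF symm_noise])
  have psi0: "0 \<le> \<psi> e x" for e x
    unfolding \<psi>_def by (intro sum_nonneg mult_nonneg_nonneg) auto
  have T: "(\<Sum>m<N. l x m ^ (2 * q + 2)) = (\<Sum>e\<in>pairs N. Xi e x * \<phi> e x)" for x
  proof -
    have "l x m ^ (2 * q + 2) = l x m ^ (2 * q + 1) * (\<Sum>e\<in>pairs N. Xi e x * ip N (u x m) (mv N (elem_sym e) (u x m)))"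
      if m: "m < N" for m
    proof -
      have "(\<Sum>e\<in>pairs N. Xi e x * ip N (u x m) (mv N (elem_sym e) (u x m)))
          = (\<Sum>a<N. \<Sum>b<N. Xi (pair_key a b) x * (u x m a * u x m b))"
        unfolding ip_elem_sym by (rule sum_pairs_key)
      also have "\<dots> = ip N (u x m) (mv N (noise x) (u x m))"
        by (simp add: ip_def mv_def noise_Xi sum_distrib_left algebra_simps)
      also have "\<dots> = l x m"
        using eigensystem_ip_mv[OF es symm_noise m] eigensystem_ortho[OF es m m] by simp
      finally show ?thesis by simp
    qed
    then have "(\<Sum>m<N. l x m ^ (2 * q + 2)) = (\<Sum>m<N. \<Sum>e\<in>pairs N. Xi e x * (l x m ^ (2 * q + 1) * ip N (u x m) (mv N (elem_sym e) (u x m))))"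
      by (simp add: sum_distrib_left algebra_simps)
    also have "\<dots> = (\<Sum>e\<in>pairs N. \<Sum>m<N. Xi e x * (l x m ^ (2 * q + 1) * ip N (u x m) (mv N (elem_sym e) (u x m))))"
      by (rule sum.swap)
    finally show ?thesis by (simp add: \<phi>_def sum_distrib_left)
  qed
  let ?c = "(2 * real q + 1) / 2"
  have step: "mean (pairs N) p (\<lambda>x. Xi e x * \<phi> e x) \<le> ?c * mean (pairs N) p (\<lambda>x. (of_bool (e \<in> x) + p e) * \<psi> e x)"
    if e: "e \<in> pairs N" for e
  proof -
    have pe: "0 \<le> p e" "p e \<le> 1" using p_range[OF e] by auto
    have ps: "mean (pairs N) p (\<psi> e) = mean (pairs N) p (\<lambda>x. p e * \<psi> e (insert e x) + (1 - p e) * \<psi> e (x - {e}))"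
      using mean_step[OF finE e, of p "\<psi> e"] by simp
    have pb: "mean (pairs N) p (\<lambda>x. of_bool (e \<in> x) * \<psi> e x) = mean (pairs N) p (\<lambda>x. p e * \<psi> e (insert e x))"
      using mean_step[OF finE e, of p "\<lambda>x. of_bool (e \<in> x) * \<psi> e x"] by simp
    have "mean (pairs N) p (\<lambda>x. Xi e x * \<phi> e x)
        = mean (pairs N) p (\<lambda>x. p e * (1 - p e) * (\<phi> e (insert e x) - \<phi> e (x - {e})))"
      by (simp only: mean_Xi[OF e] mean_cmult)
    also have "\<dots> \<le> mean (pairs N) p (\<lambda>x. ?c * (p e * \<psi> e (insert e x) + p e * (p e * \<psi> e (insert e x) + (1 - p e) * \<psi> e (x - {e}))))"
    proof (rule mean_mono)
      fix x
      have "\<phi> e (insert e x) - \<phi> e (x - {e}) \<le> ?c * (\<psi> e (insert e x) + \<psi> e (x - {e}))"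
        unfolding \<phi>_def \<psi>_def
        using spectral_sum_diff_le[OF es symm_noise es symm_noise, of "insert e x" "x - {e}" "elem_sym e" q]
        by (simp add: noise_def adj_insert_delete symm_elem_sym add.commute)
      then have "p e * (1 - p e) * (\<phi> e (insert e x) - \<phi> e (x - {e})) \<le> p e * (1 - p e) * (?c * (\<psi> e (insert e x) + \<psi> e (x - {e})))"
        using pe by (intro mult_left_mono) auto
      also have "\<dots> = ?c * (p e * (1 - p e) * \<psi> e (insert e x) + p e * ((1 - p e) * \<psi> e (x - {e})))"
        by (simp add: field_simps)
      also have "\<dots> \<le> ?c * (p e * \<psi> e (insert e x) + p e * (p e * \<psi> e (insert e x) + (1 - p e) * \<psi> e (x - {e})))"
      proof -
        have "p e * (1 - p e) * \<psi> e (insert e x) \<le> p e * \<psi> e (insert e x)"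
          using pe psi0 by (intro mult_right_mono) (auto simp: mult_le_cancel_left1 mult_left_le)
        moreover have "0 \<le> p e * (p e * \<psi> e (insert e x))" using pe psi0 by simp
        ultimately have "p e * (1 - p e) * \<psi> e (insert e x) + p e * ((1 - p e) * \<psi> e (x - {e}))
          \<le> p e * \<psi> e (insert e x) + p e * (p e * \<psi> e (insert e x) + (1 - p e) * \<psi> e (x - {e}))"
          unfolding distrib_left[of "p e" "p e * \<psi> e (insert e x)"] by linarith
        then show ?thesis by (intro mult_left_mono) auto
      qed
      finally show "p e * (1 - p e) * (\<phi> e (insert e x) - \<phi> e (x - {e}))
        \<le> ?c * (p e * \<psi> e (insert e x) + p e * (p e * \<psi> e (insert e x) + (1 - p e) * \<psi> e (x - {e})))" .
    qed
    also have "\<dots> = ?c * mean (pairs N) p (\<lambda>x. (of_bool (e \<in> x) + p e) * \<psi> e x)"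
      using ps pb by (simp only: mean_cmult mean_add distrib_right)
    finally show ?thesis .
  qed
  have "mean (pairs N) p (\<lambda>x. \<Sum>m<N. l x m ^ (2 * q + 2)) = (\<Sum>e\<in>pairs N. mean (pairs N) p (\<lambda>x. Xi e x * \<phi> e x))"
    unfolding T by (rule mean_sum)
  also have "\<dots> \<le> (\<Sum>e\<in>pairs N. ?c * mean (pairs N) p (\<lambda>x. (of_bool (e \<in> x) + p e) * \<psi> e x))"
    by (intro sum_mono step)
  also have "\<dots> = ?c * mean (pairs N) p (\<lambda>x. \<Sum>e\<in>pairs N. (of_bool (e \<in> x) + p e) * \<psi> e x)"
    by (simp add: mean_sum sum_distrib_left)
  also have "mean (pairs N) p (\<lambda>x. \<Sum>e\<in>pairs N. (of_bool (e \<in> x) + p e) * \<psi> e x)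
    = mean (pairs N) p (\<lambda>x. \<Sum>m<N. l x m ^ (2 * q) * (\<Sum>a<N. degsum a x * (u x m a)\<^sup>2))"
  proof (rule mean_cong)
    fix x
    let ?h = "\<lambda>e. of_bool (e \<in> x) + p e"
    have "(\<Sum>e\<in>pairs N. ?h e * \<psi> e x)
        = (\<Sum>e\<in>pairs N. \<Sum>m<N. l x m ^ (2 * q) * (?h e * ip N (mv N (elem_sym e) (u x m)) (mv N (elem_sym e) (u x m))))"
      unfolding \<psi>_def sum_distrib_left by (intro sum.cong refl) (simp only: mult_ac)
    also have "\<dots> = (\<Sum>m<N. l x m ^ (2 * q) * (\<Sum>e\<in>pairs N. ?h e * ip N (mv N (elem_sym e) (u x m)) (mv N (elem_sym e) (u x m))))"
      by (subst sum.swap) (simp add: sum_distrib_left)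
    also have "\<dots> = (\<Sum>m<N. l x m ^ (2 * q) * (\<Sum>a<N. degsum a x * (u x m a)\<^sup>2))"
    proof (intro sum.cong refl arg_cong2[where f="(*)"])
      fix m
      have "(\<Sum>e\<in>pairs N. ?h e * ip N (mv N (elem_sym e) (u x m)) (mv N (elem_sym e) (u x m)))
          = (\<Sum>a<N. \<Sum>b<N. ?h (pair_key a b) * (u x m b)\<^sup>2)"
        unfolding norm_elem_sym by (rule sum_pairs_key)
      also have "\<dots> = (\<Sum>b<N. \<Sum>a<N. ?h (pair_key a b) * (u x m b)\<^sup>2)"
        by (rule sum.swap)
      also have "\<dots> = (\<Sum>b<N. degsum b x * (u x m b)\<^sup>2)"
        unfolding degsum_def sum_distrib_right
        by (intro sum.cong refl) (simp add: pair_key_commute)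
      finally show "(\<Sum>e\<in>pairs N. ?h e * ip N (mv N (elem_sym e) (u x m)) (mv N (elem_sym e) (u x m))) = (\<Sum>b<N. degsum b x * (u x m b)\<^sup>2)" .
    qed
    finally show "(\<Sum>e\<in>pairs N. ?h e * \<psi> e x) = (\<Sum>m<N. l x m ^ (2 * q) * (\<Sum>a<N. degsum a x * (u x m a)\<^sup>2))" .
  qed
  finally show ?thesis by simp
qed

text \<open>
  Bounding the degree matrix by its largest entry \<open>D\<close> and using \<open>t s\<^sup>q \<le> s\<^sup>q\<^sup>+\<^sup>1 + t\<^sup>q\<^sup>+\<^sup>1\<close> with \<open>s = l\<^sup>2\<close>, half of the trace moment
  reappears on the right and is absorbed.
\<close>
lemma trace_moment_le_degrees:
  defines "l \<equiv> \<lambda>x. eigval N (noise x)"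
  shows "mean (pairs N) p (\<lambda>x. \<Sum>m<N. l x m ^ (2 * q + 2))
    \<le> N * (2 * real q + 1) ^ (q + 1) * (\<Sum>a<N. mean (pairs N) p (\<lambda>x. degsum a x ^ (q + 1)))"
proof -
  define T where "T = (\<lambda>x. \<Sum>m<N. l x m ^ (2 * q + 2))"
  define S where "S = (\<lambda>x. \<Sum>a<N. degsum a x ^ (q + 1))"
  let ?n = "2 * real q + 1"
  have young: "?n / 2 * (\<Sum>m<N. l x m ^ (2 * q) * (\<Sum>a<N. degsum a x * (eigvec N (noise x) m a)\<^sup>2))
     \<le> 1 / 2 * T x + 1 / 2 * (N * ?n ^ (q + 1) * S x)" for x
  proof (cases "N = 0")
    case False
    define D where "D = Max ((\<lambda>a. degsum a x) ` {..<N})"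
    have D: "degsum a x \<le> D" if "a < N" for a
      unfolding D_def using that by (intro Max_ge) auto
    have "D \<in> (\<lambda>a. degsum a x) ` {..<N}" unfolding D_def using False by (intro Max_in) auto
    then obtain c where c: "c < N" "D = degsum c x" by auto
    have D0: "0 \<le> D" using c degsum_nonneg by simp
    have DS: "D ^ (q + 1) \<le> S x"
      unfolding S_def c(2) using c(1) degsum_nonneg
      by (intro member_le_sum[where f="\<lambda>a. degsum a x ^ (q + 1)"]) auto
    have "?n / 2 * (l x m ^ (2 * q) * (\<Sum>a<N. degsum a x * (eigvec N (noise x) m a)\<^sup>2))
      \<le> 1 / 2 * l x m ^ (2 * q + 2) + 1 / 2 * (?n * D) ^ (q + 1)" if m: "m < N" for m
    proof -
      have "(\<Sum>a<N. degsum a x * (eigvec N (noise x) m a)\<^sup>2) \<le> (\<Sum>a<N. D * (eigvec N (noise x) m a)\<^sup>2)"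
        using D by (intro sum_mono mult_right_mono) auto
      also have "\<dots> = D * ip N (eigvec N (noise x) m) (eigvec N (noise x) m)"
        by (simp add: ip_def sum_distrib_left power2_eq_square)
      also have "\<dots> = D"
        using eigensystem_ortho[OF eigensystem_eigval[OF symm_noise] m m] by simp
      finally have "l x m ^ (2 * q) * (\<Sum>a<N. degsum a x * (eigvec N (noise x) m a)\<^sup>2) \<le> l x m ^ (2 * q) * D"
        by (rule mult_left_mono) simp
      then have 1: "?n / 2 * (l x m ^ (2 * q) * (\<Sum>a<N. degsum a x * (eigvec N (noise x) m a)\<^sup>2)) \<le> ?n / 2 * (l x m ^ (2 * q) * D)"
        by (rule mult_left_mono) simp
      define s where "s = (l x m)\<^sup>2"
      define t where "t = ?n * D"
      have st: "0 \<le> s" "0 \<le> t" using D0 by (auto simp: s_def t_def)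
      have "t * s ^ q \<le> s ^ (q + 1) + t ^ (q + 1)"
      proof (cases "t \<le> s")
        case True
        then have "t * s ^ q \<le> s * s ^ q" using st by (intro mult_right_mono) auto
        moreover have "0 \<le> t ^ (q + 1)" using st by simp
        ultimately show ?thesis by (simp only: power_add power_one_right mult.commute)
      next
        case False
        then have "t * s ^ q \<le> t * t ^ q" using st by (intro mult_left_mono power_mono) auto
        moreover have "0 \<le> s ^ (q + 1)" using st by simp
        ultimately show ?thesis by (simp only: power_add power_one_right mult.commute)
      qed
      moreover have "s ^ q = l x m ^ (2 * q)"
        by (simp only: s_def power_mult)
      moreover have "s ^ (q + 1) = l x m ^ (2 * q + 2)"
        unfolding s_def power_mult[symmetric] by (rule arg_cong[where f="(^) (l x m)"]) simp
      ultimately have "t * l x m ^ (2 * q) \<le> l x m ^ (2 * q + 2) + t ^ (q + 1)" by (simp only:)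
      then have "?n / 2 * (l x m ^ (2 * q) * D) \<le> 1 / 2 * l x m ^ (2 * q + 2) + 1 / 2 * (?n * D) ^ (q + 1)"
        unfolding t_def by (simp add: algebra_simps)
      then show ?thesis using 1 by linarith
    qed
    then have "(\<Sum>m<N. ?n / 2 * (l x m ^ (2 * q) * (\<Sum>a<N. degsum a x * (eigvec N (noise x) m a)\<^sup>2)))
      \<le> (\<Sum>m<N. 1 / 2 * l x m ^ (2 * q + 2) + 1 / 2 * (?n * D) ^ (q + 1))"
      by (intro sum_mono) auto
    also have "\<dots> = 1 / 2 * T x + 1 / 2 * (N * ?n ^ (q + 1) * D ^ (q + 1))"
      by (simp only: sum.distrib T_def sum_distrib_left[symmetric] sum_constant card_lessThan power_mult_distrib)
        (simp add: algebra_simps)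
    also have "\<dots> \<le> 1 / 2 * T x + 1 / 2 * (N * ?n ^ (q + 1) * S x)"
      using DS by (intro add_left_mono mult_left_mono) auto
    finally show ?thesis by (simp only: sum_distrib_left)
  qed (simp add: T_def)
  have "mean (pairs N) p T \<le> mean (pairs N) p (\<lambda>x. 1 / 2 * T x + 1 / 2 * (N * ?n ^ (q + 1) * S x))"
  proof -
    have "mean (pairs N) p T \<le> mean (pairs N) p (\<lambda>x. ?n / 2 * (\<Sum>m<N. l x m ^ (2 * q) * (\<Sum>a<N. degsum a x * (eigvec N (noise x) m a)\<^sup>2)))"
      using trace_moment_recursion[of q] unfolding T_def l_def mean_cmult by (simp add: add.commute)
    also have "\<dots> \<le> mean (pairs N) p (\<lambda>x. 1 / 2 * T x + 1 / 2 * (N * ?n ^ (q + 1) * S x))"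
      by (rule mean_mono) (rule young)
    finally show ?thesis .
  qed
  also have "\<dots> = 1 / 2 * mean (pairs N) p T + 1 / 2 * (N * ?n ^ (q + 1) * mean (pairs N) p S)"
    by (simp only: mean_add mean_cmult)
  finally have "mean (pairs N) p T \<le> N * ?n ^ (q + 1) * mean (pairs N) p S" by simp
  moreover have "mean (pairs N) p S = (\<Sum>a<N. mean (pairs N) p (\<lambda>x. degsum a x ^ (q + 1)))"
    unfolding S_def by (rule mean_sum)
  moreover have "mean (pairs N) p T = mean (pairs N) p (\<lambda>x. \<Sum>m<N. l x m ^ (2 * q + 2))"
    by (simp only: T_def)
  ultimately show ?thesis by (simp only:)
qed

text \<open>
  From the exponential moment of the degree, by \<open>y \<le> e\<^sup>y\<close> applied to \<open>y = degsum a x / L\<close>.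
\<close>
lemma degree_moment:
  fixes pmax L :: real
  assumes a: "a < N" and pq: "\<And>e. e \<in> pairs N \<Longrightarrow> p e \<le> pmax" and P: "0 < L" "real P \<le> L"
  shows "mean (pairs N) p (\<lambda>x. degsum a x ^ P) \<le> L ^ P * exp (3 * real P * (N * pmax / L))"
proof -
  define s where "s = P / L"
  have s: "0 \<le> s" "s \<le> 1" using P by (auto simp: s_def)
  define R where "R = pair_key a ` {..<N}"
  have R: "R \<subseteq> pairs N" using a by (auto simp: R_def)
  have inj: "inj_on (pair_key a) {..<N}" using pair_key_inj by (auto simp: inj_on_def)
  define g where "g e B = (if e \<in> R \<and> B then exp s else (1::real))" for e B
  have deg: "degsum a x = (\<Sum>e\<in>R. of_bool (e \<in> x)) + (\<Sum>e\<in>R. p e)" for x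
    by (simp add: degsum_def R_def sum.distrib sum.reindex[OF inj])
  have sp: "(\<Sum>e\<in>R. p e) \<le> N * pmax"
  proof -
    have "(\<Sum>e\<in>R. p e) \<le> (\<Sum>e\<in>R. pmax)" using pq R by (intro sum_mono) auto
    then show ?thesis by (simp add: R_def card_image[OF inj])
  qed
  have prod: "exp (s * (\<Sum>e\<in>R. of_bool (e \<in> x))) = (\<Prod>e\<in>pairs N. g e (e \<in> x))" for x
  proof -
    have "(\<Prod>e\<in>pairs N. g e (e \<in> x)) = (\<Prod>e\<in>R. g e (e \<in> x))"
      using R by (intro prod.mono_neutral_right) (auto simp: g_def)
    also have "\<dots> = (\<Prod>e\<in>R. exp (s * of_bool (e \<in> x)))"
      by (intro prod.cong) (auto simp: g_def)
    finally show ?thesis using finite_subset[OF R finE] by (simp only: exp_sum sum_distrib_left)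
  qed
  have "mean (pairs N) p (\<lambda>x. exp (s * (\<Sum>e\<in>R. of_bool (e \<in> x)))) = (\<Prod>e\<in>pairs N. p e * g e True + (1 - p e) * g e False)"
    unfolding prod by (simp add: mean_prod)
  also have "\<dots> \<le> (\<Prod>e\<in>pairs N. exp (if e \<in> R then 2 * s * p e else 0))"
  proof (rule prod_mono, safe)
    fix c d assume "(c, d) \<in> pairs N"
    then have pe: "0 \<le> p (c, d)" "p (c, d) \<le> 1" using p_range by auto
    show "0 \<le> p (c, d) * g (c, d) True + (1 - p (c, d)) * g (c, d) False"
      using pe by (auto simp: g_def)
    show "p (c, d) * g (c, d) True + (1 - p (c, d)) * g (c, d) False \<le> exp (if (c, d) \<in> R then 2 * s * p (c, d) else 0)"
    proof (cases "(c, d) \<in> R")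
      case True
      have "exp s \<le> 1 + s + s\<^sup>2" using exp_bound[OF s] .
      also have "\<dots> \<le> 1 + 2 * s" using s by (simp add: power2_eq_square mult_left_le)
      finally have "p (c, d) * exp s \<le> p (c, d) * (1 + 2 * s)" using pe by (intro mult_left_mono) auto
      then have "p (c, d) * exp s + (1 - p (c, d)) \<le> 1 + 2 * s * p (c, d)" by (simp add: algebra_simps)
      also have "\<dots> \<le> exp (2 * s * p (c, d))" by (rule exp_ge_add_one_self)
      finally show ?thesis using True by (simp add: g_def)
    qed (use pe in \<open>simp add: g_def\<close>)
  qed
  also have "\<dots> = exp (\<Sum>e\<in>pairs N. if e \<in> R then 2 * s * p e else 0)"
    by (simp add: exp_sum)
  also have "(\<Sum>e\<in>pairs N. if e \<in> R then 2 * s * p e else 0) = 2 * s * (\<Sum>e\<in>R. p e)"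
  proof -
    have "(\<Sum>e\<in>pairs N. if e \<in> R then 2 * s * p e else 0) = (\<Sum>e\<in>R. if e \<in> R then 2 * s * p e else 0)"
      using R by (intro sum.mono_neutral_right) auto
    then show ?thesis by (simp add: sum_distrib_left)
  qed
  finally have mgf: "mean (pairs N) p (\<lambda>x. exp (s * (\<Sum>e\<in>R. of_bool (e \<in> x)))) \<le> exp (2 * s * (\<Sum>e\<in>R. p e))" .
  have "mean (pairs N) p (\<lambda>x. degsum a x ^ P)
     \<le> mean (pairs N) p (\<lambda>x. (L ^ P * exp (s * (\<Sum>e\<in>R. p e))) * exp (s * (\<Sum>e\<in>R. of_bool (e \<in> x))))"
  proof (rule mean_mono)
    fix x
    have "degsum a x / L \<le> exp (degsum a x / L)"
      using exp_ge_add_one_self[of "degsum a x / L"] by linarith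
    then have "(degsum a x / L) ^ P \<le> exp (degsum a x / L) ^ P"
      using degsum_nonneg[OF a] P by (intro power_mono) auto
    also have "\<dots> = exp (s * degsum a x)"
      by (simp add: s_def flip: exp_of_nat_mult)
    finally have "degsum a x ^ P \<le> L ^ P * exp (s * degsum a x)"
      using P by (simp add: power_divide field_simps)
    also have "\<dots> = (L ^ P * exp (s * (\<Sum>e\<in>R. p e))) * exp (s * (\<Sum>e\<in>R. of_bool (e \<in> x)))"
      by (simp add: deg distrib_left exp_add)
    finally show "degsum a x ^ P \<le> (L ^ P * exp (s * (\<Sum>e\<in>R. p e))) * exp (s * (\<Sum>e\<in>R. of_bool (e \<in> x)))" .
  qed
  also have "\<dots> \<le> (L ^ P * exp (s * (\<Sum>e\<in>R. p e))) * exp (2 * s * (\<Sum>e\<in>R. p e))"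
    unfolding mean_cmult using mgf P by (intro mult_left_mono) auto
  also have "\<dots> = L ^ P * exp (3 * s * (\<Sum>e\<in>R. p e))"
    by (simp flip: exp_add)
  also have "\<dots> \<le> L ^ P * exp (3 * real P * (N * pmax / L))"
  proof -
    have "3 * s * (\<Sum>e\<in>R. p e) \<le> 3 * s * (N * pmax)" using sp s by (intro mult_left_mono) auto
    then show ?thesis using P by (intro mult_left_mono) (auto simp: s_def)
  qed
  finally show ?thesis .
qed

text \<open>
  Markov's inequality for the trace of an even power. To be applied with \<open>q\<close> of order \<open>log N\<close> and \<open>L\<close>, \<open>N pmax\<close> and
  \<open>t\<close> of order \<open>d\<close>: then the base of the power is of order \<open>log N / d\<close>.
\<close>
theorem noise_norm_tail:
  fixes pmax L t :: real
  assumes pq: "\<And>e. e \<in> pairs N \<Longrightarrow> p e \<le> pmax" and L: "real (q + 1) \<le> L" and t: "0 < t"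
  shows "mean (pairs N) p (\<lambda>x. of_bool (\<not> op_le N (noise x) t))
    \<le> (real N)\<^sup>2 * ((2 * real q + 1) * L * exp (3 * (N * pmax / L)) / t\<^sup>2) ^ (q + 1)"
proof -
  let ?P = "q + 1"
  have L0: "0 < L" using L by simp
  let ?T = "\<lambda>x. \<Sum>m<N. eigval N (noise x) m ^ (2 * q + 2)"
  have T0: "0 \<le> ?T x" for x
    by (intro sum_nonneg zero_le_even_power) auto
  have "mean (pairs N) p (\<lambda>x. of_bool (\<not> op_le N (noise x) t) :: real) \<le> mean (pairs N) p (\<lambda>x. of_bool (t ^ (2 * q + 2) \<le> ?T x))"
  proof (rule mean_mono)
    fix x
    have "t ^ (2 * q + 2) \<le> ?T x" if "\<not> op_le N (noise x) t"
    proof -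
      have "\<exists>m<N. t < \<bar>eigval N (noise x) m\<bar>"
      proof (rule ccontr)
        assume "\<not> (\<exists>m<N. t < \<bar>eigval N (noise x) m\<bar>)"
        then have "op_le N (noise x) t"
          using t by (intro op_le_eigensystem[OF eigensystem_eigval[OF symm_noise] symm_noise]) (fastforce simp: not_less)+
        with that show False by simp
      qed
      then obtain m where m: "m < N" "t < \<bar>eigval N (noise x) m\<bar>" by blast
      have "t ^ (2 * q + 2) \<le> \<bar>eigval N (noise x) m\<bar> ^ (2 * q + 2)"
        using m t by (intro power_mono) auto
      also have "\<dots> = eigval N (noise x) m ^ (2 * q + 2)"
        by (intro power_even_abs) auto
      also have "\<dots> \<le> ?T x"
        using m by (intro member_le_sum[where f="\<lambda>m. eigval N (noise x) m ^ (2 * q + 2)"] zero_le_even_power) auto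
      finally show ?thesis .
    qed
    then show "of_bool (\<not> op_le N (noise x) t) \<le> (of_bool (t ^ (2 * q + 2) \<le> ?T x) :: real)" by auto
  qed
  also have "\<dots> \<le> mean (pairs N) p ?T / t ^ (2 * q + 2)"
    using t T0 by (intro mean_markov) auto
  also have "\<dots> \<le> (N * (2 * real q + 1) ^ ?P * (\<Sum>a<N. L ^ ?P * exp (3 * real ?P * (N * pmax / L)))) / t ^ (2 * q + 2)"
  proof (rule divide_right_mono)
    have "(\<Sum>a<N. mean (pairs N) p (\<lambda>x. degsum a x ^ ?P)) \<le> (\<Sum>a<N. L ^ ?P * exp (3 * real ?P * (N * pmax / L)))"
      using degree_moment[OF _ pq L0 L] by (intro sum_mono) auto
    then show "mean (pairs N) p ?T \<le> N * (2 * real q + 1) ^ ?P * (\<Sum>a<N. L ^ ?P * exp (3 * real ?P * (N * pmax / L)))"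
      by (intro order_trans[OF trace_moment_le_degrees] mult_left_mono) auto
  qed (use t in auto)
  also have "\<dots> = (real N)\<^sup>2 * ((2 * real q + 1) * L * exp (3 * (N * pmax / L)) / t\<^sup>2) ^ ?P"
  proof -
    define P where "P = q + 1"
    define X where "X = exp (3 * (N * pmax / L))"
    have "exp (3 * real P * (N * pmax / L)) = exp (real P * (3 * (N * pmax / L)))"
      by (rule arg_cong[where f=exp]) (simp only: mult_ac)
    then have X: "exp (3 * real P * (N * pmax / L)) = X ^ P"
      by (simp only: X_def exp_of_nat_mult)
    have "2 * q + 2 = 2 * P" by (simp add: P_def)
    then have tP: "t ^ (2 * q + 2) = (t\<^sup>2) ^ P" by (simp only: power_mult)
    have "a * n ^ P * (a * (L ^ P * X ^ P)) / (t\<^sup>2) ^ P = a\<^sup>2 * (n * L * X / t\<^sup>2) ^ P" for a n :: real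
      by (simp add: power_mult_distrib power_divide power2_eq_square)
    then show ?thesis
      unfolding P_def[symmetric] X X_def[symmetric] tP by simp
  qed
  finally show ?thesis .
qed

end

section \<open>Delocalization of the eigenvector\<close>

lemma op_le_cong:
  assumes "\<And>a b. a < N \<Longrightarrow> b < N \<Longrightarrow> M a b = M' a b"
  shows "op_le N M t \<longleftrightarrow> op_le N M' t"
proof -
  have "mv N M x a = mv N M' x a" if "a < N" for x a
    using assms that by (simp add: mv_def)
  then have "ip N (mv N M x) (mv N M x) = ip N (mv N M' x) (mv N M' x)" for x
    by (intro ip_cong) auto
  then show ?thesis by (simp add: op_le_def)
qed

lemma sum_fourth_le: "(\<Sum>b<N. (u b :: real) ^ 4) \<le> (ip N u u)\<^sup>2"
proof -
  have "(\<Sum>b<N. (u b) ^ 4) = (\<Sum>b<N. (u b)\<^sup>2 * (u b)\<^sup>2)"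
    by (simp flip: power_add)
  also have "\<dots> \<le> (\<Sum>b<N. (u b)\<^sup>2 * ip N u u)"
    using ip_self_ge_coord by (intro sum_mono mult_left_mono) auto
  also have "\<dots> = (ip N u u)\<^sup>2"
    by (simp add: sum_distrib_right[symmetric] ip_def power2_eq_square)
  finally show ?thesis .
qed

lemma fourth_power_add_le: "(y + z :: real) ^ 4 \<le> 8 * (y ^ 4 + z ^ 4)"
proof -
  have sq: "(a + b)\<^sup>2 \<le> 2 * (a\<^sup>2 + b\<^sup>2)" for a b :: real
    using sum_squares_bound[of a b] by (simp add: power2_sum)
  have "((y + z)\<^sup>2)\<^sup>2 \<le> (2 * (y\<^sup>2 + z\<^sup>2))\<^sup>2"
    by (intro power_mono sq) auto
  also have "\<dots> = 4 * (y\<^sup>2 + z\<^sup>2)\<^sup>2" by (simp only: power_mult_distrib) simp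
  also have "\<dots> \<le> 4 * (2 * ((y\<^sup>2)\<^sup>2 + (z\<^sup>2)\<^sup>2))"
    by (intro mult_left_mono sq) auto
  finally show ?thesis by (simp flip: power_mult)
qed

definition star_edges :: "nat \<Rightarrow> nat \<Rightarrow> (nat \<times> nat) set" where
  "star_edges N a = pair_key a ` {..<N}"

lemma row_subset: "a < N \<Longrightarrow> star_edges N a \<subseteq> pairs N"
  by (auto simp: star_edges_def)

lemma pair_key_in_row: "c < N \<Longrightarrow> b < N \<Longrightarrow> a < N \<Longrightarrow> pair_key c b \<in> star_edges N a \<longleftrightarrow> c = a \<or> b = a"
proof
  assume "c < N" "b < N" "a < N" "pair_key c b \<in> star_edges N a"
  then show "c = a \<or> b = a"
    by (auto simp: star_edges_def pair_key_def min_def max_def split: if_splits)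
next
  assume "c < N" "b < N" "a < N" "c = a \<or> b = a"
  then show "pair_key c b \<in> star_edges N a"
    by (auto simp: star_edges_def intro: image_eqI[of _ _ b] image_eqI[of _ _ c] simp: pair_key_commute)
qed

lemma adj_minus_row:
  assumes "a < N" "b < N" "c < N"
  shows "adj (x - star_edges N a) c b = (if c = a \<or> b = a then 0 else adj x c b)"
  using pair_key_in_row[OF assms(3,2,1)] by (auto simp: adj_def)

text \<open>
  The mean matrix is a signal of size \<open>d\<close>, all probabilities are at most \<open>q\<close>, and \<open>\<theta> i\<close> is separated by \<open>\<gamma>\<close> from the
  other \<open>\<theta> j\<close> and from \<open>0\<close>. The relative noise level \<open>\<delta>\<close> and the defect \<open>\<eta>\<close> are small compared with \<open>\<gamma>\<close>; the constants leave room for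
  the perturbations by one entry and by one row. The condition \<open>q_sqrt\<close> makes the norm of a row of the mean
  matrix at most \<open>\<delta> d\<close>.
\<close>
locale spiked_bernoulli = bernoulli_matrix N p for N and p :: "nat \<times> nat \<Rightarrow> real" +
  fixes k :: nat and \<theta> :: "nat \<Rightarrow> real" and e :: "nat \<Rightarrow> nat \<Rightarrow> real"
    and d q \<delta> \<eta> \<gamma> :: real and i :: nat
  assumes k1: "1 \<le> k"
    and theta_mono: "\<And>i j. 1 \<le> i \<Longrightarrow> i \<le> j \<Longrightarrow> j \<le> k \<Longrightarrow> \<theta> j \<le> \<theta> i"
    and theta_pos: "0 < \<theta> k"
    and d_pos: "0 < d"
    and eta_nonneg: "0 \<le> \<eta>"
    and k_eta: "k * \<eta> \<le> 1 / 2"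
    and near: "near_orthonormal N k e \<eta>"
    and mean_signal: "\<And>a b. a < N \<Longrightarrow> b < N \<Longrightarrow> p (pair_key a b) = d * signal k \<theta> e a b"
    and p_le: "\<And>c. c \<in> pairs N \<Longrightarrow> p c \<le> q"
    and q_nonneg: "0 \<le> q"
    and i: "i \<in> {1..k}" "i \<le> N"
    and gap: "0 < \<gamma>" "\<gamma> \<le> \<theta> i" "1 < i \<Longrightarrow> \<theta> i + \<gamma> \<le> \<theta> (i - 1)" "i < k \<Longrightarrow> \<theta> (i + 1) + \<gamma> \<le> \<theta> i"
    and small: "0 \<le> \<delta>" "\<delta> \<le> \<gamma> / 64" "k * \<theta> 1 * \<eta> \<le> \<gamma> / 16"
    and q_sqrt: "q * sqrt N \<le> \<delta> * d"
    and large: "8 \<le> d * \<gamma>"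
begin

abbreviation "expn \<equiv> mean (pairs N) p"

text \<open>
  On good configurations the noise is small and the perturbation theory applies. Next come the \<open>i\<close>-th eigenvalue
  and eigenvector, the eigenvector \<open>vr a x\<close> after removal of row and column \<open>a\<close> (hence independent of the entries
  there), the linear form \<open>Y a x\<close> obtained by pairing it with the row \<open>a\<close>, and a lower bound \<open>g\<close> for the
  spectral gap.
\<close>
definition "good x \<longleftrightarrow> op_le N (noise x) (\<delta> * d)"
definition "lam x = eigval N (adj x) (i - 1)"
definition "v x = eigvec N (adj x) (i - 1)"
definition "vr a x = eigvec N (adj (x - star_edges N a)) (i - 1)"
definition "Y a x = (\<Sum>b<N. adj x a b * vr a x b)"
definition "g = 3 / 4 * d * \<gamma>"

lemma i1: "i - 1 < N" using i by auto

lemma g_pos: "0 < g" using d_pos gap by (simp add: g_def)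

lemma g_large: "6 \<le> g"
proof -
  have "g = 3 / 4 * (d * \<gamma>)" by (simp add: g_def)
  then show ?thesis using large by linarith
qed

lemma v_unit: "ip N (v x) (v x) = 1" "ip N (vr a x) (vr a x) = 1"
  using eigensystem_ortho[OF eigensystem_eigval[OF symm_adj] i1 i1] by (auto simp: v_def vr_def)

lemma signal_noiseI:
  assumes "op_le N (\<lambda>a b. M a b - p (pair_key a b)) (\<delta>' * d)" "symm N M"
  shows "signal_noise N k \<theta> e d \<delta>' \<eta> M"
proof
  show "op_le N (\<lambda>a b. M a b - d * signal k \<theta> e a b) (\<delta>' * d)"
    using assms(1) by (subst op_le_cong[of N _ "\<lambda>a b. M a b - p (pair_key a b)"]) (simp_all add: mean_signal)
qed (use k1 theta_mono theta_pos d_pos eta_nonneg k_eta near assms in auto)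

lemma gap_of:
  assumes sn: "signal_noise N k \<theta> e d \<delta>' \<eta> M" and "\<delta>' \<le> \<gamma> / 16" "n < N" "n \<noteq> i - 1"
  shows "g \<le> \<bar>eigval N M n - eigval N M (i - 1)\<bar>"
  unfolding g_def using assms small
  by (intro signal_noise.eigenvalue_gap[OF sn i gap]) (auto simp: signal_noise.tau_def[OF sn])

lemma good_signal_noise: "good x \<Longrightarrow> signal_noise N k \<theta> e d \<delta> \<eta> (adj x)"
  by (rule signal_noiseI) (auto simp: good_def noise_def[abs_def] symm_adj)

text \<open>
  A row is the image of a coordinate vector, so the norm of the noise bounds it; the row of the mean is small by
  assumption.
\<close>
lemma row_norm:
  assumes x: "good x" and a: "a < N"
  shows "sqrt (ip N (adj x a) (adj x a)) \<le> 2 * \<delta> * d"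
proof -
  define z where "z = (\<lambda>b. of_bool (b = a) :: real)"
  have z1: "ip N z z = 1"
    using a by (simp add: ip_def z_def)
  have "ip N (noise x a) (noise x a) = ip N (mv N (noise x) z) (mv N (noise x) z)"
  proof (rule ip_cong)
    fix b assume "b < N"
    have "mv N (noise x) z b = (\<Sum>c<N. if c = a then noise x b c else 0)"
      unfolding mv_def z_def by (intro sum.cong) auto
    then have "mv N (noise x) z b = noise x b a" using a by simp
    then show "noise x a b = mv N (noise x) z b" by (simp add: noise_Xi pair_key_commute)
    then show "noise x a b = mv N (noise x) z b" .
  qed
  then have 1: "sqrt (ip N (noise x a) (noise x a)) \<le> \<delta> * d"
    using op_leD[of N "noise x" "\<delta> * d" z] x z1 by (simp add: good_def)
  have "ip N (\<lambda>b. p (pair_key a b)) (\<lambda>b. p (pair_key a b)) \<le> (\<Sum>b<N. q * q)"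
    unfolding ip_def using p_le p_range a by (intro sum_mono mult_mono) (auto simp: q_nonneg)
  also have "\<dots> = (q * sqrt N)\<^sup>2" by (simp add: power_mult_distrib power2_eq_square algebra_simps)
  finally have "sqrt (ip N (\<lambda>b. p (pair_key a b)) (\<lambda>b. p (pair_key a b))) \<le> q * sqrt N"
    using q_nonneg by (intro real_le_lsqrt) auto
  then have 2: "sqrt (ip N (\<lambda>b. p (pair_key a b)) (\<lambda>b. p (pair_key a b))) \<le> \<delta> * d"
    using q_sqrt by linarith
  have "adj x a = (\<lambda>b. noise x a b + p (pair_key a b))"
    by (simp add: noise_def)
  then show ?thesis
    using sqrt_ip_triangle[of N "noise x a" "\<lambda>b. p (pair_key a b)"] 1 2 by simp
qed

text \<open>
  The matrix is a perturbation of the reduced matrix by its row and column \<open>a\<close>. The reduced eigenvector \<open>u\<close>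
  vanishes at \<open>a\<close>, because the row \<open>a\<close> of the reduced matrix is zero while its eigenvalue is not; so the
  perturbation maps \<open>u\<close> to \<open>Y a x\<close> times the coordinate vector of \<open>a\<close>, and
  \<open>simple_eigenvector_perturbation\<close> bounds the component of \<open>v\<close> off \<open>u\<close> by \<open>2 \<bar>Y a x\<bar> / g\<close>. That component
  equals \<open>v\<close> at \<open>a\<close>, which is the first claim. The second claim compares fourth powers: the coefficient \<open>c\<close> of \<open>u\<close> in \<open>v\<close>
  satisfies \<open>c\<^sup>2 \<ge> 4/5\<close>, whence the constant \<open>8 (25/16) = 25/2\<close>.
\<close>
lemma leave_one_out:
  assumes x: "good x" and a: "a < N"
  shows "\<bar>v x a\<bar> \<le> 2 / g * \<bar>Y a x\<bar>"
    and "(\<Sum>b<N. (vr a x b) ^ 4) \<le> 25 / 2 * ((\<Sum>b<N. (v x b) ^ 4) + (2 / g) ^ 4 * (Y a x) ^ 4)"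
proof -
  define M where "M = adj (x - star_edges N a)"
  define H where "H = (\<lambda>c b. adj x c b - M c b)"
  define u where "u = vr a x"
  define w where "w = v x"
  define w' where "w' = (\<lambda>b. w b - ip N u w * u b)"
  note es = eigensystem_eigval[OF symm_adj]
  have Hab: "H c b = (if c = a \<or> b = a then adj x c b else 0)" if "c < N" "b < N" for c b
    using adj_minus_row[OF a that(2,1)] by (simp add: H_def M_def)
  have symH: "symm N H"
    using symm_adj[of N x] symm_adj[of N "x - star_edges N a"] by (simp add: symm_def H_def M_def)
  have deg: "ip N (adj x a) (adj x a) \<le> (2 * \<delta> * d)\<^sup>2"
    using row_norm[OF x a] by (rule sqrt_le_D)
  have opH: "op_le N H (3 * \<delta> * d)"
  proof (rule op_le_mono[OF op_le_frobenius], rule real_le_lsqrt)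
    have "(\<Sum>c<N. \<Sum>b<N. (H c b)\<^sup>2) \<le> (\<Sum>c<N. \<Sum>b<N. of_bool (c = a) * (adj x c b)\<^sup>2 + of_bool (b = a) * (adj x c b)\<^sup>2)"
      by (intro sum_mono) (auto simp: Hab)
    also have "\<dots> = (\<Sum>c<N. \<Sum>b<N. of_bool (c = a) * (adj x c b)\<^sup>2) + (\<Sum>c<N. \<Sum>b<N. of_bool (b = a) * (adj x c b)\<^sup>2)"
      by (simp only: sum.distrib)
    also have "(\<Sum>c<N. \<Sum>b<N. of_bool (b = a) * (adj x c b)\<^sup>2) = (\<Sum>b<N. \<Sum>c<N. of_bool (b = a) * (adj x b c)\<^sup>2)"
      by (subst sum.swap) (simp only: adj_def pair_key_commute)
    also have "(\<Sum>c<N. \<Sum>b<N. of_bool (c = a) * (adj x c b)\<^sup>2) = ip N (adj x a) (adj x a)"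
    proof -
      have "(\<Sum>c<N. \<Sum>b<N. of_bool (c = a) * (adj x c b)\<^sup>2) = (\<Sum>c<N. if c = a then (\<Sum>b<N. (adj x a b)\<^sup>2) else 0)"
        by (intro sum.cong) auto
      then show ?thesis using a by (simp add: ip_def power2_eq_square)
    qed
    finally have "(\<Sum>c<N. \<Sum>b<N. (H c b)\<^sup>2) \<le> 2 * (2 * \<delta> * d)\<^sup>2"
      using deg by linarith
    also have "\<dots> = 8 * (\<delta> * d)\<^sup>2" by (simp add: power2_eq_square algebra_simps)
    also have "\<dots> \<le> 9 * (\<delta> * d)\<^sup>2" by (intro mult_right_mono) auto
    also have "\<dots> = (3 * \<delta> * d)\<^sup>2" by (simp add: power2_eq_square algebra_simps)
    finally show "(\<Sum>c<N. \<Sum>b<N. (H c b)\<^sup>2) \<le> (3 * \<delta> * d)\<^sup>2" .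
  qed (use small d_pos in auto)
  have snM: "signal_noise N k \<theta> e d (4 * \<delta>) \<eta> M"
  proof (rule signal_noiseI)
    have "op_le N (\<lambda>b c. noise x b c - H b c) (\<delta> * d + 3 * \<delta> * d)"
      using x opH by (intro op_le_diff) (auto simp: good_def)
    moreover have "(\<lambda>b c. noise x b c - H b c) = (\<lambda>b c. M b c - p (pair_key b c))"
      by (simp add: noise_def H_def fun_eq_iff)
    ultimately show "op_le N (\<lambda>b c. M b c - p (pair_key b c)) (4 * \<delta> * d)" by (simp add: mult.assoc)
  qed (simp add: M_def symm_adj)
  have gapM: "g \<le> \<bar>eigval N M n - eigval N M (i - 1)\<bar>" if "n < N" "n \<noteq> i - 1" for n
    using that small by (intro gap_of[OF snM]) auto
  have hg: "3 * \<delta> * d \<le> g / 4"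
  proof -
    have "3 * \<delta> * d \<le> 3 * (\<gamma> / 64) * d" using small d_pos by (intro mult_right_mono) auto
    also have "\<dots> \<le> g / 4" using d_pos gap by (simp add: g_def)
    finally show ?thesis .
  qed
  have u1: "ip N u u = 1" and w1: "ip N w w = 1" by (simp_all add: u_def w_def v_unit)
  have weq: "mv N M w b + mv N H w b = lam x * w b" if "b < N" for b
  proof -
    have "mv N M w b + mv N H w b = mv N (adj x) w b"
      by (simp add: mv_def H_def sum.distrib[symmetric] algebra_simps)
    then show ?thesis
      using eigensystem_mv[OF es i1 that] by (simp add: w_def v_def lam_def)
  qed
  have mu: "\<bar>lam x - eigval N M (i - 1)\<bar> \<le> g / 4"
  proof -
    have "\<bar>eigval N (adj x) (i - 1) - eigval N M (i - 1)\<bar> \<le> 3 * \<delta> * d"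
      unfolding M_def
      by (rule weyl_op[OF es symm_adj es symm_adj i1]) (use opH in \<open>simp add: H_def M_def\<close>)
    then show ?thesis using hg by (simp add: lam_def)
  qed
  have esM: "eigensystem N M (eigval N M) (eigvec N M)" "symm N M"
    by (simp_all add: M_def es symm_adj)
  have uu: "eigvec N M (i - 1) = u" by (simp add: u_def vr_def M_def)
  note pert = simple_eigenvector_perturbation[OF esM i1 g_pos gapM symH opH hg w1 weq mu, unfolded uu, folded w'_def]
  have ua: "u a = 0"
  proof -
    have "mv N M u a = 0"
      unfolding mv_def M_def using adj_minus_row[OF a _ a] by simp
    moreover have "mv N M u a = eigval N M (i - 1) * u a"
      using eigensystem_mv[OF esM(1) i1 a] unfolding uu .
    moreover have "eigval N M (i - 1) \<noteq> 0"
    proof -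
      have "\<bar>eigval N M (i - 1) - d * \<theta> i\<bar> \<le> d * signal_noise.tau k \<theta> (4 * \<delta>) \<eta>"
        by (rule signal_noise.eigval_close[OF snM i])
      also have "\<dots> \<le> d * (\<gamma> / 8)"
        using small d_pos by (intro mult_left_mono) (auto simp: signal_noise.tau_def[OF snM])
      also have "\<dots> < d * \<theta> i" using d_pos gap by (intro mult_strict_left_mono) auto
      finally show ?thesis by auto
    qed
    ultimately show ?thesis by simp
  qed
  have Hu: "mv N H u c = (if c = a then Y a x else 0)" if "c < N" for c
  proof (cases "c = a")
    case True
    then show ?thesis using a by (simp add: mv_def Y_def Hab u_def)
  next
    case False
    have "mv N H u c = (\<Sum>b<N. if b = a then adj x c b * u b else 0)"
      unfolding mv_def using that False by (intro sum.cong) (auto simp: Hab)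
    then show ?thesis using False ua a by simp
  qed
  have nH: "sqrt (ip N (mv N H u) (mv N H u)) = \<bar>Y a x\<bar>"
  proof -
    have "ip N (mv N H u) (mv N H u) = (\<Sum>c<N. if c = a then (Y a x)\<^sup>2 else 0)"
      unfolding ip_def by (intro sum.cong) (auto simp: Hu power2_eq_square)
    then show ?thesis using a by simp
  qed
  define c where "c = ip N u w"
  have w'c: "w' = (\<lambda>b. w b - c * u b)" by (simp add: w'_def c_def)
  have c1: "\<bar>c\<bar> \<le> 1"
    using ip_Cauchy_Schwarz_abs[of N u w] by (simp add: c_def u1 w1)
  have w'n: "sqrt (ip N w' w') \<le> 2 / g * \<bar>c\<bar> * \<bar>Y a x\<bar>"
    using pert(1) unfolding nH c_def[symmetric] .
  have w'Y: "sqrt (ip N w' w') \<le> 2 / g * \<bar>Y a x\<bar>"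
  proof (rule order_trans[OF w'n])
    have "2 / g * \<bar>c\<bar> * \<bar>Y a x\<bar> \<le> 2 / g * 1 * \<bar>Y a x\<bar>"
      using c1 g_pos by (intro mult_right_mono mult_left_mono) auto
    then show "2 / g * \<bar>c\<bar> * \<bar>Y a x\<bar> \<le> 2 / g * \<bar>Y a x\<bar>" by simp
  qed
  have "\<bar>w a\<bar> = \<bar>w' a\<bar>" by (simp add: w'c ua)
  also have "\<dots> \<le> sqrt (ip N w' w')"
    using ip_self_ge_coord[OF a, of w'] real_sqrt_le_mono by fastforce
  finally show "\<bar>v x a\<bar> \<le> 2 / g * \<bar>Y a x\<bar>"
    using w'Y by (simp add: w_def)
  have Yle: "\<bar>Y a x\<bar> \<le> g / 4"
  proof -
    have "\<bar>Y a x\<bar> \<le> 3 * \<delta> * d * sqrt (ip N u u)"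
      unfolding nH[symmetric] by (rule op_leD[OF opH])
    then show ?thesis using hg u1 by simp
  qed
  have "sqrt (ip N w' w') \<le> 2 / g * \<bar>c\<bar> * (g / 4)"
    using w'n Yle g_pos by (meson mult_left_mono order_trans abs_ge_zero divide_nonneg_pos mult_nonneg_nonneg zero_le_numeral)
  then have w'half: "sqrt (ip N w' w') \<le> \<bar>c\<bar> / 2" using g_pos by simp
  then have w'sq: "ip N w' w' \<le> c\<^sup>2 / 4"
    using sqrt_le_D[OF w'half] by (simp add: power_divide)
  have "ip N w' w' = 1 - c\<^sup>2"
  proof -
    have "ip N w' w' = ip N w w - 2 * c * ip N u w + c\<^sup>2 * ip N u u"
      unfolding w'c by (simp add: ip_diff_left ip_diff_right ip_scale_left ip_scale_right ip_commute[of N w u] power2_eq_square algebra_simps)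
    then show ?thesis by (simp add: u1 w1 c_def[symmetric] power2_eq_square)
  qed
  then have c45: "4 / 5 \<le> c\<^sup>2" using w'sq by simp
  have c4: "16 / 25 \<le> c ^ 4"
  proof -
    have "(4 / 5)\<^sup>2 \<le> (c\<^sup>2)\<^sup>2" using c45 by (intro power_mono) auto
    then show ?thesis by (simp add: power_divide flip: power_mult)
  qed
  have "c ^ 4 * (\<Sum>b<N. (u b) ^ 4) = (\<Sum>b<N. (w b + (- w' b)) ^ 4)"
    unfolding sum_distrib_left by (intro sum.cong refl) (simp add: w'c power_mult_distrib)
  also have "\<dots> \<le> (\<Sum>b<N. 8 * ((w b) ^ 4 + (- w' b) ^ 4))"
    by (intro sum_mono fourth_power_add_le)
  also have "\<dots> = 8 * ((\<Sum>b<N. (w b) ^ 4) + (\<Sum>b<N. (w' b) ^ 4))"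
    by (simp add: sum_distrib_left sum.distrib)
  also have "\<dots> \<le> 8 * ((\<Sum>b<N. (w b) ^ 4) + (2 / g) ^ 4 * (Y a x) ^ 4)"
  proof (intro mult_left_mono add_left_mono)
    have "sqrt (ip N w' w') ^ 4 = (sqrt (ip N w' w') ^ 2) ^ 2"
      by (simp only: power_mult[symmetric]) simp
    then have "(\<Sum>b<N. (w' b) ^ 4) \<le> (sqrt (ip N w' w')) ^ 4"
      using sum_fourth_le[of w' N] by simp
    also have "\<dots> \<le> (2 / g * \<bar>Y a x\<bar>) ^ 4"
      using w'Y by (intro power_mono) auto
    also have "\<dots> = (2 / g) ^ 4 * (Y a x) ^ 4"
      by (simp only: power_mult_distrib) (simp add: power_even_abs)
    finally show "(\<Sum>b<N. (w' b) ^ 4) \<le> (2 / g) ^ 4 * (Y a x) ^ 4" .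
  qed simp
  finally have "c ^ 4 * (\<Sum>b<N. (u b) ^ 4) \<le> 8 * ((\<Sum>b<N. (w b) ^ 4) + (2 / g) ^ 4 * (Y a x) ^ 4)" .
  moreover have "16 / 25 * (\<Sum>b<N. (u b) ^ 4) \<le> c ^ 4 * (\<Sum>b<N. (u b) ^ 4)"
    using c4 by (intro mult_right_mono) (auto intro: sum_nonneg)
  ultimately show "(\<Sum>b<N. (vr a x b) ^ 4) \<le> 25 / 2 * ((\<Sum>b<N. (v x b) ^ 4) + (2 / g) ^ 4 * (Y a x) ^ 4)"
    by (simp add: u_def w_def)
qed

end

lemma sum_key_square_le:
  fixes t :: "nat \<Rightarrow> nat \<Rightarrow> real"
  assumes "c \<in> pairs N"
  shows "(\<Sum>a<N. \<Sum>b<N. of_bool (pair_key a b = c) * t a b)\<^sup>2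
    \<le> 2 * (\<Sum>a<N. \<Sum>b<N. of_bool (pair_key a b = c) * (t a b)\<^sup>2)"
proof -
  obtain a b where c: "c = (a, b)" "(a, b) \<in> pairs N" using assms by (cases c) auto
  have "(s + t)\<^sup>2 \<le> 2 * (s\<^sup>2 + t\<^sup>2)" for s t :: real
    using sum_squares_bound[of s t] by (simp add: power2_sum)
  then show ?thesis
    unfolding c(1) sum_key_fixed[OF c(2)] by simp
qed

lemma sum_pairs_indicator:
  fixes f :: "nat \<Rightarrow> nat \<Rightarrow> real"
  shows "(\<Sum>c\<in>pairs N. \<Sum>a<N. \<Sum>b<N. of_bool (pair_key a b = c) * f a b) = (\<Sum>a<N. \<Sum>b<N. f a b)"
  using sum_pairs_key[where g="\<lambda>_. 1" and f=f and N=N] by (simp only: mult_1)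

lemma card_pairs_le: "card (pairs N) \<le> N\<^sup>2"
proof -
  have "card (pairs N) \<le> card ({..<N} \<times> {..<N})"
    by (rule card_mono) (auto simp: pairs_def)
  then show ?thesis by (simp add: power2_eq_square)
qed

text \<open>
  The endpoint of \<open>c\<close> different from \<open>a\<close>, or \<open>a\<close> itself for a loop.
\<close>
definition other :: "nat \<Rightarrow> nat \<times> nat \<Rightarrow> nat" where
  "other a c = (if fst c = a then snd c else fst c)"

lemma other_pair_key: "other a (pair_key a b) = b"
  by (auto simp: other_def pair_key_def min_def max_def)

lemma inj_pair_key: "inj_on (pair_key a) S"
  using pair_key_inj by (auto simp: inj_on_def)

context spiked_bernoulli
begin

text \<open>
  Fourth powers measure localization: they are at most \<open>1\<close>, and of order \<open>1/N\<close> for a spread out unit vector. The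
  expectation \<open>s\<close> is taken on good configurations only.
\<close>
definition "S x = (\<Sum>b<N. (v x b) ^ 4)"
definition "Sr a x = (\<Sum>b<N. (vr a x b) ^ 4)"
definition "bad = expn (\<lambda>x. of_bool (\<not> good x) :: real)"
definition "s = expn (\<lambda>x. of_bool (good x) * S x)"

lemma S_nonneg: "0 \<le> S x" "0 \<le> Sr a x"
  by (auto simp: S_def Sr_def intro!: sum_nonneg)

lemma Sr_le_1: "Sr a x \<le> 1"
  using sum_fourth_le[of "vr a x" N] by (simp add: Sr_def v_unit)

lemma s_nonneg: "0 \<le> s"
  unfolding s_def using S_nonneg by (intro mean_nonneg) auto

text \<open>
  Conditionally on the other rows, \<open>Y a\<close> is a linear form in independent variables with coefficients of total square
  \<open>1\<close>; its conditional mean is at most \<open>q sqrt N\<close>.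
\<close>
lemma Y_moment:
  assumes a: "a < N"
  shows "expn (\<lambda>x. (Y a x) ^ 4) \<le> 8 * (8 * q\<^sup>2 + 3 * q * expn (Sr a) + q ^ 4 * (real N)\<^sup>2)"
proof -
  define w where "w x c = vr a x (other a c)" for x c
  define Z where "Z = (\<lambda>x. \<Sum>c\<in>star_edges N a. Xi c x * w x c)"
  have reindex: "(\<Sum>c\<in>star_edges N a. h c) = (\<Sum>b<N. h (pair_key a b))" for h :: "nat \<times> nat \<Rightarrow> real"
    by (simp add: star_edges_def sum.reindex[OF inj_pair_key])
  have Yeq: "Y a x = Z x + (\<Sum>b<N. p (pair_key a b) * vr a x b)" for x
    unfolding Z_def reindex w_def other_pair_key Y_def sum.distrib[symmetric]
    by (intro sum.cong refl) (simp add: Xi_def adj_def algebra_simps)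
  have drift: "(\<Sum>b<N. p (pair_key a b) * vr a x b) ^ 4 \<le> q ^ 4 * (real N)\<^sup>2" for x
  proof -
    have "(\<Sum>b<N. p (pair_key a b) * vr a x b)\<^sup>2 \<le> ip N (\<lambda>b. p (pair_key a b)) (\<lambda>b. p (pair_key a b)) * ip N (vr a x) (vr a x)"
      using ip_Cauchy_Schwarz[of N "\<lambda>b. p (pair_key a b)" "vr a x"] by (simp add: ip_def)
    also have "\<dots> \<le> (\<Sum>b<N. q * q)"
      unfolding v_unit mult_1_right unfolding ip_def
      using p_le p_range a by (intro sum_mono mult_mono) (auto simp: q_nonneg)
    finally have "((\<Sum>b<N. p (pair_key a b) * vr a x b)\<^sup>2)\<^sup>2 \<le> (\<Sum>b<N. q * q)\<^sup>2"
      by (intro power_mono) auto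
    then show ?thesis by (simp add: power_mult_distrib eval_nat_numeral algebra_simps)
  qed
  have "expn (\<lambda>x. (Y a x) ^ 4) \<le> expn (\<lambda>x. 8 * ((Z x) ^ 4 + q ^ 4 * (real N)\<^sup>2))"
  proof (rule mean_mono)
    fix x
    show "(Y a x) ^ 4 \<le> 8 * ((Z x) ^ 4 + q ^ 4 * (real N)\<^sup>2)"
      unfolding Yeq
      by (rule order_trans[OF fourth_power_add_le]) (intro mult_left_mono add_left_mono drift, simp)
  qed
  also have "\<dots> = 8 * (expn (\<lambda>x. (Z x) ^ 4) + q ^ 4 * (real N)\<^sup>2)"
    by (simp only: mean_cmult mean_add mean_const)
  also have "expn (\<lambda>x. (Z x) ^ 4) \<le> 8 * q\<^sup>2 * expn (\<lambda>x. (\<Sum>c\<in>star_edges N a. (w x c)\<^sup>2)\<^sup>2) + 3 * q * expn (\<lambda>x. \<Sum>c\<in>star_edges N a. (w x c)^4)"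
    unfolding Z_def
  proof (rule fourth_moment_linear_form)
    show "finite (star_edges N a)" by (simp add: star_edges_def)
    fix c f x assume c: "c \<in> star_edges N a"
    have "insert c x - star_edges N a = x - {c} - star_edges N a" using c by auto
    then show "w (insert c x) f = w (x - {c}) f" by (simp add: w_def vr_def)
  qed (use row_subset[OF a] p_le q_nonneg in blast)+
  also have "(\<lambda>x. (\<Sum>c\<in>star_edges N a. (w x c)\<^sup>2)\<^sup>2) = (\<lambda>x. 1)"
  proof
    fix x
    have "(\<Sum>c\<in>star_edges N a. (w x c)\<^sup>2) = ip N (vr a x) (vr a x)"
      unfolding reindex w_def other_pair_key by (simp add: ip_def power2_eq_square)
    then show "(\<Sum>c\<in>star_edges N a. (w x c)\<^sup>2)\<^sup>2 = 1" by (simp add: v_unit)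
  qed
  also have "(\<lambda>x. \<Sum>c\<in>star_edges N a. (w x c)^4) = Sr a"
    unfolding reindex w_def other_pair_key by (simp add: Sr_def fun_eq_iff)
  finally show ?thesis by (simp add: mean_const)
qed

lemma Sr_mean_le:
  assumes a: "a < N"
  shows "expn (Sr a) \<le> 25 / 2 * (s + (2 / g) ^ 4 * expn (\<lambda>x. (Y a x) ^ 4)) + bad"
proof -
  have "expn (Sr a) \<le> expn (\<lambda>x. 25 / 2 * (of_bool (good x) * S x + (2 / g) ^ 4 * (Y a x) ^ 4) + of_bool (\<not> good x))"
  proof (rule mean_mono)
    fix x
    show "Sr a x \<le> 25 / 2 * (of_bool (good x) * S x + (2 / g) ^ 4 * (Y a x) ^ 4) + of_bool (\<not> good x)"
    proof (cases "good x")
      case True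
      then show ?thesis using leave_one_out(2)[OF True a] by (simp add: Sr_def S_def)
    next
      case False
      have "0 \<le> 25 / 2 * ((2 / g) ^ 4 * (Y a x) ^ 4)" using g_pos by simp
      moreover have "25 / 2 * (of_bool (good x) * S x + (2 / g) ^ 4 * (Y a x) ^ 4) + of_bool (\<not> good x)
          = 25 / 2 * ((2 / g) ^ 4 * (Y a x) ^ 4) + (1 :: real)"
        using False by (simp only: of_bool_eq not_False_eq_True) simp
      ultimately show ?thesis using Sr_le_1[of a x] by linarith
    qed
  qed
  also have "\<dots> = 25 / 2 * (s + (2 / g) ^ 4 * expn (\<lambda>x. (Y a x) ^ 4)) + bad"
    by (simp only: mean_add mean_cmult s_def bad_def)
  finally show ?thesis .
qed

text \<open>
  By \<open>leave_one_out\<close>, \<open>s\<close> is at most \<open>N (2/g)\<^sup>4\<close> times the fourth moment of \<open>Y\<close>. That moment is bounded in terms of the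
  fourth powers of \<open>vr\<close>, which are bounded in terms of \<open>s\<close> and of the fourth moment of \<open>Y\<close> again. Both recurring terms
  have a factor \<open>q N / g\<^sup>4\<close>; the hypothesis makes it small enough for them to be absorbed. If \<open>N q\<close> and \<open>g\<close> are of order \<open>d\<close>, the
  bound is of order \<open>1/N\<close>, up to the term with \<open>bad\<close>.
\<close>
lemma delocalization:
  assumes h: "19200 * (N * q) \<le> g ^ 4"
  shows "s \<le> 32 * real N / g ^ 4 * (128 * q\<^sup>2 + 16 * q ^ 4 * (real N)\<^sup>2 + 48 * q * bad)"
proof -
  define c where "c = 16 / g ^ 4"
  have c: "(2 / g) ^ 4 = c" by (simp add: c_def power_divide)
  have c0: "0 \<le> c" using g_pos by (simp add: c_def)
  have h': "1200 * (c * (N * q)) \<le> 1" using h g_pos by (simp add: c_def field_simps)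
  have N1: "1 \<le> real N" using i by simp
  have "c * q \<le> c * (N * q)" using c0 q_nonneg N1 by (intro mult_left_mono) (auto simp: mult_le_cancel_right1)
  then have cq: "600 * (c * q) \<le> 1" using h' mult_nonneg_nonneg[OF c0 q_nonneg] by linarith
  define B where "B = 128 * q\<^sup>2 + 16 * q ^ 4 * (real N)\<^sup>2 + 600 * q * s + 48 * q * bad"
  have Y: "expn (\<lambda>x. (Y a x) ^ 4) \<le> B" if a: "a < N" for a
  proof -
    define y where "y = expn (\<lambda>x. (Y a x) ^ 4)"
    have y0: "0 \<le> y" unfolding y_def by (rule mean_nonneg) simp
    have "y \<le> 8 * (8 * q\<^sup>2 + 3 * q * expn (Sr a) + q ^ 4 * (real N)\<^sup>2)"
      unfolding y_def by (rule Y_moment[OF a])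
    moreover have "3 * q * expn (Sr a) \<le> 3 * q * (25 / 2 * (s + c * y) + bad)"
      using Sr_mean_le[OF a] q_nonneg unfolding c y_def[symmetric] by (intro mult_left_mono) auto
    moreover have "y \<le> 8 * (A + B' + C)" if "y \<le> 8 * (A + B + C)" "B \<le> B'" for A B B' C :: real
      using that by simp
    ultimately have "y \<le> 8 * (8 * q\<^sup>2 + 3 * q * (25 / 2 * (s + c * y) + bad) + q ^ 4 * (real N)\<^sup>2)"
      by blast
    also have "\<dots> = 64 * q\<^sup>2 + 300 * q * s + (300 * (c * q)) * y + 24 * q * bad + 8 * q ^ 4 * (real N)\<^sup>2"
      by (simp add: field_simps)
    also have "(300 * (c * q)) * y \<le> 1 / 2 * y"
      using cq y0 by (intro mult_right_mono) auto
    finally show ?thesis unfolding y_def[symmetric] B_def by simp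
  qed
  have "s \<le> expn (\<lambda>x. \<Sum>a<N. c * (Y a x) ^ 4)"
    unfolding s_def
  proof (rule mean_mono)
    fix x
    show "of_bool (good x) * S x \<le> (\<Sum>a<N. c * (Y a x) ^ 4)"
    proof (cases "good x")
      case True
      have "(v x a) ^ 4 \<le> c * (Y a x) ^ 4" if "a < N" for a
      proof -
        have "\<bar>v x a\<bar> ^ 4 \<le> (2 / g * \<bar>Y a x\<bar>) ^ 4"
          using leave_one_out(1)[OF True that] by (intro power_mono) auto
        then show ?thesis by (simp only: power_mult_distrib c) (simp add: power_even_abs)
      qed
      then show ?thesis using True by (auto simp: S_def intro!: sum_mono)
    next
      case False
      then show ?thesis using c0 by (auto intro!: sum_nonneg)
    qed
  qed
  also have "\<dots> = (\<Sum>a<N. c * expn (\<lambda>x. (Y a x) ^ 4))"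
    by (simp only: mean_sum mean_cmult)
  also have "\<dots> \<le> (\<Sum>a<N. c * B)"
    using Y c0 by (intro sum_mono mult_left_mono) auto
  also have "\<dots> = real N * c * (128 * q\<^sup>2 + 16 * q ^ 4 * (real N)\<^sup>2 + 48 * q * bad) + (600 * (c * (N * q))) * s"
    by (simp add: B_def algebra_simps)
  also have "(600 * (c * (N * q))) * s \<le> 1 / 2 * s"
    using h' s_nonneg by (intro mult_right_mono) auto
  finally have "s \<le> 2 * (real N * c * (128 * q\<^sup>2 + 16 * q ^ 4 * (real N)\<^sup>2 + 48 * q * bad))" by linarith
  then show ?thesis by (simp add: c_def algebra_simps)
qed

section \<open>The variance of the nonlinear part of the eigenvalue\<close>

text \<open>
  The configurations differ by at most one entry, whose norm is small against the gap at the good configuration \<open>x\<close>.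
\<close>
lemma first_order_expansion:
  assumes x: "good x" and H: "symm N H" "op_le N H (sqrt 2)"
    and x': "\<And>a b. adj x' a b = adj x a b + H a b"
  shows "\<bar>lam x' - lam x - ip N (v x) (mv N H (v x))\<bar> \<le> 2 / g * ip N (mv N H (v x)) (mv N H (v x))"
proof -
  note es = eigensystem_eigval[OF symm_adj]
  have "sqrt 2 \<le> 3 / 2" by (rule real_le_lsqrt) (auto simp: power2_eq_square)
  then have s2: "sqrt 2 \<le> g / 4" using g_large by linarith
  have "\<delta> \<le> \<gamma> / 16" using small gap by linarith
  then have gapx: "g \<le> \<bar>eigval N (adj x) n - eigval N (adj x) (i - 1)\<bar>" if "n < N" "n \<noteq> i - 1" for n
    using that by (intro gap_of[OF good_signal_noise[OF x]]) auto
  have weq: "mv N (adj x) (v x') a + mv N H (v x') a = lam x' * v x' a" if "a < N" for a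
  proof -
    have "mv N (adj x) (v x') a + mv N H (v x') a = mv N (adj x') (v x') a"
      by (simp add: mv_def x' sum.distrib[symmetric] algebra_simps)
    then show ?thesis
      using eigensystem_mv[OF es i1 that] by (simp add: v_def lam_def)
  qed
  have "\<bar>eigval N (adj x') (i - 1) - eigval N (adj x) (i - 1)\<bar> \<le> sqrt 2"
    by (rule weyl_op[OF es symm_adj es symm_adj i1]) (use H(2) in \<open>simp add: x'\<close>)
  then have mu: "\<bar>lam x' - eigval N (adj x) (i - 1)\<bar> \<le> g / 4"
    using s2 by (simp add: lam_def)
  show ?thesis
    using simple_eigenvector_perturbation(2)[OF es symm_adj i1 g_pos gapx H s2 v_unit(1) weq mu]
    by (simp add: lam_def v_def)
qed

lemma discrete_derivative:
  assumes x: "good x"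
  shows "\<bar>lam (insert c x) - lam (x - {c}) - ip N (v x) (mv N (elem_sym c) (v x))\<bar>
    \<le> 2 / g * ip N (mv N (elem_sym c) (v x)) (mv N (elem_sym c) (v x))"
\<comment> \<open>One of the two configurations is \<open>x\<close> itself; the expansion starts there.\<close>
proof (cases "c \<in> x")
  case True
  let ?H = "\<lambda>a b. - elem_sym c a b"
  have mvH: "mv N ?H (v x) = (\<lambda>a. (- 1) * mv N (elem_sym c) (v x) a)"
    by (rule ext) (simp add: mv_def sum_negf)
  have "symm N ?H" using symm_elem_sym[of N c] by (simp add: symm_def)
  moreover have "op_le N ?H (sqrt 2)" by (intro op_le_uminus op_le_elem_sym)
  moreover have "adj (x - {c}) a b = adj x a b + ?H a b" for a b
    using adj_insert_delete[of c x a b] True by (simp add: insert_absorb)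
  ultimately have "\<bar>lam (x - {c}) - lam x - ip N (v x) (mv N ?H (v x))\<bar> \<le> 2 / g * ip N (mv N ?H (v x)) (mv N ?H (v x))"
    by (rule first_order_expansion[OF x])
  then show ?thesis
    unfolding mvH ip_scale_left ip_scale_right using True by (simp add: insert_absorb abs_minus_commute algebra_simps)
next
  case False
  have "adj (insert c x) a b = adj x a b + elem_sym c a b" for a b
    using adj_insert_delete[of c x a b] False by simp
  from first_order_expansion[OF x symm_elem_sym op_le_elem_sym this] show ?thesis
    using False by simp
qed

lemma lam_insert_delete: "\<bar>lam (insert c x) - lam (x - {c})\<bar> \<le> sqrt 2"
  unfolding lam_def
  by (rule weyl_op[OF eigensystem_eigval[OF symm_adj] symm_adj eigensystem_eigval[OF symm_adj] symm_adj i1])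
    (simp add: adj_insert_delete op_le_elem_sym)

text \<open>
  What remains of the eigenvalue after its linear part is removed.
\<close>
definition "fluct x = lam x - ip N (e i) (mv N (adj x) (e i))"

lemma fluct_insert_delete:
  "fluct (insert c x) - fluct (x - {c}) = lam (insert c x) - lam (x - {c}) - ip N (e i) (mv N (elem_sym c) (e i))"
proof -
  have "mv N (adj (insert c x)) (e i) = (\<lambda>a. mv N (adj (x - {c})) (e i) a + mv N (elem_sym c) (e i) a)"
    by (rule ext) (simp add: mv_def sum.distrib[symmetric] adj_insert_delete[of c x, symmetric] algebra_simps)
  then show ?thesis by (simp add: fluct_def ip_add_right)
qed

lemma e_i_norm: "ip N (e i) (e i) \<le> 4"
proof -
  have "\<bar>ip N (e i) (e i) - 1\<bar> \<le> \<eta>"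
    using near i unfolding near_orthonormal_def by force
  moreover have "\<eta> \<le> k * \<eta>" using k1 eta_nonneg by (simp add: mult_le_cancel_right1)
  ultimately show ?thesis using k_eta by linarith
qed

text \<open>
  The Poincare inequality, with the discrete derivative of \<open>fluct\<close> split into its first-order part, controlled
  by the distance of \<open>v v\<^sup>T\<close> from \<open>e i (e i)\<^sup>T\<close>, and the second-order error, controlled by the fourth powers of \<open>v\<close>. On bad
  configurations the crude bound \<open>8\<close> for each derivative is used.
\<close>
theorem eigenvalue_variance:
  assumes h: "19200 * (N * q) \<le> g ^ 4"
  shows "expn (\<lambda>x. (fluct x - expn fluct)\<^sup>2)
    \<le> q * (4 * (\<eta>\<^sup>2 + 64 * (k * \<theta> 1 * \<eta> + \<delta>)\<^sup>2 / \<gamma>\<^sup>2) + 16 * real N / g\<^sup>2 * s + 64 * (real N)\<^sup>2 * bad)"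
proof -
  define D where "D c x = fluct (insert c x) - fluct (x - {c})" for c x
  define Fr where "Fr = \<eta>\<^sup>2 + 64 * (k * \<theta> 1 * \<eta> + \<delta>)\<^sup>2 / \<gamma>\<^sup>2"
  \<comment> \<open>\<open>A c\<close> is the first-order part of the derivative, and \<open>2 / g * B c\<close> bounds the rest.\<close>
  have goodD: "(\<Sum>c\<in>pairs N. (D c x)\<^sup>2) \<le> 4 * Fr + 16 * real N / g\<^sup>2 * S x" if x: "good x" for x
  proof -
    note sn = good_signal_noise[OF x]
    define t where "t a b = v x a * v x b - e i a * e i b" for a b
    define A where "A c = ip N (v x) (mv N (elem_sym c) (v x)) - ip N (e i) (mv N (elem_sym c) (e i))" for c
    define B where "B c = ip N (mv N (elem_sym c) (v x)) (mv N (elem_sym c) (v x))" for c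
    have A: "A c = (\<Sum>a<N. \<Sum>b<N. of_bool (pair_key a b = c) * t a b)" for c
      unfolding A_def ip_elem_sym t_def by (simp only: sum_subtractf right_diff_distrib)
    have "(\<Sum>c\<in>pairs N. (A c)\<^sup>2) \<le> (\<Sum>c\<in>pairs N. 2 * (\<Sum>a<N. \<Sum>b<N. of_bool (pair_key a b = c) * (t a b)\<^sup>2))"
      unfolding A by (intro sum_mono sum_key_square_le)
    also have "\<dots> = 2 * (\<Sum>a<N. \<Sum>b<N. (t a b)\<^sup>2)"
      by (simp only: sum_distrib_left[symmetric, of 2] sum_pairs_indicator)
    also have "(\<Sum>a<N. \<Sum>b<N. (t a b)\<^sup>2) \<le> Fr"
      unfolding t_def Fr_def v_def signal_noise.tau_def[OF sn, symmetric]
    proof (rule signal_noise.eigenvector_close[OF sn i gap])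
      show "signal_noise.tau k \<theta> \<delta> \<eta> \<le> \<gamma> / 8"
        unfolding signal_noise.tau_def[OF sn] using small gap by linarith
    qed
    finally have SA: "(\<Sum>c\<in>pairs N. (A c)\<^sup>2) \<le> 2 * Fr" by simp
    have "(\<Sum>c\<in>pairs N. (B c)\<^sup>2) \<le> (\<Sum>c\<in>pairs N. 2 * (\<Sum>a<N. \<Sum>b<N. of_bool (pair_key a b = c) * ((v x b)\<^sup>2)\<^sup>2))"
      unfolding B_def norm_elem_sym by (intro sum_mono sum_key_square_le)
    also have "\<dots> = 2 * (\<Sum>a<N. \<Sum>b<N. ((v x b)\<^sup>2)\<^sup>2)"
      by (simp only: sum_distrib_left[symmetric, of 2] sum_pairs_indicator)
    also have "\<dots> = 2 * (N * S x)"
      by (simp add: S_def flip: power_mult)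
    finally have SB: "(\<Sum>c\<in>pairs N. (B c)\<^sup>2) \<le> 2 * (N * S x)" .
    have "(\<Sum>c\<in>pairs N. (D c x)\<^sup>2) \<le> (\<Sum>c\<in>pairs N. 2 * (A c)\<^sup>2 + 8 / g\<^sup>2 * (B c)\<^sup>2)"
    proof (rule sum_mono)
      fix c
      define r where "r = D c x - A c"
      have B0: "0 \<le> B c" by (simp add: B_def)
      have "\<bar>r\<bar> \<le> 2 / g * B c"
        using discrete_derivative[OF x, of c] unfolding r_def D_def fluct_insert_delete A_def B_def by simp
      then have "\<bar>r\<bar>\<^sup>2 \<le> (2 / g * B c)\<^sup>2" by (intro power_mono) auto
      then have r2: "r\<^sup>2 \<le> 4 / g\<^sup>2 * (B c)\<^sup>2" by (simp add: power_mult_distrib power_divide)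
      have "(D c x)\<^sup>2 = (A c + r)\<^sup>2" by (simp add: r_def)
      also have "\<dots> \<le> 2 * (A c)\<^sup>2 + 2 * r\<^sup>2"
        using sum_squares_bound[of "A c" r] by (simp add: power2_sum)
      finally show "(D c x)\<^sup>2 \<le> 2 * (A c)\<^sup>2 + 8 / g\<^sup>2 * (B c)\<^sup>2" using r2 by simp
    qed
    also have "\<dots> = 2 * (\<Sum>c\<in>pairs N. (A c)\<^sup>2) + 8 / g\<^sup>2 * (\<Sum>c\<in>pairs N. (B c)\<^sup>2)"
      by (simp only: sum.distrib sum_distrib_left)
    also have "\<dots> \<le> 2 * (2 * Fr) + 8 / g\<^sup>2 * (2 * (N * S x))"
      using SA SB by (intro add_mono mult_left_mono) auto
    finally show ?thesis by simp
  qed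
  have badD: "(\<Sum>c\<in>pairs N. (D c x)\<^sup>2) \<le> 64 * (real N)\<^sup>2" for x
  proof -
    have "(D c x)\<^sup>2 \<le> 64" for c
    proof -
      have "sqrt 2 \<le> 3 / 2" by (rule real_le_lsqrt) (auto simp: power2_eq_square)
      moreover have "\<bar>ip N (e i) (mv N (elem_sym c) (e i))\<bar> \<le> sqrt 2 * 4"
        by (rule order_trans[OF op_le_quadratic_form[OF op_le_elem_sym]]) (use e_i_norm in simp)
      ultimately have "\<bar>D c x\<bar> \<le> 8"
        using lam_insert_delete[of c x] unfolding D_def fluct_insert_delete by linarith
      then have "\<bar>D c x\<bar>\<^sup>2 \<le> 8\<^sup>2" by (intro power_mono) auto
      then show ?thesis by simp
    qed
    then have "(\<Sum>c\<in>pairs N. (D c x)\<^sup>2) \<le> (\<Sum>c\<in>pairs N. 64)" by (intro sum_mono)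
    also have "\<dots> = 64 * real (card (pairs N))" by simp
    also have "\<dots> \<le> 64 * (real N)\<^sup>2" using card_pairs_le[of N] by (simp flip: of_nat_power)
    finally show ?thesis .
  qed
  have "expn (\<lambda>x. (fluct x - expn fluct)\<^sup>2) = expn (\<lambda>x. (fluct x)\<^sup>2) - (expn fluct)\<^sup>2"
    by (rule mean_variance)
  also have "\<dots> \<le> (\<Sum>c\<in>pairs N. p c * (1 - p c) * expn (\<lambda>x. (D c x)\<^sup>2))"
    unfolding D_def by (rule bernoulli_poincare) (rule bernoulli_axioms)
  also have "\<dots> \<le> (\<Sum>c\<in>pairs N. q * expn (\<lambda>x. (D c x)\<^sup>2))"
  proof (intro sum_mono mult_right_mono mean_nonneg)
    fix c assume c: "c \<in> pairs N"
    have "p c * (1 - p c) \<le> p c * 1" using p_range[OF c] by (intro mult_left_mono) auto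
    then show "p c * (1 - p c) \<le> q" using p_le[OF c] by linarith
  qed simp
  also have "\<dots> = q * expn (\<lambda>x. \<Sum>c\<in>pairs N. (D c x)\<^sup>2)"
    by (simp only: mean_sum sum_distrib_left)
  also have "\<dots> \<le> q * expn (\<lambda>x. (4 * Fr + 16 * real N / g\<^sup>2 * (of_bool (good x) * S x)) + 64 * (real N)\<^sup>2 * of_bool (\<not> good x))"
  proof (intro mult_left_mono mean_mono)
    fix x
    have "0 \<le> Fr" by (simp add: Fr_def)
    then show "(\<Sum>c\<in>pairs N. (D c x)\<^sup>2) \<le> (4 * Fr + 16 * real N / g\<^sup>2 * (of_bool (good x) * S x)) + 64 * (real N)\<^sup>2 * of_bool (\<not> good x)"
      using goodD[of x] badD[of x] by (cases "good x") auto
  qed (rule q_nonneg)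
  also have "\<dots> = q * (4 * Fr + 16 * real N / g\<^sup>2 * s + 64 * (real N)\<^sup>2 * bad)"
    by (simp only: mean_add mean_cmult mean_const s_def bad_def)
  finally show ?thesis by (simp only: Fr_def)
qed

end

section \<open>Characteristic functions and weak convergence in several variables\<close>

text \<open>
  Finite combinations of characters with arbitrary real frequencies.
\<close>
inductive trig_poly :: "'i set \<Rightarrow> (('i \<Rightarrow> real) \<Rightarrow> complex) \<Rightarrow> bool" for I where
  monomial: "trig_poly I (\<lambda>x. c * iexp (\<Sum>a\<in>I. t a * x a))"
| add: "trig_poly I f \<Longrightarrow> trig_poly I g \<Longrightarrow> trig_poly I (\<lambda>x. f x + g x)"

lemma trig_poly_const: "trig_poly I (\<lambda>_. c)"
  using trig_poly.monomial[of I c "\<lambda>_. 0"] by simp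

lemma trig_poly_mult:
  assumes "trig_poly I f" "trig_poly I g"
  shows "trig_poly I (\<lambda>x. f x * g x)"
  using assms(1)
proof induction
  case (monomial c t)
  show ?case using assms(2)
  proof induction
    case (monomial c' t')
    have "(\<lambda>x. c * iexp (\<Sum>a\<in>I. t a * x a) * (c' * iexp (\<Sum>a\<in>I. t' a * x a)))
       = (\<lambda>x. (c * c') * iexp (\<Sum>a\<in>I. (t a + t' a) * x a))"
      by (simp add: fun_eq_iff distrib_right sum.distrib distrib_left exp_add)
    then show ?case using trig_poly.monomial[of I "c * c'" "\<lambda>a. t a + t' a"] by simp
  next
    case (add f g)
    then show ?case using trig_poly.add[OF add.IH] by (simp add: distrib_left)
  qed
next
  case (add f h)
  then show ?case using trig_poly.add[OF add.IH] by (simp add: distrib_right)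
qed

lemma borel_measurable_trig_poly:
  assumes "trig_poly I f"
  shows "f \<in> borel_measurable (Pi\<^sub>M I (\<lambda>_. borel))"
  using assms
proof induction
  case (monomial c t)
  have "(\<lambda>x. \<Sum>a\<in>I. t a * x a) \<in> borel_measurable (Pi\<^sub>M I (\<lambda>_. borel))"
    by (intro borel_measurable_sum borel_measurable_times measurable_component_singleton) auto
  then have "(\<lambda>x. of_real (\<Sum>a\<in>I. t a * x a) :: complex) \<in> borel_measurable (Pi\<^sub>M I (\<lambda>_. borel))"
    by (rule measurable_compose[OF _ borel_measurable_continuous_onI[OF continuous_on_of_real[OF continuous_on_id]]])
  then show ?case
    by (intro borel_measurable_times borel_measurable_const measurable_compose[OF _ borel_measurable_exp])
next
  case (add f g)
  then show ?case by (intro borel_measurable_add)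
qed

lemma trig_poly_bounded: "trig_poly I f \<Longrightarrow> \<exists>B. \<forall>x. norm (f x) \<le> B"
proof (induction rule: trig_poly.induct)
  case (monomial c t)
  then show ?case by (intro exI[of _ "norm c"]) (simp add: norm_mult)
next
  case (add f g)
  then obtain B B' where "\<forall>x. norm (f x) \<le> B" "\<forall>x. norm (g x) \<le> B'" by auto
  then show ?case by (intro exI[of _ "B + B'"]) (auto intro: norm_triangle_mono)
qed

lemma (in prob_space) integrable_bounded:
  fixes f :: "'a \<Rightarrow> 'b::{banach, second_countable_topology}"
  shows "f \<in> borel_measurable M \<Longrightarrow> (\<And>x. norm (f x) \<le> B) \<Longrightarrow> integrable M f"
  by (rule integrable_const_bound) auto

lemma trig_poly_integral_tendsto:
  fixes \<mu> :: "nat \<Rightarrow> ('i \<Rightarrow> real) measure"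
  assumes f: "trig_poly I f"
    and mu: "\<And>n. prob_space (\<mu> n)" "\<And>n. sets (\<mu> n) = sets (Pi\<^sub>M I (\<lambda>_. borel))"
    and nu: "prob_space \<nu>" "sets \<nu> = sets (Pi\<^sub>M I (\<lambda>_. borel))"
    and char: "\<And>t. (\<lambda>n. \<integral>x. iexp (\<Sum>a\<in>I. t a * x a) \<partial>\<mu> n) \<longlonglongrightarrow> (\<integral>x. iexp (\<Sum>a\<in>I. t a * x a) \<partial>\<nu>)"
  shows "(\<lambda>n. \<integral>x. f x \<partial>\<mu> n) \<longlonglongrightarrow> (\<integral>x. f x \<partial>\<nu>)"
  using f
proof induction
  case (monomial c t)
  then show ?case using tendsto_mult_left[OF char[of t], of c] by simp
next
  case (add f g)
  have int: "integrable M h" if h: "trig_poly I h" "prob_space M" "sets M = sets (Pi\<^sub>M I (\<lambda>_. borel))" for M h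
  proof -
    obtain B where "\<forall>x. norm (h x) \<le> B" using trig_poly_bounded[OF h(1)] by blast
    then show ?thesis
      using borel_measurable_trig_poly[OF h(1)] measurable_cong_sets[OF h(3) refl]
      by (intro prob_space.integrable_bounded[OF h(2), of h B]) auto
  qed
  have "(\<integral>x. f x + g x \<partial>M) = (\<integral>x. f x \<partial>M) + (\<integral>x. g x \<partial>M)" if "prob_space M" "sets M = sets (Pi\<^sub>M I (\<lambda>_. borel))" for M
    using int[OF add.hyps(1) that] int[OF add.hyps(2) that] by simp
  then show ?case
    using tendsto_add[OF add.IH] mu nu by simp
qed

definition torus :: "nat set \<Rightarrow> (nat \<Rightarrow> complex) set" where
  "torus I = {z. \<forall>a. z a \<in> (if a \<in> I then sphere 0 1 else {0})}"

text \<open>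
  The space \<open>\<real>\<^sup>I\<close> is wound around the torus with frequency \<open>c\<close>; polynomials in real and imaginary parts of the
  coordinates pull back to trigonometric polynomials. Coordinates outside \<open>I\<close> are frozen at \<open>0\<close>, to keep the
  torus compact.
\<close>
definition wind :: "nat set \<Rightarrow> real \<Rightarrow> (nat \<Rightarrow> real) \<Rightarrow> nat \<Rightarrow> complex" where
  "wind I c x = (\<lambda>a. if a \<in> I then cis (c * x a) else 0)"

lemma wind_in_torus: "wind I c x \<in> torus I"
  by (simp add: wind_def torus_def)

lemma continuous_on_coord_complex: "continuous_on S (\<lambda>x::nat \<Rightarrow> complex. x a)"
  by (rule continuous_on_subset[where s=UNIV]) (simp_all add: continuous_on_product_coordinates)

text \<open>
  The Stone-Weierstrass theorem on the torus: the functions that pull back to trigonometric polynomials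
  form an algebra that separates points.
\<close>
lemma torus_trig_approximation:
  assumes "finite I" and G: "continuous_on (torus I) (G :: (nat \<Rightarrow> complex) \<Rightarrow> real)" and "0 < e"
  shows "\<exists>f. trig_poly I (\<lambda>x. complex_of_real (f x)) \<and> (\<forall>x. \<bar>G (wind I c x) - f x\<bar> < e)"
proof -
  define R where "R = {h. continuous_on (torus I) h \<and> trig_poly I (\<lambda>x. complex_of_real (h (wind I c x)))}"
  have comp: "compact (torus I)"
    unfolding torus_def by (rule compact_box_functions) auto
  interpret function_ring_on R "torus I"
  proof
    show "compact (torus I)" by (rule comp)
    show "continuous_on (torus I) f" if "f \<in> R" for f using that by (simp add: R_def)
    show "(\<lambda>x. f x + g x) \<in> R" if "f \<in> R" "g \<in> R" for f g
      using that by (auto simp: R_def intro!: continuous_on_add trig_poly.add)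
    show "(\<lambda>x. f x * g x) \<in> R" if "f \<in> R" "g \<in> R" for f g
      using that by (auto simp: R_def intro!: continuous_on_mult trig_poly_mult)
    show "(\<lambda>_. c) \<in> R" for c by (simp add: R_def trig_poly_const)
    fix z w assume zw: "z \<in> torus I" "w \<in> torus I" "z \<noteq> w"
    then obtain a where a: "z a \<noteq> w a" by auto
    have aI: "a \<in> I"
    proof (rule ccontr)
      assume "a \<notin> I"
      then have "z a = 0" "w a = 0" using zw(1,2) by (auto simp: torus_def dest!: spec[of _ a])
      with a show False by simp
    qed
    define t where "t b = (if b = a then c else 0)" for b
    have t: "(\<Sum>b\<in>I. t b * x b) = c * x a" "(\<Sum>b\<in>I. - t b * x b) = - c * x a" for x
      using aI \<open>finite I\<close> by (simp_all add: t_def if_distrib[of "\<lambda>y. y * _"] cong: if_cong) (simp add: sum_negf if_distrib[of "\<lambda>y. y * _"] cong: if_cong)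
    have "trig_poly I (\<lambda>x. complex_of_real (Re (wind I c x a)))"
    proof -
      have "(\<lambda>x. complex_of_real (Re (wind I c x a))) = (\<lambda>x. 1/2 * iexp (\<Sum>b\<in>I. t b * x b) + 1/2 * iexp (\<Sum>b\<in>I. - t b * x b))"
        unfolding t using aI by (simp add: wind_def fun_eq_iff Re_exp Im_exp complex_eq_iff)
      then show ?thesis by (simp only: trig_poly.intros)
    qed
    moreover have "trig_poly I (\<lambda>x. complex_of_real (Im (wind I c x a)))"
    proof -
      have "(\<lambda>x. complex_of_real (Im (wind I c x a))) = (\<lambda>x. (- \<i>/2) * iexp (\<Sum>b\<in>I. t b * x b) + (\<i>/2) * iexp (\<Sum>b\<in>I. - t b * x b))"
        unfolding t using aI by (simp add: wind_def fun_eq_iff Re_exp Im_exp complex_eq_iff)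
      then show ?thesis by (simp only: trig_poly.intros)
    qed
    moreover have "continuous_on (torus I) (\<lambda>z. Re (z a))" "continuous_on (torus I) (\<lambda>z. Im (z a))"
      by (intro continuous_on_Re continuous_on_Im continuous_on_coord_complex)+
    ultimately have ReR: "(\<lambda>z. Re (z a)) \<in> R" and ImR: "(\<lambda>z. Im (z a)) \<in> R" by (simp_all add: R_def)
    show "\<exists>f\<in>R. f z \<noteq> f w"
    proof (cases "Re (z a) = Re (w a)")
      case True
      then have "Im (z a) \<noteq> Im (w a)" using a by (simp add: complex_eq_iff)
      with ImR show ?thesis by (intro bexI[of _ "\<lambda>z. Im (z a)"])
    next
      case False
      with ReR show ?thesis by (intro bexI[of _ "\<lambda>z. Re (z a)"])
    qed
  qed
  obtain h where h: "h \<in> R" "\<forall>x\<in>torus I. \<bar>G x - h x\<bar> < e"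
    using Stone_Weierstrass_basic[OF G \<open>0 < e\<close>] by blast
  then show ?thesis
    using wind_in_torus by (intro exI[of _ "\<lambda>x. h (wind I c x)"]) (auto simp: R_def)
qed

text \<open>
  A bounded continuous function agrees on the box \<open>[-T, T]\<^sup>I\<close> with a continuous function of \<open>wind\<close>, which is
  approximated uniformly. Outside the box the error is at most \<open>2 B\<close> plus the uniform error, and there \<open>\<Sum> (x a)\<^sup>2 / T\<^sup>2 \<ge> 1\<close>.
\<close>
lemma trig_approximation:
  fixes g :: "(nat \<Rightarrow> real) \<Rightarrow> real"
  assumes I: "finite I" and g: "continuous_on UNIV g" "\<And>x. \<bar>g x\<bar> \<le> B" and T: "0 < T" and e: "0 < e"
    and loc: "\<And>x y. (\<And>a. a \<in> I \<Longrightarrow> x a = y a) \<Longrightarrow> g x = g y"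
  shows "\<exists>f. trig_poly I (\<lambda>x. complex_of_real (f x)) \<and>
    (\<forall>x. \<bar>g x - f x\<bar> \<le> e + 2 * B * (\<Sum>a\<in>I. (x a)\<^sup>2 / T\<^sup>2))"
proof -
  have B0: "0 \<le> B" using g(2)[of undefined] by linarith
  \<comment> \<open>With this frequency the box is mapped to points with nonnegative real part. There \<open>cut\<close> is \<open>1\<close>, and \<open>m\<close>
    recovers the coordinate by the half-angle formula \<open>arctan (sin y / (1 + cos y)) = y / 2\<close>; the maximum with \<open>1/2\<close>
    only makes \<open>m\<close> continuous near \<open>-1\<close>.\<close>
  define c where "c = pi / (2 * T)"
  have c: "0 < c" using T by (simp add: c_def)
  define m where "m z = 2 / c * arctan (Im z / max (1 + Re z) (1 / 2))" for z
  define cut where "cut z = min 1 (max 0 (2 * Re z + 1))" for z :: complex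
  define G where "G z = (\<Prod>a\<in>I. cut (z a)) * g (\<lambda>a. m (z a))" for z
  have cont_m: "continuous_on UNIV m"
    unfolding m_def by (intro continuous_on_mult continuous_on_const continuous_on_arctan continuous_on_divide
        continuous_on_max continuous_on_add continuous_on_Re continuous_on_Im continuous_on_id) auto
  have cont_cut: "continuous_on UNIV cut"
    unfolding cut_def by (intro continuous_on_min continuous_on_mult continuous_on_const
        continuous_on_max continuous_on_add continuous_on_Re continuous_on_id)
  have "continuous_on (torus I) G"
    unfolding G_def
  proof (intro continuous_on_mult continuous_on_prod)
    show "continuous_on (torus I) (\<lambda>z. cut (z a))" for a
      by (rule continuous_on_compose2[OF cont_cut continuous_on_coord_complex]) auto
    have "continuous_on (torus I) (\<lambda>z a. m (z a))"
      by (intro continuous_on_coordinatewise_then_product continuous_on_compose2[OF cont_m continuous_on_coord_complex]) auto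
    then show "continuous_on (torus I) (\<lambda>z. g (\<lambda>a. m (z a)))"
      by (rule continuous_on_compose2[OF g(1)]) auto
  qed
  then obtain f where f: "trig_poly I (\<lambda>x. complex_of_real (f x))" "\<And>x. \<bar>G (wind I c x) - f x\<bar> < e"
    using torus_trig_approximation[OF I _ e] by blast
  have GB: "\<bar>G z\<bar> \<le> B" for z
  proof -
    have "0 \<le> (\<Prod>a\<in>I. cut (z a))" "(\<Prod>a\<in>I. cut (z a)) \<le> 1"
      by (auto simp: cut_def intro!: prod_nonneg prod_le_1)
    then have "\<bar>G z\<bar> \<le> 1 * B"
      unfolding G_def abs_mult using g(2) by (intro mult_mono) auto
    then show ?thesis by simp
  qed
  have Geq: "G (wind I c x) = g x" if x: "\<And>a. a \<in> I \<Longrightarrow> \<bar>x a\<bar> \<le> T" for x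
  proof -
    have small: "\<bar>c * x a\<bar> \<le> pi / 2" if "a \<in> I" for a
    proof -
      have "\<bar>c * x a\<bar> \<le> c * T" using x[OF that] c by (simp add: abs_mult)
      then show ?thesis using T by (simp add: c_def)
    qed
    have cos0: "0 \<le> cos (c * x a)" if "a \<in> I" for a
      using small[OF that] by (intro cos_ge_zero) (auto simp: abs_le_iff)
    have "(\<Prod>a\<in>I. cut (wind I c x a)) = 1"
      using cos0 by (intro prod.neutral) (auto simp: cut_def wind_def)
    moreover have "m (wind I c x a) = x a" if a: "a \<in> I" for a
    proof -
      have "m (wind I c x a) = 2 / c * arctan (sin (c * x a) / (cos (c * x a) + 1))"
        using a cos0[OF a] by (simp add: m_def wind_def max_def add.commute)
      also have "sin (c * x a) / (cos (c * x a) + 1) = tan (c * x a / 2)"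
        using tan_half[of "c * x a / 2"] by simp
      also have "arctan \<dots> = c * x a / 2"
        using small[OF a] pi_gt_zero unfolding abs_le_iff by (intro arctan_tan) linarith+
      finally show ?thesis using c by simp
    qed
    ultimately show ?thesis using loc[of "\<lambda>a. m (wind I c x a)" x] by (simp add: G_def)
  qed
  have "\<bar>g x - f x\<bar> \<le> e + 2 * B * (\<Sum>a\<in>I. (x a)\<^sup>2 / T\<^sup>2)" for x
  proof (cases "\<forall>a\<in>I. \<bar>x a\<bar> \<le> T")
    case True
    have "0 \<le> 2 * B * (\<Sum>a\<in>I. (x a)\<^sup>2 / T\<^sup>2)" using B0 by (auto intro!: mult_nonneg_nonneg sum_nonneg)
    then show ?thesis using Geq[of x] True f(2)[of x] by simp
  next
    case False
    then obtain a where a: "a \<in> I" "T < \<bar>x a\<bar>" by auto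
    have "T\<^sup>2 \<le> (x a)\<^sup>2" using a T by (simp add: abs_le_square_iff[symmetric])
    then have "1 \<le> (x a)\<^sup>2 / T\<^sup>2" using T by simp
    also have "\<dots> \<le> (\<Sum>a\<in>I. (x a)\<^sup>2 / T\<^sup>2)"
      using a I by (intro member_le_sum[where f="\<lambda>a. (x a)\<^sup>2 / T\<^sup>2"]) auto
    finally have "2 * B * 1 \<le> 2 * B * (\<Sum>a\<in>I. (x a)\<^sup>2 / T\<^sup>2)" using B0 by (intro mult_left_mono) auto
    then show ?thesis using g(2)[of x] GB[of "wind I c x"] f(2)[of x] by linarith
  qed
  with f(1) show ?thesis by blast
qed

lemma continuous_on_restrict: "continuous_on UNIV (\<lambda>x::nat \<Rightarrow> real. restrict x I)"
proof (rule continuous_on_coordinatewise_then_product)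
  fix a show "continuous_on UNIV (\<lambda>x::nat \<Rightarrow> real. restrict x I a)"
    by (cases "a \<in> I") (simp_all add: continuous_on_product_coordinates)
qed

lemma borel_measurable_continuous_PiM:
  fixes g :: "(nat \<Rightarrow> real) \<Rightarrow> real"
  assumes "continuous_on UNIV g"
  shows "(\<lambda>x. g (restrict x I)) \<in> borel_measurable (Pi\<^sub>M I (\<lambda>_. borel))"
proof -
  have "(\<lambda>x. restrict x I) \<in> measurable (Pi\<^sub>M I (\<lambda>_. borel)) (Pi\<^sub>M UNIV (\<lambda>_. borel :: real measure))"
  proof (rule measurable_PiM_single')
    fix a :: nat
    show "(\<lambda>x. restrict x I a) \<in> borel_measurable (Pi\<^sub>M I (\<lambda>_. borel :: real measure))"
      by (cases "a \<in> I") (simp_all add: measurable_component_singleton)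
  qed auto
  then have "(\<lambda>x. restrict x I) \<in> measurable (Pi\<^sub>M I (\<lambda>_. borel)) (borel :: (nat \<Rightarrow> real) measure)"
    using measurable_cong_sets[OF refl sets_PiM_equal_borel] by blast
  then show ?thesis
    using borel_measurable_continuous_onI[OF assms] by (rule measurable_compose)
qed

text \<open>
  Convergence of characteristic functions gives convergence of the integrals of trigonometric polynomials. By
  \<open>trig_approximation\<close> with large \<open>T\<close>, the uniform bound on second moments replaces tightness.
\<close>
theorem multivariate_levy_continuity:
  fixes \<mu> :: "nat \<Rightarrow> (nat \<Rightarrow> real) measure"
  assumes I: "finite I"
    and mu: "\<And>n. prob_space (\<mu> n)" "\<And>n. sets (\<mu> n) = sets (Pi\<^sub>M I (\<lambda>_. borel))"
    and nu: "prob_space \<nu>" "sets \<nu> = sets (Pi\<^sub>M I (\<lambda>_. borel))"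
    and mom: "\<And>n a. a \<in> I \<Longrightarrow> integrable (\<mu> n) (\<lambda>x. (x a)\<^sup>2) \<and> (\<integral>x. (x a)\<^sup>2 \<partial>\<mu> n) \<le> C"
    and mom': "\<And>a. a \<in> I \<Longrightarrow> integrable \<nu> (\<lambda>x. (x a)\<^sup>2) \<and> (\<integral>x. (x a)\<^sup>2 \<partial>\<nu>) \<le> C"
    and char: "\<And>t. (\<lambda>n. \<integral>x. iexp (\<Sum>a\<in>I. t a * x a) \<partial>\<mu> n) \<longlonglongrightarrow> (\<integral>x. iexp (\<Sum>a\<in>I. t a * x a) \<partial>\<nu>)"
  shows "weak_conv_PiM I \<mu> \<nu>"
  unfolding weak_conv_PiM_def
proof (intro allI impI, elim conjE)
  fix g0 :: "(nat \<Rightarrow> real) \<Rightarrow> real"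
  assume g0: "continuous_on (Pi\<^sub>E I (\<lambda>_. UNIV)) g0" "bounded (g0 ` Pi\<^sub>E I (\<lambda>_. UNIV))"
  define g where "g x = g0 (restrict x I)" for x
  have rI: "restrict x I \<in> Pi\<^sub>E I (\<lambda>_. UNIV)" for x :: "nat \<Rightarrow> real" by auto
  have g_cont: "continuous_on UNIV g"
    unfolding g_def by (rule continuous_on_compose2[OF g0(1) continuous_on_restrict]) auto
  obtain B where B: "\<And>x. \<bar>g x\<bar> \<le> B"
    using g0(2) rI unfolding g_def bounded_iff by force
  have B0: "0 \<le> B" using B[of undefined] by linarith
  have g_loc: "g x = g y" if "\<And>a. a \<in> I \<Longrightarrow> x a = y a" for x y
    unfolding g_def using that by (metis restrict_ext)
  have g_meas: "g \<in> borel_measurable (Pi\<^sub>M I (\<lambda>_. borel))"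
  proof -
    have "(\<lambda>x. g (restrict x I)) = g" by (rule ext) (rule g_loc, simp)
    then show ?thesis using borel_measurable_continuous_PiM[OF g_cont, of I] by simp
  qed
  have g_eq: "(\<integral>x. g0 x \<partial>M) = (\<integral>x. g x \<partial>M)" if "sets M = sets (Pi\<^sub>M I (\<lambda>_. borel))" for M
  proof (rule Bochner_Integration.integral_cong[OF refl])
    fix x assume "x \<in> space M"
    then have "x \<in> Pi\<^sub>E I (\<lambda>_. UNIV)"
      using sets_eq_imp_space_eq[OF that] by (simp add: space_PiM)
    then show "g0 x = g x" by (simp add: g_def PiE_restrict)
  qed
  have C0: "0 \<le> C \<or> I = {}"
  proof (cases "I = {}")
    case False
    then obtain a where "a \<in> I" by auto
    then have "0 \<le> (\<integral>x. (x a)\<^sup>2 \<partial>\<nu>)" "(\<integral>x. (x a)\<^sup>2 \<partial>\<nu>) \<le> C" using mom' by auto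
    then show ?thesis by linarith
  qed simp
  have "(\<lambda>n. \<integral>x. g x \<partial>\<mu> n) \<longlonglongrightarrow> (\<integral>x. g x \<partial>\<nu>)"
  proof (rule LIMSEQ_I)
    fix r :: real assume r: "0 < r"
    define e where "e = r / 8"
    have e: "0 < e" using r by (simp add: e_def)
    define K where "K = 2 * B * card I * \<bar>C\<bar>"
    have K0: "0 \<le> K" using B0 by (simp add: K_def)
    define T where "T = sqrt ((K + 1) / e)"
    have T: "0 < T" "T\<^sup>2 = (K + 1) / e" using K0 e by (auto simp: T_def)
    obtain f where f: "trig_poly I (\<lambda>x. complex_of_real (f x))"
        "\<And>x. \<bar>g x - f x\<bar> \<le> e + 2 * B * (\<Sum>a\<in>I. (x a)\<^sup>2 / T\<^sup>2)"
      using trig_approximation[OF I g_cont B T(1) e g_loc] by blast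
    obtain Bf where Bf: "\<And>x. norm (complex_of_real (f x)) \<le> Bf" using trig_poly_bounded[OF f(1)] by blast
    have fm: "f \<in> borel_measurable (Pi\<^sub>M I (\<lambda>_. borel))"
      using measurable_compose[OF borel_measurable_trig_poly[OF f(1)] borel_measurable_Re] by simp
    have close: "\<bar>(\<integral>x. g x \<partial>M) - (\<integral>x. f x \<partial>M)\<bar> \<le> 2 * e"
      if M: "prob_space M" "sets M = sets (Pi\<^sub>M I (\<lambda>_. borel))"
        and mo: "\<And>a. a \<in> I \<Longrightarrow> integrable M (\<lambda>x. (x a)\<^sup>2) \<and> (\<integral>x. (x a)\<^sup>2 \<partial>M) \<le> C" for M
    proof -
      interpret prob_space M by (rule M)
      have meas: "g \<in> borel_measurable M" "f \<in> borel_measurable M"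
        using g_meas fm measurable_cong_sets[OF M(2) refl] by auto
      have ig: "integrable M g" by (rule integrable_bounded[OF meas(1), of B]) (use B in auto)
      have jf: "integrable M f" by (rule integrable_bounded[OF meas(2), of Bf]) (use Bf in auto)
      have ib: "integrable M (\<lambda>x. e + 2 * B * (\<Sum>a\<in>I. (x a)\<^sup>2 / T\<^sup>2))"
        using mo by (intro Bochner_Integration.integrable_add integrable_const integrable_mult_right
            Bochner_Integration.integrable_sum integrable_divide) auto
      have "\<bar>(\<integral>x. g x \<partial>M) - (\<integral>x. f x \<partial>M)\<bar> = \<bar>\<integral>x. g x - f x \<partial>M\<bar>"
        using ig jf by simp
      also have "\<dots> \<le> (\<integral>x. \<bar>g x - f x\<bar> \<partial>M)"
        by (rule integral_abs_bound)
      also have "\<dots> \<le> (\<integral>x. e + 2 * B * (\<Sum>a\<in>I. (x a)\<^sup>2 / T\<^sup>2) \<partial>M)"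
        using ig jf ib f(2) by (intro integral_mono) auto
      also have "\<dots> = e + 2 * B * (\<Sum>a\<in>I. (\<integral>x. (x a)\<^sup>2 \<partial>M) / T\<^sup>2)"
        using mo by (simp add: prob_space)
      also have "\<dots> \<le> e + 2 * B * (\<Sum>a\<in>I. \<bar>C\<bar> / T\<^sup>2)"
        using mo B0 by (intro add_left_mono mult_left_mono sum_mono divide_right_mono) force+
      also have "\<dots> = e + K / T\<^sup>2" by (simp add: K_def)
      also have "\<dots> \<le> 2 * e" using K0 e by (simp add: T(2) field_simps)
      finally show ?thesis .
    qed
    have "(\<lambda>n. \<integral>x. complex_of_real (f x) \<partial>\<mu> n) \<longlonglongrightarrow> (\<integral>x. complex_of_real (f x) \<partial>\<nu>)"
      by (rule trig_poly_integral_tendsto[OF f(1) mu nu char])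
    then have "(\<lambda>n. complex_of_real (\<integral>x. f x \<partial>\<mu> n)) \<longlonglongrightarrow> complex_of_real (\<integral>x. f x \<partial>\<nu>)"
      by simp
    then have "(\<lambda>n. \<integral>x. f x \<partial>\<mu> n) \<longlonglongrightarrow> (\<integral>x. f x \<partial>\<nu>)"
      by (simp only: tendsto_of_real_iff)
    from LIMSEQ_D[OF this e] obtain n0 where n0: "\<And>n. n \<ge> n0 \<Longrightarrow> \<bar>(\<integral>x. f x \<partial>\<mu> n) - (\<integral>x. f x \<partial>\<nu>)\<bar> < e"
      by auto
    have "\<bar>(\<integral>x. g x \<partial>\<mu> n) - (\<integral>x. g x \<partial>\<nu>)\<bar> < r" if "n \<ge> n0" for n
      using close[OF mu mom, of n] close[OF nu mom'] n0[OF that] unfolding e_def by linarith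
    then show "\<exists>n0. \<forall>n\<ge>n0. norm ((\<integral>x. g x \<partial>\<mu> n) - (\<integral>x. g x \<partial>\<nu>)) < r" by auto
  qed
  then show "(\<lambda>n. \<integral>x. g0 x \<partial>\<mu> n) \<longlonglongrightarrow> (\<integral>x. g0 x \<partial>\<nu>)"
    using g_eq mu(2) nu(2) by simp
qed

section \<open>Gaussian laws with a given covariance\<close>

abbreviation "std \<equiv> std_normal_distribution"

lemma prob_space_std: "prob_space std"
  by (rule prob_space_normal_density) simp

lemma normal_law_eq_distr:
  assumes "0 \<le> \<sigma>"
  shows "normal_law 0 \<sigma> = distr std borel (\<lambda>x. \<sigma> * x)"
proof (cases "\<sigma> = 0")
  case True
  then show ?thesis
    using prob_space.distr_const[OF prob_space_std, of "0::real" borel] by (simp add: normal_law_def)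
next
  case False
  then have s: "0 < \<sigma>" using assms by simp
  interpret prob_space std by (rule prob_space_std)
  have "distributed std lborel (\<lambda>x. x) std_normal_density"
    by (auto simp: distributed_def distr_id2)
  from normal_density_affine[OF this _ False, of 0] s
  have "distributed std lborel (\<lambda>x. \<sigma> * x) (normal_density 0 \<sigma>)" by simp
  then have "distr std lborel (\<lambda>x. \<sigma> * x) = density lborel (normal_density 0 \<sigma>)"
    by (simp add: distributed_def)
  moreover have "distr std lborel (\<lambda>x. \<sigma> * x) = distr std borel (\<lambda>x. \<sigma> * x)"
    by (rule distr_cong) auto
  ultimately show ?thesis using False by (simp add: normal_law_def)
qed

lemma normal_law_moments:
  assumes s: "0 \<le> \<sigma>"
  shows "integrable (normal_law 0 \<sigma>) (\<lambda>x. x)" "(\<integral>x. x \<partial>normal_law 0 \<sigma>) = 0"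
    "integrable (normal_law 0 \<sigma>) (\<lambda>x. x\<^sup>2)" "(\<integral>x. x\<^sup>2 \<partial>normal_law 0 \<sigma>) = \<sigma>\<^sup>2"
proof -
  have m [measurable]: "(\<lambda>x. \<sigma> * x) \<in> measurable std borel" by simp
  have i1: "integrable std (\<lambda>x::real. x)" using integrable_std_normal_distribution_moment[of 1] by simp
  have i2: "integrable std (\<lambda>x::real. x\<^sup>2)" by (rule integrable_std_normal_distribution_moment)
  have e1: "(\<integral>x. x \<partial>std) = 0" using integral_std_normal_distribution_moment_odd[of 1] by simp
  have e2: "(\<integral>x. x\<^sup>2 \<partial>std) = 1" using std_normal_distribution_even_moments(1)[of 1] by simp
  note N = normal_law_eq_distr[OF s]
  have b2: "(\<lambda>x::real. x\<^sup>2) \<in> borel_measurable borel" by simp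
  have b1: "(\<lambda>x::real. x) \<in> borel_measurable borel" by simp
  have "integrable std (\<lambda>x. \<sigma> * x)"
    using i1 by (rule integrable_mult_right)
  then show "integrable (normal_law 0 \<sigma>) (\<lambda>x. x)"
    unfolding N integrable_distr_eq[OF m b1] .
  have "(\<integral>x. \<sigma> * x \<partial>std) = \<sigma> * (\<integral>x. x \<partial>std)"
    by (rule integral_mult_right_zero)
  then show "(\<integral>x. x \<partial>normal_law 0 \<sigma>) = 0"
    unfolding N integral_distr[OF m b1] e1 by (simp only: mult_zero_right)
  have "integrable std (\<lambda>x. (\<sigma> * x)\<^sup>2)"
    unfolding power_mult_distrib using i2 by (rule integrable_mult_right)
  then show "integrable (normal_law 0 \<sigma>) (\<lambda>x. x\<^sup>2)"
    unfolding N integrable_distr_eq[OF m b2] .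
  have "(\<integral>x. (\<sigma> * x)\<^sup>2 \<partial>std) = \<sigma>\<^sup>2 * (\<integral>x. x\<^sup>2 \<partial>std)"
    unfolding power_mult_distrib by (rule integral_mult_right_zero)
  then show "(\<integral>x. x\<^sup>2 \<partial>normal_law 0 \<sigma>) = \<sigma>\<^sup>2"
    unfolding N integral_distr[OF m b2] e2 by (simp only: mult_1_right)
qed

lemma real_distribution_normal_law: "0 \<le> \<sigma> \<Longrightarrow> real_distribution (normal_law 0 \<sigma>)"
  unfolding normal_law_eq_distr
  by (intro prob_space.real_distribution_distr[OF prob_space_std]) simp

lemma char_normal_law:
  assumes s: "0 \<le> \<sigma>"
  shows "char (normal_law 0 \<sigma>) t = complex_of_real (exp (- (\<sigma>\<^sup>2 * t\<^sup>2) / 2))"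
proof -
  have "char (normal_law 0 \<sigma>) t = char std (t * \<sigma>)"
    unfolding normal_law_eq_distr[OF s] char_def by (subst integral_distr) (simp_all add: mult.assoc)
  then show ?thesis
    by (simp add: char_std_normal_distribution power_mult_distrib mult.commute)
qed

text \<open>
  The spectral theorem provides a square root: \<open>b\<close> has the columns \<open>sqrt (l m) u m\<close>.
\<close>
lemma psd_factorization:
  assumes sym: "symm n C" and psd: "\<And>t. 0 \<le> ip n t (mv n C t)"
  obtains b :: "nat \<Rightarrow> nat \<Rightarrow> real" where "\<And>i j. i < n \<Longrightarrow> j < n \<Longrightarrow> C i j = (\<Sum>m<n. b i m * b j m)"
proof -
  note es = eigensystem_eigval[OF sym]
  have l0: "0 \<le> eigval n C m" if m: "m < n" for m
    using psd[of "eigvec n C m"] eigensystem_ip_mv[OF es sym m] eigensystem_ortho[OF es m m] by simp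
  have "C i j = (\<Sum>m<n. (sqrt (eigval n C m) * eigvec n C m i) * (sqrt (eigval n C m) * eigvec n C m j))" if ij: "i < n" "j < n" for i j
  proof -
    have "C i j = (\<Sum>m<n. ip n (eigvec n C m) (C i) * eigvec n C m j)"
      by (rule eigensystem_expand[OF es ij(2)])
    also have "\<dots> = (\<Sum>m<n. mv n C (eigvec n C m) i * eigvec n C m j)"
      by (simp add: ip_def mv_def mult.commute)
    also have "\<dots> = (\<Sum>m<n. eigval n C m * eigvec n C m i * eigvec n C m j)"
      using eigensystem_mv[OF es _ ij(1)] by simp
    also have "\<dots> = (\<Sum>m<n. (sqrt (eigval n C m) * eigvec n C m i) * (sqrt (eigval n C m) * eigvec n C m j))"
    proof (rule sum.cong[OF refl])
      fix m assume "m \<in> {..<n}"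
      then have "sqrt (eigval n C m) * sqrt (eigval n C m) = eigval n C m" using l0 by simp
      then show "eigval n C m * eigvec n C m i * eigvec n C m j = (sqrt (eigval n C m) * eigvec n C m i) * (sqrt (eigval n C m) * eigvec n C m j)"
        by (metis mult.assoc mult.left_commute)
    qed
    finally show ?thesis .
  qed
  then show ?thesis by (rule that)
qed

text \<open>
  The law of \<open>b z\<close>, where \<open>C = b b\<^sup>T\<close> and the coordinates of \<open>z\<close> are independent standard normal variables. A
  linear combination of the coordinates has a normal characteristic function, so it is normal; all moments
  are read off from the linear combinations, the mixed ones by polarization.
\<close>
theorem gaussian_measure_exists:
  assumes I: "finite I" "I \<subseteq> {..<n}"
    and sym: "symm n C" and psd: "\<And>t. 0 \<le> ip n t (mv n C t)"
  shows "\<exists>G. multivariate_normal I G \<and> prob_space G \<and> sets G = sets (Pi\<^sub>M I (\<lambda>_. borel))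
    \<and> (\<forall>i\<in>I. (\<integral>x. x i \<partial>G) = 0)
    \<and> (\<forall>i\<in>I. integrable G (\<lambda>x. (x i)\<^sup>2) \<and> (\<integral>x. (x i)\<^sup>2 \<partial>G) = C i i)
    \<and> (\<forall>i\<in>I. \<forall>j\<in>I. covariance G (\<lambda>x. x i) (\<lambda>x. x j) = C i j)
    \<and> (\<forall>t. (\<integral>x. iexp (\<Sum>a\<in>I. t a * x a) \<partial>G) = complex_of_real (exp (- (\<Sum>i\<in>I. \<Sum>j\<in>I. t i * t j * C i j) / 2)))"
proof -
  obtain b :: "nat \<Rightarrow> nat \<Rightarrow> real" where b: "\<And>i j. i < n \<Longrightarrow> j < n \<Longrightarrow> C i j = (\<Sum>m<n. b i m * b j m)"
    using psd_factorization[OF sym psd] by blast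
  interpret S: prob_space std by (rule prob_space_std)
  interpret P: product_prob_space "\<lambda>_::nat. std" "{..<n}" by unfold_locales
  define Z where "Z = (Pi\<^sub>M {..<n} (\<lambda>_. std))"
  interpret Z: prob_space Z unfolding Z_def by (rule P.P.prob_space_axioms)
  define L where "L z = (\<lambda>i\<in>I. \<Sum>m<n. b i m * z m)" for z :: "nat \<Rightarrow> real"
  have comp: "(\<lambda>z. z m) \<in> borel_measurable Z" if "m < n" for m
    using measurable_component_singleton[of m "{..<n}" "\<lambda>_. std"] that by (simp add: Z_def)
  have L: "L \<in> measurable Z (Pi\<^sub>M I (\<lambda>_. borel))"
    unfolding L_def using comp by (intro measurable_restrict borel_measurable_sum borel_measurable_times) auto
  define G where "G = distr Z (Pi\<^sub>M I (\<lambda>_. borel)) L"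
  interpret G: prob_space G unfolding G_def by (rule Z.prob_space_distr[OF L])
  have setsG: "sets G = sets (Pi\<^sub>M I (\<lambda>_. borel))" by (simp add: G_def)
  define q where "q t = (\<Sum>i\<in>I. \<Sum>j\<in>I. t i * t j * C i j)" for t :: "nat \<Rightarrow> real"
  have bI: "C i j = (\<Sum>m<n. b i m * b j m)" if "i \<in> I" "j \<in> I" for i j
    using b that I(2) by blast
  have q: "q t = (\<Sum>m<n. (\<Sum>i\<in>I. t i * b i m)\<^sup>2)" for t
  proof -
    have "q t = (\<Sum>i\<in>I. \<Sum>j\<in>I. \<Sum>m<n. (t i * b i m) * (t j * b j m))"
      unfolding q_def by (intro sum.cong refl) (simp add: bI sum_distrib_left mult_ac)
    also have "\<dots> = (\<Sum>i\<in>I. \<Sum>m<n. \<Sum>j\<in>I. (t i * b i m) * (t j * b j m))"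
      by (intro sum.cong refl sum.swap)
    also have "\<dots> = (\<Sum>m<n. \<Sum>i\<in>I. \<Sum>j\<in>I. (t i * b i m) * (t j * b j m))"
      by (rule sum.swap)
    finally show ?thesis by (simp add: power2_eq_square sum_product)
  qed
  have q0: "0 \<le> q t" for t unfolding q by (intro sum_nonneg) auto
  have lin_meas: "(\<lambda>x. \<Sum>a\<in>I. t a * x a) \<in> borel_measurable (Pi\<^sub>M I (\<lambda>_. borel))" for t :: "nat \<Rightarrow> real"
    by (intro borel_measurable_sum borel_measurable_times measurable_component_singleton) auto
  have lin_measG: "(\<lambda>x. \<Sum>a\<in>I. t a * x a) \<in> borel_measurable G" for t :: "nat \<Rightarrow> real"
    using lin_meas measurable_cong_sets[OF setsG refl] by blast
  have iexp_meas: "(\<lambda>x. iexp (\<Sum>a\<in>I. t a * x a)) \<in> borel_measurable (Pi\<^sub>M I (\<lambda>_. borel))" for t :: "nat \<Rightarrow> real"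
    by (rule measurable_compose[OF lin_meas])
      (intro borel_measurable_continuous_onI continuous_intros)
  have charG: "(\<integral>x. iexp (\<Sum>a\<in>I. t a * x a) \<partial>G) = complex_of_real (exp (- q t / 2))" for t
  proof -
    have "(\<integral>x. iexp (\<Sum>a\<in>I. t a * x a) \<partial>G) = (\<integral>z. iexp (\<Sum>a\<in>I. t a * L z a) \<partial>Z)"
      unfolding G_def by (rule integral_distr[OF L iexp_meas])
    also have "\<dots> = (\<integral>z. (\<Prod>m<n. iexp ((\<Sum>i\<in>I. t i * b i m) * z m)) \<partial>Z)"
    proof (rule Bochner_Integration.integral_cong[OF refl])
      fix z
      have "(\<Sum>a\<in>I. t a * L z a) = (\<Sum>m<n. (\<Sum>i\<in>I. t i * b i m) * z m)"
        by (simp add: L_def sum_distrib_left sum_distrib_right mult.assoc) (rule sum.swap)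
      then show "iexp (\<Sum>a\<in>I. t a * L z a) = (\<Prod>m<n. iexp ((\<Sum>i\<in>I. t i * b i m) * z m))"
        by (simp add: exp_sum sum_distrib_left)
    qed
    also have "\<dots> = (\<Prod>m<n. \<integral>y. iexp ((\<Sum>i\<in>I. t i * b i m) * y) \<partial>std)"
      unfolding Z_def
      by (rule P.product_integral_prod) (auto intro!: S.integrable_iexp)
    also have "\<dots> = (\<Prod>m<n. complex_of_real (exp (- ((\<Sum>i\<in>I. t i * b i m)\<^sup>2) / 2)))"
    proof (rule prod.cong[OF refl])
      fix m
      show "(\<integral>y. iexp ((\<Sum>i\<in>I. t i * b i m) * y) \<partial>std) = complex_of_real (exp (- ((\<Sum>i\<in>I. t i * b i m)\<^sup>2) / 2))"
        using fun_cong[OF char_std_normal_distribution, of "\<Sum>i\<in>I. t i * b i m"] unfolding char_def .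
    qed
    also have "\<dots> = complex_of_real (exp (- q t / 2))"
      unfolding q by (simp add: exp_sum[symmetric] sum_negf sum_divide_distrib flip: of_real_prod)
    finally show ?thesis .
  qed
  have law: "distr G borel (\<lambda>x. \<Sum>a\<in>I. t a * x a) = normal_law 0 (sqrt (q t))" for t
  proof (rule Levy_uniqueness)
    show "real_distribution (distr G borel (\<lambda>x. \<Sum>a\<in>I. t a * x a))"
      by (rule G.real_distribution_distr[OF lin_measG])
    show "real_distribution (normal_law 0 (sqrt (q t)))"
      by (rule real_distribution_normal_law) (simp add: q0)
    show "char (distr G borel (\<lambda>x. \<Sum>a\<in>I. t a * x a)) = char (normal_law 0 (sqrt (q t)))"
    proof
      fix r
      have "char (distr G borel (\<lambda>x. \<Sum>a\<in>I. t a * x a)) r = (\<integral>x. iexp (r * (\<Sum>a\<in>I. t a * x a)) \<partial>G)"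
        unfolding char_def
        by (rule integral_distr[OF lin_measG]) (intro borel_measurable_continuous_onI continuous_intros)
      also have "\<dots> = (\<integral>x. iexp (\<Sum>a\<in>I. (r * t a) * x a) \<partial>G)"
        by (simp add: sum_distrib_left mult.assoc)
      also have "\<dots> = complex_of_real (exp (- q (\<lambda>a. r * t a) / 2))" by (rule charG)
      also have "q (\<lambda>a. r * t a) = q t * r\<^sup>2"
        by (simp add: q_def sum_distrib_left power2_eq_square mult_ac)
      finally show "char (distr G borel (\<lambda>x. \<Sum>a\<in>I. t a * x a)) r = char (normal_law 0 (sqrt (q t))) r"
        by (simp add: char_normal_law q0)
    qed
  qed
  have mv: "multivariate_normal I G"
    unfolding multivariate_normal_def
  proof (intro conjI allI)
    show "sets G = sets (Pi\<^sub>M I (\<lambda>_. borel))" by (rule setsG)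
    fix t
    show "\<exists>m \<sigma>. 0 \<le> \<sigma> \<and> distr G borel (\<lambda>x. \<Sum>i\<in>I. t i * x i) = normal_law m \<sigma>"
      by (intro exI[of _ 0] exI[of _ "sqrt (q t)"] conjI law) (simp add: q0)
  qed
  have sq0: "0 \<le> sqrt (q t)" and sq2: "(sqrt (q t))\<^sup>2 = q t" for t by (simp_all add: q0)
  have b1: "(\<lambda>y::real. y) \<in> borel_measurable borel" and b2: "(\<lambda>y::real. y\<^sup>2) \<in> borel_measurable borel" by simp_all
  have lin1: "integrable G (\<lambda>x. \<Sum>a\<in>I. t a * x a)" "(\<integral>x. (\<Sum>a\<in>I. t a * x a) \<partial>G) = 0" for t
    using normal_law_moments(1,2)[OF sq0[of t]]
    unfolding law[symmetric] integrable_distr_eq[OF lin_measG b1] integral_distr[OF lin_measG b1] by (simp_all only:)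
  have lin2: "integrable G (\<lambda>x. (\<Sum>a\<in>I. t a * x a)\<^sup>2)" "(\<integral>x. (\<Sum>a\<in>I. t a * x a)\<^sup>2 \<partial>G) = q t" for t
    using normal_law_moments(3,4)[OF sq0[of t]]
    unfolding law[symmetric] integrable_distr_eq[OF lin_measG b2] integral_distr[OF lin_measG b2] sq2 by (simp_all only:)
  define \<delta> where "\<delta> i a = (if a = i then 1 else 0 :: real)" for i a :: nat
  have d: "(\<Sum>a\<in>I. \<delta> i a * x a) = x i" if "i \<in> I" for i and x :: "nat \<Rightarrow> real"
  proof -
    have "(\<Sum>a\<in>I. \<delta> i a * x a) = (\<Sum>a\<in>I. if a = i then x a else 0)" by (intro sum.cong) (auto simp: \<delta>_def)
    then show ?thesis using that I(1) by simp
  qed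
  have Csym: "C i j = C j i" if "i \<in> I" "j \<in> I" for i j
    using sym that I(2) unfolding symm_def by auto
  have qd: "q (\<delta> i) = C i i" if "i \<in> I" for i
  proof -
    have "q (\<delta> i) = (\<Sum>a\<in>I. \<delta> i a * (\<Sum>j\<in>I. \<delta> i j * C a j))"
      by (simp add: q_def sum_distrib_left mult.assoc)
    then show ?thesis using that by (simp add: d)
  qed
  have qdd: "q (\<lambda>a. \<delta> i a + \<delta> j a) = C i i + C j j + 2 * C i j" if "i \<in> I" "j \<in> I" for i j
  proof -
    have "q (\<lambda>a. \<delta> i a + \<delta> j a) = (\<Sum>a\<in>I. \<delta> i a * (\<Sum>c\<in>I. \<delta> i c * C a c)) + (\<Sum>a\<in>I. \<delta> j a * (\<Sum>c\<in>I. \<delta> j c * C a c))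
        + (\<Sum>a\<in>I. \<delta> i a * (\<Sum>c\<in>I. \<delta> j c * C a c)) + (\<Sum>a\<in>I. \<delta> j a * (\<Sum>c\<in>I. \<delta> i c * C a c))"
      unfolding q_def sum_distrib_left sum.distrib[symmetric] by (intro sum.cong refl) (simp add: algebra_simps)
    then show ?thesis using that Csym[of i j] by (simp add: d)
  qed
  have m1: "integrable G (\<lambda>x. x i)" "(\<integral>x. x i \<partial>G) = 0" if "i \<in> I" for i
    using lin1[of "\<delta> i"] d[OF that] by simp_all
  have m2: "integrable G (\<lambda>x. (x i)\<^sup>2)" "(\<integral>x. (x i)\<^sup>2 \<partial>G) = C i i" if "i \<in> I" for i
    using lin2[of "\<delta> i"] d[OF that] qd[OF that] by simp_all
  have cov: "covariance G (\<lambda>x. x i) (\<lambda>x. x j) = C i j" if ij: "i \<in> I" "j \<in> I" for i j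
  proof -
    have s: "(\<Sum>a\<in>I. (\<delta> i a + \<delta> j a) * x a) = x i + x j" for x :: "nat \<Rightarrow> real"
      using d[OF ij(1)] d[OF ij(2)] by (simp add: distrib_right sum.distrib)
    have i: "integrable G (\<lambda>x. (x i + x j)\<^sup>2)" "(\<integral>x. (x i + x j)\<^sup>2 \<partial>G) = C i i + C j j + 2 * C i j"
      using lin2[of "\<lambda>a. \<delta> i a + \<delta> j a"] qdd[OF ij] by (simp_all add: s)
    have "(\<integral>x. x i * x j \<partial>G) = (\<integral>x. ((x i + x j)\<^sup>2 - (x i)\<^sup>2 - (x j)\<^sup>2) / 2 \<partial>G)"
      by (intro Bochner_Integration.integral_cong) (auto simp: power2_eq_square algebra_simps)
    also have "\<dots> = C i j"
      using i m2[OF ij(1)] m2[OF ij(2)] by simp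
    finally show ?thesis using m1 ij by (simp add: covariance_def)
  qed
  show ?thesis
    by (rule exI[of _ G]) (intro conjI ballI allI mv G.prob_space_axioms setsG m1 m2 cov charG[unfolded q_def])
qed

section \<open>The central limit theorem for Bernoulli sums\<close>

lemma exp_minus_approx:
  assumes "0 \<le> (y::real)"
  shows "\<bar>exp (- y) - (1 - y)\<bar> \<le> y\<^sup>2"
proof -
  have "1 - y \<le> exp (- y)" using exp_ge_add_one_self[of "- y"] by simp
  moreover have "exp (- y) \<le> 1 / (1 + y)"
  proof -
    have "1 + y \<le> exp y" by (rule exp_ge_add_one_self)
    then show ?thesis using assms by (simp add: exp_minus field_simps)
  qed
  moreover have "1 / (1 + y) \<le> 1 - y + y\<^sup>2"
  proof -
    have "1 \<le> (1 - y + y\<^sup>2) * (1 + y)" using assms by (simp add: algebra_simps power2_eq_square)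
    then show ?thesis using assms by (simp add: divide_le_eq)
  qed
  ultimately show ?thesis by (simp add: abs_le_iff)
qed

text \<open>
  The characteristic function of one centred and scaled Bernoulli variable agrees with that of a normal variable of the
  same variance to second order; the error is governed by the third absolute moment, which is at most \<open>\<bar>c\<bar>\<close> times the variance.
\<close>
lemma centered_bernoulli_char:
  fixes p c :: real
  assumes p: "0 \<le> p" "p \<le> 1" and c: "\<bar>c\<bar> \<le> K" "K \<le> 1"
  defines "z \<equiv> p *\<^sub>R iexp (c * (1 - p)) + (1 - p) *\<^sub>R iexp (c * (0 - p))"
  shows "norm z \<le> 1" "norm (z - of_real (exp (- (p * (1 - p) * c\<^sup>2) / 2))) \<le> K * (p * (1 - p) * c\<^sup>2)"
proof -
  define v where "v = p * (1 - p) * c\<^sup>2"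
  have "norm z \<le> norm (p *\<^sub>R iexp (c * (1 - p))) + norm ((1 - p) *\<^sub>R iexp (c * (0 - p)))"
    unfolding z_def by (rule norm_triangle_ineq)
  also have "\<dots> = 1" using p by (simp add: norm_scaleR)
  finally show "norm z \<le> 1" .
  define P where "P x = 1 + \<i> * complex_of_real x - complex_of_real (x\<^sup>2 / 2)" for x
  have ap: "norm (iexp x - P x) \<le> \<bar>x\<bar> ^ 3 / 6" for x
    using iexp_approx1[of x 2] by (simp add: P_def eval_nat_numeral algebra_simps)
  have sc: "norm (s *\<^sub>R (iexp x - P x)) \<le> s * (\<bar>x\<bar> ^ 3 / 6)" if "0 \<le> s" for s x
    unfolding norm_scaleR abs_of_nonneg[OF that] by (rule mult_left_mono[OF ap that])
  have v0: "0 \<le> v" using p by (simp add: v_def)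
  have "p *\<^sub>R P (c * (1 - p)) + (1 - p) *\<^sub>R P (c * (0 - p)) = of_real (1 - v / 2)"
    by (simp add: P_def v_def complex_eq_iff power2_eq_square field_simps)
  then have "z - of_real (1 - v / 2) = p *\<^sub>R (iexp (c * (1 - p)) - P (c * (1 - p))) + (1 - p) *\<^sub>R (iexp (c * (0 - p)) - P (c * (0 - p)))"
    unfolding z_def scaleR_diff_right by (simp add: algebra_simps)
  also have "norm \<dots> \<le> p * (\<bar>c * (1 - p)\<bar> ^ 3 / 6) + (1 - p) * (\<bar>c * (0 - p)\<bar> ^ 3 / 6)"
    using p by (intro norm_triangle_mono sc) auto
  also have "\<dots> = \<bar>c\<bar> * v / 6 * ((1 - p)\<^sup>2 + p\<^sup>2)"
  proof -
    have c3: "\<bar>c\<bar> ^ 3 = \<bar>c\<bar> * c\<^sup>2" by (simp add: power3_eq_cube power2_eq_square)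
    have e: "\<bar>c * (1 - p)\<bar> ^ 3 = \<bar>c\<bar> ^ 3 * (1 - p) ^ 3" "\<bar>c * (0 - p)\<bar> ^ 3 = \<bar>c\<bar> ^ 3 * p ^ 3"
      using p by (simp_all add: abs_mult power_mult_distrib)
    show ?thesis unfolding e c3 by (simp add: v_def power2_eq_square power3_eq_cube field_simps)
  qed
  also have "\<dots> \<le> \<bar>c\<bar> * v / 6 * 1"
  proof (rule mult_left_mono)
    have "0 \<le> p * (1 - p)" using p by simp
    then show "(1 - p)\<^sup>2 + p\<^sup>2 \<le> 1" by (simp add: power2_eq_square algebra_simps)
  qed (use v0 in simp)
  also have "\<dots> \<le> K * v / 6" using c v0 by (simp add: mult_right_mono)
  finally have A: "norm (z - of_real (1 - v / 2)) \<le> K * v / 6" .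
  have "norm (complex_of_real (exp (- (v / 2))) - of_real (1 - v / 2)) \<le> (v / 2)\<^sup>2"
    using exp_minus_approx[of "v / 2"] v0 unfolding of_real_diff[symmetric] norm_of_real by simp
  also have "\<dots> \<le> K * v / 4"
  proof -
    have "v \<le> 1 * c\<^sup>2" unfolding v_def using p by (intro mult_right_mono) (auto simp: mult_le_one)
    also have "c\<^sup>2 = \<bar>c\<bar> * \<bar>c\<bar>" by (simp add: power2_eq_square)
    also have "1 * (\<bar>c\<bar> * \<bar>c\<bar>) \<le> K * 1"
      unfolding mult_1 using c by (intro mult_mono) auto
    finally have "v * v \<le> K * v" using v0 by (intro mult_right_mono) auto
    then show ?thesis by (simp add: power2_eq_square)
  qed
  finally have B: "norm (of_real (1 - v / 2) - complex_of_real (exp (- (v / 2)))) \<le> K * v / 4"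
    by (simp add: norm_minus_commute)
  have "norm (z - of_real (exp (- (v / 2)))) \<le> K * v / 6 + K * v / 4"
    using norm_triangle_mono[OF A B] by simp
  also have "\<dots> \<le> K * v"
  proof -
    have "0 \<le> K * v" using c v0 by (intro mult_nonneg_nonneg) auto
    then show ?thesis by linarith
  qed
  finally show "norm (z - of_real (exp (- (p * (1 - p) * c\<^sup>2) / 2))) \<le> K * (p * (1 - p) * c\<^sup>2)"
    by (simp add: v_def)
qed

text \<open>
  Lindeberg's comparison: factors of modulus at most \<open>1\<close> are replaced one by one.
\<close>
theorem bernoulli_clt_char:
  assumes "bernoulli E p" and c: "\<And>e. e \<in> E \<Longrightarrow> \<bar>c e\<bar> \<le> K" "K \<le> 1"
  defines "\<sigma>2 \<equiv> \<Sum>e\<in>E. p e * (1 - p e) * (c e)\<^sup>2"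
  shows "norm (mean E p (\<lambda>x. iexp (\<Sum>e\<in>E. c e * (of_bool (e \<in> x) - p e))) - of_real (exp (- \<sigma>2 / 2))) \<le> K * \<sigma>2"
proof -
  interpret bernoulli E p by fact
  define z where "z e = p e *\<^sub>R iexp (c e * (1 - p e)) + (1 - p e) *\<^sub>R iexp (c e * (0 - p e))" for e
  define w where "w e = complex_of_real (exp (- (p e * (1 - p e) * (c e)\<^sup>2) / 2))" for e
  have "mean E p (\<lambda>x. iexp (\<Sum>e\<in>E. c e * (of_bool (e \<in> x) - p e)))
      = mean E p (\<lambda>x. \<Prod>e\<in>E. iexp (c e * (of_bool (e \<in> x) - p e)))"
    by (simp add: exp_sum[symmetric] sum_distrib_left)
  also have "\<dots> = (\<Prod>e\<in>E. z e)"
    using mean_prod[OF finE, of p "\<lambda>e b. iexp (c e * (of_bool b - p e))"] by (simp add: z_def)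
  finally have 1: "mean E p (\<lambda>x. iexp (\<Sum>e\<in>E. c e * (of_bool (e \<in> x) - p e))) = (\<Prod>e\<in>E. z e)" .
  have 2: "of_real (exp (- \<sigma>2 / 2)) = (\<Prod>e\<in>E. w e)"
    unfolding w_def of_real_prod[symmetric] exp_sum[OF finE, symmetric]
    by (simp add: \<sigma>2_def sum_negf sum_divide_distrib)
  have "norm ((\<Prod>e\<in>E. z e) - (\<Prod>e\<in>E. w e)) \<le> (\<Sum>e\<in>E. norm (z e - w e))"
  proof (rule norm_prod_diff)
    fix e assume e: "e \<in> E"
    show "norm (z e) \<le> 1" unfolding z_def by (rule centered_bernoulli_char(1)) (use p01[OF e] c(1)[OF e] c(2) in auto)
    show "norm (w e) \<le> 1" using p01[OF e] by (simp add: w_def norm_of_real del: of_real_exp)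
  qed
  also have "\<dots> \<le> (\<Sum>e\<in>E. K * (p e * (1 - p e) * (c e)\<^sup>2))"
    unfolding z_def w_def using p01 c by (intro sum_mono centered_bernoulli_char(2)) auto
  also have "\<dots> = K * \<sigma>2" by (simp add: \<sigma>2_def sum_distrib_left)
  finally show ?thesis unfolding 1 2 .
qed

section \<open>Riemann sums\<close>

definition cell :: "nat \<Rightarrow> nat \<Rightarrow> real set" where
  "cell N c = {real c / real N .. real (c + 1) / real N}"

text \<open>
  Darboux's criterion on the equal partitions into cells, expressed by pairs of tags. Unlike the definition by
  convergence of Riemann sums, it passes to products of bounded functions directly.
\<close>
definition vanishing_oscillation :: "(real \<Rightarrow> real) \<Rightarrow> bool" where
  "vanishing_oscillation f \<longleftrightarrow> (\<forall>\<epsilon>>0. \<exists>N0. \<forall>N\<ge>N0. \<forall>x y.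
     (\<forall>c<N. x c \<in> cell N c \<and> y c \<in> cell N c) \<longrightarrow> (\<Sum>c<N. \<bar>f (x c) - f (y c)\<bar>) / N < \<epsilon>)"

definition riemann_regular :: "(real \<Rightarrow> real) \<Rightarrow> bool" where
  "riemann_regular f \<longleftrightarrow> f \<in> borel_measurable (lebesgue_on {0..1}) \<and> bounded (f ` {0..1}) \<and> vanishing_oscillation f"

lemma cell_subset: "c < N \<Longrightarrow> cell N c \<subseteq> {0..1}"
  by (auto simp: cell_def field_simps)

lemma cell_tagged_division:
  assumes N: "1 \<le> N" and x: "\<forall>c<N. x c \<in> cell N c"
  shows "(\<lambda>c. (x c, cell N c)) ` {..<N} tagged_division_of {0..1}"
  unfolding tagged_division_of
proof (intro conjI allI impI)
  show "finite ((\<lambda>c. (x c, cell N c)) ` {..<N})" by simp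
  fix y K assume "(y, K) \<in> (\<lambda>c. (x c, cell N c)) ` {..<N}"
  then obtain c where c: "c < N" "y = x c" "K = cell N c" by auto
  show "y \<in> K" using c x by simp
  show "K \<subseteq> {0..1}" using c cell_subset by simp
  show "\<exists>a b. K = cbox a b" using c by (auto simp: cell_def)
next
  fix y1 K1 y2 K2
  assume "(y1, K1) \<in> (\<lambda>c. (x c, cell N c)) ` {..<N} \<and> (y2, K2) \<in> (\<lambda>c. (x c, cell N c)) ` {..<N} \<and> (y1, K1) \<noteq> (y2, K2)"
  then obtain c d where cd: "K1 = cell N c" "K2 = cell N d" "c \<noteq> d" by auto
  have disj: "interior (cell N c) \<inter> interior (cell N d) = {}" if "c < d" for c d
  proof -
    have "real (c + 1) / real N \<le> real d / real N" using that N by (intro divide_right_mono) auto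
    then show ?thesis by (auto simp: cell_def)
  qed
  show "interior K1 \<inter> interior K2 = {}"
    using disj[of c d] disj[of d c] cd by (cases "c < d") (auto simp: Int_commute)
next
  have cells: "{K. \<exists>y. (y, K) \<in> (\<lambda>c. (x c, cell N c)) ` {..<N}} = cell N ` {..<N}"
    by auto
  show "\<Union>{K. \<exists>y. (y, K) \<in> (\<lambda>c. (x c, cell N c)) ` {..<N}} = {0..1}"
    unfolding cells
  proof
    show "\<Union> (cell N ` {..<N}) \<subseteq> {0..1}"
      using cell_subset by (intro UN_least) simp
    show "{0..1} \<subseteq> \<Union> (cell N ` {..<N})"
    proof
      fix t :: real assume t: "t \<in> {0..1}"
      define c where "c = (if t = 1 then N - 1 else nat \<lfloor>t * N\<rfloor>)"
      have "c < N \<and> t \<in> cell N c"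
      proof (cases "t = 1")
        case True
        then show ?thesis using N by (auto simp: c_def cell_def field_simps of_nat_diff)
      next
        case False
        then have "t * N < N" "0 \<le> t * N" using t N by auto
        then have "real c \<le> t * N" "t * N < real c + 1" "c < N"
          using False by (auto simp: c_def) linarith+
        then show ?thesis using N by (auto simp: cell_def field_simps)
      qed
      then show "t \<in> \<Union> (cell N ` {..<N})" by blast
    qed
  qed
qed

lemma cell_riemann_sum:
  assumes N: "1 \<le> N" and x: "\<forall>c<N. x c \<in> cell N c"
  shows "(\<Sum>(y, K)\<in>(\<lambda>c. (x c, cell N c)) ` {..<N}. measure lborel K * f y) = (\<Sum>c<N. f (x c)) / N"
proof -
  have inj: "inj_on (\<lambda>c. (x c, cell N c)) {..<N}"
  proof (rule inj_onI)
    fix c d assume "(x c, cell N c) = (x d, cell N d)"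
    then have "{real c / N .. real (c + 1) / N} = {real d / N .. real (d + 1) / N}" by (simp add: cell_def)
    then have "real c / N = real d / N" using N by (simp add: divide_right_mono)
    then show "c = d" using N by simp
  qed
  have "measure lborel (cell N c) = 1 / N" for c
    using N by (simp add: cell_def divide_right_mono diff_divide_distrib[symmetric])
  then show ?thesis
    by (simp add: sum.reindex[OF inj] sum_divide_distrib)
qed

text \<open>
  In each cell the tag with the larger value is put into one family and the other tag into a second one. Both families
  have Riemann sums close to the integral, and their difference is the sum of the oscillations.
\<close>
lemma riemann_integrable_vanishing_oscillation:
  assumes "riemann_integrable 0 1 f"
  shows "vanishing_oscillation f"
  unfolding vanishing_oscillation_def
proof (intro allI impI)
  fix \<epsilon> :: real assume e: "0 < \<epsilon>"
  obtain I where I: "\<forall>e>0. \<exists>d>0. \<forall>p. p tagged_division_of {0..1} \<and> (\<forall>(x, K)\<in>p. diameter K < d) \<longrightarrow>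
        \<bar>(\<Sum>(x, K)\<in>p. measure lborel K * f x) - I\<bar> < e"
    using assms unfolding riemann_integrable_def by blast
  obtain d where d: "d > 0" "\<forall>p. p tagged_division_of {0..1} \<and> (\<forall>(x, K)\<in>p. diameter K < d) \<longrightarrow>
        \<bar>(\<Sum>(x, K)\<in>p. measure lborel K * f x) - I\<bar> < \<epsilon> / 2"
    using I e by (meson half_gt_zero)
  obtain n :: nat where n: "1 / d < real n" using reals_Archimedean2 by blast
  have sums: "\<bar>(\<Sum>c<N. f (x c)) / N - I\<bar> < \<epsilon> / 2" if N: "max 1 n \<le> N" and x: "\<forall>c<N. x c \<in> cell N c" for N x
  proof -
    have N1: "1 \<le> N" using N by simp
    have "1 / N < d"
    proof -
      have "1 / d < real N" using n N by simp
      then show ?thesis using d(1) N1 by (simp add: field_simps)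
    qed
    then have "diameter (cell N c) < d" for c
      using N1 d(1) by (simp add: cell_def diff_divide_distrib[symmetric] divide_right_mono)
    then have dd: "\<forall>(y, K)\<in>(\<lambda>c. (x c, cell N c)) ` {..<N}. diameter K < d" by auto
    show ?thesis
      using d(2)[THEN spec, THEN mp, OF conjI[OF cell_tagged_division[OF N1 x] dd]]
      unfolding cell_riemann_sum[OF N1 x] .
  qed
  show "\<exists>N0. \<forall>N\<ge>N0. \<forall>x y. (\<forall>c<N. x c \<in> cell N c \<and> y c \<in> cell N c) \<longrightarrow> (\<Sum>c<N. \<bar>f (x c) - f (y c)\<bar>) / N < \<epsilon>"
  proof (intro exI[of _ "max 1 n"] allI impI)
    fix N x y assume N: "max 1 n \<le> N" and xy: "\<forall>c<N. x c \<in> cell N c \<and> y c \<in> cell N c"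
    define hi where "hi c = (if f (x c) \<ge> f (y c) then x c else y c)" for c
    define lo where "lo c = (if f (x c) \<ge> f (y c) then y c else x c)" for c
    have "(\<Sum>c<N. \<bar>f (x c) - f (y c)\<bar>) / N = (\<Sum>c<N. f (hi c)) / N - (\<Sum>c<N. f (lo c)) / N"
      unfolding diff_divide_distrib[symmetric] sum_subtractf[symmetric]
      by (intro arg_cong2[where f="(/)"] sum.cong) (auto simp: hi_def lo_def)
    also have "\<dots> < \<epsilon>"
    proof -
      have "\<forall>c<N. hi c \<in> cell N c" "\<forall>c<N. lo c \<in> cell N c" using xy by (auto simp: hi_def lo_def)
      from sums[OF N this(1)] sums[OF N this(2)] show ?thesis unfolding abs_less_iff by linarith
    qed
    finally show "(\<Sum>c<N. \<bar>f (x c) - f (y c)\<bar>) / N < \<epsilon>" .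
  qed
qed

lemma riemann_regular_bound:
  assumes "riemann_regular f"
  shows "\<exists>B. \<forall>x\<in>{0..1}. \<bar>f x\<bar> \<le> B"
  using assms unfolding riemann_regular_def bounded_iff by auto

lemma riemann_regular_mult:
  assumes f: "riemann_regular f" and g: "riemann_regular g"
  shows "riemann_regular (\<lambda>x. f x * g x)"
proof -
  obtain B where B: "\<And>x. x \<in> {0..1} \<Longrightarrow> \<bar>f x\<bar> \<le> B" using riemann_regular_bound[OF f] by blast
  obtain C where C: "\<And>x. x \<in> {0..1} \<Longrightarrow> \<bar>g x\<bar> \<le> C" using riemann_regular_bound[OF g] by blast
  define D where "D = max 1 (max B C)"
  have D: "\<bar>f x\<bar> \<le> D" "\<bar>g x\<bar> \<le> D" if "x \<in> {0..1}" for x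
    using B[OF that] C[OF that] by (auto simp: D_def)
  have D1: "1 \<le> D" by (simp add: D_def)
  have "bounded ((\<lambda>x. f x * g x) ` {0..1})"
    unfolding bounded_iff using D D1 by (intro exI[of _ "D * D"]) (auto simp: abs_mult intro!: mult_mono)
  moreover have "vanishing_oscillation (\<lambda>x. f x * g x)"
    unfolding vanishing_oscillation_def
  proof (intro allI impI)
    fix \<epsilon> :: real assume e: "0 < \<epsilon>"
    define e' where "e' = \<epsilon> / (2 * D)"
    have e': "0 < e'" using e D1 by (simp add: e'_def)
    obtain N1 where N1: "\<forall>N\<ge>N1. \<forall>x y. (\<forall>c<N. x c \<in> cell N c \<and> y c \<in> cell N c) \<longrightarrow> (\<Sum>c<N. \<bar>f (x c) - f (y c)\<bar>) / N < e'"
      using f e' unfolding riemann_regular_def vanishing_oscillation_def by blast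
    obtain N2 where N2: "\<forall>N\<ge>N2. \<forall>x y. (\<forall>c<N. x c \<in> cell N c \<and> y c \<in> cell N c) \<longrightarrow> (\<Sum>c<N. \<bar>g (x c) - g (y c)\<bar>) / N < e'"
      using g e' unfolding riemann_regular_def vanishing_oscillation_def by blast
    show "\<exists>N0. \<forall>N\<ge>N0. \<forall>x y. (\<forall>c<N. x c \<in> cell N c \<and> y c \<in> cell N c) \<longrightarrow>
       (\<Sum>c<N. \<bar>f (x c) * g (x c) - f (y c) * g (y c)\<bar>) / N < \<epsilon>"
    proof (intro exI[of _ "max N1 N2"] allI impI)
      fix N x y assume N: "max N1 N2 \<le> N" and xy: "\<forall>c<N. x c \<in> cell N c \<and> y c \<in> cell N c"
      have "(\<Sum>c<N. \<bar>f (x c) * g (x c) - f (y c) * g (y c)\<bar>) \<le> (\<Sum>c<N. D * \<bar>f (x c) - f (y c)\<bar> + D * \<bar>g (x c) - g (y c)\<bar>)"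
      proof (rule sum_mono)
        fix c assume "c \<in> {..<N}"
        then have x: "x c \<in> {0..1}" "y c \<in> {0..1}" using xy cell_subset[of c N] by auto
        have "f (x c) * g (x c) - f (y c) * g (y c) = g (x c) * (f (x c) - f (y c)) + f (y c) * (g (x c) - g (y c))"
          by (simp add: algebra_simps)
        then have "\<bar>f (x c) * g (x c) - f (y c) * g (y c)\<bar> \<le> \<bar>g (x c)\<bar> * \<bar>f (x c) - f (y c)\<bar> + \<bar>f (y c)\<bar> * \<bar>g (x c) - g (y c)\<bar>"
          using abs_triangle_ineq[of "g (x c) * (f (x c) - f (y c))" "f (y c) * (g (x c) - g (y c))"] by (simp add: abs_mult)
        also have "\<dots> \<le> D * \<bar>f (x c) - f (y c)\<bar> + D * \<bar>g (x c) - g (y c)\<bar>"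
          using D(2)[OF x(1)] D(1)[OF x(2)] by (intro add_mono mult_right_mono) auto
        finally show "\<bar>f (x c) * g (x c) - f (y c) * g (y c)\<bar> \<le> D * \<bar>f (x c) - f (y c)\<bar> + D * \<bar>g (x c) - g (y c)\<bar>" .
      qed
      then have "(\<Sum>c<N. \<bar>f (x c) * g (x c) - f (y c) * g (y c)\<bar>) / N
          \<le> (\<Sum>c<N. D * \<bar>f (x c) - f (y c)\<bar> + D * \<bar>g (x c) - g (y c)\<bar>) / N"
        by (rule divide_right_mono) simp
      also have "\<dots> = D * ((\<Sum>c<N. \<bar>f (x c) - f (y c)\<bar>) / N) + D * ((\<Sum>c<N. \<bar>g (x c) - g (y c)\<bar>) / N)"
        by (simp add: sum.distrib sum_distrib_left add_divide_distrib sum_divide_distrib)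
      also have "\<dots> < D * e' + D * e'"
        using N1 N2 N xy D1 by (intro add_strict_mono mult_strict_left_mono) auto
      also have "\<dots> = \<epsilon>" using D1 by (simp add: e'_def field_simps)
      finally show "(\<Sum>c<N. \<bar>f (x c) * g (x c) - f (y c) * g (y c)\<bar>) / N < \<epsilon>" .
    qed
  qed
  ultimately show ?thesis
    using f g unfolding riemann_regular_def by (intro conjI borel_measurable_times) auto
qed

lemma riemann_regular_integrable:
  assumes "riemann_regular f"
  shows "integrable (lebesgue_on {0..1}) f"
proof -
  obtain B where "\<And>x. x \<in> {0..1} \<Longrightarrow> \<bar>f x\<bar> \<le> B" using riemann_regular_bound[OF assms] by blast
  then show ?thesis
    using assms unfolding riemann_regular_def
    by (intro finite_measure.integrable_const_bound[of _ _ B] finite_measure_lebesgue_on AE_I2) auto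
qed

text \<open>
  Measurability and boundedness give the Lebesgue integral; on a cell its mean value is within the oscillation of the
  value at the tag, since otherwise a bound for \<open>f y - f (x c)\<close> valid on the whole cell would contradict the mean value.
\<close>
theorem riemann_sum_tendsto:
  assumes f: "riemann_regular f"
  shows "(\<lambda>N. (\<Sum>a<N. f (real (a + 1) / real N)) / N) \<longlonglongrightarrow> (\<integral>x. f x \<partial>lebesgue_on {0..1})"
proof (rule LIMSEQ_I)
  fix \<epsilon> :: real assume e: "0 < \<epsilon>"
  have int: "f integrable_on {0..1}"
    using integrable_on_lebesgue_on[OF riemann_regular_integrable[OF f]] by simp
  have I: "(\<integral>x. f x \<partial>lebesgue_on {0..1}) = integral {0..1} f"
    by (rule lebesgue_integral_eq_integral[OF riemann_regular_integrable[OF f]]) simp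
  obtain N0 where N0: "\<forall>N\<ge>N0. \<forall>x y. (\<forall>c<N. x c \<in> cell N c \<and> y c \<in> cell N c) \<longrightarrow> (\<Sum>c<N. \<bar>f (x c) - f (y c)\<bar>) / N < \<epsilon> / 2"
    using f e unfolding riemann_regular_def vanishing_oscillation_def by (meson half_gt_zero)
  show "\<exists>n0. \<forall>N\<ge>n0. norm ((\<Sum>a<N. f (real (a + 1) / real N)) / N - (\<integral>x. f x \<partial>lebesgue_on {0..1})) < \<epsilon>"
  proof (intro exI[of _ "max 1 N0"] allI impI)
    fix N assume N: "max 1 N0 \<le> N"
    then have N1: "0 < real N" by simp
    define x where "x c = real (c + 1) / real N" for c
    have xc: "x c \<in> cell N c" for c using N1 by (auto simp: x_def cell_def divide_right_mono)
    have intc: "f integrable_on cell N c" if "c < N" for c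
      using integrable_on_subinterval[OF int, of "real c / N" "real (c + 1) / N"] cell_subset[OF that] by (simp add: cell_def)
    have split: "integral {0..real m / N} f = (\<Sum>c<m. integral (cell N c) f)" if "m \<le> N" for m
      using that
    proof (induction m)
      case (Suc m)
      have "f integrable_on {0..real (Suc m) / N}"
        by (rule integrable_on_subinterval[OF int]) (use Suc.prems N1 in \<open>auto simp: field_simps\<close>)
      then have "integral {0..real m / N} f + integral {real m / N..real (Suc m) / N} f = integral {0..real (Suc m) / N} f"
        by (intro Henstock_Kurzweil_Integration.integral_combine) (auto simp: divide_right_mono)
      then show ?case using Suc by (simp add: cell_def add.commute)
    qed simp
    have total: "integral {0..1} f = (\<Sum>c<N. integral (cell N c) f)"
      using split[of N] N1 by simp
    \<comment> \<open>A single point \<open>y\<close> witnesses the deviation up to \<open>\<epsilon> / 2\<close>; the supremum over the cell need not be attained.\<close>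
    have ex: "\<exists>y\<in>cell N c. \<bar>N * integral (cell N c) f - f (x c)\<bar> \<le> \<bar>f y - f (x c)\<bar> + \<epsilon> / 2" if c: "c < N" for c
    proof (rule ccontr)
      assume "\<not> ?thesis"
      then have lt: "\<bar>f y - f (x c)\<bar> \<le> \<bar>N * integral (cell N c) f - f (x c)\<bar> - \<epsilon> / 2" if "y \<in> cell N c" for y
        using that by force
      define s where "s = \<bar>N * integral (cell N c) f - f (x c)\<bar>"
      have s0: "0 \<le> s - \<epsilon> / 2" using lt[OF xc] by (simp add: s_def)
      have cont: "measure lborel (cbox (real c / N) (real (c + 1) / N)) = 1 / N"
        using N1 by (simp add: divide_right_mono diff_divide_distrib[symmetric])
      have "((\<lambda>y. f y - f (x c)) has_integral integral (cell N c) f - 1 / N * f (x c)) (cbox (real c / N) (real (c + 1) / N))"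
        using has_integral_diff[OF integrable_integral[OF intc[OF c], unfolded cell_def] has_integral_const_real[of "f (x c)" "real c / N" "real (c + 1) / N"]]
          cont by (simp add: cell_def)
      then have "norm (integral (cell N c) f - 1 / N * f (x c)) \<le> (s - \<epsilon> / 2) * measure lborel (cbox (real c / N) (real (c + 1) / N))"
        by (rule has_integral_bound[OF s0]) (use lt in \<open>auto simp: cell_def s_def\<close>)
      then have "N * \<bar>integral (cell N c) f - 1 / N * f (x c)\<bar> \<le> s - \<epsilon> / 2"
        using N1 unfolding cont by (simp add: field_simps)
      moreover have "N * \<bar>integral (cell N c) f - 1 / N * f (x c)\<bar> = s"
      proof -
        have "N * \<bar>integral (cell N c) f - 1 / N * f (x c)\<bar> = \<bar>N * (integral (cell N c) f - 1 / N * f (x c))\<bar>"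
          by (simp add: abs_mult)
        also have "N * (integral (cell N c) f - 1 / N * f (x c)) = N * integral (cell N c) f - f (x c)"
          using N1 by (simp add: field_simps)
        finally show ?thesis by (simp add: s_def)
      qed
      ultimately show False using e by simp
    qed
    then obtain y where y: "\<And>c. c < N \<Longrightarrow> y c \<in> cell N c \<and> \<bar>N * integral (cell N c) f - f (x c)\<bar> \<le> \<bar>f (y c) - f (x c)\<bar> + \<epsilon> / 2"
      by metis
    have "(\<Sum>c<N. f (x c)) / N - integral {0..1} f = (\<Sum>c<N. f (x c) - N * integral (cell N c) f) / N"
      unfolding total using N1 by (simp add: sum_subtractf diff_divide_distrib sum_distrib_left[symmetric])
    also have "\<bar>\<dots>\<bar> \<le> (\<Sum>c<N. \<bar>N * integral (cell N c) f - f (x c)\<bar>) / N"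
      using N1 by (simp add: abs_minus_commute divide_right_mono order_trans[OF sum_abs])
    also have "\<dots> \<le> (\<Sum>c<N. \<bar>f (y c) - f (x c)\<bar> + \<epsilon> / 2) / N"
      using y N1 by (intro divide_right_mono sum_mono) auto
    also have "\<dots> = (\<Sum>c<N. \<bar>f (y c) - f (x c)\<bar>) / N + \<epsilon> / 2"
      using N1 by (simp add: sum.distrib add_divide_distrib)
    also have "\<dots> < \<epsilon> / 2 + \<epsilon> / 2"
      using N0 N y xc by (intro add_strict_right_mono) auto
    finally show "norm ((\<Sum>a<N. f (real (a + 1) / real N)) / N - (\<integral>x. f x \<partial>lebesgue_on {0..1})) < \<epsilon>"
      unfolding I by (simp add: x_def)
  qed
qed

section \<open>The inhomogeneous random graph\<close>

locale inhomogeneous =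
  fixes k :: nat and \<theta> :: "nat \<Rightarrow> real" and r :: "nat \<Rightarrow> real \<Rightarrow> real"
    and \<epsilon> :: "nat \<Rightarrow> real" and \<epsilon>_inf :: real
  assumes k1: "1 \<le> k"
    and theta_mono: "\<And>i j. 1 \<le> i \<Longrightarrow> i \<le> j \<Longrightarrow> j \<le> k \<Longrightarrow> \<theta> j \<le> \<theta> i"
    and theta_pos: "0 < \<theta> k"
    and ortho: "orthonormal_L2 k r"
    and kernel_nonneg: "\<And>x y. x \<in> {0..1} \<Longrightarrow> y \<in> {0..1} \<Longrightarrow> 0 \<le> edge_kernel k \<theta> r x y"
    and eps_pos: "\<And>N. 1 \<le> N \<Longrightarrow> 0 < \<epsilon> N"
    and eps_kernel: "\<And>N x y. 1 \<le> N \<Longrightarrow> x \<in> {0..1} \<Longrightarrow> y \<in> {0..1} \<Longrightarrow> \<epsilon> N * edge_kernel k \<theta> r x y \<le> 1"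
    and regular: "\<And>i. i \<in> {1..k} \<Longrightarrow> riemann_regular (r i)"
    and dense: "(\<lambda>N. ln (real N) / (real N * \<epsilon> N)) \<longlonglongrightarrow> 0"
    and eps_lim: "\<epsilon> \<longlonglongrightarrow> \<epsilon>_inf"
begin

text \<open>
  Sample points (indices start at \<open>0\<close>, so the points are \<open>1/N, \<dots>, 1\<close>), expected degree scale, edge
  probabilities, discretized eigenfunctions, a bound for the \<open>r i\<close>, a bound for the kernel, and the defect of orthonormality.
\<close>
definition pt :: "nat \<Rightarrow> nat \<Rightarrow> real" where "pt N a = real (a + 1) / real N"
definition dg :: "nat \<Rightarrow> real" where "dg N = real N * \<epsilon> N"
definition pr :: "nat \<Rightarrow> nat \<times> nat \<Rightarrow> real" where
  "pr N e = \<epsilon> N * edge_kernel k \<theta> r (pt N (fst e)) (pt N (snd e))"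
definition ev :: "nat \<Rightarrow> nat \<Rightarrow> nat \<Rightarrow> real" where "ev N i a = r i (pt N a) / sqrt (real N)"
definition R :: real where "R = (SOME B. 1 \<le> B \<and> (\<forall>i\<in>{1..k}. \<forall>x\<in>{0..1}. \<bar>r i x\<bar> \<le> B))"
definition F :: real where "F = max 1 (\<Sum>i=1..k. \<theta> i * R * R)"
definition eta :: "nat \<Rightarrow> real" where
  "eta N = (\<Sum>i=1..k. \<Sum>j=1..k. \<bar>ip N (ev N i) (ev N j) - (if i = j then 1 else 0)\<bar>)"

abbreviation "expect N \<equiv> mean (pairs N) (pr N)"

lemma theta_positive: "i \<in> {1..k} \<Longrightarrow> 0 < \<theta> i"
  using theta_mono[of i k] theta_pos by auto

lemma R: "1 \<le> R" "\<And>i x. i \<in> {1..k} \<Longrightarrow> x \<in> {0..1} \<Longrightarrow> \<bar>r i x\<bar> \<le> R"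
proof -
  have "\<forall>i\<in>{1..k}. \<exists>B. \<forall>x\<in>{0..1}. \<bar>r i x\<bar> \<le> B"
    using riemann_regular_bound[OF regular] by blast
  then obtain B where B: "\<And>i x. i \<in> {1..k} \<Longrightarrow> x \<in> {0..1} \<Longrightarrow> \<bar>r i x\<bar> \<le> B i"
    by metis
  have B0: "0 \<le> B i" if "i \<in> {1..k}" for i
    using B[OF that, of 0] by auto
  have "\<exists>B. 1 \<le> B \<and> (\<forall>i\<in>{1..k}. \<forall>x\<in>{0..1}. \<bar>r i x\<bar> \<le> B)"
  proof (intro exI[of _ "1 + (\<Sum>i=1..k. B i)"] conjI ballI)
    have "0 \<le> (\<Sum>i=1..k. B i)" using B0 by (rule sum_nonneg)
    then show "1 \<le> 1 + (\<Sum>i=1..k. B i)" by linarith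
    fix i x assume i: "i \<in> {1..k}" and x: "x \<in> {0..1::real}"
    have "B i \<le> (\<Sum>i=1..k. B i)" using i B0 by (intro member_le_sum) auto
    then show "\<bar>r i x\<bar> \<le> 1 + (\<Sum>i=1..k. B i)" using B[OF i x] by linarith
  qed
  from someI_ex[OF this] show "1 \<le> R" "\<And>i x. i \<in> {1..k} \<Longrightarrow> x \<in> {0..1} \<Longrightarrow> \<bar>r i x\<bar> \<le> R"
    unfolding R_def[symmetric] by auto
qed

lemma F1: "1 \<le> F"
  by (simp add: F_def)

lemma kernel_le: "x \<in> {0..1} \<Longrightarrow> y \<in> {0..1} \<Longrightarrow> edge_kernel k \<theta> r x y \<le> F"
proof -
  assume xy: "x \<in> {0..1}" "y \<in> {0..1}"
  have "edge_kernel k \<theta> r x y \<le> (\<Sum>i=1..k. \<theta> i * R * R)"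
    unfolding edge_kernel_def
  proof (rule sum_mono)
    fix i assume i: "i \<in> {1..k}"
    have "r i x * r i y \<le> \<bar>r i x\<bar> * \<bar>r i y\<bar>" by (simp flip: abs_mult)
    also have "\<dots> \<le> R * R" using R i xy by (intro mult_mono) auto
    finally have "\<theta> i * (r i x * r i y) \<le> \<theta> i * (R * R)"
      using theta_positive[OF i] by (intro mult_left_mono) auto
    then show "\<theta> i * r i x * r i y \<le> \<theta> i * R * R" by (simp add: mult.assoc)
  qed
  then show ?thesis by (simp add: F_def)
qed

lemma kernel_commute: "edge_kernel k \<theta> r x y = edge_kernel k \<theta> r y x"
  by (simp add: edge_kernel_def mult.commute mult.left_commute)

lemma pt_in: "a < N \<Longrightarrow> pt N a \<in> {0..1}"
  by (auto simp: pt_def field_simps)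

lemma pr_key: "pr N (pair_key a b) = \<epsilon> N * edge_kernel k \<theta> r (pt N a) (pt N b)"
  by (auto simp: pr_def pair_key_def min_def max_def kernel_commute)

lemma pr_signal:
  assumes "1 \<le> N"
  shows "pr N (pair_key a b) = dg N * signal k \<theta> (ev N) a b"
proof -
  have "dg N * signal k \<theta> (ev N) a b = (\<Sum>j=1..k. \<epsilon> N * (\<theta> j * r j (pt N a) * r j (pt N b)))"
    unfolding signal_def sum_distrib_left dg_def ev_def
    using assms by (intro sum.cong refl) (simp add: field_simps)
  then show ?thesis
    by (simp add: pr_key edge_kernel_def sum_distrib_left)
qed

lemma pr_range:
  assumes "1 \<le> N" "e \<in> pairs N"
  shows "0 \<le> pr N e" "pr N e \<le> 1" "pr N e \<le> F * \<epsilon> N"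
proof -
  have "fst e < N" "snd e < N" using assms(2) by (auto simp: pairs_def)
  then have e: "pt N (fst e) \<in> {0..1}" "pt N (snd e) \<in> {0..1}"
    by (simp_all only: pt_in)
  show "0 \<le> pr N e" "pr N e \<le> 1"
    using kernel_nonneg[OF e] eps_kernel[OF assms(1) e] eps_pos[OF assms(1)] by (auto simp: pr_def)
  show "pr N e \<le> F * \<epsilon> N"
    using kernel_le[OF e] eps_pos[OF assms(1)] by (simp add: pr_def mult.commute[of F] mult_left_mono)
qed

lemma bernoulli_matrix_pr: "1 \<le> N \<Longrightarrow> bernoulli_matrix N (pr N)"
  using pr_range by unfold_locales auto

lemma bernoulli_pr: "1 \<le> N \<Longrightarrow> bernoulli (pairs N) (pr N)"
  using pr_range by unfold_locales auto

lemma dg_pos: "1 \<le> N \<Longrightarrow> 0 < dg N"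
  using eps_pos by (simp add: dg_def)

lemma eventually_ln_dg: "0 < c \<Longrightarrow> \<forall>\<^sub>F N in sequentially. ln (real N) \<le> c * dg N"
proof -
  assume c: "0 < c"
  have "\<forall>\<^sub>F N in sequentially. ln (real N) / dg N < c"
    using order_tendstoD(2)[OF dense c] by (simp add: dg_def)
  then show ?thesis
    using eventually_ge_at_top[of 1]
  proof eventually_elim
    case (elim N)
    then show ?case using dg_pos[of N] by (simp add: field_simps)
  qed
qed

lemma eventually_dg_ge: "\<forall>\<^sub>F N in sequentially. c \<le> dg N"
proof -
  have "\<forall>\<^sub>F N in sequentially. 1 \<le> ln (real N)"
    by real_asymp
  moreover have "\<forall>\<^sub>F N in sequentially. ln (real N) \<le> 1 / (\<bar>c\<bar> + 1) * dg N"
    by (rule eventually_ln_dg) simp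
  ultimately show ?thesis
  proof eventually_elim
    case (elim N)
    then have "1 \<le> 1 / (\<bar>c\<bar> + 1) * dg N" by linarith
    then have "\<bar>c\<bar> + 1 \<le> dg N" by (simp add: field_simps)
    then show ?case by linarith
  qed
qed

definition bad_prob :: "real \<Rightarrow> nat \<Rightarrow> real" where
  "bad_prob \<delta> N = expect N (\<lambda>x. of_bool (\<not> op_le N (\<lambda>a b. adj x a b - pr N (pair_key a b)) (\<delta> * dg N)))"

lemma bad_prob_nonneg: "1 \<le> N \<Longrightarrow> 0 \<le> bad_prob \<delta> N"
  unfolding bad_prob_def by (rule bernoulli.mean_nonneg[OF bernoulli_pr]) auto

text \<open>
  \<open>noise_norm_tail\<close> with \<open>q = \<lceil>log N\<rceil>\<close>. As \<open>log N = o(dg N)\<close>, the base of the power is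
  at most \<open>e\<^sup>-\<^sup>6\<close> eventually, so the probability is at most \<open>N\<^sup>2 N\<^sup>-\<^sup>6\<close>.
\<close>
lemma eventually_bad_prob:
  assumes d: "0 < \<delta>"
  shows "\<forall>\<^sub>F N in sequentially. (real N)\<^sup>2 * bad_prob \<delta> N \<le> 1 / real N"
proof -
  \<comment> \<open>This constant makes the base at most \<open>e\<^sup>-\<^sup>6\<close> when \<open>log N \<le> c (dg N)\<close>; the \<open>1/3\<close> ensures \<open>q + 1 \<le> dg N\<close>.\<close>
  define c where "c = min (1 / 3) (exp (- 6) * \<delta>\<^sup>2 / (6 * exp (3 * F)))"
  have c: "0 < c" using d by (simp add: c_def)
  have "\<forall>\<^sub>F N in sequentially. 1 \<le> ln (real N)"
    by real_asymp
  then show ?thesis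
    using eventually_ln_dg[OF c] eventually_ge_at_top[of 1]
  proof eventually_elim
    case (elim N)
    interpret bernoulli_matrix N "pr N" by (rule bernoulli_matrix_pr[OF elim(3)])
    define l where "l = ln (real N)"
    define q where "q = nat \<lceil>l\<rceil>"
    have l1: "1 \<le> l" and ld: "l \<le> c * dg N" using elim by (auto simp: l_def)
    have dg0: "0 < dg N" by (rule dg_pos[OF elim(3)])
    have q: "l \<le> real q" "real q \<le> l + 1" using l1 by (auto simp: q_def)
    have L: "real (q + 1) \<le> dg N"
    proof -
      have "c * dg N \<le> 1 / 3 * dg N" using dg0 by (intro mult_right_mono) (auto simp: c_def)
      then show ?thesis using q l1 ld by simp
    qed
    have NF: "N * (F * \<epsilon> N) / dg N = F" using elim(3) eps_pos[of N] by (simp add: dg_def)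
    have nn: "noise x = (\<lambda>a b. adj x a b - pr N (pair_key a b))" for x
      by (simp add: noise_def fun_eq_iff)
    have "bad_prob \<delta> N \<le> (real N)\<^sup>2 * ((2 * real q + 1) * dg N * exp (3 * F) / (\<delta> * dg N)\<^sup>2) ^ (q + 1)"
      using noise_norm_tail[of "F * \<epsilon> N" q "dg N" "\<delta> * dg N"] pr_range(3)[OF elim(3)] L d dg0
      unfolding bad_prob_def NF nn by simp
    also have "\<dots> \<le> (real N)\<^sup>2 * (exp (- 6)) ^ (q + 1)"
    proof (intro mult_left_mono power_mono)
      have "(2 * real q + 1) \<le> 6 * l" using q l1 by linarith
      also have "\<dots> \<le> 6 * (c * dg N)" using ld by simp
      also have "\<dots> \<le> 6 * (exp (- 6) * \<delta>\<^sup>2 / (6 * exp (3 * F)) * dg N)"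
        using dg0 by (intro mult_left_mono mult_right_mono) (auto simp: c_def)
      also have "\<dots> = exp (- 6) * \<delta>\<^sup>2 * dg N / exp (3 * F)" by simp
      finally have "(2 * real q + 1) * exp (3 * F) \<le> exp (- 6) * \<delta>\<^sup>2 * dg N"
        by (simp add: pos_le_divide_eq)
      then have "(2 * real q + 1) * exp (3 * F) * dg N \<le> exp (- 6) * \<delta>\<^sup>2 * dg N * dg N"
        using dg0 by (intro mult_right_mono) auto
      then show "(2 * real q + 1) * dg N * exp (3 * F) / (\<delta> * dg N)\<^sup>2 \<le> exp (- 6)"
        using d dg0 by (subst pos_divide_le_eq) (auto simp: power2_eq_square mult_ac)
    qed (use d dg0 in auto)
    finally have A: "bad_prob \<delta> N \<le> (real N)\<^sup>2 * (exp (- 6)) ^ (q + 1)" .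
    have "(exp (- 6)) ^ (q + 1) = exp (real (q + 1) * (- 6 :: real))"
      by (rule exp_of_nat_mult[symmetric])
    also have "\<dots> \<le> exp (real 6 * (- l))" using q by simp
    also have "\<dots> = exp (- l) ^ 6"
      by (rule exp_of_nat_mult)
    also have "exp (- l) = 1 / real N"
      using elim(3) by (simp add: l_def exp_minus inverse_eq_divide)
    finally have "(real N)\<^sup>2 * (exp (- 6)) ^ (q + 1) \<le> (real N)\<^sup>2 * (1 / real N) ^ 6"
      by (intro mult_left_mono) auto
    with A have "bad_prob \<delta> N \<le> (real N)\<^sup>2 * (1 / real N) ^ 6" by (rule order_trans)
    then have "(real N)\<^sup>2 * bad_prob \<delta> N \<le> (real N)\<^sup>2 * ((real N)\<^sup>2 * (1 / real N) ^ 6)"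
      by (intro mult_left_mono) auto
    also have "\<dots> = (1 / real N)\<^sup>2" using elim(3) by (simp add: power_divide eval_nat_numeral)
    also have "\<dots> \<le> 1 / real N"
      using elim(3) power_decreasing[of 1 2 "1 / real N"] by simp
    finally show ?case .
  qed
qed

lemma ip_ev: "ip N (ev N i) (ev N j) = (\<Sum>a<N. r i (real (a + 1) / real N) * r j (real (a + 1) / real N)) / N"
  by (cases "N = 0") (simp_all add: ip_def ev_def pt_def sum_divide_distrib)

text \<open>
  Orthonormality of the \<open>r i\<close> enters here: the inner products are Riemann sums.
\<close>
lemma eta_tendsto: "eta \<longlonglongrightarrow> 0"
proof -
  have "(\<lambda>N. \<bar>ip N (ev N i) (ev N j) - (if i = j then 1 else 0)\<bar>) \<longlonglongrightarrow> 0" if ij: "i \<in> {1..k}" "j \<in> {1..k}" for i j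
  proof -
    have "(\<lambda>N. ip N (ev N i) (ev N j)) \<longlonglongrightarrow> (\<integral>x. r i x * r j x \<partial>lebesgue_on {0..1})"
      unfolding ip_ev by (rule riemann_sum_tendsto[OF riemann_regular_mult[OF regular[OF ij(1)] regular[OF ij(2)]]])
    also have "(\<integral>x. r i x * r j x \<partial>lebesgue_on {0..1}) = (if i = j then 1 else 0)"
      using ortho ij unfolding orthonormal_L2_def by blast
    finally have "(\<lambda>N. ip N (ev N i) (ev N j) - (if i = j then 1 else 0)) \<longlonglongrightarrow> (if i = j then 1 else 0) - (if i = j then 1 else 0)"
      by (intro tendsto_diff tendsto_const)
    then show ?thesis by (simp add: tendsto_rabs_zero)
  qed
  then have "(\<lambda>N. \<Sum>i=1..k. \<Sum>j=1..k. \<bar>ip N (ev N i) (ev N j) - (if i = j then 1 else 0)\<bar>) \<longlonglongrightarrow> (\<Sum>i=1..k. \<Sum>j=1..k. 0)"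
    by (intro tendsto_sum) auto
  then show ?thesis by (simp add: eta_def[abs_def])
qed

lemma eta_nonneg: "0 \<le> eta N"
  by (simp add: eta_def sum_nonneg)

lemma near_orthonormal_ev: "near_orthonormal N k (ev N) (eta N)"
  unfolding near_orthonormal_def
proof (intro ballI)
  fix i j assume ij: "i \<in> {1..k}" "j \<in> {1..k}"
  let ?h = "\<lambda>i j. \<bar>ip N (ev N i) (ev N j) - (if i = j then 1 else 0)\<bar>"
  have "?h i j \<le> (\<Sum>j=1..k. ?h i j)" using ij by (intro member_le_sum[where f="?h i"]) auto
  also have "\<dots> \<le> (\<Sum>i=1..k. \<Sum>j=1..k. ?h i j)"
    using ij by (intro member_le_sum[where f="\<lambda>i. \<Sum>j=1..k. ?h i j"]) (auto intro: sum_nonneg)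
  finally show "?h i j \<le> eta N" by (simp add: eta_def)
qed

lemma eventually_eta: "0 < c \<Longrightarrow> \<forall>\<^sub>F N in sequentially. eta N \<le> c"
  using order_tendstoD(2)[OF eta_tendsto] by (rule eventually_mono) auto

text \<open>
  The nonlinear part of the \<open>i\<close>-th eigenvalue.
\<close>
definition "fl i N x = eigval N (adj x) (i - 1) - ip N (ev N i) (mv N (adj x) (ev N i))"

lemma simple_gap:
  assumes i: "i \<in> simple_indices k \<theta>"
  shows "i \<in> {1..k}"
    and "\<exists>\<gamma>>0. \<gamma> \<le> \<theta> i \<and> (1 < i \<longrightarrow> \<theta> i + \<gamma> \<le> \<theta> (i - 1)) \<and> (i < k \<longrightarrow> \<theta> (i + 1) + \<gamma> \<le> \<theta> i)"
proof -
  show ik: "i \<in> {1..k}" using i by (simp add: simple_indices_def)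
  have up: "\<theta> i < \<theta> (i - 1)" if "1 < i"
  proof -
    have "i - 1 \<noteq> 0" "i - 1 \<noteq> k + 1" "i \<noteq> 0" "i \<noteq> k + 1" using that ik by auto
    then show ?thesis using i by (simp add: simple_indices_def extended_theta_def)
  qed
  have down: "\<theta> (i + 1) < \<theta> i" if "i < k"
  proof -
    have "i + 1 \<noteq> 0" "i + 1 \<noteq> k + 1" "i \<noteq> 0" "i \<noteq> k + 1" using that ik by auto
    then show ?thesis using i by (simp add: simple_indices_def extended_theta_def)
  qed
  define \<gamma> where "\<gamma> = min (\<theta> i) (min (if 1 < i then \<theta> (i - 1) - \<theta> i else \<theta> i) (if i < k then \<theta> i - \<theta> (i + 1) else \<theta> i))"
  have "0 < \<gamma>" using theta_positive[OF ik] up down by (simp add: \<gamma>_def)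
  moreover have "\<gamma> \<le> \<theta> i" by (simp add: \<gamma>_def)
  moreover have "\<theta> i + \<gamma> \<le> \<theta> (i - 1)" if "1 < i" using that by (simp add: \<gamma>_def min_def)
  moreover have "\<theta> (i + 1) + \<gamma> \<le> \<theta> i" if "i < k" using that by (simp add: \<gamma>_def min_def)
  ultimately show "\<exists>\<gamma>>0. \<gamma> \<le> \<theta> i \<and> (1 < i \<longrightarrow> \<theta> i + \<gamma> \<le> \<theta> (i - 1)) \<and> (i < k \<longrightarrow> \<theta> (i + 1) + \<gamma> \<le> \<theta> i)"
    by blast
qed

text \<open>
  For a fixed relative noise level \<open>\<delta>\<close> all hypotheses of \<open>eigenvalue_variance\<close> hold eventually, and each of the three
  terms of its bound is a multiple of \<open>\<delta>\<^sup>2\<close>.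
\<close>
lemma eventually_variance_small:
  assumes i: "i \<in> simple_indices k \<theta>" and \<gamma>: "0 < \<gamma>" "\<gamma> \<le> \<theta> i"
      "1 < i \<Longrightarrow> \<theta> i + \<gamma> \<le> \<theta> (i - 1)" "i < k \<Longrightarrow> \<theta> (i + 1) + \<gamma> \<le> \<theta> i"
    and d: "0 < \<delta>" "\<delta> \<le> \<gamma> / 64"
  shows "\<forall>\<^sub>F N in sequentially. expect N (\<lambda>x. (fl i N x - expect N (fl i N))\<^sup>2)
     \<le> F * \<epsilon> N * ((6 + 1024 / \<gamma>\<^sup>2) * \<delta>\<^sup>2)"
proof -
  have ik: "i \<in> {1..k}" by (rule simple_gap[OF i])
  have th1: "0 < \<theta> 1" using theta_positive[of 1] k1 by simp
  define h where "h = 3 / 4 * \<gamma>"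
  have h: "0 < h" using \<gamma> by (simp add: h_def)
  define c1 where "c1 = min (\<delta> / (k * \<theta> 1)) (min (1 / (2 * k)) \<delta>)"
  have c1: "0 < c1" using d k1 th1 by (simp add: c1_def)
  \<comment> \<open>Lower bounds for \<open>dg N\<close>: the second is needed for the gap to exceed the effect of one entry, the third for
    \<open>delocalization\<close>, and the last makes the fourth-power term at most \<open>\<delta>\<^sup>2\<close>.\<close>
  define c2 where "c2 = max 1 (max (8 / \<gamma>) (max (19200 * F / h ^ 4) (98304 * F ^ 4 / (h ^ 6 * \<delta>\<^sup>2))))"
  have "filterlim (\<lambda>N. sqrt (real N)) at_top sequentially"
    by real_asymp
  then have "\<forall>\<^sub>F N in sequentially. F / \<delta> \<le> sqrt (real N)"
    by (simp add: filterlim_at_top)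
  moreover have "\<forall>\<^sub>F N in sequentially. 1 / real N \<le> \<delta>\<^sup>2 / 64"
  proof -
    have "((\<lambda>N. 1 / real N) \<longlongrightarrow> 0) sequentially" by real_asymp
    from order_tendstoD(2)[OF this, of "\<delta>\<^sup>2 / 64"] d
    have "\<forall>\<^sub>F N in sequentially. 1 / real N < \<delta>\<^sup>2 / 64" by simp
    then show ?thesis by (rule eventually_mono) simp
  qed
  ultimately show ?thesis
    using eventually_eta[OF c1] eventually_dg_ge[of c2] eventually_bad_prob[OF d(1)]
      eventually_ge_at_top[of "max k 1"]
  proof eventually_elim
    case (elim N)
    then have N1: "1 \<le> N" and kN: "k \<le> N" by auto
    define D where "D = dg N"
    have D: "1 \<le> D" "8 / \<gamma> \<le> D" "19200 * F / h ^ 4 \<le> D" "98304 * F ^ 4 / (h ^ 6 * \<delta>\<^sup>2) \<le> D"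
      using elim(4) by (auto simp: D_def c2_def)
    have eps: "0 < \<epsilon> N" by (rule eps_pos[OF N1])
    have Dq: "real N * (F * \<epsilon> N) = F * D" by (simp add: D_def dg_def)
    have et: "k * \<theta> 1 * eta N \<le> \<delta>" "k * eta N \<le> 1 / 2" "eta N \<le> \<delta>"
    proof -
      have "eta N \<le> \<delta> / (k * \<theta> 1)" "eta N \<le> 1 / (2 * k)" "eta N \<le> \<delta>" using elim(3) by (auto simp: c1_def)
      then show "k * \<theta> 1 * eta N \<le> \<delta>" "k * eta N \<le> 1 / 2" "eta N \<le> \<delta>"
        using k1 th1 by (simp_all add: field_simps)
    qed
    interpret B: bernoulli_matrix N "pr N" by (rule bernoulli_matrix_pr[OF N1])
    interpret S: spiked_bernoulli N "pr N" k \<theta> "ev N" "dg N" "F * \<epsilon> N" \<delta> "eta N" \<gamma> i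
    proof
      show "real k * eta N \<le> 1 / 2" by (rule et)
      show "near_orthonormal N k (ev N) (eta N)" by (rule near_orthonormal_ev)
      show "pr N (pair_key a b) = dg N * signal k \<theta> (ev N) a b" for a b by (rule pr_signal[OF N1])
      show "i \<le> N" using ik kN by auto
      show "k * \<theta> 1 * eta N \<le> \<gamma> / 16" using et d by linarith
      show "F * \<epsilon> N * sqrt N \<le> \<delta> * dg N"
      proof -
        have "F \<le> \<delta> * sqrt N" using elim(1) d by (simp add: field_simps)
        then have "F * (\<epsilon> N * sqrt N) \<le> (\<delta> * sqrt N) * (\<epsilon> N * sqrt N)"
          using eps by (intro mult_right_mono) auto
        also have "\<dots> = \<delta> * dg N" by (simp add: dg_def)
        finally show ?thesis by (simp add: mult.assoc)
      qed
      show "8 \<le> dg N * \<gamma>" using D(2) \<gamma> by (simp add: D_def field_simps)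
      show "0 \<le> F * \<epsilon> N" using F1 eps by simp
    qed (use k1 theta_mono theta_pos dg_pos[OF N1] eta_nonneg ik \<gamma> d pr_range(3)[OF N1] in auto)
    have g: "S.g = h * D" by (simp add: S.g_def h_def D_def)
    have g0: "0 < S.g" by (rule S.g_pos)
    have bad: "S.bad = bad_prob \<delta> N"
      unfolding S.bad_def bad_prob_def S.good_def by (simp add: B.noise_def[abs_def])
    have bad0: "0 \<le> bad_prob \<delta> N" by (rule bad_prob_nonneg[OF N1])
    have fl: "S.fluct = fl i N" by (simp add: S.fluct_def S.lam_def fl_def fun_eq_iff)
    have hh: "19200 * (N * (F * \<epsilon> N)) \<le> S.g ^ 4"
    proof -
      have "19200 * F \<le> h ^ 4 * D" using D(3) h by (simp add: field_simps)
      also have "\<dots> \<le> h ^ 4 * D ^ 3" using D(1) h by (intro mult_left_mono) (auto simp: self_le_power)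
      finally have "19200 * F * D \<le> h ^ 4 * D ^ 3 * D" using D(1) by (intro mult_right_mono) auto
      then show ?thesis unfolding Dq g by (simp add: power_mult_distrib eval_nat_numeral mult_ac)
    qed
    have Nbad: "real N * bad_prob \<delta> N \<le> 1"
    proof -
      have "real N * bad_prob \<delta> N \<le> (real N)\<^sup>2 * bad_prob \<delta> N"
        using N1 bad0 by (intro mult_right_mono) (auto simp: power2_eq_square)
      also have "\<dots> \<le> 1 / real N" by (rule elim(5))
      also have "\<dots> \<le> 1" using N1 by simp
      finally show ?thesis .
    qed
    have sterm: "16 * real N / S.g\<^sup>2 * S.s \<le> \<delta>\<^sup>2"
    proof -
      define q where "q = F * \<epsilon> N"
      have Nq: "real N * q = F * D" by (simp add: q_def Dq)
      have "16 * real N / S.g\<^sup>2 * S.s \<le> 16 * real N / S.g\<^sup>2 * (32 * real N / S.g ^ 4 * (128 * q\<^sup>2 + 16 * q ^ 4 * (real N)\<^sup>2 + 48 * q * bad_prob \<delta> N))"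
        using S.delocalization[OF hh] unfolding bad q_def by (intro mult_left_mono) auto
      also have "\<dots> = 512 / S.g ^ 6 * (128 * (real N * q)\<^sup>2 + 16 * (real N * q) ^ 4 + 48 * (real N * q) * (real N * bad_prob \<delta> N))"
        using g0 by (simp add: eval_nat_numeral field_simps)
      also have "\<dots> \<le> 512 / S.g ^ 6 * (192 * (F * D) ^ 4)"
      proof (rule mult_left_mono)
        have FD: "1 \<le> F * D" using mult_mono[OF F1 D(1)] F1 by simp
        have "(F * D)\<^sup>2 \<le> (F * D) ^ 4" "F * D \<le> (F * D) ^ 4"
          using FD power_increasing[of 2 4 "F * D"] power_increasing[of 1 4 "F * D"] by auto
        moreover have "(F * D) * (real N * bad_prob \<delta> N) \<le> (F * D) * 1"
          using Nbad FD by (intro mult_left_mono) auto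
        ultimately show "128 * (real N * q)\<^sup>2 + 16 * (real N * q) ^ 4 + 48 * (real N * q) * (real N * bad_prob \<delta> N) \<le> 192 * (F * D) ^ 4"
          unfolding Nq by linarith
      qed (use g0 in auto)
      also have "\<dots> = (98304 * F ^ 4 / h ^ 6) / D\<^sup>2"
        unfolding g using h D(1) by (simp add: power_mult_distrib eval_nat_numeral field_simps)
      also have "\<dots> \<le> \<delta>\<^sup>2"
      proof -
        have "98304 * F ^ 4 / h ^ 6 \<le> \<delta>\<^sup>2 * D" using D(4) h d by (simp add: field_simps)
        also have "\<dots> \<le> \<delta>\<^sup>2 * D\<^sup>2" using D(1) by (intro mult_left_mono) (auto simp: power2_eq_square)
        finally show ?thesis using D(1) by (subst pos_divide_le_eq) simp_all
      qed
      finally show ?thesis .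
    qed
    have bterm: "64 * (real N)\<^sup>2 * S.bad \<le> \<delta>\<^sup>2"
      using elim(2,5) unfolding bad by linarith
    have "expect N (\<lambda>x. (fl i N x - expect N (fl i N))\<^sup>2)
        \<le> F * \<epsilon> N * (4 * ((eta N)\<^sup>2 + 64 * (k * \<theta> 1 * eta N + \<delta>)\<^sup>2 / \<gamma>\<^sup>2) + 16 * real N / S.g\<^sup>2 * S.s + 64 * (real N)\<^sup>2 * S.bad)"
      using S.eigenvalue_variance[OF hh] unfolding fl .
    also have "\<dots> \<le> F * \<epsilon> N * (4 * (\<delta>\<^sup>2 + 64 * (\<delta> + \<delta>)\<^sup>2 / \<gamma>\<^sup>2) + \<delta>\<^sup>2 + \<delta>\<^sup>2)"
      using et eta_nonneg[of N] k1 th1 d sterm bterm F1 eps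
      by (intro mult_left_mono add_mono divide_right_mono power_mono) auto
    also have "4 * (\<delta>\<^sup>2 + 64 * (\<delta> + \<delta>)\<^sup>2 / \<gamma>\<^sup>2) + \<delta>\<^sup>2 + \<delta>\<^sup>2 = (6 + 1024 / \<gamma>\<^sup>2) * \<delta>\<^sup>2"
      by (simp add: power2_eq_square field_simps)
    finally show ?case .
  qed
qed

theorem fluct_variance_tendsto:
  assumes i: "i \<in> simple_indices k \<theta>"
  shows "(\<lambda>N. expect N (\<lambda>x. (fl i N x - expect N (fl i N))\<^sup>2) / \<epsilon> N) \<longlonglongrightarrow> 0"
proof (rule LIMSEQ_I)
  fix \<kappa> :: real assume \<kappa>: "0 < \<kappa>"
  obtain \<gamma> where \<gamma>: "0 < \<gamma>" "\<gamma> \<le> \<theta> i"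
      "1 < i \<Longrightarrow> \<theta> i + \<gamma> \<le> \<theta> (i - 1)" "i < k \<Longrightarrow> \<theta> (i + 1) + \<gamma> \<le> \<theta> i"
    using simple_gap(2)[OF i] by blast
  define c where "c = F * (6 + 1024 / \<gamma>\<^sup>2)"
  have c: "0 < c" using F1 by (auto simp: c_def intro!: mult_pos_pos add_pos_nonneg)
  define \<delta> where "\<delta> = min (\<gamma> / 64) (min 1 (\<kappa> / (2 * c)))"
  have d: "0 < \<delta>" "\<delta> \<le> \<gamma> / 64" "\<delta> \<le> 1" "\<delta> \<le> \<kappa> / (2 * c)" using \<gamma> c \<kappa> by (auto simp: \<delta>_def)
  have cd: "c * \<delta>\<^sup>2 < \<kappa>"
  proof -
    have "\<delta>\<^sup>2 \<le> \<delta>" using d by (simp add: power2_eq_square mult_left_le)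
    then have "c * \<delta>\<^sup>2 \<le> c * (\<kappa> / (2 * c))" using d c by (intro mult_left_mono) auto
    then show ?thesis using c \<kappa> by simp
  qed
  have ev: "\<forall>\<^sub>F N in sequentially. expect N (\<lambda>x. (fl i N x - expect N (fl i N))\<^sup>2)
     \<le> F * \<epsilon> N * ((6 + 1024 / \<gamma>\<^sup>2) * \<delta>\<^sup>2)"
    by (rule eventually_variance_small[OF i \<gamma>(1,2) _ _ d(1,2)]) (use \<gamma>(3,4) in auto)
  have "\<forall>\<^sub>F N in sequentially. norm (expect N (\<lambda>x. (fl i N x - expect N (fl i N))\<^sup>2) / \<epsilon> N - 0) < \<kappa>"
    using ev eventually_ge_at_top[of 1]
  proof eventually_elim
    case (elim N)
    define V where "V = expect N (\<lambda>x. (fl i N x - expect N (fl i N))\<^sup>2)"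
    have V0: "0 \<le> V" unfolding V_def by (rule bernoulli.mean_nonneg[OF bernoulli_pr[OF elim(2)]]) simp
    have "V \<le> \<epsilon> N * (c * \<delta>\<^sup>2)" using elim(1) by (simp add: V_def c_def mult_ac)
    then have "V / \<epsilon> N \<le> c * \<delta>\<^sup>2" using eps_pos[OF elim(2)] by (simp add: divide_le_eq mult_ac)
    then show ?case using cd V0 eps_pos[OF elim(2)] unfolding V_def[symmetric] by simp
  qed
  then show "\<exists>n0. \<forall>N\<ge>n0. norm (expect N (\<lambda>x. (fl i N x - expect N (fl i N))\<^sup>2) / \<epsilon> N - 0) < \<kappa>"
    by (simp add: eventually_sequentially)
qed

section \<open>The limiting covariance\<close>

text \<open>
  The coefficient of the entry \<open>e\<close> in the linear part of the \<open>i\<close>-th eigenvalue.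
\<close>
definition hc :: "nat \<Rightarrow> nat \<Rightarrow> nat \<times> nat \<Rightarrow> real" where
  "hc N i e = ip N (ev N i) (mv N (elem_sym e) (ev N i))"

definition wt :: "nat \<Rightarrow> nat \<Rightarrow> nat \<Rightarrow> nat \<Rightarrow> nat \<Rightarrow> real" where
  "wt N i j a b = pr N (pair_key a b) * (1 - pr N (pair_key a b)) * (ev N i a * ev N i b * (ev N j a * ev N j b))"

text \<open>
  The covariance of the normalized linear parts.
\<close>
definition V :: "nat \<Rightarrow> nat \<Rightarrow> nat \<Rightarrow> real" where
  "V N i j = (\<Sum>e\<in>pairs N. pr N e * (1 - pr N e) * (hc N i e * hc N j e)) / \<epsilon> N"

text \<open>
  The limit of \<open>V\<close>. As the kernel has finite rank, the double integral of the claim is a combination of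
  squares of one-dimensional integrals; this form needs only one-dimensional Riemann sums.
\<close>
definition C :: "nat \<Rightarrow> nat \<Rightarrow> real" where
  "C i j = 2 * ((\<Sum>l=1..k. \<theta> l * (\<integral>x. r i x * r j x * r l x \<partial>lebesgue_on {0..1})\<^sup>2)
     - \<epsilon>_inf * (\<Sum>l=1..k. \<Sum>m=1..k. \<theta> l * \<theta> m * (\<integral>x. r i x * r j x * (r l x * r m x) \<partial>lebesgue_on {0..1})\<^sup>2))"

lemma hc_pair:
  assumes "(c, d) \<in> pairs N"
  shows "hc N i (c, d) = (if c = d then ev N i c * ev N i c else 2 * (ev N i c * ev N i d))"
  unfolding hc_def ip_elem_sym sum_key_fixed[OF assms] by simp

lemma ev_bound: "i \<in> {1..k} \<Longrightarrow> a < N \<Longrightarrow> \<bar>ev N i a\<bar> \<le> R / sqrt N"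
  using R(2)[OF _ pt_in] by (simp add: ev_def abs_divide divide_right_mono)

lemma ev_prod_bound:
  assumes "i \<in> {1..k}" "j \<in> {1..k}" "a < N" "b < N"
  shows "\<bar>ev N i a * ev N j b\<bar> \<le> R\<^sup>2 / N"
proof -
  have "\<bar>ev N i a\<bar> * \<bar>ev N j b\<bar> \<le> (R / sqrt N) * (R / sqrt N)"
    using assms R(1) by (intro mult_mono ev_bound) auto
  then show ?thesis by (simp add: abs_mult power2_eq_square)
qed

lemma hc_bound:
  assumes "i \<in> {1..k}" "e \<in> pairs N"
  shows "\<bar>hc N i e\<bar> \<le> 2 * R\<^sup>2 / N"
proof -
  obtain c d where e: "e = (c, d)" "(c, d) \<in> pairs N" using assms(2) by (cases e) auto
  then have cd: "c < N" "d < N" by (auto simp: pairs_def)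
  have "R\<^sup>2 / N \<le> 2 * R\<^sup>2 / N" by (intro divide_right_mono) auto
  then have "\<bar>ev N i c * ev N i c\<bar> \<le> 2 * R\<^sup>2 / N"
    using ev_prod_bound[OF assms(1) assms(1) cd(1,1)] by (rule order_trans[rotated])
  then show ?thesis
    unfolding e(1) hc_pair[OF e(2)]
    using ev_prod_bound[OF assms(1) assms(1) cd] by (auto simp: abs_mult)
qed

text \<open>
  An off-diagonal coefficient is \<open>2 e\<^sub>i(a) e\<^sub>i(b)\<close> and a diagonal one is \<open>e\<^sub>i(a)\<^sup>2\<close>, so the diagonal is counted once instead of twice. The
  correction is of lower order.
\<close>
lemma variance_split:
  "(\<Sum>e\<in>pairs N. pr N e * (1 - pr N e) * (hc N i e * hc N j e))
    = 2 * (\<Sum>a<N. \<Sum>b<N. wt N i j a b) - (\<Sum>c<N. wt N i j c c)"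
proof -
  let ?D = "\<lambda>e. if fst e = snd e then wt N i j (fst e) (fst e) else 0"
  have "pr N e * (1 - pr N e) * (hc N i e * hc N j e)
     = 2 * (\<Sum>a<N. \<Sum>b<N. of_bool (pair_key a b = e) * wt N i j a b) - ?D e" if e0: "e \<in> pairs N" for e
  proof -
    obtain c d where e: "e = (c, d)" "(c, d) \<in> pairs N" using e0 by (cases e) auto
    then have key: "pair_key c d = (c, d)" "pair_key d c = (c, d)" by (auto simp: pairs_def pair_key_eq)
    show ?thesis
      unfolding e(1) sum_key_fixed[OF e(2)] hc_pair[OF e(2)]
      using key by (auto simp: wt_def algebra_simps)
  qed
  then have "(\<Sum>e\<in>pairs N. pr N e * (1 - pr N e) * (hc N i e * hc N j e))
    = 2 * (\<Sum>e\<in>pairs N. \<Sum>a<N. \<Sum>b<N. of_bool (pair_key a b = e) * wt N i j a b) - (\<Sum>e\<in>pairs N. ?D e)"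
    by (simp only: sum_subtractf sum_distrib_left cong: sum.cong)
  also have "(\<Sum>e\<in>pairs N. ?D e) = (\<Sum>c<N. wt N i j c c)"
  proof -
    have "(\<Sum>e\<in>pairs N. ?D e) = (\<Sum>e\<in>(\<lambda>c. (c, c)) ` {..<N}. ?D e)"
      by (rule sum.mono_neutral_right[OF finite_pairs]) (auto simp: pairs_def)
    then show ?thesis by (subst (asm) sum.reindex) (auto simp: inj_on_def)
  qed
  finally show ?thesis unfolding sum_pairs_indicator .
qed

definition RS :: "nat \<Rightarrow> (real \<Rightarrow> real) \<Rightarrow> real" where
  "RS N g = (\<Sum>a<N. g (pt N a)) / N"

lemma RS_square: "(RS N g)\<^sup>2 = (\<Sum>a<N. \<Sum>b<N. g (pt N a) * g (pt N b)) / (real N)\<^sup>2"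
  by (simp add: RS_def power_divide power2_eq_square sum_product)

lemma RS_tendsto: "riemann_regular g \<Longrightarrow> (\<lambda>N. RS N g) \<longlonglongrightarrow> (\<integral>x. g x \<partial>lebesgue_on {0..1})"
  unfolding RS_def pt_def by (rule riemann_sum_tendsto)

lemma sum_wt:
  assumes "1 \<le> N"
  shows "(\<Sum>a<N. \<Sum>b<N. wt N i j a b) / \<epsilon> N
    = (\<Sum>l=1..k. \<theta> l * (RS N (\<lambda>x. r i x * r j x * r l x))\<^sup>2)
      - \<epsilon> N * (\<Sum>l=1..k. \<Sum>m=1..k. \<theta> l * \<theta> m * (RS N (\<lambda>x. r i x * r j x * (r l x * r m x)))\<^sup>2)"
proof -
  let ?f = "\<lambda>a b. edge_kernel k \<theta> r (pt N a) (pt N b)"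
  let ?u = "\<lambda>a. r i (pt N a) * r j (pt N a)"
  have eps: "\<epsilon> N \<noteq> 0" using eps_pos[OF assms] by simp
  have 1: "?f a b * (?u a * ?u b) = (\<Sum>l=1..k. \<theta> l * ((?u a * r l (pt N a)) * (?u b * r l (pt N b))))" for a b
    unfolding edge_kernel_def sum_distrib_right by (intro sum.cong refl) (simp only: mult_ac)
  have 2: "?f a b * ?f a b * (?u a * ?u b) = (\<Sum>l=1..k. \<Sum>m=1..k. \<theta> l * \<theta> m * ((?u a * (r l (pt N a) * r m (pt N a))) * (?u b * (r l (pt N b) * r m (pt N b)))))" for a b
    unfolding edge_kernel_def sum_product unfolding sum_distrib_right by (intro sum.cong refl) (simp only: mult_ac)
  have s1: "(\<Sum>a<N. \<Sum>b<N. ?f a b * (?u a * ?u b)) / (real N)\<^sup>2 = (\<Sum>l=1..k. \<theta> l * (RS N (\<lambda>x. r i x * r j x * r l x))\<^sup>2)"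
  proof -
    have "(\<Sum>a<N. \<Sum>b<N. ?f a b * (?u a * ?u b)) = (\<Sum>a<N. \<Sum>l=1..k. \<Sum>b<N. \<theta> l * ((?u a * r l (pt N a)) * (?u b * r l (pt N b))))"
      unfolding 1 by (intro sum.cong refl sum.swap)
    also have "\<dots> = (\<Sum>l=1..k. \<Sum>a<N. \<Sum>b<N. \<theta> l * ((?u a * r l (pt N a)) * (?u b * r l (pt N b))))"
      by (rule sum.swap)
    finally show ?thesis
      unfolding RS_square by (simp only: sum_distrib_left sum_divide_distrib times_divide_eq_right)
  qed
  have s2: "(\<Sum>a<N. \<Sum>b<N. ?f a b * ?f a b * (?u a * ?u b)) / (real N)\<^sup>2
     = (\<Sum>l=1..k. \<Sum>m=1..k. \<theta> l * \<theta> m * (RS N (\<lambda>x. r i x * r j x * (r l x * r m x)))\<^sup>2)"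
  proof -
    let ?t = "\<lambda>a b l m. \<theta> l * \<theta> m * ((?u a * (r l (pt N a) * r m (pt N a))) * (?u b * (r l (pt N b) * r m (pt N b))))"
    have "(\<Sum>a<N. \<Sum>b<N. ?f a b * ?f a b * (?u a * ?u b)) = (\<Sum>a<N. \<Sum>l=1..k. \<Sum>b<N. \<Sum>m=1..k. ?t a b l m)"
      unfolding 2 by (intro sum.cong refl sum.swap)
    also have "\<dots> = (\<Sum>l=1..k. \<Sum>a<N. \<Sum>b<N. \<Sum>m=1..k. ?t a b l m)"
      by (rule sum.swap)
    also have "\<dots> = (\<Sum>l=1..k. \<Sum>a<N. \<Sum>m=1..k. \<Sum>b<N. ?t a b l m)"
      by (intro sum.cong refl sum.swap)
    also have "\<dots> = (\<Sum>l=1..k. \<Sum>m=1..k. \<Sum>a<N. \<Sum>b<N. ?t a b l m)"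
      by (intro sum.cong refl sum.swap)
    finally show ?thesis
      unfolding RS_square by (simp only: sum_distrib_left sum_divide_distrib times_divide_eq_right)
  qed
  have "(\<Sum>a<N. \<Sum>b<N. wt N i j a b) / \<epsilon> N
     = (\<Sum>a<N. \<Sum>b<N. ?f a b * (?u a * ?u b) / (real N)\<^sup>2 - \<epsilon> N * (?f a b * ?f a b * (?u a * ?u b) / (real N)\<^sup>2))"
    unfolding sum_divide_distrib
  proof (intro sum.cong refl)
    fix a b
    have sq: "sqrt (real N) * sqrt (real N) = real N" by simp
    have "ev N i a * ev N i b * (ev N j a * ev N j b) = (?u a * ?u b) / ((sqrt (real N) * sqrt (real N)) * (sqrt (real N) * sqrt (real N)))"
      by (simp only: ev_def times_divide_times_eq mult_ac)
    then have evp: "ev N i a * ev N i b * (ev N j a * ev N j b) = (?u a * ?u b) / (real N)\<^sup>2"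
      by (simp only: sq power2_eq_square)
    show "wt N i j a b / \<epsilon> N = ?f a b * (?u a * ?u b) / (real N)\<^sup>2 - \<epsilon> N * (?f a b * ?f a b * (?u a * ?u b) / (real N)\<^sup>2)"
      unfolding wt_def pr_key evp using eps assms by (simp add: field_simps)
  qed
  also have "\<dots> = (\<Sum>a<N. \<Sum>b<N. ?f a b * (?u a * ?u b)) / (real N)\<^sup>2 - \<epsilon> N * ((\<Sum>a<N. \<Sum>b<N. ?f a b * ?f a b * (?u a * ?u b)) / (real N)\<^sup>2)"
    by (simp only: sum_subtractf sum_divide_distrib sum_distrib_left)
  finally show ?thesis unfolding s1 s2 .
qed

lemma V_tendsto:
  assumes ij: "i \<in> {1..k}" "j \<in> {1..k}"
  shows "(\<lambda>N. V N i j) \<longlonglongrightarrow> C i j"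
proof -
  define A where "A N = (\<Sum>l=1..k. \<theta> l * (RS N (\<lambda>x. r i x * r j x * r l x))\<^sup>2)
      - \<epsilon> N * (\<Sum>l=1..k. \<Sum>m=1..k. \<theta> l * \<theta> m * (RS N (\<lambda>x. r i x * r j x * (r l x * r m x)))\<^sup>2)" for N
  define d where "d N = (\<Sum>c<N. wt N i j c c) / \<epsilon> N" for N
  have "(\<lambda>N. A N) \<longlonglongrightarrow> (\<Sum>l=1..k. \<theta> l * (\<integral>x. r i x * r j x * r l x \<partial>lebesgue_on {0..1})\<^sup>2)
     - \<epsilon>_inf * (\<Sum>l=1..k. \<Sum>m=1..k. \<theta> l * \<theta> m * (\<integral>x. r i x * r j x * (r l x * r m x) \<partial>lebesgue_on {0..1})\<^sup>2)"
    unfolding A_def using ij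
    by (intro tendsto_diff tendsto_sum tendsto_mult tendsto_const tendsto_power eps_lim RS_tendsto
        riemann_regular_mult regular) auto
  then have "(\<lambda>N. 2 * A N) \<longlonglongrightarrow> C i j"
    unfolding C_def by (intro tendsto_mult tendsto_const)
  moreover have "d \<longlonglongrightarrow> 0"
  proof (rule tendsto_sandwich[of "\<lambda>N. - (F * R ^ 4 / real N)" _ _ "\<lambda>N. F * R ^ 4 / real N"])
    have b: "\<bar>d N\<bar> \<le> F * R ^ 4 / real N" if N: "1 \<le> N" for N
    proof -
      have w: "\<bar>wt N i j c c\<bar> \<le> F * \<epsilon> N * (R ^ 4 / (real N)\<^sup>2)" if c: "c < N" for c
      proof -
        have key: "pair_key c c \<in> pairs N" using c by simp
        have "\<bar>pr N (pair_key c c) * (1 - pr N (pair_key c c))\<bar> \<le> F * \<epsilon> N * 1"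
          unfolding abs_mult using pr_range[OF N key] by (intro mult_mono) auto
        moreover have "\<bar>ev N i c * ev N i c * (ev N j c * ev N j c)\<bar> \<le> (R\<^sup>2 / N) * (R\<^sup>2 / N)"
          unfolding abs_mult[of "ev N i c * ev N i c"] using ij c by (intro mult_mono ev_prod_bound) auto
        ultimately have "\<bar>wt N i j c c\<bar> \<le> (F * \<epsilon> N * 1) * ((R\<^sup>2 / N) * (R\<^sup>2 / N))"
          unfolding wt_def abs_mult[of "pr N (pair_key c c) * (1 - pr N (pair_key c c))"]
          using F1 eps_pos[OF N] by (intro mult_mono) auto
        then show ?thesis by (simp add: power2_eq_square eval_nat_numeral)
      qed
      have "\<bar>\<Sum>c<N. wt N i j c c\<bar> \<le> (\<Sum>c<N. F * \<epsilon> N * (R ^ 4 / (real N)\<^sup>2))"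
        using w by (intro order_trans[OF sum_abs] sum_mono) auto
      also have "\<dots> = \<epsilon> N * (F * R ^ 4 / real N)"
        using N by (simp add: power2_eq_square field_simps)
      finally show ?thesis
        using eps_pos[OF N] by (simp add: d_def abs_divide divide_le_eq mult.commute)
    qed
    show "\<forall>\<^sub>F N in sequentially. - (F * R ^ 4 / real N) \<le> d N"
      using eventually_ge_at_top[of 1] by (rule eventually_mono) (use b in \<open>force simp: abs_le_iff\<close>)
    show "\<forall>\<^sub>F N in sequentially. d N \<le> F * R ^ 4 / real N"
      using eventually_ge_at_top[of 1] by (rule eventually_mono) (use b in \<open>force simp: abs_le_iff\<close>)
    have "(\<lambda>N. F * R ^ 4 / real N) \<longlonglongrightarrow> 0"
      by (rule lim_const_over_n)
    then show "(\<lambda>N. F * R ^ 4 / real N) \<longlonglongrightarrow> 0" "(\<lambda>N. - (F * R ^ 4 / real N)) \<longlonglongrightarrow> 0"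
      using tendsto_minus[of "\<lambda>N. F * R ^ 4 / real N" 0] by simp_all
  qed
  ultimately have "(\<lambda>N. 2 * A N - d N) \<longlonglongrightarrow> C i j - 0"
    by (rule tendsto_diff)
  moreover have "\<forall>\<^sub>F N in sequentially. 2 * A N - d N = V N i j"
    using eventually_ge_at_top[of 1]
  proof eventually_elim
    case (elim N)
    show ?case
      unfolding V_def variance_split diff_divide_distrib times_divide_eq_right[symmetric] sum_wt[OF elim]
      by (simp add: A_def d_def)
  qed
  ultimately show ?thesis
    using Lim_transform_eventually by fastforce
qed

text \<open>
  The kernel and its square are finite sums of products of functions of one variable, so the iterated integral is computed by
  linearity.
\<close>
lemma C_integral:
  assumes ij: "i \<in> {1..k}" "j \<in> {1..k}"
  shows "C i j = 2 * (\<integral>x. (\<integral>y. r i x * r i y * r j x * r j y * edge_kernel k \<theta> r x y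
                        * (1 - \<epsilon>_inf * edge_kernel k \<theta> r x y)
              \<partial>lebesgue_on {0..1}) \<partial>lebesgue_on {0..1})"
proof -
  let ?L = "lebesgue_on {0..1::real}"
  define g where "g l x = r i x * r j x * r l x" for l x
  define h where "h l m x = r i x * r j x * (r l x * r m x)" for l m x
  have ig: "integrable ?L (g l)" if "l \<in> {1..k}" for l
    unfolding g_def using ij that by (intro riemann_regular_integrable riemann_regular_mult regular)
  have ih: "integrable ?L (h l m)" if "l \<in> {1..k}" "m \<in> {1..k}" for l m
    unfolding h_def using ij that by (intro riemann_regular_integrable riemann_regular_mult regular)
  have split: "r i x * r i y * r j x * r j y * edge_kernel k \<theta> r x y * (1 - \<epsilon>_inf * edge_kernel k \<theta> r x y)
     = (\<Sum>l=1..k. \<theta> l * g l x * g l y) - \<epsilon>_inf * (\<Sum>l=1..k. \<Sum>m=1..k. \<theta> l * \<theta> m * h l m x * h l m y)" for x y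
  proof -
    have 1: "r i x * r i y * r j x * r j y * edge_kernel k \<theta> r x y = (\<Sum>l=1..k. \<theta> l * g l x * g l y)"
      unfolding edge_kernel_def sum_distrib_left g_def by (intro sum.cong refl) (simp only: mult_ac)
    have 2: "r i x * r i y * r j x * r j y * (edge_kernel k \<theta> r x y * edge_kernel k \<theta> r x y)
       = (\<Sum>l=1..k. \<Sum>m=1..k. \<theta> l * \<theta> m * h l m x * h l m y)"
      unfolding edge_kernel_def sum_product unfolding sum_distrib_left h_def by (intro sum.cong refl) (simp only: mult_ac)
    show ?thesis unfolding 1[symmetric] 2[symmetric] by (simp add: algebra_simps)
  qed
  have comb: "(\<integral>y. (\<Sum>l=1..k. a l * g l y) - c * (\<Sum>l=1..k. \<Sum>m=1..k. b l m * h l m y) \<partial>?L)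
     = (\<Sum>l=1..k. a l * (\<integral>y. g l y \<partial>?L)) - c * (\<Sum>l=1..k. \<Sum>m=1..k. b l m * (\<integral>y. h l m y \<partial>?L))"
    for a :: "nat \<Rightarrow> real" and b :: "nat \<Rightarrow> nat \<Rightarrow> real" and c :: real
  proof -
    have "has_bochner_integral ?L (\<lambda>y. (\<Sum>l=1..k. a l * g l y) - c * (\<Sum>l=1..k. \<Sum>m=1..k. b l m * h l m y))
       ((\<Sum>l=1..k. a l * (\<integral>y. g l y \<partial>?L)) - c * (\<Sum>l=1..k. \<Sum>m=1..k. b l m * (\<integral>y. h l m y \<partial>?L)))"
      by (intro has_bochner_integral_diff has_bochner_integral_mult_right has_bochner_integral_sum
          has_bochner_integral_integrable ig ih)
    then show ?thesis by (rule has_bochner_integral_integral_eq)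
  qed
  have inner: "(\<integral>y. r i x * r i y * r j x * r j y * edge_kernel k \<theta> r x y * (1 - \<epsilon>_inf * edge_kernel k \<theta> r x y) \<partial>?L)
     = (\<Sum>l=1..k. \<theta> l * g l x * (\<integral>y. g l y \<partial>?L)) - \<epsilon>_inf * (\<Sum>l=1..k. \<Sum>m=1..k. \<theta> l * \<theta> m * h l m x * (\<integral>y. h l m y \<partial>?L))" for x
    unfolding split by (rule comb)
  have "(\<integral>x. (\<Sum>l=1..k. \<theta> l * g l x * (\<integral>y. g l y \<partial>?L)) - \<epsilon>_inf * (\<Sum>l=1..k. \<Sum>m=1..k. \<theta> l * \<theta> m * h l m x * (\<integral>y. h l m y \<partial>?L)) \<partial>?L)
    = (\<Sum>l=1..k. \<theta> l * (\<integral>y. g l y \<partial>?L) * (\<integral>y. g l y \<partial>?L)) - \<epsilon>_inf * (\<Sum>l=1..k. \<Sum>m=1..k. \<theta> l * \<theta> m * (\<integral>y. h l m y \<partial>?L) * (\<integral>y. h l m y \<partial>?L))"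
    using comb[of "\<lambda>l. \<theta> l * (\<integral>y. g l y \<partial>?L)" \<epsilon>_inf "\<lambda>l m. \<theta> l * \<theta> m * (\<integral>y. h l m y \<partial>?L)"]
    by (simp only: mult_ac)
  then show ?thesis
    unfolding inner C_def g_def[abs_def] h_def[abs_def] by (simp add: power2_eq_square mult.assoc)
qed

lemma C_commute: "C i j = C j i"
  by (simp add: C_def mult.commute)

section \<open>The limit law of the eigenvalues\<close>

text \<open>
  Centred and scaled as in the limit theorem; \<open>lin\<close> below is its leading part.
\<close>
definition cen :: "nat \<Rightarrow> nat \<Rightarrow> (nat \<times> nat) set \<Rightarrow> real" where
  "cen N i x = (eigval N (adj x) (i - 1) - expect N (\<lambda>x. eigval N (adj x) (i - 1))) / sqrt (\<epsilon> N)"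

definition lin :: "nat \<Rightarrow> nat \<Rightarrow> (nat \<times> nat) set \<Rightarrow> real" where
  "lin N i x = (\<Sum>e\<in>pairs N. hc N i e * (of_bool (e \<in> x) - pr N e)) / sqrt (\<epsilon> N)"

lemma cen_minus_lin:
  assumes "1 \<le> N"
  shows "cen N i x - lin N i x = (fl i N x - expect N (fl i N)) / sqrt (\<epsilon> N)"
proof -
  interpret bernoulli "pairs N" "pr N" by (rule bernoulli_pr[OF assms])
  define Z where "Z x = (\<Sum>e\<in>pairs N. hc N i e * (of_bool (e \<in> x) - pr N e))" for x
  define c where "c = (\<Sum>e\<in>pairs N. hc N i e * pr N e)"
  have quad: "ip N (ev N i) (mv N (adj x) (ev N i)) = Z x + c" for x
  proof -
    have "ip N (ev N i) (mv N (adj x) (ev N i)) = (\<Sum>a<N. \<Sum>b<N. of_bool (pair_key a b \<in> x) * (ev N i a * ev N i b))"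
      unfolding ip_def mv_def adj_def sum_distrib_left by (intro sum.cong refl) (simp only: mult_ac)
    also have "\<dots> = (\<Sum>e\<in>pairs N. of_bool (e \<in> x) * hc N i e)"
      unfolding hc_def ip_elem_sym by (rule sum_pairs_key[symmetric])
    also have "\<dots> = Z x + c"
      unfolding Z_def c_def sum.distrib[symmetric] by (intro sum.cong refl) (simp add: algebra_simps)
    finally show ?thesis .
  qed
  have "expect N (\<lambda>x. hc N i e * (of_bool (e \<in> x) - pr N e)) = 0" if e: "e \<in> pairs N" for e
    using mean_Xi_indep(1)[OF e, of "\<lambda>_. hc N i e"] by (simp add: Xi_def mult.commute)
  then have Z0: "expect N Z = 0" unfolding Z_def mean_sum by simp
  have "fl i N = (\<lambda>x. eigval N (adj x) (i - 1) - (Z x + c))"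
    by (simp add: fl_def quad fun_eq_iff)
  then have "fl i N x - expect N (fl i N) = (eigval N (adj x) (i - 1) - expect N (\<lambda>x. eigval N (adj x) (i - 1))) - Z x"
    by (simp add: mean_diff mean_add mean_const Z0)
  then show ?thesis
    by (simp add: cen_def lin_def Z_def[symmetric] diff_divide_distrib)
qed

lemma cen_lin_L2:
  assumes i: "i \<in> simple_indices k \<theta>"
  shows "(\<lambda>N. expect N (\<lambda>x. (cen N i x - lin N i x)\<^sup>2)) \<longlonglongrightarrow> 0"
proof (rule Lim_transform_eventually[OF fluct_variance_tendsto[OF i]])
  show "\<forall>\<^sub>F N in sequentially. expect N (\<lambda>x. (fl i N x - expect N (fl i N))\<^sup>2) / \<epsilon> N = expect N (\<lambda>x. (cen N i x - lin N i x)\<^sup>2)"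
    using eventually_ge_at_top[of 1]
  proof eventually_elim
    case (elim N)
    have "(cen N i x - lin N i x)\<^sup>2 = 1 / \<epsilon> N * (fl i N x - expect N (fl i N))\<^sup>2" for x
      using eps_pos[OF elim] unfolding cen_minus_lin[OF elim] by (simp add: power_divide)
    then show ?case by (simp only: mean_cmult) simp
  qed
qed

lemma lin_second_moment:
  assumes "1 \<le> N"
  shows "expect N (\<lambda>x. (lin N i x)\<^sup>2) = V N i i"
proof -
  interpret bernoulli "pairs N" "pr N" by (rule bernoulli_pr[OF assms])
  have gen: "expect N (\<lambda>x. (\<Sum>e\<in>T. hc N i e * Xi e x)\<^sup>2) = (\<Sum>e\<in>T. pr N e * (1 - pr N e) * (hc N i e * hc N i e))"
    if T: "finite T" "T \<subseteq> pairs N" for T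
    using T
  proof (induction T rule: finite_induct)
    case empty
    then show ?case by (simp add: mean_const)
  next
    case (insert f T)
    define Y where "Y x = (\<Sum>e\<in>T. hc N i e * Xi e x)" for x
    have f: "f \<in> pairs N" using insert.prems by auto
    have Yf: "Y (insert f x) = Y (x - {f})" for x
      unfolding Y_def using insert.hyps by (intro sum.cong refl) (auto simp: Xi_def)
    have "expect N (\<lambda>x. (\<Sum>e\<in>insert f T. hc N i e * Xi e x)\<^sup>2)
       = expect N (\<lambda>x. (Y x)\<^sup>2 + (Xi f x * (2 * hc N i f * Y x) + (Xi f x)\<^sup>2 * (hc N i f * hc N i f)))"
    proof (rule mean_cong)
      fix x
      have "(\<Sum>e\<in>insert f T. hc N i e * Xi e x) = hc N i f * Xi f x + Y x"
        using insert.hyps by (simp add: Y_def)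
      then show "(\<Sum>e\<in>insert f T. hc N i e * Xi e x)\<^sup>2 = (Y x)\<^sup>2 + (Xi f x * (2 * hc N i f * Y x) + (Xi f x)\<^sup>2 * (hc N i f * hc N i f))"
        by (simp add: power2_eq_square algebra_simps)
    qed
    also have "\<dots> = expect N (\<lambda>x. (Y x)\<^sup>2) + pr N f * (1 - pr N f) * (hc N i f * hc N i f)"
      unfolding mean_add using mean_Xi_indep(1)[OF f, of "\<lambda>x. 2 * hc N i f * Y x"] mean_Xi_indep(2)[OF f, of "\<lambda>x. hc N i f * hc N i f"]
      by (simp add: Yf mean_const)
    also have "expect N (\<lambda>x. (Y x)\<^sup>2) = (\<Sum>e\<in>T. pr N e * (1 - pr N e) * (hc N i e * hc N i e))"
      unfolding Y_def using insert by simp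
    finally show ?case using insert.hyps by simp
  qed
  have "(lin N i x)\<^sup>2 = 1 / \<epsilon> N * (\<Sum>e\<in>pairs N. hc N i e * Xi e x)\<^sup>2" for x
    using eps_pos[OF assms] by (simp add: lin_def Xi_def power_divide)
  then show ?thesis
    using gen[of "pairs N"] by (simp only: mean_cmult V_def) simp
qed

text \<open>
  Supplies the moment hypothesis of the continuity theorem.
\<close>
theorem cen_second_moment_bounded:
  assumes i: "i \<in> simple_indices k \<theta>"
  shows "\<forall>\<^sub>F N in sequentially. expect N (\<lambda>x. (cen N i x)\<^sup>2) \<le> 2 + 2 * (\<bar>C i i\<bar> + 1)"
proof -
  have ik: "i \<in> {1..k}" by (rule simple_gap[OF i])
  have "\<forall>\<^sub>F N in sequentially. expect N (\<lambda>x. (cen N i x - lin N i x)\<^sup>2) < 1"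
    using order_tendstoD(2)[OF cen_lin_L2[OF i], of 1] by simp
  moreover have "\<forall>\<^sub>F N in sequentially. V N i i < \<bar>C i i\<bar> + 1"
    using order_tendstoD(2)[OF V_tendsto[OF ik ik], of "\<bar>C i i\<bar> + 1"] by simp
  ultimately show ?thesis
    using eventually_ge_at_top[of 1]
  proof eventually_elim
    case (elim N)
    interpret bernoulli "pairs N" "pr N" by (rule bernoulli_pr[OF elim(3)])
    have "expect N (\<lambda>x. (cen N i x)\<^sup>2) \<le> expect N (\<lambda>x. 2 * (cen N i x - lin N i x)\<^sup>2 + 2 * (lin N i x)\<^sup>2)"
    proof (rule mean_mono)
      fix x
      have "(a + b)\<^sup>2 \<le> 2 * a\<^sup>2 + 2 * b\<^sup>2" for a b :: real
        using sum_squares_bound[of a b] by (simp add: power2_sum)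
      from this[of "cen N i x - lin N i x" "lin N i x"]
      show "(cen N i x)\<^sup>2 \<le> 2 * (cen N i x - lin N i x)\<^sup>2 + 2 * (lin N i x)\<^sup>2" by simp
    qed
    also have "\<dots> = 2 * expect N (\<lambda>x. (cen N i x - lin N i x)\<^sup>2) + 2 * V N i i"
      by (simp only: mean_add mean_cmult lin_second_moment[OF elim(3)])
    finally have le: "expect N (\<lambda>x. (cen N i x)\<^sup>2) \<le> 2 * expect N (\<lambda>x. (cen N i x - lin N i x)\<^sup>2) + 2 * V N i i" .
    have "x \<le> 2 + 2 * c" if "x \<le> 2 * a + 2 * v" "a < 1" "v < c" for x a v c :: real
      using that by simp
    from this[OF le elim(1,2)] show ?case .
  qed
qed

lemma iexp_Lipschitz: "norm (iexp a - iexp b) \<le> \<bar>a - b\<bar>"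
proof -
  have "iexp a - iexp b = iexp b * (iexp (a - b) - 1)"
    by (simp add: algebra_simps flip: exp_add)
  then show ?thesis
    using iexp_approx1[of "a - b" 0] by (simp add: norm_mult)
qed

text \<open>
  A linear combination of the linear parts is a sum of independent variables whose coefficients are at most a
  multiple of \<open>1 / sqrt N\<close> as soon as \<open>dg N \<ge> 1\<close>. The nonlinear parts are negligible in mean square, and characters are Lipschitz.
\<close>
theorem cen_char_tendsto:
  fixes t :: "nat \<Rightarrow> real"
  defines "I \<equiv> simple_indices k \<theta>"
  shows "(\<lambda>N. expect N (\<lambda>x. iexp (\<Sum>i\<in>I. t i * cen N i x)))
    \<longlonglongrightarrow> complex_of_real (exp (- (\<Sum>i\<in>I. \<Sum>j\<in>I. t i * t j * C i j) / 2))"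
proof -
  have Ik: "I \<subseteq> {1..k}" using simple_gap(1) by (auto simp: I_def)
  have finI: "finite I" using Ik finite_subset by blast
  define \<sigma>2 where "\<sigma>2 N = (\<Sum>i\<in>I. \<Sum>j\<in>I. t i * t j * V N i j)" for N
  have s2: "\<sigma>2 \<longlonglongrightarrow> (\<Sum>i\<in>I. \<Sum>j\<in>I. t i * t j * C i j)"
    unfolding \<sigma>2_def[abs_def] using Ik by (intro tendsto_sum tendsto_mult tendsto_const V_tendsto) auto
  define c where "c N e = (\<Sum>i\<in>I. t i * hc N i e) / sqrt (\<epsilon> N)" for N e
  define T where "T = (\<Sum>i\<in>I. \<bar>t i\<bar>) * (2 * R\<^sup>2)"
  have T0: "0 \<le> T" by (simp add: T_def sum_nonneg)
  define K where "K N = T / sqrt (real N)" for N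
  have K0: "K \<longlonglongrightarrow> 0"
  proof -
    have "(\<lambda>N. 1 / sqrt (real N)) \<longlonglongrightarrow> 0" by real_asymp
    from tendsto_mult_left[OF this, of T] show ?thesis by (simp add: K_def[abs_def])
  qed
  have lin_sum: "(\<Sum>i\<in>I. t i * lin N i x) = (\<Sum>e\<in>pairs N. c N e * (of_bool (e \<in> x) - pr N e))" for N x
  proof -
    have "(\<Sum>i\<in>I. t i * lin N i x) = (\<Sum>i\<in>I. \<Sum>e\<in>pairs N. t i * hc N i e / sqrt (\<epsilon> N) * (of_bool (e \<in> x) - pr N e))"
      unfolding lin_def sum_divide_distrib sum_distrib_left by (intro sum.cong refl) simp
    also have "\<dots> = (\<Sum>e\<in>pairs N. \<Sum>i\<in>I. t i * hc N i e / sqrt (\<epsilon> N) * (of_bool (e \<in> x) - pr N e))"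
      by (rule sum.swap)
    finally show ?thesis by (simp only: c_def sum_divide_distrib sum_distrib_right)
  qed
  have var: "(\<Sum>e\<in>pairs N. pr N e * (1 - pr N e) * (c N e)\<^sup>2) = \<sigma>2 N" if N: "1 \<le> N" for N
  proof -
    have "\<sigma>2 N = (\<Sum>i\<in>I. \<Sum>j\<in>I. \<Sum>e\<in>pairs N. pr N e * (1 - pr N e) * ((t i * hc N i e) * (t j * hc N j e)) / \<epsilon> N)"
      unfolding \<sigma>2_def V_def sum_divide_distrib sum_distrib_left
      by (intro sum.cong refl) (simp only: times_divide_eq_right mult_ac)
    also have "\<dots> = (\<Sum>i\<in>I. \<Sum>e\<in>pairs N. \<Sum>j\<in>I. pr N e * (1 - pr N e) * ((t i * hc N i e) * (t j * hc N j e)) / \<epsilon> N)"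
      by (intro sum.cong refl sum.swap)
    also have "\<dots> = (\<Sum>e\<in>pairs N. \<Sum>i\<in>I. \<Sum>j\<in>I. pr N e * (1 - pr N e) * ((t i * hc N i e) * (t j * hc N j e)) / \<epsilon> N)"
      by (rule sum.swap)
    also have "\<dots> = (\<Sum>e\<in>pairs N. pr N e * (1 - pr N e) * (c N e)\<^sup>2)"
    proof (rule sum.cong[OF refl])
      fix e
      have "(c N e)\<^sup>2 = ((\<Sum>i\<in>I. t i * hc N i e) * (\<Sum>j\<in>I. t j * hc N j e)) / \<epsilon> N"
        using eps_pos[OF N] by (simp add: c_def power_divide power2_eq_square)
      then have "(c N e)\<^sup>2 = (\<Sum>i\<in>I. \<Sum>j\<in>I. (t i * hc N i e) * (t j * hc N j e)) / \<epsilon> N"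
        by (simp only: sum_product)
      then show "(\<Sum>i\<in>I. \<Sum>j\<in>I. pr N e * (1 - pr N e) * ((t i * hc N i e) * (t j * hc N j e)) / \<epsilon> N) = pr N e * (1 - pr N e) * (c N e)\<^sup>2"
        by (simp only: sum_distrib_left sum_divide_distrib times_divide_eq_right)
    qed
    finally show ?thesis by simp
  qed
  have gauss: "(\<lambda>N. expect N (\<lambda>x. iexp (\<Sum>i\<in>I. t i * lin N i x)) - complex_of_real (exp (- \<sigma>2 N / 2))) \<longlonglongrightarrow> 0"
  proof (rule Lim_null_comparison[where g = "\<lambda>N. K N * \<sigma>2 N"])
    show "(\<lambda>N. K N * \<sigma>2 N) \<longlonglongrightarrow> 0"
      using tendsto_mult[OF K0 s2] by simp
    have "\<forall>\<^sub>F N in sequentially. K N < 1" using order_tendstoD(2)[OF K0, of 1] by simp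
    then show "\<forall>\<^sub>F N in sequentially. norm (expect N (\<lambda>x. iexp (\<Sum>i\<in>I. t i * lin N i x)) - complex_of_real (exp (- \<sigma>2 N / 2))) \<le> K N * \<sigma>2 N"
      using eventually_ge_at_top[of 1] eventually_dg_ge[of 1]
    proof eventually_elim
      case (elim N)
      have cK: "\<bar>c N e\<bar> \<le> K N" if e: "e \<in> pairs N" for e
      proof -
        have "\<bar>\<Sum>i\<in>I. t i * hc N i e\<bar> \<le> (\<Sum>i\<in>I. \<bar>t i\<bar> * (2 * R\<^sup>2 / N))"
        proof (rule order_trans[OF sum_abs sum_mono])
          fix i assume "i \<in> I"
          then have "\<bar>t i\<bar> * \<bar>hc N i e\<bar> \<le> \<bar>t i\<bar> * (2 * R\<^sup>2 / N)"
            using Ik by (intro mult_left_mono hc_bound[OF _ e]) auto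
          then show "\<bar>t i * hc N i e\<bar> \<le> \<bar>t i\<bar> * (2 * R\<^sup>2 / N)" by (simp only: abs_mult)
        qed
        also have "\<dots> = T / N" by (simp add: T_def sum_distrib_right sum_divide_distrib)
        finally have "\<bar>\<Sum>i\<in>I. t i * hc N i e\<bar> / sqrt (\<epsilon> N) \<le> T / N / sqrt (\<epsilon> N)"
          by (rule divide_right_mono) (use eps_pos[OF elim(2)] in simp)
        moreover have "\<bar>c N e\<bar> = \<bar>\<Sum>i\<in>I. t i * hc N i e\<bar> / sqrt (\<epsilon> N)"
          using eps_pos[OF elim(2)] by (simp add: c_def abs_divide)
        ultimately have "\<bar>c N e\<bar> \<le> T / N / sqrt (\<epsilon> N)" by (simp only:)
        also have "\<dots> = T / (sqrt N * sqrt (dg N))"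
        proof -
          have "sqrt N * sqrt (dg N) = N * sqrt (\<epsilon> N)" by (simp add: dg_def real_sqrt_mult)
          then show ?thesis by simp
        qed
        also have "\<dots> \<le> T / (sqrt N * 1)"
          using elim T0 by (intro divide_left_mono mult_left_mono mult_pos_pos) auto
        finally show ?thesis by (simp add: K_def)
      qed
      show ?case
        unfolding lin_sum using bernoulli_clt_char[where c="c N" and K="K N", OF bernoulli_pr[OF elim(2)] cK less_imp_le[OF elim(1)]]
        unfolding var[OF elim(2)] .
    qed
  qed
  have diff: "(\<lambda>N. expect N (\<lambda>x. iexp (\<Sum>i\<in>I. t i * cen N i x)) - expect N (\<lambda>x. iexp (\<Sum>i\<in>I. t i * lin N i x))) \<longlonglongrightarrow> 0"
  proof (rule Lim_null_comparison[where g = "\<lambda>N. \<Sum>i\<in>I. \<bar>t i\<bar> * sqrt (expect N (\<lambda>x. (cen N i x - lin N i x)\<^sup>2))"])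
    have "(\<lambda>N. \<Sum>i\<in>I. \<bar>t i\<bar> * sqrt (expect N (\<lambda>x. (cen N i x - lin N i x)\<^sup>2))) \<longlonglongrightarrow> (\<Sum>i\<in>I. \<bar>t i\<bar> * sqrt 0)"
      by (intro tendsto_sum tendsto_mult tendsto_const tendsto_real_sqrt cen_lin_L2) (auto simp: I_def)
    then show "(\<lambda>N. \<Sum>i\<in>I. \<bar>t i\<bar> * sqrt (expect N (\<lambda>x. (cen N i x - lin N i x)\<^sup>2))) \<longlonglongrightarrow> 0" by simp
    show "\<forall>\<^sub>F N in sequentially. norm (expect N (\<lambda>x. iexp (\<Sum>i\<in>I. t i * cen N i x)) - expect N (\<lambda>x. iexp (\<Sum>i\<in>I. t i * lin N i x)))
        \<le> (\<Sum>i\<in>I. \<bar>t i\<bar> * sqrt (expect N (\<lambda>x. (cen N i x - lin N i x)\<^sup>2)))"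
      using eventually_ge_at_top[of 1]
    proof eventually_elim
      case (elim N)
      interpret bernoulli "pairs N" "pr N" by (rule bernoulli_pr[OF elim])
      have "norm (expect N (\<lambda>x. iexp (\<Sum>i\<in>I. t i * cen N i x)) - expect N (\<lambda>x. iexp (\<Sum>i\<in>I. t i * lin N i x)))
         \<le> expect N (\<lambda>x. norm (iexp (\<Sum>i\<in>I. t i * cen N i x) - iexp (\<Sum>i\<in>I. t i * lin N i x)))"
        unfolding mean_diff[symmetric] by (rule norm_mean_le)
      also have "\<dots> \<le> expect N (\<lambda>x. \<Sum>i\<in>I. \<bar>t i\<bar> * \<bar>cen N i x - lin N i x\<bar>)"
      proof (rule mean_mono)
        fix x
        have "norm (iexp (\<Sum>i\<in>I. t i * cen N i x) - iexp (\<Sum>i\<in>I. t i * lin N i x))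
           \<le> \<bar>(\<Sum>i\<in>I. t i * cen N i x) - (\<Sum>i\<in>I. t i * lin N i x)\<bar>"
          by (rule iexp_Lipschitz)
        also have "\<dots> \<le> (\<Sum>i\<in>I. \<bar>t i * cen N i x - t i * lin N i x\<bar>)"
          unfolding sum_subtractf[symmetric] by (rule sum_abs)
        also have "\<dots> = (\<Sum>i\<in>I. \<bar>t i\<bar> * \<bar>cen N i x - lin N i x\<bar>)"
          by (simp only: right_diff_distrib[symmetric] abs_mult)
        finally show "norm (iexp (\<Sum>i\<in>I. t i * cen N i x) - iexp (\<Sum>i\<in>I. t i * lin N i x)) \<le> (\<Sum>i\<in>I. \<bar>t i\<bar> * \<bar>cen N i x - lin N i x\<bar>)" .
      qed
      also have "\<dots> = (\<Sum>i\<in>I. \<bar>t i\<bar> * expect N (\<lambda>x. \<bar>cen N i x - lin N i x\<bar>))"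
        by (simp only: mean_sum mean_cmult)
      also have "\<dots> \<le> (\<Sum>i\<in>I. \<bar>t i\<bar> * sqrt (expect N (\<lambda>x. (cen N i x - lin N i x)\<^sup>2)))"
      proof (intro sum_mono mult_left_mono real_le_rsqrt)
        fix i show "(expect N (\<lambda>x. \<bar>cen N i x - lin N i x\<bar>))\<^sup>2 \<le> expect N (\<lambda>x. (cen N i x - lin N i x)\<^sup>2)"
          using mean_square_le[of "\<lambda>x. \<bar>cen N i x - lin N i x\<bar>"] by simp
      qed simp
      finally show ?case .
    qed
  qed
  have "(\<lambda>N. complex_of_real (exp (- \<sigma>2 N / 2))) \<longlonglongrightarrow> complex_of_real (exp (- (\<Sum>i\<in>I. \<Sum>j\<in>I. t i * t j * C i j) / 2))"
    by (intro tendsto_of_real tendsto_exp tendsto_divide tendsto_minus s2 tendsto_const) simp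
  from tendsto_add[OF tendsto_add[OF diff gauss] this] show ?thesis by simp
qed

text \<open>
  A limit of covariance matrices is positive semidefinite.
\<close>
lemma C_psd: "0 \<le> (\<Sum>i\<in>simple_indices k \<theta>. \<Sum>j\<in>simple_indices k \<theta>. t i * t j * C i j)"
proof (rule LIMSEQ_le_const)
  show "(\<lambda>N. \<Sum>i\<in>simple_indices k \<theta>. \<Sum>j\<in>simple_indices k \<theta>. t i * t j * V N i j)
      \<longlonglongrightarrow> (\<Sum>i\<in>simple_indices k \<theta>. \<Sum>j\<in>simple_indices k \<theta>. t i * t j * C i j)"
    using simple_gap(1) by (intro tendsto_sum tendsto_mult tendsto_const V_tendsto) auto
  let ?I = "simple_indices k \<theta>"
  have "0 \<le> (\<Sum>i\<in>?I. \<Sum>j\<in>?I. t i * t j * V N i j)" if N: "1 \<le> N" for N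
  proof -
    have "(\<Sum>i\<in>?I. \<Sum>j\<in>?I. t i * t j * V N i j) = (\<Sum>i\<in>?I. \<Sum>j\<in>?I. \<Sum>e\<in>pairs N. pr N e * (1 - pr N e) / \<epsilon> N * ((t i * hc N i e) * (t j * hc N j e)))"
      unfolding V_def sum_divide_distrib sum_distrib_left
      by (intro sum.cong refl) (simp add: mult_ac)
    also have "\<dots> = (\<Sum>i\<in>?I. \<Sum>e\<in>pairs N. \<Sum>j\<in>?I. pr N e * (1 - pr N e) / \<epsilon> N * ((t i * hc N i e) * (t j * hc N j e)))"
      by (intro sum.cong refl sum.swap)
    also have "\<dots> = (\<Sum>e\<in>pairs N. \<Sum>i\<in>?I. \<Sum>j\<in>?I. pr N e * (1 - pr N e) / \<epsilon> N * ((t i * hc N i e) * (t j * hc N j e)))"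
      by (rule sum.swap)
    also have "\<dots> = (\<Sum>e\<in>pairs N. pr N e * (1 - pr N e) / \<epsilon> N * ((\<Sum>i\<in>?I. t i * hc N i e) * (\<Sum>i\<in>?I. t i * hc N i e)))"
      unfolding sum_product by (simp only: sum_distrib_left)
    also have "0 \<le> \<dots>"
    proof (rule sum_nonneg)
      fix e assume "e \<in> pairs N"
      then have "0 \<le> pr N e * (1 - pr N e) / \<epsilon> N"
        using pr_range[OF N] eps_pos[OF N] by (intro divide_nonneg_nonneg mult_nonneg_nonneg) auto
      then show "0 \<le> pr N e * (1 - pr N e) / \<epsilon> N * ((\<Sum>i\<in>?I. t i * hc N i e) * (\<Sum>i\<in>?I. t i * hc N i e))"
        by (rule mult_nonneg_nonneg[OF _ zero_le_square])
    qed
    finally show ?thesis .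
  qed
  then show "\<exists>N0. \<forall>N\<ge>N0. 0 \<le> (\<Sum>i\<in>?I. \<Sum>j\<in>?I. t i * t j * V N i j)" by blast
qed

end

section \<open>Random matrices on an arbitrary probability space\<close>

lemma bernoulli_law_measure:
  assumes "0 \<le> p" "p \<le> 1"
  shows "measure (bernoulli_law p) {1} = p" "measure (bernoulli_law p) (- {1}) = 1 - p"
    "measure (bernoulli_law p) {0, 1} = 1"
proof -
  have m: "of_bool \<in> measurable (measure_pmf (bernoulli_pmf p)) (borel :: real measure)" by simp
  have v: "of_bool -` {1 :: real} = {True}" "of_bool -` (- {1 :: real}) = {False}" "of_bool -` {0, 1 :: real} = UNIV"
    by auto
  have "measure (bernoulli_law p) B = measure (measure_pmf (bernoulli_pmf p)) (of_bool -` B)" if "B \<in> sets borel" for B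
    unfolding bernoulli_law_def using measure_distr[OF m that] by simp
  then show "measure (bernoulli_law p) {1} = p" "measure (bernoulli_law p) (- {1}) = 1 - p"
    "measure (bernoulli_law p) {0, 1} = 1"
    using assms by (simp_all add: v measure_pmf_single)
qed

text \<open>
  A random symmetric matrix whose upper triangle, diagonal included, consists of independent Bernoulli variables. Its law is
  that of the adjacency matrix of a random set \<open>X\<close> of entries, so expectations become finite sums.
\<close>
locale bernoulli_sample = prob_space M for M :: "'w measure" +
  fixes N :: nat and p :: "nat \<times> nat \<Rightarrow> real" and A :: "'w \<Rightarrow> real mat"
  assumes N1: "1 \<le> N"
    and p01: "\<And>e. e \<in> pairs N \<Longrightarrow> 0 \<le> p e \<and> p e \<le> 1"
    and carrier: "\<And>\<omega>. \<omega> \<in> space M \<Longrightarrow> A \<omega> \<in> carrier_mat N N"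
    and sym: "\<And>\<omega>. \<omega> \<in> space M \<Longrightarrow> transpose_mat (A \<omega>) = A \<omega>"
    and indep: "indep_vars (\<lambda>_. borel) (\<lambda>e \<omega>. A \<omega> $$ e) (pairs N)"
    and law: "\<And>e. e \<in> pairs N \<Longrightarrow> distr M borel (\<lambda>\<omega>. A \<omega> $$ e) = bernoulli_law (p e)"
begin

definition X :: "'w \<Rightarrow> (nat \<times> nat) set" where
  "X \<omega> = {e \<in> pairs N. A \<omega> $$ e = 1}"

lemma pairs_nonempty: "pairs N \<noteq> {}"
proof -
  have "(0, 0) \<in> pairs N" using N1 by (simp add: pairs_def)
  then show ?thesis by blast
qed

lemma entry_measurable: "e \<in> pairs N \<Longrightarrow> (\<lambda>\<omega>. A \<omega> $$ e) \<in> borel_measurable M"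
  using indep unfolding indep_vars_def by auto

lemma prob_entry:
  assumes e: "e \<in> pairs N" and B: "B \<in> sets borel"
  shows "prob ((\<lambda>\<omega>. A \<omega> $$ e) -` B \<inter> space M) = measure (bernoulli_law (p e)) B"
  using measure_distr[OF entry_measurable[OF e] B] law[OF e] by simp

lemma X_event:
  assumes "x \<subseteq> pairs N"
  shows "X -` {x} \<inter> space M = (\<Inter>e\<in>pairs N. (\<lambda>\<omega>. A \<omega> $$ e) -` (if e \<in> x then {1} else - {1}) \<inter> space M)"
proof -
  have ne: "pairs N \<noteq> {}" by (rule pairs_nonempty)
  have "X \<omega> = x \<longleftrightarrow> (\<forall>e\<in>pairs N. A \<omega> $$ e \<in> (if e \<in> x then {1} else - {1}))" for \<omega>
    using assms by (auto simp: X_def split: if_splits)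
  then show ?thesis using ne by auto
qed

lemma X_measurable: "X \<in> measurable M (count_space (Pow (pairs N)))"
proof (subst measurable_count_space_eq2)
  show "finite (Pow (pairs N))" by simp
  show "X \<in> space M \<rightarrow> Pow (pairs N) \<and> (\<forall>x\<in>Pow (pairs N). X -` {x} \<inter> space M \<in> sets M)"
  proof (intro conjI ballI)
    show "X \<in> space M \<rightarrow> Pow (pairs N)" by (auto simp: X_def)
    fix x assume "x \<in> Pow (pairs N)"
    then have x: "x \<subseteq> pairs N" by simp
    have ne: "pairs N \<noteq> {}" by (rule pairs_nonempty)
    show "X -` {x} \<inter> space M \<in> sets M"
      unfolding X_event[OF x] using entry_measurable ne
      by (intro sets.finite_INT) (auto intro!: measurable_sets)
  qed
qed

text \<open>
  The complement of \<open>{1}\<close> is used for absent entries, rather than \<open>{0}\<close>: the entries are \<open>0\<close> or \<open>1\<close> only almost surely.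
\<close>
lemma prob_X:
  assumes x: "x \<subseteq> pairs N"
  shows "prob (X -` {x} \<inter> space M) = bern_wt (pairs N) p x"
proof -
  have ne: "pairs N \<noteq> {}" by (rule pairs_nonempty)
  have "prob (X -` {x} \<inter> space M) = (\<Prod>e\<in>pairs N. prob ((\<lambda>\<omega>. A \<omega> $$ e) -` (if e \<in> x then {1} else - {1}) \<inter> space M))"
    unfolding X_event[OF x] by (rule indep_varsD[OF indep ne]) auto
  also have "\<dots> = (\<Prod>e\<in>pairs N. if e \<in> x then p e else 1 - p e)"
    using p01 by (intro prod.cong refl) (auto simp: prob_entry bernoulli_law_measure)
  finally show ?thesis by (simp add: bern_wt_def)
qed

lemma X_comp_measurable: "(\<lambda>\<omega>. h (X \<omega>)) \<in> borel_measurable M"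
  by (rule measurable_compose[OF X_measurable]) simp

lemma X_comp_integrable:
  fixes h :: "(nat \<times> nat) set \<Rightarrow> 'b::{banach, second_countable_topology}"
  shows "integrable M (\<lambda>\<omega>. h (X \<omega>))"
proof (rule integrable_const_bound[where B = "Max ((\<lambda>x. norm (h x)) ` Pow (pairs N))"])
  show "AE \<omega> in M. norm (h (X \<omega>)) \<le> Max ((\<lambda>x. norm (h x)) ` Pow (pairs N))"
    by (rule AE_I2, rule Max_ge) (auto simp: X_def)
qed (rule X_comp_measurable)

lemma X_comp_integral:
  fixes h :: "(nat \<times> nat) set \<Rightarrow> 'b::{banach, second_countable_topology}"
  shows "(\<integral>\<omega>. h (X \<omega>) \<partial>M) = mean (pairs N) p h"
proof -
  have ev: "X -` {x} \<inter> space M \<in> sets M" if "x \<in> Pow (pairs N)" for x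
    using measurable_sets[OF X_measurable, of "{x}"] that by simp
  have "(\<integral>\<omega>. h (X \<omega>) \<partial>M) = (\<integral>\<omega>. (\<Sum>x\<in>Pow (pairs N). indicator (X -` {x} \<inter> space M) \<omega> *\<^sub>R h x) \<partial>M)"
  proof (rule Bochner_Integration.integral_cong[OF refl])
    fix \<omega> assume w: "\<omega> \<in> space M"
    have "X \<omega> \<in> Pow (pairs N)" by (auto simp: X_def)
    then have "h (X \<omega>) = (\<Sum>x\<in>Pow (pairs N). if x = X \<omega> then h x else 0)" by simp
    also have "\<dots> = (\<Sum>x\<in>Pow (pairs N). indicator (X -` {x} \<inter> space M) \<omega> *\<^sub>R h x)"
      using w by (intro sum.cong refl) (auto simp: indicator_def)
    finally show "h (X \<omega>) = (\<Sum>x\<in>Pow (pairs N). indicator (X -` {x} \<inter> space M) \<omega> *\<^sub>R h x)" .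
  qed
  also have "\<dots> = (\<Sum>x\<in>Pow (pairs N). \<integral>\<omega>. indicator (X -` {x} \<inter> space M) \<omega> *\<^sub>R h x \<partial>M)"
    using ev by (intro Bochner_Integration.integral_sum integrable_scaleR_left integrable_real_indicator)
      (auto simp: emeasure_eq_measure)
  also have "\<dots> = (\<Sum>x\<in>Pow (pairs N). bern_wt (pairs N) p x *\<^sub>R h x)"
  proof (rule sum.cong[OF refl])
    fix x assume x: "x \<in> Pow (pairs N)"
    have "(\<integral>\<omega>. indicator (X -` {x} \<inter> space M) \<omega> *\<^sub>R h x \<partial>M) = (\<integral>\<omega>. indicator (X -` {x} \<inter> space M) \<omega> \<partial>M) *\<^sub>R h x"
      using ev[OF x] by (intro integral_scaleR_left) (auto intro!: integrable_real_indicator simp: emeasure_eq_measure)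
    then show "(\<integral>\<omega>. indicator (X -` {x} \<inter> space M) \<omega> *\<^sub>R h x \<partial>M) = bern_wt (pairs N) p x *\<^sub>R h x"
      using prob_X[of x] x by simp
  qed
  finally show ?thesis by (simp add: mean_def)
qed

lemma AE_adjacency: "AE \<omega> in M. \<forall>a<N. \<forall>b<N. A \<omega> $$ (a, b) = adj (X \<omega>) a b"
proof -
  have "AE \<omega> in M. A \<omega> $$ e \<in> {0, 1}" if e: "e \<in> pairs N" for e
  proof -
    have "prob ((\<lambda>\<omega>. A \<omega> $$ e) -` {0, 1} \<inter> space M) = 1"
      using p01[OF e] by (subst prob_entry[OF e]) (auto simp: bernoulli_law_measure)
    then have "AE \<omega> in M. \<omega> \<in> (\<lambda>\<omega>. A \<omega> $$ e) -` {0, 1} \<inter> space M"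
      by (subst prob_eq_1[symmetric]) (auto intro!: measurable_sets[OF entry_measurable[OF e]])
    then show ?thesis by (rule AE_mp) (rule AE_I2, auto)
  qed
  then have "AE \<omega> in M. \<forall>e\<in>pairs N. A \<omega> $$ e \<in> {0, 1}"
    by (subst AE_finite_all) auto
  then show ?thesis
  proof (rule AE_mp, intro AE_I2 impI allI)
    fix \<omega> a b assume w: "\<omega> \<in> space M" and v: "\<forall>e\<in>pairs N. A \<omega> $$ e \<in> {0, 1}" and ab: "a < N" "b < N"
    have "A \<omega> $$ (a, b) = A \<omega> $$ (b, a)"
      using arg_cong[OF sym[OF w], of "\<lambda>B. B $$ (a, b)"] carrier[OF w] ab by simp
    then have "A \<omega> $$ (a, b) = A \<omega> $$ pair_key a b"
      by (cases "a \<le> b") (simp_all add: pair_key_def min_def max_def)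
    moreover have "pair_key a b \<in> pairs N" using ab by simp
    ultimately show "A \<omega> $$ (a, b) = adj (X \<omega>) a b"
      using v by (auto simp: adj_def X_def)
  qed
qed

lemma eig_of_entries:
  assumes "\<omega> \<in> space M" "m < N"
  shows "eig (Suc m) (A \<omega>) = eigval N (\<lambda>a b. A \<omega> $$ pair_key a b) m"
proof -
  have eq: "A \<omega> $$ (a, b) = A \<omega> $$ pair_key a b" if ab: "a < N" "b < N" for a b
  proof -
    have "A \<omega> $$ (a, b) = A \<omega> $$ (b, a)"
      using arg_cong[OF sym[OF assms(1)], of "\<lambda>B. B $$ (a, b)"] carrier[OF assms(1)] ab by simp
    then show ?thesis by (cases "a \<le> b") (simp_all add: pair_key_def min_def max_def)
  qed
  have "A \<omega> = mat_fun N (\<lambda>a b. A \<omega> $$ pair_key a b)"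
    using carrier[OF assms(1)] eq by (intro eq_matI) (auto simp: mat_fun_def)
  moreover have "symm N (\<lambda>a b. A \<omega> $$ pair_key a b)" by (simp add: symm_def pair_key_commute)
  ultimately show ?thesis using eig_eigval[OF _ assms(2)] by metis
qed

text \<open>
  In the product topology on all index pairs; it makes eigenvalues measurable functions of the entries.
\<close>
lemma continuous_eigval:
  assumes m: "m < N"
  shows "continuous_on UNIV (\<lambda>y :: nat \<times> nat \<Rightarrow> real. eigval N (\<lambda>a b. y (pair_key a b)) m)"
  unfolding continuous_on_def
proof
  fix y :: "nat \<times> nat \<Rightarrow> real"
  define B where "B z = sqrt (\<Sum>a<N. \<Sum>b<N. (z (pair_key a b) - y (pair_key a b))\<^sup>2)" for z
  have s: "symm N (\<lambda>a b. z (pair_key a b))" for z :: "nat \<times> nat \<Rightarrow> real" by (simp add: symm_def pair_key_commute)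
  have "((\<lambda>z. eigval N (\<lambda>a b. z (pair_key a b)) m - eigval N (\<lambda>a b. y (pair_key a b)) m) \<longlongrightarrow> 0) (at y)"
  proof (rule Lim_null_comparison)
    show "\<forall>\<^sub>F z in at y. norm (eigval N (\<lambda>a b. z (pair_key a b)) m - eigval N (\<lambda>a b. y (pair_key a b)) m) \<le> B z"
      using eigval_Lipschitz[OF s s m] by (intro always_eventually) (simp add: B_def)
    have c: "((\<lambda>z :: nat \<times> nat \<Rightarrow> real. z e) \<longlongrightarrow> y e) (at y)" for e
      using continuous_on_product_coordinates[where i = e and ?'a = "nat \<times> nat" and ?'b = real, unfolded continuous_on_def] by simp
    have "(B \<longlongrightarrow> sqrt (\<Sum>a<N. \<Sum>b<N. (y (pair_key a b) - y (pair_key a b))\<^sup>2)) (at y)"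
      unfolding B_def[abs_def] by (intro tendsto_real_sqrt tendsto_sum tendsto_power tendsto_diff tendsto_const c)
    then show "(B \<longlongrightarrow> 0) (at y)" by simp
  qed
  then have "((\<lambda>z. eigval N (\<lambda>a b. z (pair_key a b)) m) \<longlongrightarrow> eigval N (\<lambda>a b. y (pair_key a b)) m) (at y)"
    by (rule LIM_zero_cancel)
  then show "((\<lambda>z. eigval N (\<lambda>a b. z (pair_key a b)) m) \<longlongrightarrow> eigval N (\<lambda>a b. y (pair_key a b)) m) (at y within UNIV)" by simp
qed

text \<open>
  Measurability must be shown for the eigenvalue itself, which coincides only almost surely with a function of \<open>X\<close>; the measure need not be
  complete.
\<close>
lemma eig_measurable:
  assumes m: "m < N"
  shows "(\<lambda>\<omega>. eig (Suc m) (A \<omega>)) \<in> borel_measurable M"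
proof -
  define y where "y \<omega> = (\<lambda>e. if e \<in> pairs N then A \<omega> $$ e else 0)" for \<omega>
  have "y \<in> measurable M (Pi\<^sub>M UNIV (\<lambda>_. borel))"
  proof (rule measurable_PiM_single')
    fix e show "(\<lambda>\<omega>. y \<omega> e) \<in> borel_measurable M"
      using entry_measurable by (cases "e \<in> pairs N") (simp_all add: y_def)
  qed auto
  then have "y \<in> measurable M borel"
    using measurable_cong_sets[OF refl sets_PiM_equal_borel] by blast
  then have "(\<lambda>\<omega>. eigval N (\<lambda>a b. y \<omega> (pair_key a b)) m) \<in> borel_measurable M"
    using borel_measurable_continuous_onI[OF continuous_eigval[OF m]] by (rule measurable_compose)
  moreover have "eig (Suc m) (A \<omega>) = eigval N (\<lambda>a b. y \<omega> (pair_key a b)) m" if "\<omega> \<in> space M" for \<omega>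
  proof -
    have s: "symm N (\<lambda>a b. z (pair_key a b))" for z :: "nat \<times> nat \<Rightarrow> real" by (simp add: symm_def pair_key_commute)
    have "\<bar>eigval N (\<lambda>a b. A \<omega> $$ pair_key a b) m - eigval N (\<lambda>a b. y \<omega> (pair_key a b)) m\<bar>
       \<le> sqrt (\<Sum>a<N. \<Sum>b<N. (A \<omega> $$ pair_key a b - y \<omega> (pair_key a b))\<^sup>2)"
      by (rule eigval_Lipschitz[OF s[of "\<lambda>e. A \<omega> $$ e"] s[of "y \<omega>"] m])
    also have "\<dots> = 0" by (simp add: y_def)
    finally show ?thesis using eig_of_entries[OF that m] by simp
  qed
  ultimately show ?thesis by (simp cong: measurable_cong)
qed

lemma AE_eig:
  assumes m: "m < N"
  shows "AE \<omega> in M. eig (Suc m) (A \<omega>) = eigval N (adj (X \<omega>)) m"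
  using AE_adjacency
proof (rule AE_mp, intro AE_I2 impI)
  fix \<omega> assume w: "\<omega> \<in> space M" and eq: "\<forall>a<N. \<forall>b<N. A \<omega> $$ (a, b) = adj (X \<omega>) a b"
  have "A \<omega> = mat_fun N (adj (X \<omega>))"
    using carrier[OF w] eq by (intro eq_matI) (auto simp: mat_fun_def)
  then show "eig (Suc m) (A \<omega>) = eigval N (adj (X \<omega>)) m"
    using eig_eigval[OF symm_adj m] by simp
qed

lemma eig_expectation:
  assumes m: "m < N"
  shows "(\<integral>\<omega>. eig (Suc m) (A \<omega>) \<partial>M) = mean (pairs N) p (\<lambda>x. eigval N (adj x) m)"
proof -
  have "(\<integral>\<omega>. eig (Suc m) (A \<omega>) \<partial>M) = (\<integral>\<omega>. eigval N (adj (X \<omega>)) m \<partial>M)"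
    by (rule integral_cong_AE[OF eig_measurable[OF m] X_comp_measurable AE_eig[OF m]])
  then show ?thesis
    using X_comp_integral[of "\<lambda>x. eigval N (adj x) m"] by simp
qed

end

lemma random_bernoulli_matrix_sample:
  assumes "1 \<le> N" "prob_space M"
    and rm: "random_bernoulli_matrix M N \<epsilon> f A"
    and p: "\<And>a b. a \<le> b \<Longrightarrow> b < N \<Longrightarrow> p (a, b) = \<epsilon> * f (real (a + 1) / real N) (real (b + 1) / real N)"
    and p01: "\<And>e. e \<in> pairs N \<Longrightarrow> 0 \<le> p e \<and> p e \<le> 1"
  shows "bernoulli_sample M N p A"
proof -
  interpret prob_space M by fact
  have fn: "(\<lambda>(i, j) \<omega>. A \<omega> $$ (i, j)) = (\<lambda>e \<omega>. A \<omega> $$ e)" by (auto simp: fun_eq_iff)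
  show ?thesis
  proof
    show "indep_vars (\<lambda>_. borel) (\<lambda>e \<omega>. A \<omega> $$ e) (pairs N)"
      using rm unfolding random_bernoulli_matrix_def fn pairs_def by blast
    show "distr M borel (\<lambda>\<omega>. A \<omega> $$ e) = bernoulli_law (p e)" if "e \<in> pairs N" for e
      using rm that p unfolding random_bernoulli_matrix_def by (cases e) (auto simp: pairs_def)
  qed (use assms in \<open>auto simp: random_bernoulli_matrix_def\<close>)
qed

text \<open>
  Lets finitely many small \<open>N\<close> be disregarded, such as those with \<open>N < k\<close>, for which some of the eigenvalues do not
  exist.
\<close>
lemma weak_conv_PiM_offset:
  assumes "weak_conv_PiM I (\<lambda>n. \<mu> (n + n0)) \<nu>"
  shows "weak_conv_PiM I \<mu> \<nu>"
  using assms unfolding weak_conv_PiM_def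
proof (intro allI impI)
  fix g :: "('a \<Rightarrow> real) \<Rightarrow> real"
  assume a: "\<forall>g :: ('a \<Rightarrow> real) \<Rightarrow> real. continuous_on (Pi\<^sub>E I (\<lambda>_. UNIV)) g \<and> bounded (g ` Pi\<^sub>E I (\<lambda>_. UNIV)) \<longrightarrow>
        (\<lambda>n. \<integral>x. g x \<partial>\<mu> (n + n0)) \<longlonglongrightarrow> (\<integral>x. g x \<partial>\<nu>)"
    and g: "continuous_on (Pi\<^sub>E I (\<lambda>_. UNIV)) g \<and> bounded (g ` Pi\<^sub>E I (\<lambda>_. UNIV))"
  from a[THEN spec, THEN mp, OF g] show "(\<lambda>n. \<integral>x. g x \<partial>\<mu> n) \<longlonglongrightarrow> (\<integral>x. g x \<partial>\<nu>)"
    by (rule LIMSEQ_offset)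
qed

text \<open>
  A nonpositive supremum is excluded by the hypothesis on \<open>\<epsilon>\<close>, whose upper bound would not be positive.
\<close>
lemma kernel_scaled_le_1:
  fixes f :: "real \<Rightarrow> real \<Rightarrow> real"
  assumes bd: "\<And>x y. x \<in> {0..1} \<Longrightarrow> y \<in> {0..1} \<Longrightarrow> f x y \<le> B"
    and eps: "0 < \<epsilon>" "\<epsilon> \<le> inverse (SUP (x, y)\<in>{0..1} \<times> {0..1}. f x y)"
    and xy: "x \<in> {0..1}" "y \<in> {0..1}"
  shows "\<epsilon> * f x y \<le> 1"
proof -
  define s where "s = (SUP (x, y)\<in>{0..1} \<times> {0..1}. f x y)"
  have "f x y \<le> s"
    unfolding s_def using cSUP_upper[of "(x, y)" "{0..1} \<times> {0..1}" "\<lambda>(x, y). f x y"] xy bd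
    by (force intro!: bdd_aboveI2[where M=B])
  moreover have "0 < s"
    using eps unfolding s_def[symmetric] by (metis inverse_positive_iff_positive order_less_le_trans)
  moreover have "\<epsilon> * s \<le> 1"
    using eps(2) \<open>0 < s\<close> unfolding s_def[symmetric] by (simp add: field_simps)
  ultimately show ?thesis
    using eps(1) by (meson mult_left_mono less_imp_le order_trans)
qed

theorem theorem2p3:
  fixes k :: nat
    and \<theta> :: "nat \<Rightarrow> real"
    and r :: "nat \<Rightarrow> real \<Rightarrow> real"
    and \<epsilon> :: "nat \<Rightarrow> real"
    and \<epsilon>_inf \<xi> :: real
    and M :: "nat \<Rightarrow> 'w measure"
    and A :: "nat \<Rightarrow> 'w \<Rightarrow> real mat"
  assumes "k \<ge> 1"
    and "\<And>i j. 1 \<le> i \<Longrightarrow> i \<le> j \<Longrightarrow> j \<le> k \<Longrightarrow> \<theta> j \<le> \<theta> i"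
    and "\<theta> k > 0"
    and "orthonormal_L2 k r"
    and "\<And>x y. x \<in> {0..1} \<Longrightarrow> y \<in> {0..1} \<Longrightarrow> edge_kernel k \<theta> r x y \<ge> 0"
    and "\<And>N. N \<ge> 1 \<Longrightarrow>
           0 < \<epsilon> N \<and> \<epsilon> N \<le> inverse (SUP (x, y)\<in>{0..1} \<times> {0..1}. edge_kernel k \<theta> r x y)"
    and "\<And>N. N \<ge> 1 \<Longrightarrow> prob_space (M N)"
    and "\<And>N. N \<ge> 1 \<Longrightarrow> random_bernoulli_matrix (M N) N (\<epsilon> N) (edge_kernel k \<theta> r) (A N)"
    and "\<And>i. i \<in> {1..k} \<Longrightarrow> bounded (r i ` {0..1}) \<and> riemann_integrable 0 1 (r i)"
    and "\<xi> > 8"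
    and "(\<lambda>N. inverse (real N * \<epsilon> N) * ln (real N) powr \<xi>) \<longlonglongrightarrow> 0"
    and "\<epsilon> \<longlonglongrightarrow> \<epsilon>_inf"
    and "\<epsilon>_inf \<ge> 0"
    and "simple_indices k \<theta> \<noteq> {}"
  shows "\<exists>G :: (nat \<Rightarrow> real) measure.
    multivariate_normal (simple_indices k \<theta>) G \<and>
    (\<forall>i\<in>simple_indices k \<theta>. (\<integral>x. x i \<partial>G) = 0) \<and>
    (\<forall>i\<in>simple_indices k \<theta>. \<forall>j\<in>simple_indices k \<theta>.
       covariance G (\<lambda>x. x i) (\<lambda>x. x j) =
       2 * (\<integral>x. (\<integral>y. r i x * r i y * r j x * r j y * edge_kernel k \<theta> r x y
                        * (1 - \<epsilon>_inf * edge_kernel k \<theta> r x y)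
              \<partial>lebesgue_on {0..1}) \<partial>lebesgue_on {0..1})) \<and>
    weak_conv_PiM (simple_indices k \<theta>)
      (\<lambda>N. distr (M N) (Pi\<^sub>M (simple_indices k \<theta>) (\<lambda>_. borel))
         (\<lambda>\<omega>. \<lambda>i\<in>simple_indices k \<theta>.
            \<epsilon> N powr (-1/2) * (eig i (A N \<omega>) - (\<integral>\<omega>'. eig i (A N \<omega>') \<partial>M N))))
      G"
proof -
  have regular: "riemann_regular (r i)" if "i \<in> {1..k}" for i
    using assms(4,9) that riemann_integrable_vanishing_oscillation[of "r i"]
    unfolding riemann_regular_def orthonormal_L2_def by blast
  have eps0: "0 < \<epsilon> N" if "1 \<le> N" for N using assms(6)[OF that] by simp
  obtain B where B: "\<And>x y. x \<in> {0..1} \<Longrightarrow> y \<in> {0..1} \<Longrightarrow> edge_kernel k \<theta> r x y \<le> B"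
  proof -
    obtain R where R: "\<And>i x. i \<in> {1..k} \<Longrightarrow> x \<in> {0..1} \<Longrightarrow> \<bar>r i x\<bar> \<le> R i"
      using riemann_regular_bound[OF regular] by metis
    have "edge_kernel k \<theta> r x y \<le> (\<Sum>i=1..k. \<bar>\<theta> i\<bar> * R i * R i)" if xy: "x \<in> {0..1}" "y \<in> {0..1}" for x y
      unfolding edge_kernel_def
    proof (rule sum_mono)
      fix i assume i: "i \<in> {1..k}"
      have "\<theta> i * r i x * r i y \<le> \<bar>\<theta> i\<bar> * \<bar>r i x\<bar> * \<bar>r i y\<bar>" by (simp flip: abs_mult)
      also have "\<dots> \<le> \<bar>\<theta> i\<bar> * R i * R i"
        using R[OF i xy(1)] R[OF i xy(2)] by (intro mult_mono) auto
      finally show "\<theta> i * r i x * r i y \<le> \<bar>\<theta> i\<bar> * R i * R i" .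
    qed
    then show ?thesis by (rule that)
  qed
  have dense: "(\<lambda>N. ln (real N) / (real N * \<epsilon> N)) \<longlonglongrightarrow> 0"
  proof (rule Lim_null_comparison[OF _ assms(11)])
    have "\<forall>\<^sub>F N in sequentially. 1 \<le> ln (real N)" by real_asymp
    then show "\<forall>\<^sub>F N in sequentially. norm (ln (real N) / (real N * \<epsilon> N)) \<le> inverse (real N * \<epsilon> N) * ln (real N) powr \<xi>"
      using eventually_ge_at_top[of 1]
    proof eventually_elim
      case (elim N)
      have "ln (real N) = ln (real N) powr 1" using elim by simp
      also have "\<dots> \<le> ln (real N) powr \<xi>" using elim assms(10) by (intro powr_mono) auto
      finally have "inverse (real N * \<epsilon> N) * ln (real N) \<le> inverse (real N * \<epsilon> N) * ln (real N) powr \<xi>"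
        using eps0[OF elim(2)] by (intro mult_left_mono) auto
      then show ?case using elim eps0[OF elim(2)] by (simp add: field_simps)
    qed
  qed
  interpret inhomogeneous k \<theta> r \<epsilon> \<epsilon>_inf
  proof
    show "\<epsilon> N * edge_kernel k \<theta> r x y \<le> 1" if "1 \<le> N" "x \<in> {0..1}" "y \<in> {0..1}" for N x y
      using assms(6)[OF that(1)] that(2,3)
      by (intro kernel_scaled_le_1[where f = "edge_kernel k \<theta> r" and B = B]) (auto intro: B)
  qed (use assms regular dense eps0 in auto)
  define I where "I = simple_indices k \<theta>"
  have Ik: "I \<subseteq> {1..k}" using simple_gap(1) by (auto simp: I_def)
  have finI: "finite I" using Ik finite_subset by blast
  \<comment> \<open>The covariance extended by \<open>0\<close>, to be a matrix on all indices up to \<open>k\<close>.\<close>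
  define D where "D i j = (if i \<in> I \<and> j \<in> I then C i j else 0)" for i j
  have "ip (Suc k) t (mv (Suc k) D t) = (\<Sum>i\<in>I. \<Sum>j\<in>I. t i * t j * C i j)" for t
  proof -
    have sub: "I \<subseteq> {..<Suc k}" using Ik by auto
    have "ip (Suc k) t (mv (Suc k) D t) = (\<Sum>i<Suc k. \<Sum>j<Suc k. t i * t j * D i j)"
      unfolding ip_def mv_def sum_distrib_left by (intro sum.cong refl) (simp only: mult_ac)
    also have "\<dots> = (\<Sum>i\<in>I. \<Sum>j<Suc k. t i * t j * D i j)"
      using sub by (intro sum.mono_neutral_right) (auto simp: D_def)
    also have "\<dots> = (\<Sum>i\<in>I. \<Sum>j\<in>I. t i * t j * D i j)"
      using sub by (intro sum.cong refl sum.mono_neutral_right) (auto simp: D_def)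
    finally show ?thesis by (simp add: D_def)
  qed
  then have psd: "0 \<le> ip (Suc k) t (mv (Suc k) D t)" for t
    using C_psd by (simp add: I_def)
  have symD: "symm (Suc k) D" by (auto simp: symm_def D_def C_commute)
  have Isub: "I \<subseteq> {..<Suc k}" using Ik by auto
  obtain G where G: "multivariate_normal I G" "prob_space G" "sets G = sets (Pi\<^sub>M I (\<lambda>_. borel))"
    "\<And>i. i \<in> I \<Longrightarrow> (\<integral>x. x i \<partial>G) = 0"
    "\<And>i. i \<in> I \<Longrightarrow> integrable G (\<lambda>x. (x i)\<^sup>2) \<and> (\<integral>x. (x i)\<^sup>2 \<partial>G) = D i i"
    "\<And>i j. i \<in> I \<Longrightarrow> j \<in> I \<Longrightarrow> covariance G (\<lambda>x. x i) (\<lambda>x. x j) = D i j"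
    "\<And>t. (\<integral>x. iexp (\<Sum>a\<in>I. t a * x a) \<partial>G) = complex_of_real (exp (- (\<Sum>i\<in>I. \<Sum>j\<in>I. t i * t j * D i j) / 2))"
    using gaussian_measure_exists[OF finI Isub symD psd] by blast
  define Z where "Z N = (\<lambda>\<omega>. \<lambda>i\<in>I. \<epsilon> N powr (-1/2) * (eig i (A N \<omega>) - (\<integral>\<omega>'. eig i (A N \<omega>') \<partial>M N)))" for N
  define \<mu> where "\<mu> N = distr (M N) (Pi\<^sub>M I (\<lambda>_. borel)) (Z N)" for N
  define K where "K = (\<Sum>i\<in>I. 2 + 2 * (\<bar>C i i\<bar> + 1))"
  have "\<forall>\<^sub>F N in sequentially. \<forall>i\<in>I. expect N (\<lambda>x. (cen N i x)\<^sup>2) \<le> 2 + 2 * (\<bar>C i i\<bar> + 1)"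
    using cen_second_moment_bounded finI by (intro eventually_ball_finite) (auto simp: I_def)
  then obtain n1 where n1: "\<And>N i. n1 \<le> N \<Longrightarrow> i \<in> I \<Longrightarrow> expect N (\<lambda>x. (cen N i x)\<^sup>2) \<le> 2 + 2 * (\<bar>C i i\<bar> + 1)"
    unfolding eventually_sequentially by blast
  \<comment> \<open>From here on there are at least \<open>k\<close> eigenvalues and the second moments are bounded.\<close>
  define n0 where "n0 = max n1 (max k 1)"
  \<comment> \<open>The law \<open>\<mu> N\<close> is expressed by expectations over sets of entries.\<close>
  have main: "prob_space (\<mu> N)" "\<And>t. (\<integral>x. iexp (\<Sum>i\<in>I. t i * x i) \<partial>\<mu> N) = expect N (\<lambda>x. iexp (\<Sum>i\<in>I. t i * cen N i x))"
    "\<And>i. i \<in> I \<Longrightarrow> integrable (\<mu> N) (\<lambda>x. (x i)\<^sup>2) \<and> (\<integral>x. (x i)\<^sup>2 \<partial>\<mu> N) = expect N (\<lambda>x. (cen N i x)\<^sup>2)"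
    if N: "n0 \<le> N" for N
  proof -
    have N1: "1 \<le> N" and Nk: "k \<le> N" using N by (auto simp: n0_def)
    interpret S: bernoulli_sample "M N" N "pr N" "A N"
      by (rule random_bernoulli_matrix_sample[OF N1 assms(7)[OF N1] assms(8)[OF N1]])
        (use pr_range[OF N1] in \<open>auto simp: pr_def pt_def\<close>)
    have ind: "i - 1 < N" "Suc (i - 1) = i" if "i \<in> I" for i
    proof -
      have "1 \<le> i" "i \<le> k" using that Ik by auto
      then show "i - 1 < N" "Suc (i - 1) = i" using Nk by simp_all
    qed
    have eigm: "(\<lambda>\<omega>. eig i (A N \<omega>)) \<in> borel_measurable (M N)" if "i \<in> I" for i
      using S.eig_measurable[OF ind(1)[OF that]] unfolding ind(2)[OF that] .
    have Zm: "Z N \<in> measurable (M N) (Pi\<^sub>M I (\<lambda>_. borel))"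
      unfolding Z_def using eigm
      by (intro measurable_restrict borel_measurable_times borel_measurable_diff borel_measurable_const) auto
    have scale: "\<epsilon> N powr - (1 / 2) = 1 / sqrt (\<epsilon> N)"
      using eps0[OF N1] by (simp add: powr_minus powr_half_sqrt inverse_eq_divide)
    have "AE \<omega> in M N. \<forall>i\<in>I. Z N \<omega> i = cen N i (S.X \<omega>)"
    proof (subst AE_finite_all[OF finI], intro ballI)
      fix i assume i: "i \<in> I"
      have E: "(\<integral>\<omega>'. eig i (A N \<omega>') \<partial>M N) = expect N (\<lambda>x. eigval N (adj x) (i - 1))"
        using S.eig_expectation[OF ind(1)[OF i]] unfolding ind(2)[OF i] .
      have "AE \<omega> in M N. eig i (A N \<omega>) = eigval N (adj (S.X \<omega>)) (i - 1)"
        using S.AE_eig[OF ind(1)[OF i]] unfolding ind(2)[OF i] .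
      then show "AE \<omega> in M N. Z N \<omega> i = cen N i (S.X \<omega>)"
        by (rule AE_mp) (rule AE_I2, use i in \<open>simp add: Z_def cen_def E scale\<close>)
    qed
    note AEZ = this
    show "prob_space (\<mu> N)" unfolding \<mu>_def by (rule S.prob_space_distr[OF Zm])
    show "(\<integral>x. iexp (\<Sum>i\<in>I. t i * x i) \<partial>\<mu> N) = expect N (\<lambda>x. iexp (\<Sum>i\<in>I. t i * cen N i x))" for t
    proof -
      have m: "(\<lambda>x. iexp (\<Sum>i\<in>I. t i * x i)) \<in> borel_measurable (Pi\<^sub>M I (\<lambda>_. borel))"
        using borel_measurable_trig_poly[OF trig_poly.monomial[of I 1 t]] by simp
      have "(\<integral>x. iexp (\<Sum>i\<in>I. t i * x i) \<partial>\<mu> N) = (\<integral>\<omega>. iexp (\<Sum>i\<in>I. t i * Z N \<omega> i) \<partial>M N)"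
        unfolding \<mu>_def by (rule integral_distr[OF Zm m])
      also have "\<dots> = (\<integral>\<omega>. iexp (\<Sum>i\<in>I. t i * cen N i (S.X \<omega>)) \<partial>M N)"
      proof (rule integral_cong_AE[OF measurable_compose[OF Zm m] S.X_comp_measurable])
        show "AE \<omega> in M N. iexp (\<Sum>i\<in>I. t i * Z N \<omega> i) = iexp (\<Sum>i\<in>I. t i * cen N i (S.X \<omega>))"
          using AEZ by (rule AE_mp) (rule AE_I2, simp)
      qed
      also have "\<dots> = expect N (\<lambda>x. iexp (\<Sum>i\<in>I. t i * cen N i x))"
        by (rule S.X_comp_integral)
      finally show ?thesis .
    qed
    fix i assume i: "i \<in> I"
    have m: "(\<lambda>x. (x i)\<^sup>2) \<in> borel_measurable (Pi\<^sub>M I (\<lambda>_. borel :: real measure))"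
      using i by (intro borel_measurable_power measurable_component_singleton)
    have ae: "AE \<omega> in M N. (Z N \<omega> i)\<^sup>2 = (cen N i (S.X \<omega>))\<^sup>2"
      using AEZ by (rule AE_mp) (rule AE_I2, use i in simp)
    have "integrable (M N) (\<lambda>\<omega>. (Z N \<omega> i)\<^sup>2)"
      using S.X_comp_integrable[of "\<lambda>x. (cen N i x)\<^sup>2"]
      by (subst integrable_cong_AE[OF measurable_compose[OF Zm m] S.X_comp_measurable ae])
    moreover have "(\<integral>\<omega>. (Z N \<omega> i)\<^sup>2 \<partial>M N) = expect N (\<lambda>x. (cen N i x)\<^sup>2)"
      using integral_cong_AE[OF measurable_compose[OF Zm m] S.X_comp_measurable ae]
        S.X_comp_integral[of "\<lambda>x. (cen N i x)\<^sup>2"] by simp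
    ultimately show "integrable (\<mu> N) (\<lambda>x. (x i)\<^sup>2) \<and> (\<integral>x. (x i)\<^sup>2 \<partial>\<mu> N) = expect N (\<lambda>x. (cen N i x)\<^sup>2)"
      unfolding \<mu>_def integrable_distr_eq[OF Zm m] integral_distr[OF Zm m] by simp
  qed
  have KC: "\<bar>C i i\<bar> \<le> K" "2 + 2 * (\<bar>C i i\<bar> + 1) \<le> K" if "i \<in> I" for i
  proof -
    show "2 + 2 * (\<bar>C i i\<bar> + 1) \<le> K"
      unfolding K_def using that finI by (intro member_le_sum[where f="\<lambda>i. 2 + 2 * (\<bar>C i i\<bar> + 1)"]) auto
    then show "\<bar>C i i\<bar> \<le> K" by simp
  qed
  have "weak_conv_PiM I (\<lambda>n. \<mu> (n + n0)) G"
  proof (rule multivariate_levy_continuity[OF finI, where C = K])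
    show "prob_space (\<mu> (n + n0))" for n by (rule main(1)) simp
    show "sets (\<mu> (n + n0)) = sets (Pi\<^sub>M I (\<lambda>_. borel))" for n by (simp add: \<mu>_def)
    show "prob_space G" "sets G = sets (Pi\<^sub>M I (\<lambda>_. borel))" by (rule G)+
    show "integrable (\<mu> (n + n0)) (\<lambda>x. (x a)\<^sup>2) \<and> (\<integral>x. (x a)\<^sup>2 \<partial>\<mu> (n + n0)) \<le> K" if a: "a \<in> I" for n a
    proof -
      have "n0 \<le> n + n0" "n1 \<le> n + n0" by (simp_all add: n0_def)
      then show ?thesis
        using main(3)[of "n + n0" a] order_trans[OF n1[of "n + n0" a] KC(2)[OF a]] a by simp
    qed
    show "integrable G (\<lambda>x. (x a)\<^sup>2) \<and> (\<integral>x. (x a)\<^sup>2 \<partial>G) \<le> K" if a: "a \<in> I" for a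
      using G(5)[OF a] KC(1)[OF a] a by (simp add: D_def)
    show "(\<lambda>n. \<integral>x. iexp (\<Sum>a\<in>I. t a * x a) \<partial>\<mu> (n + n0)) \<longlonglongrightarrow> (\<integral>x. iexp (\<Sum>a\<in>I. t a * x a) \<partial>G)" for t
    proof -
      have "(\<Sum>i\<in>I. \<Sum>j\<in>I. t i * t j * D i j) = (\<Sum>i\<in>I. \<Sum>j\<in>I. t i * t j * C i j)"
        by (intro sum.cong refl) (simp add: D_def)
      then have "(\<lambda>N. expect N (\<lambda>x. iexp (\<Sum>i\<in>I. t i * cen N i x))) \<longlonglongrightarrow> (\<integral>x. iexp (\<Sum>a\<in>I. t a * x a) \<partial>G)"
        unfolding G(7) using cen_char_tendsto[of t] by (simp only: I_def)
      from LIMSEQ_ignore_initial_segment[OF this, of n0] show ?thesis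
        using main(2) by simp
    qed
  qed
  then have weak: "weak_conv_PiM I \<mu> G" by (rule weak_conv_PiM_offset)
  show ?thesis
    unfolding I_def[symmetric]
  proof (intro exI[of _ G] conjI ballI)
    show "multivariate_normal I G" by (rule G(1))
    show "(\<integral>x. x i \<partial>G) = 0" if "i \<in> I" for i by (rule G(4)[OF that])
    show "covariance G (\<lambda>x. x i) (\<lambda>x. x j) =
       2 * (\<integral>x. (\<integral>y. r i x * r i y * r j x * r j y * edge_kernel k \<theta> r x y
                        * (1 - \<epsilon>_inf * edge_kernel k \<theta> r x y)
              \<partial>lebesgue_on {0..1}) \<partial>lebesgue_on {0..1})" if ij: "i \<in> I" "j \<in> I" for i j
    proof -
      have "i \<in> {1..k}" "j \<in> {1..k}" using ij Ik by auto
      from C_integral[OF this] show ?thesis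
        using G(6)[OF ij] ij by (simp only: D_def if_True simp_thms)
    qed
    show "weak_conv_PiM I (\<lambda>N. distr (M N) (Pi\<^sub>M I (\<lambda>_. borel))
         (\<lambda>\<omega>. \<lambda>i\<in>I. \<epsilon> N powr (-1/2) * (eig i (A N \<omega>) - (\<integral>\<omega>'. eig i (A N \<omega>') \<partial>M N)))) G"
      using weak unfolding \<mu>_def[abs_def] Z_def .
  qed
qed

end
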